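(* Let $n=(n_1,n_2)\neq(0,0)$ and let $T_{0,n_2+1}$ be the corresponding coefficient of the Dulac time of the hyperbolic saddle of $X_{\hat\mu}$ from $\Sigma_1$ to $\Sigma_2$ (notation in the context). Write $\mathbb N_{\ge\frac{n_1}{n_2}}=\{i\in\mathbb N:n_2i\ge n_1\}$ and $\mathbb N_{<\frac{n_1}{n_2}}=\{i\in\mathbb N:n_2i<n_1\}$, and recall that $D_{0,n_2+1}^n=\{\frac{m}{n_2+1}:m\in\mathbb N,\ m\ge n_1\}\cup\mathbb N$. The following assertions hold. (a) For any $\hat\mu_0=(\lambda_0,\mu_0)\in D_{0,n_2+1}^n\times W$ with $\lambda_0\in\mathbb N_{\ge\frac{n_1}{n_2}}$, the function $\hat\mu\mapsto(\lambda-\lambda_0)^2T_{0,n_2+1}(\hat\mu)$ extends $C^\infty$ at $\hat\mu=\hat\mu_0$, and if $\lambda_0=i\in\mathbb N_{\ge\frac{n_1}{n_2}}$ then $$\lim_{\hat\mu\to\hat\mu_0}(\lambda-\lambda_0)^2T_{0,n_2+1}(\hat\mu)=\frac{n_2\Delta_{00}^{n_2+1}\sigma_{210}^{(n_2+1)i}\sigma_{221}^{n_2+1}}{(n_2+1)L_2^{n_2+1}(\sigma_{210})}\frac{M_2^{(i)}(0)}{i!}\frac{A_2^{(n_2i-n_1)}(0)}{(n_2i-n_1)!}\Big|_{\hat\mu=\hat\mu_0}.$$ (b) For any $\hat\mu_0=(\lambda_0,\mu_0)\in D_{0,n_2+1}^n\times W$ with $\lambda_0\notin\mathbb N_{\ge\frac{n_1}{n_2}}$,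 the function $\hat\mu\mapsto(\lambda-\lambda_0)T_{0,n_2+1}(\hat\mu)$ extends $C^\infty$ at $\hat\mu=\hat\mu_0$, and (b1) if $\lambda_0=i\in\mathbb N_{<\frac{n_1}{n_2}}$ then, setting $i_1:=(n_2+1)i-n_1$, $$\lim_{\hat\mu\to\hat\mu_0}(\lambda-\lambda_0)T_{0,n_2+1}(\hat\mu)=-\frac{\Delta_{00}^{n_2+1}\sigma_{221}^{n_2+1}\sigma_{210}^{n_1}}{L_2^{n_2+1}(\sigma_{210})}\Bigg(n_2\frac{M_2^{(i)}(0)}{i!}\sigma_{210}^i\hat A_2(in_2-n_1,\sigma_{210})+\frac{n_2\sigma_{210}^{i_1}}{(n_2+1)\,i_1!}\sum_{j=0}^{i_1}\binom{i_1}{j}\frac{M_2^{(j)}(0)A_2^{(i_1-j)}(0)}{j-i}+R\Bigg)\Bigg|_{\hat\mu=\hat\mu_0},$$ where $R=\frac{\sigma_{210}^{i_1}}{(n_2+1)\,i_1!}\partial_u^{i_1}\big(L_2^{n_2+1}(u)\partial_2P_1^{-1}(u,0)\big)\big|_{u=0}$ for $i_1\ge0$ and $R=0$ otherwise (and the term with the sum is zero if $i_1<0$); (b2) if $\lambda_0=\frac{n_1+i}{n_2+1}\notin\mathbb N$ with $i\in\mathbb Z_{\ge0}$, then $$\lim_{\hat\mu\to\hat\mu_0}(\lambda-\lambda_0)T_{0,n_2+1}(\hat\mu)=-\frac{\Delta_{00}^{n_2+1}\sigma_{221}^{n_2+1}\sigma_{210}^{n_1+i}}{(n_2+1)L_2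^{n_2+1}(\sigma_{210})}\frac{B_2^{(i)}(0)}{i!}\Big|_{\hat\mu=\hat\mu_0}.$$
   Context: Setting. $\mathbb N=\{1,2,\dots\}$. $W\subset\mathbb R^N$ is open, $\hat W=(0,+\infty)\times W$, $\hat\mu=(\lambda,\mu)\in\hat W$, $n=(n_1,n_2)\in\mathbb Z_{\ge0}^2$ is fixed, and $$X_{\hat\mu}=\frac{1}{x_1^{n_1}x_2^{n_2}}\big(x_1P_1(x_1,x_2;\hat\mu)\partial_{x_1}+x_2P_2(x_1,x_2;\hat\mu)\partial_{x_2}\big),$$ where $P_1,P_2\in C^\infty(\mathcal U\times\hat W)$ for an open set $\mathcal U\subset\mathbb R^2$ containing the origin, $P_1(x_1,0;\hat\mu)>0$ and $P_2(0,x_2;\hat\mu)<0$ for all $(x_1,0),(0,x_2)\in\mathcal U$, $\hat\mu\in\hat W$, and $\lambda=-P_2(0,0;\hat\mu)/P_1(0,0;\hat\mu)$. For $i=1,2$, $\sigma_i(s;\hat\mu)=(\sigma_{i1}(s;\hat\mu),\sigma_{i2}(s;\hat\mu))$, $(s,\hat\mu)\in(-\varepsilon,\varepsilon)\times\hat W$, is a $C^\infty$ parametrization of a section $\Sigma_i$ transverse to $X_{\hat\mu}$ at the axis $\{x_i=0\}$, with $\sigma_1(0;\hat\mu)\in\{(0,x_2):x_2>0\}$ and $\sigma_2(0;\hat\mu)\in\{(x_1,0):x_1>0\}$, parametrized so that $s>0$ corresponds to the first quadrant, i.e. $\partial_s\sigma_{11}(0;\hat\mu)>0$ and $\partial_s\sigma_{22}(0;\hat\mu)>0$.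 For some small $\rho>0$, $\mathcal U$ contains $(\{0\}\times I_1)\cup(I_2\times\{0\})$ where $I_1=(-\rho,\sigma_{12}(0)+\rho)$ and $I_2=(-\rho,\sigma_{21}(0)+\rho)$. For small $s>0$, the Dulac map $D(s;\hat\mu)$ and Dulac time $T(s;\hat\mu)$ are defined by $\varphi(T(s),\sigma_1(s))=\sigma_2(D(s))$, where $\varphi(t,p;\hat\mu)$ is the solution of $X_{\hat\mu}$ with $\varphi(0,p)=p$ (passage from $\Sigma_1$ to $\Sigma_2$ near the corner formed by the axes). Index sets. For $k=(k_1,k_2)\in\mathbb Z_{\ge0}^2$: $\Lambda_k=(\mathbb Z_{\ge k_1}\times\{0\})\cup(\mathbb Z_{\ge0}\times\mathbb Z_{\ge k_2})$; $D_{ij}^k=\{\lambda>0:\exists(i',j')\in\Lambda_k\setminus\{(i,j)\},\ i+\lambda j=i'+\lambda j'\}$; $\mathcal B_{\lambda,L}^k=\{(i,j)\in\Lambda_k:i+\lambda j\le L\}$; $D_L^k=\{\lambda>0:\exists(i,j)\in\mathcal B^k_{\lambda,L},\ \lambda\in D_{ij}^k\}$. A superscript or subscript $0$ stands for $k=(0,0)$; $n$ stands for $k=n=(n_1,n_2)$. Flat remainders. $\psi(s;\hat\mu)$, smooth for $s>0$ small, belongs to $\mathcal F_L^\infty(\hat\mu_0)$ if for every multi-index $\nu=(\nu_0,\dots,\nu_{N+1})$ there are a neighbourhood $V$ of $\hat\mu_0$ and $C,s_0>0$ with $|\partial_s^{\nu_0}\partial_{\hat\mu}^{(\nu_1,\dots,\nu_{N+1})}\psi(s;\hat\mu)|\le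 Cs^{L-\nu_0}$ for $s\in(0,s_0)$, $\hat\mu\in V$; $\mathcal F_L^\infty(A)=\bigcap_{\hat\mu_0\in A}\mathcal F_L^\infty(\hat\mu_0)$. Coefficients (known result, taken as given; for $n\neq(0,0)$). There exist $\Delta_{ij}\in C^\infty(((0,+\infty)\setminus D_{ij}^0)\times W)$, $(i,j)\in\Lambda_0$, and $T_{ij}\in C^\infty(((0,+\infty)\setminus D_{ij}^n)\times W)$, $(i,j)\in\Lambda_n$, such that for all $L>0$, $\lambda_0>0$: if $\lambda_0\notin D^0_{L-\lambda_0}$ then $D(s;\hat\mu)=s^\lambda\sum_{(i,j)\in\mathcal B^0_{\lambda_0,L-\lambda_0}}\Delta_{ij}(\hat\mu)s^{i+\lambda j}+\mathcal F_L^\infty(\{\lambda_0\}\times W)$; and if $\lambda_0\notin D^n_L$ then $T(s;\hat\mu)=\sum_{(i,j)\in\mathcal B^n_{\lambda_0,L}}T_{ij}(\hat\mu)s^{i+\lambda j}+\mathcal F_L^\infty(\{\lambda_0\}\times W)$. These expansions determine the coefficients. Here $D_{00}^0=\emptyset$ and $\Delta_{00}>0$ on $\hat W$. Incomplete Mellin transform. For $f$ $C^\infty$ on an open interval $I\ni0$ and $\alpha\in\mathbb R\setminus\mathbb Z_{\ge0}$, $\hat f(\alpha,\cdot)$ is the unique $C^\infty$ function $y$ on $I$ satisfying $xy'(x)-\alpha y(x)=f(x)$. Functions (dependence on $\hat\mu$ omitted; $\partial_2P_1^{-1}$ denotes the derivative of $1/P_1$ with respect to $x_2$), for $u\in I_2$: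 $L_2(u)=\exp\int_0^u\big(\frac{P_2(z,0)}{P_1(z,0)}+\lambda\big)\frac{dz}{z}$, $M_2(u)=L_2(u)\,\partial_2\!\big(\frac{P_2}{P_1}\big)(u,0)$, $A_2(u)=\frac{L_2^{n_2}(u)}{P_1(u,0)}$, $B_2(u)=n_2A_2(u)\hat M_2(\lambda,u)+L_2^{n_2+1}(u)\partial_2P_1^{-1}(u,0)$. Superscripts $(k)$ denote $k$-th derivatives in $u$. Also $\sigma_{ijk}(\hat\mu)=\partial_s^k\sigma_{ij}(0;\hat\mu)$. "Extends $C^\infty$ at $\hat\mu_0$" means that it extends to a $C^\infty$ function on a neighbourhood of $\hat\mu_0$. *)

theory Defs
  imports "HOL-Analysis.Analysis"
begin

type_synonym 'n param = "real \<times> (real ^ 'n)"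

abbreviation hat :: "(real ^ 'n) set \<Rightarrow> ('n::finite) param set" where
  "hat W \<equiv> {0<..} \<times> W"


section \<open>Smooth functions\<close>

(* Only used for open S; values of f outside S are irrelevant then. *)

primrec Ck_on ::
  "nat \<Rightarrow> 'a::real_normed_vector set \<Rightarrow> ('a \<Rightarrow> 'b::real_normed_vector) \<Rightarrow> bool"
where
  "Ck_on 0 S f \<longleftrightarrow> continuous_on S f"
| "Ck_on (Suc k) S f \<longleftrightarrow>
     (\<forall>x\<in>S. f differentiable (at x)) \<and> (\<forall>v. Ck_on k S (\<lambda>x. frechet_derivative f (at x) v))"

definition smooth_on ::
  "'a::real_normed_vector set \<Rightarrow> ('a \<Rightarrow> 'b::real_normed_vector) \<Rightarrow> bool" where
  "smooth_on S f \<longleftrightarrow> (\<forall>k. Ck_on k S f)"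

(* g is a function with domain A, and p may lie outside A. *)

definition extends_smooth_at ::
  "'a::real_normed_vector set \<Rightarrow> ('a \<Rightarrow> 'b::real_normed_vector) \<Rightarrow> 'a \<Rightarrow> bool" where
  "extends_smooth_at A g p \<longleftrightarrow>
     (\<exists>V h. open V \<and> p \<in> V \<and> smooth_on V h \<and> (\<forall>x\<in>V \<inter> A. h x = g x))"

primrec iter_pd ::
  "'a::real_normed_vector list \<Rightarrow> ('a \<Rightarrow> real) \<Rightarrow> 'a \<Rightarrow> real" where
  "iter_pd [] f = f"
| "iter_pd (v # vs) f = (\<lambda>x. frechet_derivative (iter_pd vs f) (at x) v)"


section \<open>The family of vector fields\<close>

(* The field without its denominator; it has the same orbits off the axes. *)

definition saddle_field ::
  "(real \<times> real \<Rightarrow> 'n::finite param \<Rightarrow> real) \<Rightarrow> (real \<times> real \<Rightarrow> 'n param \<Rightarrow> real)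
    \<Rightarrow> 'n param \<Rightarrow> real \<times> real \<Rightarrow> real \<times> real" where
  "saddle_field P1 P2 m x = (fst x * P1 x m, snd x * P2 x m)"

definition X_field ::
  "nat \<Rightarrow> nat \<Rightarrow> (real \<times> real \<Rightarrow> 'n::finite param \<Rightarrow> real)
    \<Rightarrow> (real \<times> real \<Rightarrow> 'n param \<Rightarrow> real) \<Rightarrow> 'n param \<Rightarrow> real \<times> real \<Rightarrow> real \<times> real" where
  "X_field n1 n2 P1 P2 m x =
     (1 / (fst x ^ n1 * snd x ^ n2)) *\<^sub>R saddle_field P1 P2 m x"

definition saddle_family ::
  "(real ^ 'n) set \<Rightarrow> (real \<times> real) set \<Rightarrow> (real \<times> real \<Rightarrow> 'n::finite param \<Rightarrow> real)
    \<Rightarrow> (real \<times> real \<Rightarrow> 'n param \<Rightarrow> real) \<Rightarrow> bool" where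
  "saddle_family W U P1 P2 \<longleftrightarrow>
     open W \<and> open U \<and> (0, 0) \<in> U \<and>
     smooth_on (U \<times> hat W) (\<lambda>(x, m). P1 x m) \<and>
     smooth_on (U \<times> hat W) (\<lambda>(x, m). P2 x m) \<and>
     (\<forall>m\<in>hat W.
        (\<forall>x1. (x1, 0) \<in> U \<longrightarrow> P1 (x1, 0) m > 0) \<and>
        (\<forall>x2. (0, x2) \<in> U \<longrightarrow> P2 (0, x2) m < 0) \<and>
        fst m = - P2 (0, 0) m / P1 (0, 0) m)"


section \<open>Transverse sections\<close>

(* Transversality on an axis, where X_field may have a pole, refers to the direction field,
   i.e. to saddle_field. *)

definition transverse_at_0 ::
  "(real \<times> real \<Rightarrow> 'n::finite param \<Rightarrow> real) \<Rightarrow> (real \<times> real \<Rightarrow> 'n param \<Rightarrow> real)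
    \<Rightarrow> (real \<Rightarrow> 'n param \<Rightarrow> real \<times> real) \<Rightarrow> 'n param \<Rightarrow> bool" where
  "transverse_at_0 P1 P2 \<sigma> m \<longleftrightarrow>
     deriv (\<lambda>s. fst (\<sigma> s m)) 0 * snd (saddle_field P1 P2 m (\<sigma> 0 m))
     - deriv (\<lambda>s. snd (\<sigma> s m)) 0 * fst (saddle_field P1 P2 m (\<sigma> 0 m)) \<noteq> 0"

definition I1 :: "(real \<Rightarrow> 'n::finite param \<Rightarrow> real \<times> real) \<Rightarrow> real \<Rightarrow> 'n param \<Rightarrow> real set" where
  "I1 \<sigma>1 \<rho> m = {-\<rho><..<snd (\<sigma>1 0 m) + \<rho>}"

definition I2 :: "(real \<Rightarrow> 'n::finite param \<Rightarrow> real \<times> real) \<Rightarrow> real \<Rightarrow> 'n param \<Rightarrow> real set" where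
  "I2 \<sigma>2 \<rho> m = {-\<rho><..<fst (\<sigma>2 0 m) + \<rho>}"

definition transverse_sections ::
  "(real ^ 'n) set \<Rightarrow> (real \<times> real) set \<Rightarrow> (real \<times> real \<Rightarrow> 'n::finite param \<Rightarrow> real)
    \<Rightarrow> (real \<times> real \<Rightarrow> 'n param \<Rightarrow> real) \<Rightarrow> real \<Rightarrow> real
    \<Rightarrow> (real \<Rightarrow> 'n param \<Rightarrow> real \<times> real) \<Rightarrow> (real \<Rightarrow> 'n param \<Rightarrow> real \<times> real) \<Rightarrow> bool" where
  "transverse_sections W U P1 P2 \<epsilon> \<rho> \<sigma>1 \<sigma>2 \<longleftrightarrow>
     \<epsilon> > 0 \<and> \<rho> > 0 \<and>
     smooth_on ({-\<epsilon><..<\<epsilon>} \<times> hat W) (\<lambda>(s, m). \<sigma>1 s m) \<and>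
     smooth_on ({-\<epsilon><..<\<epsilon>} \<times> hat W) (\<lambda>(s, m). \<sigma>2 s m) \<and>
     (\<forall>m\<in>hat W.
        (\<forall>s\<in>{-\<epsilon><..<\<epsilon>}. \<sigma>1 s m \<in> U \<and> \<sigma>2 s m \<in> U) \<and>
        fst (\<sigma>1 0 m) = 0 \<and> snd (\<sigma>1 0 m) > 0 \<and>
        snd (\<sigma>2 0 m) = 0 \<and> fst (\<sigma>2 0 m) > 0 \<and>
        transverse_at_0 P1 P2 \<sigma>1 m \<and> transverse_at_0 P1 P2 \<sigma>2 m \<and>
        deriv (\<lambda>s. fst (\<sigma>1 s m)) 0 > 0 \<and> deriv (\<lambda>s. snd (\<sigma>2 s m)) 0 > 0 \<and>
        {0} \<times> I1 \<sigma>1 \<rho> m \<subseteq> U \<and> I2 \<sigma>2 \<rho> m \<times> {0} \<subseteq> U)"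


section \<open>Dulac map and Dulac time\<close>

definition corner_path ::
  "(real \<Rightarrow> 'n::finite param \<Rightarrow> real \<times> real) \<Rightarrow> (real \<Rightarrow> 'n param \<Rightarrow> real \<times> real)
    \<Rightarrow> 'n param \<Rightarrow> (real \<times> real) set" where
  "corner_path \<sigma>1 \<sigma>2 m =
     {0} \<times> {0..snd (\<sigma>1 0 m)} \<union> {0..fst (\<sigma>2 0 m)} \<times> {0}"

(* \<gamma> t is \<phi>(t, p), followed inside G during the time interval [0, \<tau>]. *)

definition orbit_arc ::
  "(real \<times> real \<Rightarrow> real \<times> real) \<Rightarrow> (real \<times> real) set
    \<Rightarrow> real \<times> real \<Rightarrow> real \<Rightarrow> real \<times> real \<Rightarrow> bool" where
  "orbit_arc X G p \<tau> q \<longleftrightarrow>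
     \<tau> > 0 \<and>
     (\<exists>\<gamma>. \<gamma> 0 = p \<and> \<gamma> \<tau> = q \<and>
        (\<forall>t\<in>{0..\<tau>}. \<gamma> t \<in> G \<and> (\<gamma> has_vector_derivative X (\<gamma> t)) (at t within {0..\<tau>})))"

(* D and \<tau> are only determined for small s > 0, locally uniformly in the parameter.
   That the arc stays in any prescribed neighbourhood G of the corner path, and that
   the arrival parameter D s m is close to 0, singles out the passage near the corner
   among all possible later hits of the second section. *)

definition dulac_map_time ::
  "(real ^ 'n) set \<Rightarrow> (real \<times> real) set
    \<Rightarrow> (real \<times> real \<Rightarrow> 'n::finite param \<Rightarrow> real) \<Rightarrow> (real \<times> real \<Rightarrow> 'n param \<Rightarrow> real)
    \<Rightarrow> nat \<Rightarrow> nat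
    \<Rightarrow> (real \<Rightarrow> 'n param \<Rightarrow> real \<times> real) \<Rightarrow> (real \<Rightarrow> 'n param \<Rightarrow> real \<times> real)
    \<Rightarrow> (real \<Rightarrow> 'n param \<Rightarrow> real) \<Rightarrow> (real \<Rightarrow> 'n param \<Rightarrow> real) \<Rightarrow> bool" where
  "dulac_map_time W U P1 P2 n1 n2 \<sigma>1 \<sigma>2 D \<tau> \<longleftrightarrow>
     (\<forall>m0\<in>hat W. \<forall>G \<delta>. open G \<and> corner_path \<sigma>1 \<sigma>2 m0 \<subseteq> G \<and> \<delta> > 0 \<longrightarrow>
        (\<exists>V s0. open V \<and> m0 \<in> V \<and> s0 > 0 \<and>
           (\<forall>m\<in>V \<inter> hat W. \<forall>s\<in>{0<..<s0}.
              0 < D s m \<and> D s m < \<delta> \<and>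
              orbit_arc (X_field n1 n2 P1 P2 m) (G \<inter> U \<inter> {0<..} \<times> {0<..})
                (\<sigma>1 s m) (\<tau> s m) (\<sigma>2 (D s m) m))))"


section \<open>Index sets\<close>

definition Lam :: "nat \<times> nat \<Rightarrow> (nat \<times> nat) set" where
  "Lam k = {fst k..} \<times> {0} \<union> UNIV \<times> {snd k..}"

definition Dij :: "nat \<times> nat \<Rightarrow> nat \<Rightarrow> nat \<Rightarrow> real set" where
  "Dij k i j = {l. l > 0 \<and> (\<exists>(i', j')\<in>Lam k - {(i, j)}. real i + l * real j = real i' + l * real j')}"

definition Bset :: "nat \<times> nat \<Rightarrow> real \<Rightarrow> real \<Rightarrow> (nat \<times> nat) set" where
  "Bset k l L = {(i, j)\<in>Lam k. real i + l * real j \<le> L}"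

definition DL :: "nat \<times> nat \<Rightarrow> real \<Rightarrow> real set" where
  "DL k L = {l. l > 0 \<and> (\<exists>(i, j)\<in>Bset k l L. l \<in> Dij k i j)}"

lemma Dij_0_Suc_n2:
  "Dij (n1, n2) 0 (n2 + 1) =
     {real m / real (n2 + 1) | m. m \<ge> 1 \<and> m \<ge> n1} \<union> real ` {1..}"
  (is "?L = ?R")
proof
  show "?L \<subseteq> ?R"
  proof
    fix l assume "l \<in> ?L"
    then obtain i j where l: "l > 0" and ij: "(i, j) \<in> Lam (n1, n2)" "(i, j) \<noteq> (0, n2 + 1)"
      and eq: "l * real (n2 + 1) = real i + l * real j"
      unfolding Dij_def by (auto simp del: prod.inject)
    show "l \<in> ?R"
    proof (cases "j = 0 \<and> i \<ge> n1")
      case True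
      then have "l = real i / real (n2 + 1)" using eq by (simp add: field_simps)
      moreover have "i \<ge> 1" using calculation l by (cases i) auto
      ultimately show ?thesis using True by blast
    next
      case False
      then have "j \<ge> n2" using ij(1) by (auto simp: Lam_def)
      moreover have "\<not> j > n2"
      proof
        assume "j > n2"
        then have "l * real (n2 + 1) \<le> l * real j" using l by (intro mult_left_mono) auto
        then have "i = 0" "l * real (n2 + 1) = l * real j" using eq by auto
        then have "j = n2 + 1" using l by (metis mult_cancel_left of_nat_eq_iff less_irrefl)
        then show False using ij(2) \<open>i = 0\<close> by simp
      qed
      ultimately have "l = real i" using eq by (simp add: algebra_simps)
      then show ?thesis using l by (intro UnI2 image_eqI[of _ _ i]) auto
    qed
  qed
next
  show "?R \<subseteq> ?L"
  proof
    fix l assume "l \<in> ?R"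
    then consider m where "l = real m / real (n2 + 1)" "m \<ge> 1" "m \<ge> n1"
      | i where "l = real i" "i \<ge> 1" by auto
    then show "l \<in> ?L"
    proof cases
      case 1
      then have "l > 0" "l * real (n2 + 1) = real m" by auto
      then show ?thesis using 1
        unfolding Dij_def by (auto intro!: bexI[of _ "(m, 0)"] simp: Lam_def)
    next
      case 2
      then show ?thesis
        unfolding Dij_def by (auto intro!: bexI[of _ "(i, n2)"] simp: Lam_def algebra_simps)
    qed
  qed
qed


section \<open>Flat remainders and the asymptotic expansions\<close>

(* A multi-index is a list of coordinate directions, whose order is immaterial because
   \<psi> is smooth; (1, 0) is the s-direction, so count_list vs (1, 0) is \<nu>_0. *)

definition flat_at :: "real \<Rightarrow> 'n::finite param \<Rightarrow> (real \<Rightarrow> 'n param \<Rightarrow> real) \<Rightarrow> bool" where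
  "flat_at L m0 \<psi> \<longleftrightarrow>
     (\<exists>V s0. open V \<and> m0 \<in> V \<and> s0 > 0 \<and> smooth_on ({0<..<s0} \<times> V) (\<lambda>(s, m). \<psi> s m)) \<and>
     (\<forall>vs. set vs \<subseteq> Basis \<longrightarrow>
        (\<exists>V C s0. open V \<and> m0 \<in> V \<and> C > 0 \<and> s0 > 0 \<and>
           (\<forall>s\<in>{0<..<s0}. \<forall>m\<in>V.
              \<bar>iter_pd vs (\<lambda>(s, m). \<psi> s m) (s, m)\<bar>
                \<le> C * s powr (L - real (count_list vs (1, 0))))))"

definition flat_on :: "real \<Rightarrow> 'n::finite param set \<Rightarrow> (real \<Rightarrow> 'n param \<Rightarrow> real) \<Rightarrow> bool" where
  "flat_on L A \<psi> \<longleftrightarrow> (\<forall>m0\<in>A. flat_at L m0 \<psi>)"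

definition dulac_map_coeffs ::
  "(real ^ 'n) set \<Rightarrow> (real \<Rightarrow> 'n::finite param \<Rightarrow> real) \<Rightarrow> (nat \<Rightarrow> nat \<Rightarrow> 'n param \<Rightarrow> real) \<Rightarrow> bool"
where
  "dulac_map_coeffs W D \<Delta> \<longleftrightarrow>
     (\<forall>(i, j)\<in>Lam (0, 0). smooth_on (({0<..} - Dij (0, 0) i j) \<times> W) (\<Delta> i j)) \<and>
     (\<forall>L l0. L > 0 \<and> l0 > 0 \<and> l0 \<notin> DL (0, 0) (L - l0) \<longrightarrow>
        flat_on L ({l0} \<times> W)
          (\<lambda>s m. D s m - s powr fst m *
             (\<Sum>(i, j)\<in>Bset (0, 0) l0 (L - l0). \<Delta> i j m * s powr (real i + fst m * real j))))"

definition dulac_time_coeffs ::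
  "(real ^ 'n) set \<Rightarrow> nat \<times> nat \<Rightarrow> (real \<Rightarrow> 'n::finite param \<Rightarrow> real)
    \<Rightarrow> (nat \<Rightarrow> nat \<Rightarrow> 'n param \<Rightarrow> real) \<Rightarrow> bool"
where
  "dulac_time_coeffs W n \<tau> T \<longleftrightarrow>
     (\<forall>(i, j)\<in>Lam n. smooth_on (({0<..} - Dij n i j) \<times> W) (T i j)) \<and>
     (\<forall>L l0. L > 0 \<and> l0 > 0 \<and> l0 \<notin> DL n L \<longrightarrow>
        flat_on L ({l0} \<times> W)
          (\<lambda>s m. \<tau> s m -
             (\<Sum>(i, j)\<in>Bset n l0 L. T i j m * s powr (real i + fst m * real j))))"


section \<open>Incomplete Mellin transform and auxiliary functions\<close>

(* Meaningful for an open interval I containing 0 and \<alpha> not a nonnegative integer.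
   The value 0 outside I makes the solution unique as a total function. *)

definition mellin :: "real set \<Rightarrow> (real \<Rightarrow> real) \<Rightarrow> real \<Rightarrow> real \<Rightarrow> real" where
  "mellin I f \<alpha> =
     (THE y. smooth_on I y \<and> (\<forall>x\<in>I. x * deriv y x - \<alpha> * y x = f x) \<and> (\<forall>x. x \<notin> I \<longrightarrow> y x = 0))"

definition L2 ::
  "(real \<times> real \<Rightarrow> 'n::finite param \<Rightarrow> real) \<Rightarrow> (real \<times> real \<Rightarrow> 'n param \<Rightarrow> real)
    \<Rightarrow> 'n param \<Rightarrow> real \<Rightarrow> real" where
  "L2 P1 P2 m u =
     exp (LBINT z=0..ereal u. (P2 (z, 0) m / P1 (z, 0) m + fst m) / z)"

definition M2 ::
  "(real \<times> real \<Rightarrow> 'n::finite param \<Rightarrow> real) \<Rightarrow> (real \<times> real \<Rightarrow> 'n param \<Rightarrow> real)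
    \<Rightarrow> 'n param \<Rightarrow> real \<Rightarrow> real" where
  "M2 P1 P2 m u = L2 P1 P2 m u * deriv (\<lambda>v. P2 (u, v) m / P1 (u, v) m) 0"

definition A2 ::
  "(real \<times> real \<Rightarrow> 'n::finite param \<Rightarrow> real) \<Rightarrow> (real \<times> real \<Rightarrow> 'n param \<Rightarrow> real)
    \<Rightarrow> nat \<Rightarrow> 'n param \<Rightarrow> real \<Rightarrow> real" where
  "A2 P1 P2 n2 m u = L2 P1 P2 m u ^ n2 / P1 (u, 0) m"

(* The second summand of B2: L_2^{n_2+1}(u) times the x_2-derivative of 1/P_1 at (u, 0). *)

definition C2 ::
  "(real \<times> real \<Rightarrow> 'n::finite param \<Rightarrow> real) \<Rightarrow> (real \<times> real \<Rightarrow> 'n param \<Rightarrow> real)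
    \<Rightarrow> nat \<Rightarrow> 'n param \<Rightarrow> real \<Rightarrow> real" where
  "C2 P1 P2 n2 m u = L2 P1 P2 m u ^ (n2 + 1) * deriv (\<lambda>v. 1 / P1 (u, v) m) 0"

(* I is the interval I2 of the parameter m. *)

definition B2 ::
  "(real \<times> real \<Rightarrow> 'n::finite param \<Rightarrow> real) \<Rightarrow> (real \<times> real \<Rightarrow> 'n param \<Rightarrow> real)
    \<Rightarrow> nat \<Rightarrow> real set \<Rightarrow> 'n param \<Rightarrow> real \<Rightarrow> real" where
  "B2 P1 P2 n2 I m u =
     real n2 * A2 P1 P2 n2 m u * mellin I (M2 P1 P2 m) (fst m) u + C2 P1 P2 n2 m u"

abbreviation nderiv :: "nat \<Rightarrow> (real \<Rightarrow> real) \<Rightarrow> real \<Rightarrow> real" where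
  "nderiv k f \<equiv> (deriv ^^ k) f"


section \<open>The limit values\<close>

definition lim_a ::
  "(real \<times> real \<Rightarrow> 'n::finite param \<Rightarrow> real) \<Rightarrow> (real \<times> real \<Rightarrow> 'n param \<Rightarrow> real)
    \<Rightarrow> nat \<Rightarrow> nat \<Rightarrow> (real \<Rightarrow> 'n param \<Rightarrow> real \<times> real)
    \<Rightarrow> (nat \<Rightarrow> nat \<Rightarrow> 'n param \<Rightarrow> real) \<Rightarrow> nat \<Rightarrow> 'n param \<Rightarrow> real" where
  "lim_a P1 P2 n1 n2 \<sigma>2 \<Delta> i m =
    (let \<sigma>210 = fst (\<sigma>2 0 m); \<sigma>221 = deriv (\<lambda>s. snd (\<sigma>2 s m)) 0 in
     real n2 * \<Delta> 0 0 m ^ (n2 + 1) * \<sigma>210 ^ ((n2 + 1) * i) * \<sigma>221 ^ (n2 + 1)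
       / (real (n2 + 1) * L2 P1 P2 m \<sigma>210 ^ (n2 + 1))
     * (nderiv i (M2 P1 P2 m) 0 / fact i)
     * (nderiv (n2 * i - n1) (A2 P1 P2 n2 m) 0 / fact (n2 * i - n1)))"

(* The exponent i_1 = (n_2+1) i - n_1 may be negative, in which case the two terms
   containing it are dropped; the natural number i1 is only used otherwise. *)

definition lim_b1 ::
  "(real \<times> real \<Rightarrow> 'n::finite param \<Rightarrow> real) \<Rightarrow> (real \<times> real \<Rightarrow> 'n param \<Rightarrow> real)
    \<Rightarrow> nat \<Rightarrow> nat \<Rightarrow> real \<Rightarrow> (real \<Rightarrow> 'n param \<Rightarrow> real \<times> real)
    \<Rightarrow> (nat \<Rightarrow> nat \<Rightarrow> 'n param \<Rightarrow> real) \<Rightarrow> nat \<Rightarrow> 'n param \<Rightarrow> real" where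
  "lim_b1 P1 P2 n1 n2 \<rho> \<sigma>2 \<Delta> i m =
    (let \<sigma>210 = fst (\<sigma>2 0 m); \<sigma>221 = deriv (\<lambda>s. snd (\<sigma>2 s m)) 0;
         i1 = (n2 + 1) * i - n1;
         M = M2 P1 P2 m; A = A2 P1 P2 n2 m;
         S = (if n1 \<le> (n2 + 1) * i
              then real n2 * \<sigma>210 ^ i1 / (real (n2 + 1) * fact i1)
                   * (\<Sum>j=0..i1. real (i1 choose j) * (nderiv j M 0 * nderiv (i1 - j) A 0)
                        / (real j - real i))
              else 0);
         R = (if n1 \<le> (n2 + 1) * i
              then \<sigma>210 ^ i1 / (real (n2 + 1) * fact i1) * nderiv i1 (C2 P1 P2 n2 m) 0
              else 0)
     in
     - (\<Delta> 0 0 m ^ (n2 + 1) * \<sigma>221 ^ (n2 + 1) * \<sigma>210 ^ n1 / L2 P1 P2 m \<sigma>210 ^ (n2 + 1))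
     * (real n2 * (nderiv i M 0 / fact i) * \<sigma>210 ^ i
          * mellin (I2 \<sigma>2 \<rho> m) A (real i * real n2 - real n1) \<sigma>210
        + S + R))"

definition lim_b2 ::
  "(real \<times> real \<Rightarrow> 'n::finite param \<Rightarrow> real) \<Rightarrow> (real \<times> real \<Rightarrow> 'n param \<Rightarrow> real)
    \<Rightarrow> nat \<Rightarrow> nat \<Rightarrow> real \<Rightarrow> (real \<Rightarrow> 'n param \<Rightarrow> real \<times> real)
    \<Rightarrow> (nat \<Rightarrow> nat \<Rightarrow> 'n param \<Rightarrow> real) \<Rightarrow> nat \<Rightarrow> 'n param \<Rightarrow> real" where
  "lim_b2 P1 P2 n1 n2 \<rho> \<sigma>2 \<Delta> i m =
    (let \<sigma>210 = fst (\<sigma>2 0 m); \<sigma>221 = deriv (\<lambda>s. snd (\<sigma>2 s m)) 0 in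
     - (\<Delta> 0 0 m ^ (n2 + 1) * \<sigma>221 ^ (n2 + 1) * \<sigma>210 ^ (n1 + i)
          / (real (n2 + 1) * L2 P1 P2 m \<sigma>210 ^ (n2 + 1)))
     * (nderiv i (B2 P1 P2 n2 (I2 \<sigma>2 \<rho> m) m) 0 / fact i))"

end

theory Submission
  imports Defs "HOL-Library.Landau_Symbols" "HOL-Real_Asymp.Real_Asymp"
begin

text \<open>
  Near the corner one constructs, for irrational \<open>\<lambda>\<close>, an approximate first integral
  \<open>H = x\<^sup>\<lambda> y exp (E + y\<^sup>2 q)\<close> and a function \<open>G = x\<^bsup>n1\<^esup> y\<^bsup>n2\<^esup> (Q + y\<^sup>2 q')\<close> whose derivative
  along the field is approximately \<open>1\<close>, with defects that are flat enough to be negligible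
  when integrated along an orbit.  Comparing their values on the two sections expresses the Dulac time through the Dulac map,
  and the coefficient of \<open>s\<^bsup>\<lambda>(n2+1)\<^esup>\<close> becomes an explicit expression in the incomplete Mellin
  transform of \<open>B\<^sub>2\<close> with exponent \<open>\<lambda>(n2+1) - n1\<close>.  This transform is a smooth function of the
  parameters apart from poles in the exponent at the natural numbers, with Taylor coefficients as
  residues; a second pole, at \<open>\<lambda> = i\<close>, comes from the transform of \<open>M\<^sub>2\<close> inside \<open>B\<^sub>2\<close>.  Since the
  irrational \<open>\<lambda>\<close> are dense, the smooth extension and its value at the pole carry over to the
  coefficient itself.
\<close>

section \<open>Calculus of smooth functions\<close>

text \<open>The poles lie at rational \<open>\<lambda>\<close>, where some of the divisors
  \<open>m - k / \<lambda>\<close> met on the vertical axis vanish; so the approximate integrals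
  cannot be carried across a pole. They are used at one fixed irrational parameter at a time, and
  smooth dependence on the parameters is read off afterwards from the closed formula, whose
  ingredients are built to be jointly smooth in position and parameter. Irrationality serves a
  second time when the coefficient is extracted: the exponents \<open>i + \<lambda> j\<close> are
  then pairwise distinct. Working modulo \<open>y^2\<close> is enough, because such a defect changes
  the time by \<open>O(h^(n2+2))\<close> with \<open>h\<close> of size \<open>s^\<lambda>\<close>,
  which is beyond the exponent \<open>\<lambda> (n2+1)\<close>. The first section enters through
  integer powers of \<open>s\<close> and through the leading coefficient of \<open>h\<close>; the
  latter is determined by \<open>\<Delta> 0 0\<close> and the second section, which is why no data
  of the first section appear in the limits. Of the two summands of the formula, the one with
  \<open>A2\<close> and the derivative of the first coordinate of the second section is regular and
  disappears in the limit; the poles come from the transform of \<open>B2\<close>.\<close>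

lemma frechet_eqI:
  "(f has_derivative f') (at x) \<Longrightarrow> frechet_derivative f (at x) v = f' v"
  by (metis frechet_derivative_at)

text \<open>Openness makes the derivative at a point of \<open>S\<close> depend on the values in
  \<open>S\<close> alone, although \<open>f\<close> and \<open>g\<close> may differ outside.\<close>

lemma Ck_on_cong:
  fixes f g :: "'a::real_normed_vector \<Rightarrow> 'b::real_normed_vector"
  assumes "open S" "\<And>x. x \<in> S \<Longrightarrow> f x = g x"
  shows "Ck_on k S f \<longleftrightarrow> Ck_on k S g"
  using assms(2)
proof (induction k arbitrary: f g)
  case 0
  then show ?case by (auto cong: continuous_on_cong)
next
  case (Suc k)
  have hd: "(f has_derivative f') (at x) \<longleftrightarrow> (g has_derivative f') (at x)" if "x \<in> S" for x f'
    using has_derivative_transform_within_open[OF _ assms(1) that, of f f' UNIV g]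
      has_derivative_transform_within_open[OF _ assms(1) that, of g f' UNIV f] Suc.prems by auto
  then have "f differentiable (at x) \<longleftrightarrow> g differentiable (at x)" if "x \<in> S" for x
    using that by (auto simp: differentiable_def)
  moreover have "frechet_derivative f (at x) = frechet_derivative g (at x)" if "x \<in> S" for x
    unfolding frechet_derivative_def using hd[OF that] by simp
  then have "Ck_on k S (\<lambda>x. frechet_derivative f (at x) v) \<longleftrightarrow>
      Ck_on k S (\<lambda>x. frechet_derivative g (at x) v)" for v
    by (intro Suc.IH) auto
  ultimately show ?case by auto
qed

text \<open>Exchanges \<open>frechet_derivative\<close> for a derivative given by a formula, on
  which later smoothness proofs can work; uniqueness of the derivative justifies it.\<close>

lemma Ck_on_SucI:
  assumes "open S" "\<And>x. x \<in> S \<Longrightarrow> (f has_derivative f' x) (at x)"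
    and "\<And>v. Ck_on k S (\<lambda>x. f' x v)"
  shows "Ck_on (Suc k) S f"
proof -
  have "Ck_on k S (\<lambda>x. frechet_derivative f (at x) v)" for v
    using assms(3)[of v] Ck_on_cong[OF assms(1), of "\<lambda>x. frechet_derivative f (at x) v" "\<lambda>x. f' x v" k]
      frechet_eqI[OF assms(2)] by auto
  then show ?thesis using assms(2) by (auto simp: differentiable_def)
qed

lemma Ck_on_Suc_has_derivative:
  "Ck_on (Suc k) S f \<Longrightarrow> x \<in> S \<Longrightarrow> (f has_derivative frechet_derivative f (at x)) (at x)"
  by (simp add: frechet_derivative_works[symmetric])

lemma Ck_on_Suc_frechet:
  "Ck_on (Suc k) S f \<Longrightarrow> Ck_on k S (\<lambda>x. frechet_derivative f (at x) v)"
  by simp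

lemma Ck_on_SucD: "Ck_on (Suc k) S f \<Longrightarrow> Ck_on k S f"
proof (induction k arbitrary: f)
  case 0
  then show ?case
    by (auto intro!: continuous_at_imp_continuous_on differentiable_imp_continuous_within)
next
  case (Suc k)
  from Suc.prems show ?case
    using Suc.IH Ck_on.simps(2)[of "Suc k" S f] Ck_on.simps(2)[of k S f] by blast
qed

lemma Ck_on_subset: "Ck_on k S f \<Longrightarrow> T \<subseteq> S \<Longrightarrow> Ck_on k T f"
  by (induction k arbitrary: f) (auto intro: continuous_on_subset)

lemma Ck_on_const: "open S \<Longrightarrow> Ck_on k S (\<lambda>x. c)"
proof (induction k arbitrary: c)
  case (Suc k)
  then show ?case by (intro Ck_on_SucI[where f' = "\<lambda>x v. 0"]) auto
qed auto

lemma Ck_on_linear: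
  assumes "open S" "bounded_linear f"
  shows "Ck_on k S f"
proof (cases k)
  case 0
  then show ?thesis using assms by (auto intro!: linear_continuous_on)
next
  case (Suc k')
  then show ?thesis
    using assms by (auto intro!: Ck_on_SucI[where f' = "\<lambda>x. f"] Ck_on_const
        bounded_linear_imp_has_derivative simp del: Ck_on.simps)
qed

lemma Ck_on_add:
  assumes "open S"
  shows "Ck_on k S f \<Longrightarrow> Ck_on k S g \<Longrightarrow> Ck_on k S (\<lambda>x. f x + g x)"
proof (induction k arbitrary: f g)
  case 0
  then show ?case by (auto intro: continuous_intros)
next
  case (Suc k)
  show ?case
    by (rule Ck_on_SucI[OF assms has_derivative_add[OF Ck_on_Suc_has_derivative[OF Suc.prems(1)]
            Ck_on_Suc_has_derivative[OF Suc.prems(2)]]])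
      (auto intro!: Suc.IH Ck_on_Suc_frechet[OF Suc.prems(1)] Ck_on_Suc_frechet[OF Suc.prems(2)])
qed

lemma Ck_on_sum:
  assumes "open S"
  shows "(\<And>i. i \<in> A \<Longrightarrow> Ck_on k S (f i)) \<Longrightarrow> Ck_on k S (\<lambda>x. \<Sum>i\<in>A. f i x)"
  by (induction A rule: infinite_finite_induct) (auto intro!: Ck_on_add Ck_on_const assms)

lemma Ck_on_bilinear:
  assumes "open S" and B: "bounded_bilinear B"
  shows "Ck_on k S f \<Longrightarrow> Ck_on k S g \<Longrightarrow> Ck_on k S (\<lambda>x. B (f x) (g x))"
proof (induction k arbitrary: f g)
  case 0
  then show ?case by (auto intro!: bounded_bilinear.continuous_on[OF B])
next
  case (Suc k)
  note d = Ck_on_Suc_has_derivative[OF Suc.prems(1)] Ck_on_Suc_has_derivative[OF Suc.prems(2)]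
  show ?case
    by (rule Ck_on_SucI[OF assms(1) bounded_bilinear.FDERIV[OF B d]])
      (auto intro!: Ck_on_add assms(1) Suc.IH Ck_on_Suc_frechet[OF Suc.prems(1)]
        Ck_on_Suc_frechet[OF Suc.prems(2)] Ck_on_SucD[OF Suc.prems(1)] Ck_on_SucD[OF Suc.prems(2)])
qed

lemma Ck_on_uminus:
  assumes "open S" "Ck_on k S f"
  shows "Ck_on k S (\<lambda>x. - f x)"
  using Ck_on_bilinear[OF assms(1) bounded_bilinear_scaleR
      Ck_on_const[OF assms(1), of k "-1"] assms(2)] by simp

lemma Ck_on_Pair:
  assumes "open S"
  shows "Ck_on k S f \<Longrightarrow> Ck_on k S g \<Longrightarrow> Ck_on k S (\<lambda>x. (f x, g x))"
proof (induction k arbitrary: f g)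
  case 0
  then show ?case by (auto intro: continuous_intros)
next
  case (Suc k)
  show ?case
    by (rule Ck_on_SucI[OF assms has_derivative_Pair[OF Ck_on_Suc_has_derivative[OF Suc.prems(1)]
            Ck_on_Suc_has_derivative[OF Suc.prems(2)]]])
      (auto intro!: Suc.IH Ck_on_Suc_frechet[OF Suc.prems(1)] Ck_on_Suc_frechet[OF Suc.prems(2)])
qed

lemma Ck_on_compose:
  fixes f :: "'a::real_normed_vector \<Rightarrow> 'b::euclidean_space"
    and g :: "'b \<Rightarrow> 'c::real_normed_vector"
  assumes "open S" "open T" "\<And>x. x \<in> S \<Longrightarrow> f x \<in> T"
  shows "Ck_on k S f \<Longrightarrow> Ck_on k T g \<Longrightarrow> Ck_on k S (\<lambda>x. g (f x))"
proof (induction k arbitrary: g)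
  case 0
  then show ?case
    using assms by (auto intro!: continuous_on_compose2[of T g S f])
next
  case (Suc k)
  let ?f' = "\<lambda>x. frechet_derivative f (at x)"
  let ?g' = "\<lambda>x. frechet_derivative g (at x)"
  \<comment> \<open>The direction \<open>?f' x v\<close> moves with \<open>x\<close>, while
    \<open>Ck_on\<close> speaks of fixed directions. Expanding it in the finite basis leaves sums of
    products to which the induction hypothesis applies.\<close>
  have eq: "?g' (f x) (?f' x v) = (\<Sum>b\<in>Basis. (?f' x v \<bullet> b) *\<^sub>R ?g' (f x) b)" if "x \<in> S" for x v
  proof -
    have "linear (?g' (f x))"
      using Ck_on_Suc_has_derivative[OF Suc.prems(2) assms(3)[OF that]]
      by (simp add: has_derivative_linear)
    then show ?thesis
      by (subst euclidean_representation[of "?f' x v", symmetric])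
        (simp add: linear_sum linear_scale del: euclidean_representation)
  qed
  have "((\<lambda>x. g (f x)) has_derivative (\<lambda>v. \<Sum>b\<in>Basis. (?f' x v \<bullet> b) *\<^sub>R ?g' (f x) b)) (at x)"
    if x: "x \<in> S" for x
    using diff_chain_at[OF Ck_on_Suc_has_derivative[OF Suc.prems(1) x]
        Ck_on_Suc_has_derivative[OF Suc.prems(2) assms(3)[OF x]]] eq[OF x]
    by (simp add: o_def)
  then show ?case
  proof (rule Ck_on_SucI[OF assms(1)])
    fix v
    have "Ck_on k S (\<lambda>x. ?f' x v \<bullet> b)" for b
      using Ck_on_bilinear[OF assms(1) bounded_bilinear_inner
          Ck_on_Suc_frechet[OF Suc.prems(1)] Ck_on_const[OF assms(1)]] .
    moreover have "Ck_on k S (\<lambda>x. ?g' (f x) b)" for b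
      by (rule Suc.IH[OF Ck_on_SucD[OF Suc.prems(1)] Ck_on_Suc_frechet[OF Suc.prems(2)]])
    ultimately show "Ck_on k S (\<lambda>x. \<Sum>b\<in>Basis. (?f' x v \<bullet> b) *\<^sub>R ?g' (f x) b)"
      by (intro Ck_on_sum assms(1) Ck_on_bilinear[OF assms(1) bounded_bilinear_scaleR])
  qed
qed

lemma smooth_on_cong:
  "open S \<Longrightarrow> (\<And>x. x \<in> S \<Longrightarrow> f x = g x) \<Longrightarrow> smooth_on S f \<longleftrightarrow> smooth_on S g"
  unfolding smooth_on_def using Ck_on_cong by blast

lemma smooth_on_subset: "smooth_on S f \<Longrightarrow> T \<subseteq> S \<Longrightarrow> smooth_on T f"
  unfolding smooth_on_def using Ck_on_subset by blast

lemma smooth_on_has_derivative: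
  "smooth_on S f \<Longrightarrow> x \<in> S \<Longrightarrow> (f has_derivative frechet_derivative f (at x)) (at x)"
  unfolding smooth_on_def using Ck_on_Suc_has_derivative by blast

lemma smooth_on_frechet: "smooth_on S f \<Longrightarrow> smooth_on S (\<lambda>x. frechet_derivative f (at x) v)"
  unfolding smooth_on_def using Ck_on_Suc_frechet by blast

lemma smooth_on_continuous: "smooth_on S f \<Longrightarrow> continuous_on S f"
  unfolding smooth_on_def using Ck_on.simps(1) by blast

lemma smooth_on_isCont: "smooth_on S f \<Longrightarrow> x \<in> S \<Longrightarrow> isCont f x"
  using smooth_on_has_derivative has_derivative_continuous by blast

lemma smooth_onI_has_derivative:
  assumes "open S" "\<And>x. x \<in> S \<Longrightarrow> (f has_derivative f' x) (at x)"
    and "\<And>v. smooth_on S (\<lambda>x. f' x v)"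
  shows "smooth_on S f"
  unfolding smooth_on_def
proof
  fix k
  show "Ck_on k S f"
    using Ck_on_SucD[OF Ck_on_SucI[OF assms(1,2)]] assms(3) unfolding smooth_on_def by blast
qed

lemma smooth_on_const: "open S \<Longrightarrow> smooth_on S (\<lambda>x. c)"
  by (simp add: smooth_on_def Ck_on_const)

lemma smooth_on_linear: "open S \<Longrightarrow> bounded_linear f \<Longrightarrow> smooth_on S f"
  by (simp add: smooth_on_def Ck_on_linear)

lemma smooth_on_id: "open S \<Longrightarrow> smooth_on S (\<lambda>x. x)"
  by (simp add: smooth_on_linear)

lemma smooth_on_add: "open S \<Longrightarrow> smooth_on S f \<Longrightarrow> smooth_on S g \<Longrightarrow> smooth_on S (\<lambda>x. f x + g x)"
  by (simp add: smooth_on_def Ck_on_add)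

lemma smooth_on_sum:
  "open S \<Longrightarrow> (\<And>i. i \<in> A \<Longrightarrow> smooth_on S (f i)) \<Longrightarrow> smooth_on S (\<lambda>x. \<Sum>i\<in>A. f i x)"
  by (simp add: smooth_on_def Ck_on_sum)

lemma smooth_on_Pair:
  "open S \<Longrightarrow> smooth_on S f \<Longrightarrow> smooth_on S g \<Longrightarrow> smooth_on S (\<lambda>x. (f x, g x))"
  by (simp add: smooth_on_def Ck_on_Pair)

lemma smooth_on_compose:
  fixes f :: "'a::real_normed_vector \<Rightarrow> 'b::euclidean_space"
    and g :: "'b \<Rightarrow> 'c::real_normed_vector"
  shows "open S \<Longrightarrow> open T \<Longrightarrow> (\<And>x. x \<in> S \<Longrightarrow> f x \<in> T) \<Longrightarrow> smooth_on T g \<Longrightarrow> smooth_on S f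
    \<Longrightarrow> smooth_on S (\<lambda>x. g (f x))"
  unfolding smooth_on_def using Ck_on_compose by blast

lemma smooth_on_bounded_linear:
  fixes f :: "'a::real_normed_vector \<Rightarrow> 'b::euclidean_space"
  shows "open S \<Longrightarrow> bounded_linear g \<Longrightarrow> smooth_on S f \<Longrightarrow> smooth_on S (\<lambda>x. g (f x))"
  by (rule smooth_on_compose[OF _ open_UNIV _ smooth_on_linear[OF open_UNIV]]) auto

lemma smooth_on_fst:
  fixes f :: "'a::real_normed_vector \<Rightarrow> 'b::euclidean_space \<times> 'c::euclidean_space"
  shows "open S \<Longrightarrow> smooth_on S f \<Longrightarrow> smooth_on S (\<lambda>x. fst (f x))"
  by (rule smooth_on_bounded_linear[OF _ bounded_linear_fst])

lemma smooth_on_snd: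
  fixes f :: "'a::real_normed_vector \<Rightarrow> 'b::euclidean_space \<times> 'c::euclidean_space"
  shows "open S \<Longrightarrow> smooth_on S f \<Longrightarrow> smooth_on S (\<lambda>x. snd (f x))"
  by (rule smooth_on_bounded_linear[OF _ bounded_linear_snd])

lemma smooth_on_mult:
  fixes f g :: "'a::real_normed_vector \<Rightarrow> real"
  shows "open S \<Longrightarrow> smooth_on S f \<Longrightarrow> smooth_on S g \<Longrightarrow> smooth_on S (\<lambda>x. f x * g x)"
  by (simp add: smooth_on_def Ck_on_bilinear[OF _ bounded_bilinear_mult])

lemma smooth_on_minus:
  fixes f :: "'a::real_normed_vector \<Rightarrow> real"
  shows "open S \<Longrightarrow> smooth_on S f \<Longrightarrow> smooth_on S (\<lambda>x. - f x)"
  using smooth_on_mult[OF _ smooth_on_const[of S "-1::real"]] by simp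

lemma smooth_on_diff:
  fixes f g :: "'a::real_normed_vector \<Rightarrow> real"
  shows "open S \<Longrightarrow> smooth_on S f \<Longrightarrow> smooth_on S g \<Longrightarrow> smooth_on S (\<lambda>x. f x - g x)"
  using smooth_on_add[OF _ _ smooth_on_minus] by force

lemma smooth_on_power:
  fixes f :: "'a::real_normed_vector \<Rightarrow> real"
  shows "open S \<Longrightarrow> smooth_on S f \<Longrightarrow> smooth_on S (\<lambda>x. f x ^ n)"
  by (induction n) (auto intro: smooth_on_const smooth_on_mult)

text \<open>The derivative is \<open>exp\<close> times a constant, so the induction on the order
  feeds itself; \<open>smooth_inverse\<close> uses \<open>- inverse x * inverse x\<close> in the
  same way.\<close>

lemma smooth_exp: "smooth_on UNIV (exp :: real \<Rightarrow> real)"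
  unfolding smooth_on_def
proof
  fix k show "Ck_on k UNIV (exp :: real \<Rightarrow> real)"
  proof (induction k)
    case 0
    show ?case by (simp add: continuous_on_exp)
  next
    case (Suc k)
    have "(exp has_derivative (\<lambda>v. exp x * v)) (at x)" for x :: real
      using DERIV_exp[of x] by (simp add: has_field_derivative_def)
    then show ?case
      by (rule Ck_on_SucI[OF open_UNIV])
        (intro Ck_on_bilinear[OF open_UNIV bounded_bilinear_mult] Suc Ck_on_const open_UNIV)
  qed
qed

lemma smooth_inverse: "smooth_on (- {0}) (inverse :: real \<Rightarrow> real)"
  unfolding smooth_on_def
proof
  have o: "open (- {0::real})" by (simp add: open_Compl)
  fix k show "Ck_on k (- {0}) (inverse :: real \<Rightarrow> real)"
  proof (induction k)
    case 0
    show ?case by (auto intro!: continuous_intros)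
  next
    case (Suc k)
    have d: "(inverse has_derivative (\<lambda>v. - (inverse x * inverse x) * v)) (at x)" if "x \<in> - {0}" for x :: real
      using DERIV_inverse[of x] that unfolding has_field_derivative_def
      by (simp only: power2_eq_square power_Suc power_0 mult_1_right Compl_iff singleton_iff numeral_2_eq_2 not_False_eq_True)
    have e: "Ck_on k (- {0}) (\<lambda>x. - (inverse x * inverse x) * v)" for v :: real
      by (intro Ck_on_bilinear[OF o bounded_bilinear_mult] Ck_on_uminus Suc Ck_on_const o)
    show ?case
      by (intro Ck_on_SucI[OF o, of inverse "\<lambda>x v. - (inverse x * inverse x) * v"] d e)
  qed
qed

lemma smooth_on_exp:
  fixes f :: "'a::real_normed_vector \<Rightarrow> real"
  shows "open S \<Longrightarrow> smooth_on S f \<Longrightarrow> smooth_on S (\<lambda>x. exp (f x))"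
  by (rule smooth_on_compose[OF _ open_UNIV _ smooth_exp]) auto

lemma smooth_on_inverse:
  fixes f :: "'a::real_normed_vector \<Rightarrow> real"
  shows "open S \<Longrightarrow> (\<And>x. x \<in> S \<Longrightarrow> f x \<noteq> 0) \<Longrightarrow> smooth_on S f \<Longrightarrow> smooth_on S (\<lambda>x. inverse (f x))"
  by (rule smooth_on_compose[OF _ _ _ smooth_inverse]) (auto simp: open_Compl)

lemma smooth_on_divide:
  fixes f g :: "'a::real_normed_vector \<Rightarrow> real"
  shows "open S \<Longrightarrow> (\<And>x. x \<in> S \<Longrightarrow> g x \<noteq> 0) \<Longrightarrow> smooth_on S f \<Longrightarrow> smooth_on S g
    \<Longrightarrow> smooth_on S (\<lambda>x. f x / g x)"
  by (simp add: divide_inverse smooth_on_mult smooth_on_inverse)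

lemma smooth_on_ln:
  fixes f :: "'a::real_normed_vector \<Rightarrow> real"
  assumes "open S" "\<And>x. x \<in> S \<Longrightarrow> f x > 0" "smooth_on S f"
  shows "smooth_on S (\<lambda>x. ln (f x))"
proof -
  have "(ln has_derivative (\<lambda>v. inverse x * v)) (at x)" if "x \<in> {0<..}" for x :: real
    using DERIV_ln[of x] that by (simp add: has_field_derivative_def)
  moreover have "smooth_on {0<..} (\<lambda>x. inverse x * v)" for v :: real
    by (intro smooth_on_mult smooth_on_inverse smooth_on_const smooth_on_id) auto
  ultimately have "smooth_on {0<..} (ln :: real \<Rightarrow> real)"
    using smooth_onI_has_derivative[of "{0::real<..}" ln "\<lambda>x v. inverse x * v"] by simp
  then show ?thesis
    using smooth_on_compose[OF assms(1) open_greaterThan, where f = f and g = ln] assms by auto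
qed

lemma smooth_on_powr:
  fixes f g :: "'a::real_normed_vector \<Rightarrow> real"
  assumes "open S" "\<And>x. x \<in> S \<Longrightarrow> f x > 0" "smooth_on S f" "smooth_on S g"
  shows "smooth_on S (\<lambda>x. f x powr g x)"
proof -
  have "smooth_on S (\<lambda>x. exp (g x * ln (f x)))"
    by (intro smooth_on_exp smooth_on_mult smooth_on_ln assms)
  then show ?thesis
    by (subst smooth_on_cong[OF assms(1), where g = "\<lambda>x. exp (g x * ln (f x))"])
      (use assms(2) in \<open>force simp: powr_def\<close>, assumption)
qed

lemmas smooth_intros = smooth_on_const smooth_on_id smooth_on_add smooth_on_sum smooth_on_Pair
  smooth_on_fst smooth_on_snd smooth_on_mult smooth_on_minus smooth_on_diff smooth_on_power
  smooth_on_exp smooth_on_inverse smooth_on_divide smooth_on_ln smooth_on_powr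

lemma smooth_on_deriv:
  fixes f :: "real \<Rightarrow> real"
  assumes "open S" "smooth_on S f"
  shows "smooth_on S (deriv f)"
proof -
  have "deriv f x = frechet_derivative f (at x) 1" if "x \<in> S" for x
  proof -
    have d: "(f has_derivative frechet_derivative f (at x)) (at x)"
      using smooth_on_has_derivative[OF assms(2) that] .
    then have "f differentiable (at x)" by (auto simp: differentiable_def)
    then have "(f has_derivative (*) (deriv f x)) (at x)"
      using DERIV_deriv_iff_real_differentiable has_field_derivative_def by blast
    then show ?thesis using frechet_eqI by fastforce
  qed
  then show ?thesis
    using smooth_on_cong[OF assms(1), of "deriv f" "\<lambda>x. frechet_derivative f (at x) 1"]
      smooth_on_frechet[OF assms(2), of 1] by auto
qed

lemma smooth_on_has_real_derivative:
  fixes f :: "real \<Rightarrow> real"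
  assumes "smooth_on S f" "x \<in> S"
  shows "(f has_real_derivative deriv f x) (at x)"
  using smooth_on_has_derivative[OF assms]
  by (auto simp: DERIV_deriv_iff_real_differentiable differentiable_def)

lemma partial_fst_has_derivative:
  fixes f :: "real \<times> 'p::real_normed_vector \<Rightarrow> real"
  assumes "(f has_derivative f') (at (u, p))"
  shows "((\<lambda>x. f (x, p)) has_real_derivative f' (1, 0)) (at u)"
proof -
  have lin: "linear f'" using assms has_derivative_linear by blast
  have g: "((\<lambda>x. (x, p)) has_derivative (\<lambda>h. (h, 0))) (at u)"
    by (auto intro!: derivative_eq_intros)
  have "((\<lambda>x. f (x, p)) has_derivative (\<lambda>h. f' (h, 0))) (at u)"
    using diff_chain_at[OF g] assms by (auto simp: o_def)
  moreover have "(\<lambda>h. f' (h, 0)) = (*) (f' (1, 0))"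
  proof
    fix h show "f' (h, 0) = f' (1, 0) * h"
      using linear_scale[OF lin, of h "(1, 0)"] by simp
  qed
  ultimately show ?thesis by (simp only: has_field_derivative_def)
qed

lemma partial_snd_has_derivative:
  fixes f :: "'p::real_normed_vector \<times> real \<Rightarrow> real"
  assumes "(f has_derivative f') (at (p, u))"
  shows "((\<lambda>x. f (p, x)) has_real_derivative f' (0, 1)) (at u)"
proof -
  have lin: "linear f'" using assms has_derivative_linear by blast
  have g: "((\<lambda>x. (p, x)) has_derivative (\<lambda>h. (0, h))) (at u)"
    by (auto intro!: derivative_eq_intros)
  have "((\<lambda>x. f (p, x)) has_derivative (\<lambda>h. f' (0, h))) (at u)"
    using diff_chain_at[OF g] assms by (auto simp: o_def)
  moreover have "(\<lambda>h. f' (0, h)) = (*) (f' (0, 1))"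
  proof
    fix h show "f' (0, h) = f' (0, 1) * h"
      using linear_scale[OF lin, of h "(0, 1)"] by simp
  qed
  ultimately show ?thesis by (simp only: has_field_derivative_def)
qed

section \<open>Integrals depending on parameters\<close>

text \<open>\<open>leibniz_rule\<close> asks for a convex domain and for continuity of the
  derivative as an operator. A ball around \<open>p0\<close> gives the first; in finite dimension,
  continuity in every single direction gives the second.\<close>

lemma integral_param_has_derivative:
  fixes g :: "real \<Rightarrow> 'a::euclidean_space \<Rightarrow> real"
  assumes "open P" "p0 \<in> P"
    and d: "\<And>t p. t \<in> {0..1} \<Longrightarrow> p \<in> P \<Longrightarrow> (g t has_derivative g' t p) (at p)"
    and c: "continuous_on ({0..1} \<times> P) (\<lambda>(t, p). g t p)"
    and c': "\<And>v. continuous_on ({0..1} \<times> P) (\<lambda>(t, p). g' t p v)"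
  shows "((\<lambda>p. integral {0..1} (\<lambda>t. g t p)) has_derivative
    (\<lambda>v. integral {0..1} (\<lambda>t. g' t p0 v))) (at p0)"
proof -
  obtain e where e: "e > 0" "ball p0 e \<subseteq> P"
    using assms(1,2) open_contains_ball by blast
  define F where "F p t = Blinfun (g' t p)" for p t
  have F: "blinfun_apply (F p t) = g' t p" if "t \<in> {0..1}" "p \<in> P" for t p
    unfolding F_def using d[OF that] has_derivative_bounded_linear bounded_linear_Blinfun_apply by blast
  have swap: "continuous_on (ball p0 e \<times> cbox 0 1) (\<lambda>(p, t). f t p)"
    if "continuous_on ({0..1} \<times> P) (\<lambda>(t, p). f t p)" for f :: "real \<Rightarrow> 'a \<Rightarrow> real"
  proof -
    have "continuous_on (ball p0 e \<times> cbox 0 1) (\<lambda>x. (case prod.swap x of (t, p) \<Rightarrow> f t p))"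
      by (rule continuous_on_compose2[OF that continuous_on_swap]) (use e in auto)
    then show ?thesis by (simp add: split_beta)
  qed
  have contF: "continuous_on (ball p0 e \<times> cbox 0 1) (\<lambda>(p, t). F p t)"
  proof (rule continuous_on_blinfun_componentwise)
    fix i :: 'a assume "i \<in> Basis"
    have "continuous_on (ball p0 e \<times> cbox 0 1) (\<lambda>(p, t). g' t p i)"
      by (rule swap[OF c'])
    then show "continuous_on (ball p0 e \<times> cbox 0 1) (\<lambda>x. blinfun_apply (case x of (p, t) \<Rightarrow> F p t) i)"
      by (rule continuous_on_eq) (use e F in \<open>auto split: prod.split\<close>)
  qed
  have "((\<lambda>p. integral (cbox 0 1) (\<lambda>t. g t p)) has_derivative integral (cbox 0 1) (F p0)) (at p0 within ball p0 e)"
  proof (rule leibniz_rule[OF _ _ contF])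
    fix p and t :: real assume "p \<in> ball p0 e" "t \<in> cbox 0 1"
    then show "((\<lambda>p. g t p) has_derivative blinfun_apply (F p t)) (at p within ball p0 e)"
      using d[of t p] F[of t p] subsetD[OF e(2), of p] by (auto intro: has_derivative_at_withinI)
  next
    fix p assume "p \<in> ball p0 e"
    then show "(\<lambda>t. g t p) integrable_on cbox 0 1"
      using e by (intro integrable_continuous continuous_on_compose2[OF c, of _ "\<lambda>t. (t, p)", simplified])
        (auto intro!: continuous_intros)
  qed (use e in auto)
  moreover have "blinfun_apply (integral (cbox 0 1) (F p0)) = (\<lambda>v. integral {0..1} (\<lambda>t. g' t p0 v))"
  proof
    fix v
    have int: "F p0 integrable_on cbox 0 1"
      using e by (intro integrable_continuous continuous_on_compose2[OF contF, of _ "\<lambda>t. (p0, t)", simplified])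
        (auto intro!: continuous_intros)
    have "blinfun_apply (integral (cbox 0 1) (F p0)) v = integral (cbox 0 1) (\<lambda>t. blinfun_apply (F p0 t) v)"
      by (rule blinfun_apply_integral[OF int])
    also have "\<dots> = integral {0..1} (\<lambda>t. g' t p0 v)"
      using F assms(2) by (auto intro!: integral_cong)
    finally show "blinfun_apply (integral (cbox 0 1) (F p0)) v = integral {0..1} (\<lambda>t. g' t p0 v)" .
  qed
  ultimately show ?thesis
    using e by (simp add: at_within_open[of p0 "ball p0 e"])
qed

lemma integral_param_continuous:
  fixes g :: "real \<Rightarrow> 'a::euclidean_space \<Rightarrow> real"
  assumes "continuous_on ({0..1} \<times> P) (\<lambda>(t, p). g t p)"
  shows "continuous_on P (\<lambda>p. integral {0..1} (\<lambda>t. g t p))"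
proof -
  have "continuous_on (P \<times> cbox 0 1) (\<lambda>x. (case prod.swap x of (t, p) \<Rightarrow> g t p))"
    by (rule continuous_on_compose2[OF assms continuous_on_swap]) auto
  then show ?thesis
    using integral_continuous_on_param[of P 0 1 "\<lambda>p t. g t p"] by (simp add: split_beta)
qed

section \<open>Radial integrals with the weight \<open>t powr b * ln t ^ j\<close>\<close>

lemma tendsto_powr_ln_power_0:
  fixes b :: real
  assumes "b > 0"
  shows "((\<lambda>t. t powr b * \<bar>ln t\<bar> ^ j) \<longlongrightarrow> 0) (at_right 0)"
proof (cases "j = 0")
  case True
  have "((\<lambda>t. t powr b) \<longlongrightarrow> 0) (at_right 0)" using assms by real_asymp
  then show ?thesis using True by simp
next
  case False
  \<comment> \<open>The exponent is shared among the logarithms: the function is the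
    \<open>j\<close>-th power of \<open>t powr c * \<bar>ln t\<bar>\<close>.\<close>
  define c where "c = b / real j"
  have c: "c > 0" using assms False by (simp add: c_def)
  then have "((\<lambda>t. t powr c * \<bar>ln t\<bar>) \<longlongrightarrow> 0) (at_right 0)" by real_asymp
  then have "((\<lambda>t. (t powr c * \<bar>ln t\<bar>) ^ j) \<longlongrightarrow> 0 ^ j) (at_right 0)" by (rule tendsto_power)
  moreover have "(t powr c * \<bar>ln t\<bar>) ^ j = t powr b * \<bar>ln t\<bar> ^ j" for t
    using False by (cases "t = 0") (simp_all add: power_mult_distrib powr_power c_def)
  ultimately show ?thesis using False by (simp add: power_0_left)
qed

lemma continuous_on_powr_ln_power:
  "continuous_on ({0..1} \<times> {0<..}) (\<lambda>(t::real, b::real). t powr b * ln t ^ j)"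
  unfolding continuous_on_def
proof
  fix x :: "real \<times> real" assume x: "x \<in> {0..1} \<times> {0<..}"
  obtain t0 b0 where [simp]: "x = (t0, b0)" by force
  have b0: "b0 > 0" and t0: "0 \<le> t0" "t0 \<le> 1" using x by auto
  show "((\<lambda>(t, b). t powr b * ln t ^ j) \<longlongrightarrow> (case x of (t, b) \<Rightarrow> t powr b * ln t ^ j))
      (at x within {0..1} \<times> {0<..})"
  proof (cases "t0 = 0")
    case False
    then have "isCont (\<lambda>x. fst x powr snd x * ln (fst x) ^ j) x"
      using t0 by (auto intro!: continuous_intros)
    then have "((\<lambda>x. fst x powr snd x * ln (fst x) ^ j) \<longlongrightarrow> fst x powr snd x * ln (fst x) ^ j)
        (at x within {0..1} \<times> {0<..})"
      unfolding isCont_def by (rule tendsto_within_subset) simp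
    then show ?thesis by (simp add: case_prod_unfold)
  next
    case True
    let ?F = "at x within {0..1} \<times> {0<..}"
    \<comment> \<open>For \<open>b\<close> near \<open>b0\<close> one has \<open>b > b0/2\<close>,
      and \<open>t \<le> 1\<close>, so this function of \<open>t\<close> alone dominates. The value
      0 on the left makes it continuous at 0 as a function on the whole line.\<close>
    have lim: "((\<lambda>t. if t \<le> 0 then 0 else t powr (b0/2) * \<bar>ln t\<bar> ^ j) \<longlongrightarrow> 0) (at 0)"
    proof (rule filterlim_split_at)
      show "((\<lambda>t. if t \<le> 0 then 0 else t powr (b0/2) * \<bar>ln t\<bar> ^ j) \<longlongrightarrow> 0) (at_left 0)"
        by (rule Lim_transform_eventually[OF tendsto_const]) (auto simp: eventually_at_filter)
      show "((\<lambda>t. if t \<le> 0 then 0 else t powr (b0/2) * \<bar>ln t\<bar> ^ j) \<longlongrightarrow> 0) (at_right 0)"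
        using b0 by (intro Lim_transform_eventually[OF tendsto_powr_ln_power_0[of "b0/2" j]])
          (auto simp: eventually_at_filter)
    qed
    then have "isCont (\<lambda>t. if t \<le> 0 then 0 else t powr (b0/2) * \<bar>ln t\<bar> ^ j) 0"
      by (simp add: isCont_def)
    moreover have "(fst \<longlongrightarrow> 0) ?F"
      using True tendsto_fst[OF tendsto_ident_at, of x "{0..1} \<times> {0<..}"] by simp
    ultimately have *: "((\<lambda>y. if fst y \<le> 0 then 0 else fst y powr (b0/2) * \<bar>ln (fst y)\<bar> ^ j) \<longlongrightarrow> 0) ?F"
      using True isCont_tendsto_compose[of 0 "\<lambda>t. if t \<le> 0 then 0 else t powr (b0/2) * \<bar>ln t\<bar> ^ j" fst ?F]
      by simp
    have "((\<lambda>y. fst y powr snd y * ln (fst y) ^ j) \<longlongrightarrow> 0) ?F"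
    proof (rule tendsto_0_le[OF *, of _ 1])
      have "(snd \<longlongrightarrow> b0) ?F" by (auto intro!: tendsto_eq_intros)
      then have "eventually (\<lambda>y. b0/2 < snd y) ?F"
        using b0 by (intro order_tendstoD) auto
      moreover have "eventually (\<lambda>y. y \<in> {0..1} \<times> {0<..}) ?F"
        by (simp add: eventually_at_filter)
      ultimately show "eventually (\<lambda>y. norm (fst y powr snd y * ln (fst y) ^ j)
          \<le> norm (if fst y \<le> 0 then 0 else fst y powr (b0/2) * \<bar>ln (fst y)\<bar> ^ j) * 1) ?F"
      proof eventually_elim
        case (elim y)
        show ?case
        proof (cases "fst y = 0")
          case False
          then have y: "fst y > 0" "fst y \<le> 1" using elim by auto
          then have "fst y powr snd y \<le> fst y powr (b0/2)"
            using elim by (intro powr_mono') auto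
          then show ?thesis using y
            by (auto simp: abs_mult power_abs intro!: mult_right_mono)
        qed auto
      qed
    qed
    then show ?thesis using True by (simp add: case_prod_unfold)
  qed
qed

text \<open>Star-shapedness in the first variable alone: it keeps \<open>(t * u, p)\<close> in the
  domain for all \<open>t\<close> in the range of integration.\<close>

definition radial_open :: "(real \<times> 'p::euclidean_space) set \<Rightarrow> bool" where
  "radial_open S \<longleftrightarrow> open S \<and> (\<forall>u p t. (u, p) \<in> S \<longrightarrow> 0 \<le> t \<longrightarrow> t \<le> 1 \<longrightarrow> (t * u, p) \<in> S)"

lemma radial_open_open: "radial_open S \<Longrightarrow> open S"
  by (simp add: radial_open_def)

lemma radial_open_scale: "radial_open S \<Longrightarrow> x \<in> S \<Longrightarrow> 0 \<le> t \<Longrightarrow> t \<le> 1 \<Longrightarrow> (t * fst x, snd x) \<in> S"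
  by (cases x) (auto simp: radial_open_def)

lemma radial_open_0: "radial_open S \<Longrightarrow> x \<in> S \<Longrightarrow> (0, snd x) \<in> S"
  using radial_open_scale[of S x 0] by simp

text \<open>For \<open>u > 0\<close> the substitution \<open>v = t * u\<close> shows
  \<open>u powr (- b - 1)\<close> times the integral of
  \<open>f v * v powr b * ln (v / u) ^ j\<close> over \<open>0 < v < u\<close>. The scaled form also
  makes sense, and is smooth, for \<open>u \<le> 0\<close>. The logarithms close the class under
  derivatives in the exponent.\<close>

definition radial_int :: "(real \<times> 'p \<Rightarrow> real) \<Rightarrow> ('p \<Rightarrow> real) \<Rightarrow> nat \<Rightarrow> real \<times> 'p::euclidean_space \<Rightarrow> real" where
  "radial_int f b j x = integral {0..1} (\<lambda>t. f (t * fst x, snd x) * (t powr b (snd x) * ln t ^ j))"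

lemma radial_integrand_continuous:
  assumes "radial_open S" "continuous_on S f" "continuous_on (snd ` S) b" "\<And>x. x \<in> S \<Longrightarrow> b (snd x) > 0"
  shows "continuous_on ({0..1} \<times> S) (\<lambda>(t, x). f (t * fst x, snd x) * (t powr b (snd x) * ln t ^ j))"
proof -
  have 1: "continuous_on ({0..1} \<times> S) (\<lambda>y. f (fst y * fst (snd y), snd (snd y)))"
    by (rule continuous_on_compose2[OF assms(2)])
      (auto intro!: continuous_intros radial_open_scale[OF assms(1), of "(_, _)", simplified])
  have 2: "continuous_on ({0..1} \<times> S) (\<lambda>y. b (snd (snd y)))"
    by (rule continuous_on_compose2[OF assms(3)]) (auto intro!: continuous_intros)
  have "continuous_on ({0..1} \<times> S) (\<lambda>y. case (fst y, b (snd (snd y))) of (t, b) \<Rightarrow> t powr b * ln t ^ j)"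
    by (rule continuous_on_compose2[OF continuous_on_powr_ln_power[of j]])
      (use assms(4) in \<open>auto intro!: continuous_intros 2 simp: mem_Times_iff\<close>)
  with 1 show ?thesis by (auto simp: split_beta intro!: continuous_on_mult)
qed

lemma radial_int_has_derivative:
  fixes f :: "real \<times> 'p::euclidean_space \<Rightarrow> real"
  assumes S: "radial_open S" and f: "smooth_on S f"
    and Q: "open Q" "snd ` S \<subseteq> Q" "smooth_on Q b" "\<And>p. p \<in> Q \<Longrightarrow> b p > 0" and x0: "x0 \<in> S"
  shows "(radial_int f b j has_derivative (\<lambda>v.
      fst v * radial_int (\<lambda>x. frechet_derivative f (at x) (1, 0)) (\<lambda>p. b p + 1) j x0
      + radial_int (\<lambda>x. frechet_derivative f (at x) (0, snd v)) b j x0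
      + frechet_derivative b (at (snd x0)) (snd v) * radial_int f b (Suc j) x0)) (at x0)"
proof -
  let ?f' = "\<lambda>x. frechet_derivative f (at x)"
  let ?b' = "\<lambda>p. frechet_derivative b (at p)"
  let ?q = "\<lambda>t x. (t * fst x, snd x)"
  \<comment> \<open>The three sources of a derivative: \<open>A\<close> from moving
    \<open>u\<close>, whose inner factor \<open>t\<close> raises the exponent; \<open>B\<close> from
    the parameter inside \<open>f\<close>; \<open>C\<close> from the exponent, which brings out one
    more \<open>ln t\<close>.\<close>
  define A where "A = (\<lambda>t x. ?f' (?q t x) (1, 0) * (t powr (b (snd x) + 1) * ln t ^ j))"
  define B where "B = (\<lambda>(v::real \<times> 'p) t x. ?f' (?q t x) (0, snd v) * (t powr b (snd x) * ln t ^ j))"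
  define C where "C = (\<lambda>t x. f (?q t x) * (t powr b (snd x) * ln t ^ Suc j))"
  define g' where "g' t x v = fst v * A t x + B v t x + ?b' (snd x) (snd v) * C t x" for t x v
  have cb: "continuous_on (snd ` S) b"
    using smooth_on_continuous[OF Q(3)] Q(2) continuous_on_subset by blast
  have cA: "continuous_on ({0..1} \<times> S) (\<lambda>(t, x). A t x)"
    unfolding A_def
    by (rule radial_integrand_continuous[OF S])
      (use smooth_on_continuous[OF smooth_on_frechet[OF f]] cb Q in \<open>force intro!: continuous_intros\<close>)+
  have cB: "continuous_on ({0..1} \<times> S) (\<lambda>(t, x). B v t x)" for v
    unfolding B_def
    by (rule radial_integrand_continuous[OF S])
      (use smooth_on_continuous[OF smooth_on_frechet[OF f]] cb Q in \<open>force intro!: continuous_intros\<close>)+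
  have cC: "continuous_on ({0..1} \<times> S) (\<lambda>(t, x). C t x)"
    unfolding C_def
    by (rule radial_integrand_continuous[OF S])
      (use smooth_on_continuous[OF f] cb Q in \<open>force intro!: continuous_intros\<close>)+
  have cg': "continuous_on ({0..1} \<times> S) (\<lambda>(t, x). g' t x v)" for v
  proof -
    have "continuous_on ({0..1} \<times> S) (\<lambda>y. ?b' (snd (snd y)) (snd v))"
      by (rule continuous_on_compose2[OF smooth_on_continuous[OF smooth_on_frechet[OF Q(3)]]])
        (use Q(2) in \<open>auto intro!: continuous_intros\<close>)
    then show ?thesis
      unfolding g'_def using cA cB[of v] cC
      by (auto simp: split_beta intro!: continuous_intros)
  qed
  have "((\<lambda>x. integral {0..1} (\<lambda>t. f (?q t x) * (t powr b (snd x) * ln t ^ j))) has_derivative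
      (\<lambda>v. integral {0..1} (\<lambda>t. g' t x0 v))) (at x0)"
  proof (rule integral_param_has_derivative[OF radial_open_open[OF S] x0 _ _ cg'])
    show "continuous_on ({0..1} \<times> S) (\<lambda>(t, x). f (?q t x) * (t powr b (snd x) * ln t ^ j))"
      by (rule radial_integrand_continuous[OF S])
        (use smooth_on_continuous[OF f] cb Q in \<open>force intro!: continuous_intros\<close>)+
  next
    fix t x assume t: "t \<in> {0..1::real}" and x: "x \<in> S"
    show "((\<lambda>x. f (?q t x) * (t powr b (snd x) * ln t ^ j)) has_derivative g' t x) (at x)"
    proof (cases "t = 0")
      \<comment> \<open>Here \<open>0 powr _ = 0\<close> makes the integrand and all three terms
        vanish identically, whereas the derivative rule for \<open>powr\<close> asks for a positive
        base.\<close>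
      case True
      then have "g' t x = (\<lambda>v. 0)" by (simp add: fun_eq_iff g'_def A_def B_def C_def)
      then show ?thesis using True by simp
    next
      case False
      with t have t: "0 < t" "t \<le> 1" by auto
      have fd: "(f has_derivative ?f' (?q t x)) (at (?q t x))"
        by (rule smooth_on_has_derivative[OF f radial_open_scale[OF S x]]) (use t in auto)
      have "((\<lambda>x. ?q t x) has_derivative (\<lambda>v. (t * fst v, snd v))) (at x)"
        by (auto intro!: derivative_eq_intros)
      from diff_chain_at[OF this fd]
      have d1: "((\<lambda>x. f (?q t x)) has_derivative (\<lambda>v. ?f' (?q t x) (t * fst v, snd v))) (at x)"
        by (simp add: o_def)
      have "(b has_derivative ?b' (snd x)) (at (snd x))"
        by (rule smooth_on_has_derivative[OF Q(3)]) (use Q(2) x in auto)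
      from diff_chain_at[OF has_derivative_snd[OF has_derivative_ident] this]
      have d2: "((\<lambda>x. b (snd x)) has_derivative (\<lambda>v. ?b' (snd x) (snd v))) (at x)"
        by (simp add: o_def)
      have d3: "((\<lambda>x. t powr b (snd x)) has_derivative
          (\<lambda>v. t powr b (snd x) * (?b' (snd x) (snd v) * ln t))) (at x)"
        using has_derivative_powr[OF has_derivative_const[of t] d2] t by (simp add: mult.commute)
      have lin: "?f' (?q t x) (t * fst v, snd v) = t * fst v * ?f' (?q t x) (1, 0) + ?f' (?q t x) (0, snd v)"
        for v
      proof -
        have l: "linear (?f' (?q t x))" using fd has_derivative_linear by blast
        show ?thesis
          using linear_add[OF l, of "(t * fst v) *\<^sub>R (1, 0)" "(0, snd v)"]
            linear_scale[OF l, of "t * fst v" "(1, 0)"] by simp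
      qed
      show ?thesis
        by (rule has_derivative_eq_rhs[OF has_derivative_mult[OF d1 has_derivative_mult_left[OF d3]]])
          (use t in \<open>simp add: fun_eq_iff g'_def A_def B_def C_def lin powr_add algebra_simps\<close>)
    qed
  qed
  moreover have "integral {0..1} (\<lambda>t. g' t x0 v) = fst v * integral {0..1} (\<lambda>t. A t x0)
      + integral {0..1} (\<lambda>t. B v t x0) + ?b' (snd x0) (snd v) * integral {0..1} (\<lambda>t. C t x0)" for v
  proof -
    have i: "(\<lambda>t. F t x0) integrable_on {0..1}" if "continuous_on ({0..1} \<times> S) (\<lambda>(t, x). F t x)"
      for F :: "real \<Rightarrow> real \<times> 'p \<Rightarrow> real"
      using x0 by (intro integrable_continuous_real continuous_on_compose2[OF that, of _ "\<lambda>t. (t, x0)", simplified])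
        (auto intro!: continuous_intros)
    show ?thesis
      unfolding g'_def
      using i[OF cA] i[OF cB[of v]] i[OF cC]
      by (simp add: integral_add integrable_add integrable_on_mult_right)
  qed
  ultimately show ?thesis
    by (simp add: radial_int_def[abs_def] A_def B_def C_def)
qed

text \<open>A derivative of a radial integral is a combination of radial integrals with changed
  \<open>f\<close>, \<open>b\<close> or \<open>j\<close>, so the induction on the order must
  generalize over all three.\<close>

lemma smooth_on_radial_int:
  fixes f :: "real \<times> 'p::euclidean_space \<Rightarrow> real"
  assumes S: "radial_open S" and f: "smooth_on S f"
    and Q: "open Q" "snd ` S \<subseteq> Q" "smooth_on Q b" "\<And>p. p \<in> Q \<Longrightarrow> b p > 0"
  shows "smooth_on S (radial_int f b j)"
  unfolding smooth_on_def
proof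
  fix k
  show "Ck_on k S (radial_int f b j)"
    using f Q(3,4)
  proof (induction k arbitrary: f b j)
    case 0
    have "continuous_on S (\<lambda>x. integral {0..1} (\<lambda>t. f (t * fst x, snd x) * (t powr b (snd x) * ln t ^ j)))"
      by (rule integral_param_continuous, rule radial_integrand_continuous[OF S])
        (use smooth_on_continuous[OF 0(1)] smooth_on_continuous[OF 0(2)] 0(3) Q(2) in
          \<open>auto intro: continuous_on_subset\<close>)
    then show ?case by (simp add: radial_int_def[abs_def])
  next
    case (Suc k)
    note oS = radial_open_open[OF S]
    have pd: "smooth_on S (\<lambda>x. frechet_derivative b (at (snd x)) w)" for w
      by (rule smooth_on_compose[OF oS Q(1) _ smooth_on_frechet[OF Suc.prems(2)]])
        (use Q(2) in \<open>auto intro!: smooth_on_linear oS bounded_linear_snd\<close>)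
    have b1: "smooth_on Q (\<lambda>p. b p + 1)" by (intro smooth_intros Q Suc.prems)
    show ?case
    proof (rule Ck_on_SucI[OF oS radial_int_has_derivative[OF S Suc.prems(1) Q(1,2) Suc.prems(2,3)]])
      fix v :: "real \<times> 'p"
      have "Ck_on k S (radial_int (\<lambda>x. frechet_derivative f (at x) (1, 0)) (\<lambda>p. b p + 1) j)"
        by (rule Suc.IH) (use smooth_on_frechet[OF Suc.prems(1)] b1 Suc.prems(3) in \<open>auto simp: add_pos_pos\<close>)
      moreover have "Ck_on k S (radial_int (\<lambda>x. frechet_derivative f (at x) (0, snd v)) b j)"
        by (rule Suc.IH) (use smooth_on_frechet[OF Suc.prems(1)] Suc.prems in auto)
      moreover have "Ck_on k S (radial_int f b (Suc j))"
        by (rule Suc.IH) (use Suc.prems in auto)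
      moreover have "Ck_on k S (\<lambda>x. frechet_derivative b (at (snd x)) (snd v))"
        using pd unfolding smooth_on_def by blast
      ultimately show "Ck_on k S (\<lambda>x. fst v * radial_int (\<lambda>x. frechet_derivative f (at x) (1, 0)) (\<lambda>p. b p + 1) j x
        + radial_int (\<lambda>x. frechet_derivative f (at x) (0, snd v)) b j x
        + frechet_derivative b (at (snd x)) (snd v) * radial_int f b (Suc j) x)"
        by (intro Ck_on_add Ck_on_bilinear[OF oS bounded_bilinear_mult] Ck_on_const oS)
    qed
  qed
qed

section \<open>Hadamard quotients and Taylor coefficients in a radial variable\<close>

lemma nderiv_cong:
  assumes "open I" "\<And>x. x \<in> I \<Longrightarrow> f x = g x" "x \<in> I"
  shows "nderiv k f x = nderiv k g x"
  using assms(3)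
proof (induction k arbitrary: x)
  case (Suc k)
  have "eventually (\<lambda>x. nderiv k f x = nderiv k g x) (nhds x)"
    using eventually_nhds_in_open[OF assms(1) Suc.prems] by eventually_elim (use Suc.IH in auto)
  then show ?case by (simp add: deriv_cong_ev)
qed (use assms in auto)

lemma smooth_on_nderiv: "open I \<Longrightarrow> smooth_on I f \<Longrightarrow> smooth_on I (nderiv k f)"
  by (induction k) (auto intro: smooth_on_deriv)

lemma nderiv_has_real_derivative:
  assumes "open I" "smooth_on I f" "x \<in> I"
  shows "(nderiv k f has_real_derivative nderiv (Suc k) f x) (at x)"
  using smooth_on_has_real_derivative[OF smooth_on_nderiv[OF assms(1,2)] assms(3)] by simp

text \<open>At \<open>x = 0\<close> the last term alone remains: passing to the quotient
  \<open>r\<close> lowers the order of the derivative by one and costs the factor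
  \<open>k + 1\<close>.\<close>

lemma nderiv_linear_plus:
  fixes r :: "real \<Rightarrow> real"
  assumes "open I" "smooth_on I r" "x \<in> I"
  shows "nderiv (Suc k) (\<lambda>x. c + x * r x) x = x * nderiv (Suc k) r x + real (Suc k) * nderiv k r x"
  using assms(3)
proof (induction k arbitrary: x)
  case 0
  have "((\<lambda>x. c + x * r x) has_real_derivative x * deriv r x + r x) (at x)"
    using smooth_on_has_real_derivative[OF assms(2) 0]
    by (auto intro!: derivative_eq_intros)
  then show ?case by (simp add: DERIV_imp_deriv)
next
  case (Suc k)
  have "eventually (\<lambda>x. nderiv (Suc k) (\<lambda>x. c + x * r x) x =
      x * nderiv (Suc k) r x + real (Suc k) * nderiv k r x) (nhds x)"
    using eventually_nhds_in_open[OF assms(1) Suc.prems] by eventually_elim (use Suc.IH in auto)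
  then have "deriv (nderiv (Suc k) (\<lambda>x. c + x * r x)) x =
      deriv (\<lambda>x. x * nderiv (Suc k) r x + real (Suc k) * nderiv k r x) x"
    by (rule deriv_cong_ev) simp
  also have "\<dots> = x * nderiv (Suc (Suc k)) r x + nderiv (Suc k) r x + real (Suc k) * nderiv (Suc k) r x"
    using nderiv_has_real_derivative[OF assms(1,2) Suc.prems, of "Suc k"]
      nderiv_has_real_derivative[OF assms(1,2) Suc.prems, of k]
    by (intro DERIV_imp_deriv) (auto intro!: derivative_eq_intros simp del: funpow.simps of_nat_Suc)
  finally show ?case by (simp add: algebra_simps)
qed

lemma smooth_on_slice:
  fixes f :: "real \<times> 'p::euclidean_space \<Rightarrow> real"
  assumes "open I" "open S" "\<And>u. u \<in> I \<Longrightarrow> (u, p) \<in> S" "smooth_on S f"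
  shows "smooth_on I (\<lambda>u. f (u, p))"
  by (rule smooth_on_compose[OF assms(1,2) assms(3) assms(4)]) (auto intro!: smooth_intros assms)

definition pd1 :: "(real \<times> 'p::euclidean_space \<Rightarrow> real) \<Rightarrow> real \<times> 'p \<Rightarrow> real" where
  "pd1 f x = frechet_derivative f (at x) (1, 0)"

lemma smooth_on_pd1: "smooth_on S f \<Longrightarrow> smooth_on S (pd1 f)"
  unfolding pd1_def[abs_def] by (rule smooth_on_frechet)

lemma pd1_has_real_derivative:
  assumes "smooth_on S f" "(u, p) \<in> S"
  shows "((\<lambda>x. f (x, p)) has_real_derivative pd1 f (u, p)) (at u)"
  unfolding pd1_def using partial_fst_has_derivative[OF smooth_on_has_derivative[OF assms]] .

lemma pd1_scale_has_real_derivative: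
  assumes "smooth_on S f" "(t * u, p) \<in> S"
  shows "((\<lambda>t. f (t * u, p)) has_real_derivative u * pd1 f (t * u, p)) (at t)"
proof -
  have "((\<lambda>t. t * u) has_real_derivative u) (at t)" by (auto intro!: derivative_eq_intros)
  from DERIV_chain2[where f = "\<lambda>x. f (x, p)" and g = "\<lambda>t. t * u",
      OF pd1_has_real_derivative[OF assms] this]
  show ?thesis by (simp add: mult.commute)
qed

text \<open>The usual quotient is the integral of \<open>pd1 f (t * u, p)\<close> over
  \<open>t\<close>, which would need the exponent 0. One integration by parts gives this form with
  weight \<open>t\<close>, admissible for \<open>radial_int\<close>.\<close>

definition hadamard :: "(real \<times> 'p::euclidean_space \<Rightarrow> real) \<Rightarrow> real \<times> 'p \<Rightarrow> real" where
  "hadamard f x = pd1 f x - fst x * radial_int (pd1 (pd1 f)) (\<lambda>_. 1) 0 x"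

lemma smooth_on_hadamard:
  assumes "radial_open S" "smooth_on S f"
  shows "smooth_on S (hadamard f)"
proof -
  have o: "open S" using assms(1) by (rule radial_open_open)
  have "smooth_on S (radial_int (pd1 (pd1 f)) (\<lambda>_. 1) 0)"
    by (rule smooth_on_radial_int[OF assms(1) smooth_on_pd1[OF smooth_on_pd1[OF assms(2)]] open_UNIV])
      (auto intro!: smooth_intros)
  then show ?thesis
    unfolding hadamard_def[abs_def]
    by (intro smooth_intros smooth_on_pd1 assms o)
qed

lemma hadamard_eq:
  assumes "radial_open S" "smooth_on S f" "(u, p) \<in> S"
  shows "f (u, p) = f (0, p) + u * hadamard f (u, p)"
proof -
  have in_S: "(t * u, p) \<in> S" if "t \<in> {0..1}" for t
    using assms(1,3) that by (auto simp: radial_open_def)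
  \<comment> \<open>The \<open>t\<close>-derivative of \<open>f (t u) - t u f' (t u)\<close> is
    \<open>- u^2 t f'' (t u)\<close>, the terms with \<open>f'\<close> cancel.\<close>
  have h1: "((\<lambda>t. - (u * u) * (pd1 (pd1 f) (t * u, p) * t)) has_integral
      (f (1 * u, p) - 1 * u * pd1 f (1 * u, p)) - (f (0 * u, p) - 0 * u * pd1 f (0 * u, p))) {0..1}"
  proof (rule fundamental_theorem_of_calculus)
    fix t :: real assume t: "t \<in> {0..1}"
    have "((\<lambda>t. f (t * u, p) - t * u * pd1 f (t * u, p)) has_real_derivative
        - (u * u) * (pd1 (pd1 f) (t * u, p) * t)) (at t)"
      using pd1_scale_has_real_derivative[OF assms(2) in_S[OF t]]
        pd1_scale_has_real_derivative[OF smooth_on_pd1[OF assms(2)] in_S[OF t]]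
      by (auto intro!: derivative_eq_intros simp: algebra_simps)
    then show "((\<lambda>t. f (t * u, p) - t * u * pd1 f (t * u, p)) has_vector_derivative
        - (u * u) * (pd1 (pd1 f) (t * u, p) * t)) (at t within {0..1})"
      by (simp add: has_real_derivative_iff_has_vector_derivative has_vector_derivative_at_within)
  qed simp
  have h2: "((\<lambda>t. - (u * u) * (pd1 (pd1 f) (t * u, p) * t)) has_integral
      - (u * u) * radial_int (pd1 (pd1 f)) (\<lambda>_. 1) 0 (u, p)) {0..1}"
  proof (intro has_integral_mult_right)
    have "continuous_on {0..1} (\<lambda>t. pd1 (pd1 f) (t * u, p) * t)"
      by (intro continuous_intros
          continuous_on_compose2[OF smooth_on_continuous[OF smooth_on_pd1[OF smooth_on_pd1[OF assms(2)]]]])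
        (use in_S in auto)
    then have "((\<lambda>t. pd1 (pd1 f) (t * u, p) * t) has_integral
        integral {0..1} (\<lambda>t. pd1 (pd1 f) (t * u, p) * t)) {0..1}"
      using integrable_continuous_real integrable_integral by blast
    moreover have "integral {0..1} (\<lambda>t. pd1 (pd1 f) (t * u, p) * t)
        = radial_int (pd1 (pd1 f)) (\<lambda>_. 1) 0 (u, p)"
      unfolding radial_int_def by (rule integral_cong) auto
    ultimately show "((\<lambda>t. pd1 (pd1 f) (t * u, p) * t) has_integral
        radial_int (pd1 (pd1 f)) (\<lambda>_. 1) 0 (u, p)) {0..1}" by simp
  qed
  show ?thesis using has_integral_unique[OF h1 h2] by (simp add: hadamard_def algebra_simps)
qed

text \<open>The Taylor coefficient of order \<open>k\<close> in the first variable at 0 (see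
  \<open>nderiv_0_eq_tcoef\<close>). Iterated quotients make its smooth dependence on
  \<open>p\<close> immediate.\<close>

definition tcoef :: "nat \<Rightarrow> (real \<times> 'p::euclidean_space \<Rightarrow> real) \<Rightarrow> 'p \<Rightarrow> real" where
  "tcoef k f p = (hadamard ^^ k) f (0, p)"

lemma smooth_on_hadamard_iter:
  "radial_open S \<Longrightarrow> smooth_on S f \<Longrightarrow> smooth_on S ((hadamard ^^ k) f)"
  by (induction k) (auto intro: smooth_on_hadamard)

lemma smooth_on_tcoef:
  assumes "radial_open S" "smooth_on S f"
  shows "smooth_on S (\<lambda>x. tcoef k f (snd x))"
  unfolding tcoef_def
  using radial_open_0[OF assms(1)] radial_open_open[OF assms(1)]
  by (intro smooth_on_compose[OF _ _ _ smooth_on_hadamard_iter[OF assms], of S "\<lambda>x. (0, snd x)"])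
    (auto intro!: smooth_intros)

lemma taylor_radial:
  assumes "radial_open S" "smooth_on S f" "(u, p) \<in> S"
  shows "f (u, p) = (\<Sum>k<K. tcoef k f p * u ^ k) + u ^ K * (hadamard ^^ K) f (u, p)"
proof (induction K)
  case (Suc K)
  then show ?case
    using hadamard_eq[OF assms(1) smooth_on_hadamard_iter[OF assms(1,2), of K] assms(3)]
    by (simp add: tcoef_def algebra_simps)
qed simp

lemma nderiv_0_eq_tcoef:
  assumes "radial_open S" "smooth_on S f" "(0, p) \<in> S"
  shows "nderiv k (\<lambda>u. f (u, p)) 0 = fact k * tcoef k f p"
  using assms(2)
proof (induction k arbitrary: f)
  case 0
  then show ?case by (simp add: tcoef_def)
next
  case (Suc k)
  let ?I = "{u. (u, p) \<in> S}"
  have I: "open ?I"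
  proof -
    have "continuous_on UNIV (\<lambda>u::real. (u, p))" by (intro continuous_intros)
    then show ?thesis
      using open_vimage[OF radial_open_open[OF assms(1)], of "\<lambda>u. (u, p)"] by (simp add: vimage_def)
  qed
  have h: "smooth_on ?I (\<lambda>u. hadamard f (u, p))"
    by (rule smooth_on_slice[OF I radial_open_open[OF assms(1)] _ smooth_on_hadamard[OF assms(1) Suc.prems]]) auto
  have "nderiv (Suc k) (\<lambda>u. f (u, p)) 0 = nderiv (Suc k) (\<lambda>u. f (0, p) + u * hadamard f (u, p)) 0"
  proof (rule nderiv_cong[OF I])
    show "f (u, p) = f (0, p) + u * hadamard f (u, p)" if "u \<in> ?I" for u
      by (rule hadamard_eq[OF assms(1) Suc.prems]) (use that in simp)
  qed (use assms(3) in simp)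
  also have "\<dots> = real (Suc k) * nderiv k (\<lambda>u. hadamard f (u, p)) 0"
    using nderiv_linear_plus[OF I h, of 0 k "f (0, p)"] assms(3) by (simp del: funpow.simps of_nat_Suc)
  also have "\<dots> = fact (Suc k) * tcoef (Suc k) f p"
    using Suc.IH[OF smooth_on_hadamard[OF assms(1) Suc.prems]]
    by (simp add: tcoef_def funpow_swap1 del: of_nat_Suc)
  finally show ?case .
qed

section \<open>The incomplete Mellin transform\<close>

lemma radial_int_slice_derivative:
  fixes f :: "real \<times> 'p::euclidean_space \<Rightarrow> real"
  assumes S: "radial_open S" and f: "smooth_on S f"
    and Q: "open Q" "snd ` S \<subseteq> Q" "smooth_on Q b" "\<And>p. p \<in> Q \<Longrightarrow> b p > 0" and x: "(u, p) \<in> S"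
  shows "((\<lambda>u. radial_int f b 0 (u, p)) has_real_derivative
    radial_int (pd1 f) (\<lambda>p. b p + 1) 0 (u, p)) (at u)"
proof -
  have "radial_int (\<lambda>x. frechet_derivative f (at x) (0, 0)) b 0 (u, p) = integral {0..1::real} (\<lambda>t. 0)"
    unfolding radial_int_def
  proof (rule integral_cong)
    fix t :: real assume "t \<in> {0..1}"
    then have "(t * u, p) \<in> S" using radial_open_scale[OF S x] by auto
    then have "linear (frechet_derivative f (at (t * u, p)))"
      using smooth_on_has_derivative[OF f] has_derivative_linear by blast
    from linear_0[OF this] show "frechet_derivative f (at (t * fst (u, p), snd (u, p))) (0, 0) *
        (t powr b (snd (u, p)) * ln t ^ 0) = 0" by (simp add: zero_prod_def)
  qed
  moreover have "frechet_derivative b (at p) 0 = 0"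
  proof -
    have "p \<in> Q" using Q(2) x by auto
    from linear_0[OF has_derivative_linear[OF smooth_on_has_derivative[OF Q(3) this]]]
    show ?thesis .
  qed
  ultimately show ?thesis
    using partial_fst_has_derivative[OF radial_int_has_derivative[OF S f Q x, of 0]]
    by (simp add: pd1_def[abs_def])
qed

text \<open>The left side is the integral over \<open>{0..1}\<close> of the
  \<open>t\<close>-derivative of \<open>f (t u, p) * t powr (b p + 1)\<close>, and the boundary term
  at 0 vanishes.\<close>

lemma radial_int_ode:
  fixes f :: "real \<times> 'p::euclidean_space \<Rightarrow> real"
  assumes S: "radial_open S" and f: "smooth_on S f"
    and b: "b p > 0" and x: "(u, p) \<in> S"
  shows "u * radial_int (pd1 f) (\<lambda>p. b p + 1) 0 (u, p) + (b p + 1) * radial_int f b 0 (u, p) = f (u, p)"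
proof -
  have in_S: "(t * u, p) \<in> S" if "t \<in> {0..1}" for t
    using S x that by (auto simp: radial_open_def)
  have cf: "continuous_on {0..1} (\<lambda>t. g (t * u, p))" if "smooth_on S g" for g
    by (rule continuous_on_compose2[OF smooth_on_continuous[OF that]])
      (use in_S in \<open>auto intro!: continuous_intros\<close>)
  have cp: "continuous_on {0..1} (\<lambda>t::real. t powr c)" if "c > 0" for c
    by (rule continuous_on_powr') (use that in \<open>auto intro!: continuous_intros\<close>)
  have h1: "((\<lambda>t. u * (pd1 f (t * u, p) * t powr (b p + 1)) + (b p + 1) * (f (t * u, p) * t powr b p)) has_integral
      f (1 * u, p) * 1 powr (b p + 1) - f (0 * u, p) * 0 powr (b p + 1)) {0..1}"
  proof (rule fundamental_theorem_of_calculus_interior)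
    show "continuous_on {0..1} (\<lambda>t. f (t * u, p) * t powr (b p + 1))"
      using b by (intro continuous_intros cf[OF f] cp) auto
  next
    fix t :: real assume t: "t \<in> {0<..<1}"
    then have tS: "(t * u, p) \<in> S" using in_S by auto
    have "((\<lambda>t. f (t * u, p) * t powr (b p + 1)) has_real_derivative
        u * (pd1 f (t * u, p) * t powr (b p + 1)) + (b p + 1) * (f (t * u, p) * t powr b p)) (at t)"
      using pd1_scale_has_real_derivative[OF f tS] t
      by (auto intro!: derivative_eq_intros has_real_derivative_powr simp: algebra_simps)
    then show "((\<lambda>t. f (t * u, p) * t powr (b p + 1)) has_vector_derivative
        u * (pd1 f (t * u, p) * t powr (b p + 1)) + (b p + 1) * (f (t * u, p) * t powr b p)) (at t)"
      by (simp add: has_real_derivative_iff_has_vector_derivative)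
  qed auto
  have h2: "((\<lambda>t. u * (pd1 f (t * u, p) * t powr (b p + 1)) + (b p + 1) * (f (t * u, p) * t powr b p)) has_integral
      u * radial_int (pd1 f) (\<lambda>p. b p + 1) 0 (u, p) + (b p + 1) * radial_int f b 0 (u, p)) {0..1}"
  proof -
    have i: "((\<lambda>t. g (t * u, p) * t powr c) has_integral integral {0..1} (\<lambda>t. g (t * u, p) * t powr c)) {0..1}"
      if "smooth_on S g" "c > 0" for g c
      using that by (intro integrable_integral integrable_continuous_real continuous_intros cf cp)
    show ?thesis
      unfolding radial_int_def
      using i[OF smooth_on_pd1[OF f], of "b p + 1"] i[OF f, of "b p"] b
      by (auto intro!: has_integral_add has_integral_mult_right)
  qed
  show ?thesis using has_integral_unique[OF h1 h2] by simp
qed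

text \<open>The poles of the transform in the exponent are the natural numbers; the set \<open>E\<close> lists
  those whose polar part is left out.\<close>

definition mellin_reg ::
  "nat set \<Rightarrow> nat \<Rightarrow> (real \<times> 'p::euclidean_space \<Rightarrow> real) \<Rightarrow> ('p \<Rightarrow> real) \<Rightarrow> real \<times> 'p \<Rightarrow> real" where
  "mellin_reg E K f a x =
    (\<Sum>k\<in>{..<K} - E. tcoef k f (snd x) * fst x ^ k / (real k - a (snd x)))
    + fst x ^ K * radial_int ((hadamard ^^ K) f) (\<lambda>p. real K - a p - 1) 0 x"

text \<open>The bound \<open>a p < K - 1\<close> is positivity of the exponent
  \<open>K - a p - 1\<close>, and \<open>E\<close> contains every natural number that
  \<open>a\<close> reaches on \<open>Q\<close>, so no denominator vanishes.\<close>

lemma smooth_on_mellin_reg: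
  fixes f :: "real \<times> 'p::euclidean_space \<Rightarrow> real"
  assumes S: "radial_open S" and f: "smooth_on S f"
    and Q: "open Q" "snd ` S \<subseteq> Q" "smooth_on Q a" "\<And>p. p \<in> Q \<Longrightarrow> a p < real K - 1"
    and E: "\<And>p k. p \<in> Q \<Longrightarrow> k \<notin> E \<Longrightarrow> a p \<noteq> real k"
  shows "smooth_on S (mellin_reg E K f a)"
proof -
  have o: "open S" using S by (rule radial_open_open)
  have "smooth_on S (\<lambda>x. a (snd x))"
    by (rule smooth_on_compose[OF o Q(1) _ Q(3)]) (use Q(2) o in \<open>auto intro!: smooth_intros\<close>)
  moreover have "smooth_on S (radial_int ((hadamard ^^ K) f) (\<lambda>p. real K - a p - 1) 0)"
    by (rule smooth_on_radial_int[OF S smooth_on_hadamard_iter[OF S f] Q(1,2)])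
      (use Q in \<open>auto intro!: smooth_intros simp: algebra_simps\<close>)
  moreover have "real k - a (snd x) \<noteq> 0" if "x \<in> S" "k \<notin> E" for x k
    using E[of "snd x" k] that Q(2) by auto
  ultimately show ?thesis
    unfolding mellin_reg_def[abs_def]
    by (intro smooth_intros o smooth_on_tcoef[OF S f]) auto
qed

lemma polar_term_ode:
  fixes a c t w :: real
  assumes "c \<noteq> a"
  shows "t * (c * w) / (c - a) - a * (t * w / (c - a)) = t * w"
proof -
  have "t * (c * w) / (c - a) - a * (t * w / (c - a)) = t * w * (c - a) / (c - a)"
    unfolding times_divide_eq_right diff_divide_distrib[symmetric] by (simp add: algebra_simps)
  then show ?thesis using assms by simp
qed

text \<open>Termwise: \<open>u^k / (k - a)\<close> is the transform of \<open>u^k\<close>, and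
  \<open>u^K\<close> times the radial integral is the transform of the Taylor remainder. The indices
  of \<open>E\<close> left out of the sum are missing on the right.\<close>

lemma mellin_reg_ode:
  fixes f :: "real \<times> 'p::euclidean_space \<Rightarrow> real"
  assumes S: "radial_open S" and f: "smooth_on S f"
    and Q: "open Q" "snd ` S \<subseteq> Q" "smooth_on Q a" "\<And>p. p \<in> Q \<Longrightarrow> a p < real K - 1"
    and E: "\<And>p k. p \<in> Q \<Longrightarrow> k \<notin> E \<Longrightarrow> a p \<noteq> real k" and x: "(u, p) \<in> S"
  shows "u * deriv (\<lambda>u. mellin_reg E K f a (u, p)) u - a p * mellin_reg E K f a (u, p)
    = f (u, p) - (\<Sum>k\<in>E \<inter> {..<K}. tcoef k f p * u ^ k)"
proof -
  let ?h = "(hadamard ^^ K) f" and ?b = "\<lambda>p. real K - a p - 1"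
  let ?R = "radial_int ?h ?b 0 (u, p)" and ?R' = "radial_int (pd1 ?h) (\<lambda>p. ?b p + 1) 0 (u, p)"
  have pQ: "p \<in> Q" using Q(2) x by auto
  note h = smooth_on_hadamard_iter[OF S f, of K]
  have sb: "smooth_on Q ?b" by (intro smooth_intros Q)
  have b: "?b p > 0" if "p \<in> Q" for p using Q(4)[OF that] by simp
  have R: "((\<lambda>u. radial_int ?h ?b 0 (u, p)) has_real_derivative ?R') (at u)"
    using radial_int_slice_derivative[OF S h Q(1,2) sb b x] .
  have ode: "u * ?R' + (real K - a p) * ?R = ?h (u, p)"
    using radial_int_ode[OF S h, of ?b p u] b[OF pQ] x by simp
  have pw: "u * (real k * u ^ (k - 1)) = real k * u ^ k" for k
    by (cases k) auto
  have t: "((\<lambda>u. tcoef k f p * u ^ k / (real k - a p)) has_real_derivative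
      tcoef k f p * (real k * u ^ (k - 1)) / (real k - a p)) (at u)" for k u
    using DERIV_cdivide[OF DERIV_cmult[OF DERIV_pow[of k u]], of "tcoef k f p" "real k - a p"] by simp
  have "((\<lambda>u. mellin_reg E K f a (u, p)) has_real_derivative
      (\<Sum>k\<in>{..<K} - E. tcoef k f p * (real k * u ^ (k - 1)) / (real k - a p))
      + (real K * u ^ (K - 1) * ?R + u ^ K * ?R')) (at u)"
    unfolding mellin_reg_def fst_conv snd_conv
    by (intro DERIV_add DERIV_sum t) (auto intro!: derivative_eq_intros R)
  then have "u * deriv (\<lambda>u. mellin_reg E K f a (u, p)) u =
      u * ((\<Sum>k\<in>{..<K} - E. tcoef k f p * (real k * u ^ (k - 1)) / (real k - a p))
      + (real K * u ^ (K - 1) * ?R + u ^ K * ?R'))"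
    by (simp add: DERIV_imp_deriv)
  also have "\<dots> = (\<Sum>k\<in>{..<K} - E. tcoef k f p * (u * (real k * u ^ (k - 1))) / (real k - a p))
      + (u * (real K * u ^ (K - 1)) * ?R + u ^ K * (u * ?R'))"
    by (simp add: algebra_simps sum_distrib_left)
  also have "\<dots> = (\<Sum>k\<in>{..<K} - E. tcoef k f p * (real k * u ^ k) / (real k - a p))
      + u ^ K * (a p * ?R + ?h (u, p))"
    unfolding pw using ode by (simp add: algebra_simps flip: ode)
  finally have "u * deriv (\<lambda>u. mellin_reg E K f a (u, p)) u - a p * mellin_reg E K f a (u, p) =
      (\<Sum>k\<in>{..<K} - E. tcoef k f p * (real k * u ^ k) / (real k - a p))
      - (\<Sum>k\<in>{..<K} - E. a p * (tcoef k f p * u ^ k / (real k - a p))) + u ^ K * ?h (u, p)"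
    by (simp add: mellin_reg_def algebra_simps sum_distrib_left)
  also have "(\<Sum>k\<in>{..<K} - E. tcoef k f p * (real k * u ^ k) / (real k - a p))
      - (\<Sum>k\<in>{..<K} - E. a p * (tcoef k f p * u ^ k / (real k - a p)))
      = (\<Sum>k\<in>{..<K} - E. tcoef k f p * u ^ k)"
    unfolding sum_subtractf[symmetric]
  proof (rule sum.cong)
    fix k assume "k \<in> {..<K} - E"
    then have "real k \<noteq> a p" using E[OF pQ, of k] by auto
    then show "tcoef k f p * (real k * u ^ k) / (real k - a p) - a p * (tcoef k f p * u ^ k / (real k - a p))
      = tcoef k f p * u ^ k" by (rule polar_term_ode)
  qed simp
  also have "(\<Sum>k\<in>{..<K} - E. tcoef k f p * u ^ k)
      = (\<Sum>k<K. tcoef k f p * u ^ k) - (\<Sum>k\<in>E \<inter> {..<K}. tcoef k f p * u ^ k)"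
    using sum.Int_Diff[of "{..<K}" "\<lambda>k. tcoef k f p * u ^ k" E] by (simp add: Int_commute)
  finally show ?thesis
    using taylor_radial[OF S f x, of K] by simp
qed

text \<open>The identity \<open>x (y^2)' = 2 c y^2 \<le> 0\<close> makes \<open>y^2\<close> decrease
  away from 0, where it already vanishes.\<close>

lemma mellin_homogeneous_0:
  fixes y :: "real \<Rightarrow> real"
  assumes I: "open I" "is_interval I" "0 \<in> I" and y: "smooth_on I y"
    and ode: "\<And>x. x \<in> I \<Longrightarrow> x * deriv y x = c * y x" and c: "c < 0" and x: "x \<in> I"
  shows "y x = 0"
proof -
  have d: "((\<lambda>x. (y x)\<^sup>2) has_real_derivative 2 * y z * deriv y z) (at z)" if "z \<in> I" for z
    using smooth_on_has_real_derivative[OF y that] by (auto intro!: derivative_eq_intros)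
  have y0: "y 0 = 0" using ode[OF I(3)] c by simp
  have s: "z * (2 * y z * deriv y z) = 2 * c * (y z)\<^sup>2" if "z \<in> I" for z
    using ode[OF that] by (simp add: power2_eq_square algebra_simps)
  have "(y x)\<^sup>2 \<le> 0"
  proof (cases "x \<ge> 0")
    case True
    have sub: "z \<in> I" if "0 \<le> z" "z \<le> x" for z
      by (rule mem_is_interval_1_I[OF I(2,3) x that])
    have "(y x)\<^sup>2 \<le> (y 0)\<^sup>2"
    proof (rule DERIV_nonpos_imp_nonincreasing[OF True])
      fix z assume z: "0 \<le> z" "z \<le> x"
      have "2 * y z * deriv y z \<le> 0"
      proof (cases "z = 0")
        case False
        then have "z > 0" using z by simp
        moreover have "z * (2 * y z * deriv y z) \<le> 0"
          using s[OF sub[OF z]] c by (simp add: mult_nonpos_nonneg)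
        ultimately show ?thesis using zero_less_mult_iff not_less by blast
      qed (simp add: y0)
      then show "\<exists>d. ((\<lambda>x. (y x)\<^sup>2) has_real_derivative d) (at z) \<and> d \<le> 0"
        using d[OF sub[OF z]] by blast
    qed
    then show ?thesis by (simp add: y0)
  next
    case False
    then have x0: "x \<le> 0" by simp
    have sub: "z \<in> I" if "x \<le> z" "z \<le> 0" for z
      by (rule mem_is_interval_1_I[OF I(2) x I(3) that])
    have "(y x)\<^sup>2 \<le> (y 0)\<^sup>2"
    proof (rule DERIV_nonneg_imp_nondecreasing[OF x0])
      fix z assume z: "x \<le> z" "z \<le> 0"
      have "2 * y z * deriv y z \<ge> 0"
      proof (cases "z = 0")
        case False
        then have "z < 0" using z by simp
        moreover have "z * (2 * y z * deriv y z) \<le> 0"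
          using s[OF sub[OF z]] c by (simp add: mult_nonpos_nonneg)
        ultimately show ?thesis by (simp add: mult_le_0_iff)
      qed (simp add: y0)
      then show "\<exists>d. ((\<lambda>x. (y x)\<^sup>2) has_real_derivative d) (at z) \<and> 0 \<le> d"
        using d[OF sub[OF z]] by blast
    qed
    then show ?thesis by (simp add: y0)
  qed
  then show ?thesis by simp
qed

text \<open>The \<open>k\<close>-th derivative of a homogeneous solution solves the equation with exponent
  \<open>\<alpha> - k\<close>, which has only the zero solution when \<open>k > \<alpha>\<close>.\<close>

lemma mellin_unique:
  fixes y :: "real \<Rightarrow> real"
  assumes I: "open I" "is_interval I" "0 \<in> I" and y: "smooth_on I y"
    and ode: "\<And>x. x \<in> I \<Longrightarrow> x * deriv y x = \<alpha> * y x" and \<alpha>: "\<And>k. \<alpha> \<noteq> real k" and x: "x \<in> I"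
  shows "y x = 0"
proof -
  have odek: "x * nderiv (Suc k) y x = (\<alpha> - real k) * nderiv k y x" if "x \<in> I" for k x
    using that
  proof (induction k arbitrary: x)
    case 0
    then show ?case using ode by simp
  next
    case (Suc k)
    have "eventually (\<lambda>x. x * nderiv (Suc k) y x = (\<alpha> - real k) * nderiv k y x) (nhds x)"
      using eventually_nhds_in_open[OF I(1) Suc.prems] by eventually_elim (use Suc.IH in auto)
    then have "deriv (\<lambda>x. x * nderiv (Suc k) y x) x = deriv (\<lambda>x. (\<alpha> - real k) * nderiv k y x) x"
      by (rule deriv_cong_ev) simp
    moreover have "deriv (\<lambda>x. x * nderiv (Suc k) y x) x = x * nderiv (Suc (Suc k)) y x + nderiv (Suc k) y x"
      using nderiv_has_real_derivative[OF I(1) y Suc.prems, of "Suc k"]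
      by (intro DERIV_imp_deriv) (auto intro!: derivative_eq_intros simp del: funpow.simps)
    moreover have "deriv (\<lambda>x. (\<alpha> - real k) * nderiv k y x) x = (\<alpha> - real k) * nderiv (Suc k) y x"
      using nderiv_has_real_derivative[OF I(1) y Suc.prems, of k]
      by (intro DERIV_imp_deriv) (auto intro!: derivative_eq_intros simp del: funpow.simps)
    ultimately show ?case by (simp add: algebra_simps)
  qed
  obtain K where K: "\<alpha> < real K" using reals_Archimedean2 by blast
  have K0: "nderiv K y x = 0" if "x \<in> I" for x
    by (rule mellin_homogeneous_0[OF I smooth_on_nderiv[OF I(1) y] _ _ that, where c = "\<alpha> - real K"])
      (use odek[of _ K] K in auto)
  \<comment> \<open>Descent to order 0: once \<open>nderiv (Suc k) y\<close> vanishes,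
    \<open>odek\<close> leaves \<open>(\<alpha> - k) * nderiv k y x = 0\<close>, and
    \<open>\<alpha>\<close> is no natural number.\<close>
  have "\<forall>x\<in>I. nderiv (K - j) y x = 0" if "j \<le> K" for j
    using that
  proof (induction j)
    case 0
    then show ?case using K0 by simp
  next
    case (Suc j)
    then have e: "Suc (K - Suc j) = K - j" by simp
    show ?case
    proof
      fix x assume "x \<in> I"
      from odek[OF this, of "K - Suc j"] Suc.IH Suc.prems this \<alpha>[of "K - Suc j"]
      show "nderiv (K - Suc j) y x = 0" unfolding e by simp
    qed
  qed
  from this[of K] x show ?thesis by simp
qed

text \<open>The description in \<open>mellin\<close> singles out a total function, so the solution
  is first cut off to 0 outside \<open>I\<close>; openness of \<open>I\<close> preserves its
  derivatives inside.\<close>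

lemma mellin_eqI:
  assumes I: "open I" "is_interval I" "0 \<in> I" and y: "smooth_on I y"
    and ode: "\<And>x. x \<in> I \<Longrightarrow> x * deriv y x - \<alpha> * y x = f x" and \<alpha>: "\<And>k. \<alpha> \<noteq> real k" and x: "x \<in> I"
  shows "mellin I f \<alpha> x = y x"
proof -
  have "mellin I f \<alpha> = (\<lambda>x. if x \<in> I then y x else 0)"
    unfolding mellin_def
  proof (rule the_equality)
    have "deriv (\<lambda>x. if x \<in> I then y x else 0) x = deriv y x" if "x \<in> I" for x
      using eventually_nhds_in_open[OF I(1) that]
      by (intro deriv_cong_ev) (auto elim: eventually_mono)
    moreover have "smooth_on I (\<lambda>x. if x \<in> I then y x else 0)"
      using y by (subst smooth_on_cong[OF I(1), where g = y]) auto
    ultimately show "smooth_on I (\<lambda>x. if x \<in> I then y x else 0) \<and>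
        (\<forall>x\<in>I. x * deriv (\<lambda>x. if x \<in> I then y x else 0) x - \<alpha> * (if x \<in> I then y x else 0) = f x) \<and>
        (\<forall>x. x \<notin> I \<longrightarrow> (if x \<in> I then y x else 0) = 0)"
      using ode by auto
  next
    fix z assume z: "smooth_on I z \<and> (\<forall>x\<in>I. x * deriv z x - \<alpha> * z x = f x) \<and> (\<forall>x. x \<notin> I \<longrightarrow> z x = 0)"
    have "z x - y x = 0" if x: "x \<in> I" for x
    proof (rule mellin_unique[OF I _ _ \<alpha> x])
      show "smooth_on I (\<lambda>x. z x - y x)" using z y I by (intro smooth_intros) auto
      fix x assume x: "x \<in> I"
      have d: "deriv (\<lambda>x. z x - y x) x = deriv z x - deriv y x"
        using smooth_on_has_real_derivative[OF _ x] z y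
        by (intro DERIV_imp_deriv derivative_intros) auto
      then show "x * deriv (\<lambda>x. z x - y x) x = \<alpha> * (z x - y x)"
        unfolding d right_diff_distrib using z ode[OF x] x by (auto simp: algebra_simps)
    qed
    then show "z = (\<lambda>x. if x \<in> I then y x else 0)" using z by (auto simp: fun_eq_iff)
  qed
  then show ?thesis using x by simp
qed

text \<open>Where \<open>a p\<close> avoids all natural numbers the right side solves the equation,
  and solutions are unique. This splits the transform into an explicit polar part and a part that
  stays smooth when \<open>a\<close> runs into a pole from \<open>E\<close>.\<close>

lemma mellin_eq_reg:
  fixes f :: "real \<times> 'p::euclidean_space \<Rightarrow> real"
  assumes S: "radial_open S" and f: "smooth_on S f"
    and Q: "open Q" "snd ` S \<subseteq> Q" "smooth_on Q a" "\<And>p. p \<in> Q \<Longrightarrow> a p < real K - 1"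
    and E: "\<And>p k. p \<in> Q \<Longrightarrow> k \<notin> E \<Longrightarrow> a p \<noteq> real k"
    and I: "open I" "is_interval I" "0 \<in> I" "\<And>u. u \<in> I \<Longrightarrow> (u, p) \<in> S"
    and g: "\<And>u. u \<in> I \<Longrightarrow> g u = f (u, p)"
    and \<alpha>: "\<And>k. a p \<noteq> real k" and u: "u \<in> I"
  shows "mellin I g (a p) u =
    (\<Sum>k\<in>E \<inter> {..<K}. tcoef k f p * u ^ k / (real k - a p)) + mellin_reg E K f a (u, p)"
proof -
  let ?P = "\<lambda>u. \<Sum>k\<in>E \<inter> {..<K}. tcoef k f p * u ^ k / (real k - a p)"
  have sm: "smooth_on I (\<lambda>u. mellin_reg E K f a (u, p))"
    by (rule smooth_on_slice[OF I(1) radial_open_open[OF S] I(4) smooth_on_mellin_reg[OF S f Q E]])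
  have nz: "real k - a p \<noteq> 0" for k
    using \<alpha>[of k] by simp
  have smP: "smooth_on I (\<lambda>u. ?P u + mellin_reg E K f a (u, p))"
    by (intro smooth_intros I sm nz)
  show ?thesis
  proof (rule mellin_eqI[OF I(1-3) smP _ \<alpha> u])
    fix v assume v: "v \<in> I"
    let ?P' = "\<Sum>k\<in>E \<inter> {..<K}. tcoef k f p * (real k * v ^ (k - 1)) / (real k - a p)"
    have "(?P has_real_derivative ?P') (at v)"
    proof (rule DERIV_sum)
      fix k
      show "((\<lambda>u. tcoef k f p * u ^ k / (real k - a p)) has_real_derivative
          tcoef k f p * (real k * v ^ (k - 1)) / (real k - a p)) (at v)"
        using DERIV_cdivide[OF DERIV_cmult[OF DERIV_pow[of k v]], of "tcoef k f p" "real k - a p"] by simp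
    qed
    then have d: "deriv (\<lambda>u. ?P u + mellin_reg E K f a (u, p)) v =
        ?P' + deriv (\<lambda>u. mellin_reg E K f a (u, p)) v"
      using smooth_on_has_real_derivative[OF sm v] by (intro DERIV_imp_deriv DERIV_add)
    have e: "v * ?P' - a p * ?P v = (\<Sum>k\<in>E \<inter> {..<K}. tcoef k f p * v ^ k)"
      unfolding sum_distrib_left sum_subtractf[symmetric]
    proof (rule sum.cong)
      fix k
      have "real k \<noteq> a p" using \<alpha>[of k] by simp
      note polar = polar_term_ode[OF this]
      have "k = 0 \<or> v * v ^ (k - Suc 0) = v ^ k" by (cases k) auto
      then have eq: "v * (tcoef k f p * (real k * v ^ (k - 1)) / (real k - a p)) =
          tcoef k f p * (real k * v ^ k) / (real k - a p)" by auto
      show "v * (tcoef k f p * (real k * v ^ (k - 1)) / (real k - a p))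
          - a p * (tcoef k f p * v ^ k / (real k - a p)) = tcoef k f p * v ^ k"
        unfolding eq by (rule polar)
    qed simp
    show "v * deriv (\<lambda>u. ?P u + mellin_reg E K f a (u, p)) v
        - a p * (?P v + mellin_reg E K f a (v, p)) = g v"
      unfolding d using mellin_reg_ode[OF S f Q E I(4)[OF v]] g[OF v] e
      by (simp add: algebra_simps)
  qed
qed

lemma interval_scale:
  fixes u t :: real
  assumes "is_interval I" "0 \<in> I" "u \<in> I" "0 \<le> t" "t \<le> 1"
  shows "t * u \<in> I"
proof (cases "u \<ge> 0")
  case True
  show ?thesis
    by (rule mem_is_interval_1_I[OF assms(1-3)]) (use True assms in \<open>auto simp: mult_left_le_one_le\<close>)
next
  case False
  show ?thesis
    by (rule mem_is_interval_1_I[OF assms(1,3,2)])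
      (use False assms in \<open>auto simp: mult_nonneg_nonpos mult_le_cancel_right1\<close>)
qed

lemma radial_open_interval_Times_UNIV:
  assumes "open I" "is_interval I" "0 \<in> I"
  shows "radial_open (I \<times> (UNIV :: 'p::euclidean_space set))"
  using interval_scale[OF assms(2,3)] assms(1) by (auto simp: radial_open_def open_Times)

text \<open>The transform with exponent \<open>-1\<close> solves \<open>u R' + R = g\<close>, that
  is \<open>(u R)' = g\<close>. The second coordinate of \<open>?S\<close> is a dummy
  parameter.\<close>

lemma antiderivative_exists:
  fixes g :: "real \<Rightarrow> real"
  assumes I: "open I" "is_interval I" "0 \<in> I" and g: "smooth_on I g"
  shows "\<exists>\<psi>. smooth_on I \<psi> \<and> \<psi> 0 = 0 \<and> (\<forall>x\<in>I. (\<psi> has_real_derivative g x) (at x))"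
proof -
  let ?S = "I \<times> (UNIV :: real set)" and ?a = "\<lambda>_. -1 :: real"
  have S: "radial_open ?S" by (rule radial_open_interval_Times_UNIV[OF I])
  have f: "smooth_on ?S (\<lambda>x. g (fst x))"
    by (rule smooth_on_compose[OF _ I(1) _ g]) (use I in \<open>auto intro!: smooth_intros open_Times\<close>)
  define R where "R u = mellin_reg {} 1 (\<lambda>x. g (fst x)) ?a (u, 0::real)" for u
  have sm: "smooth_on I R"
    unfolding R_def[abs_def]
    by (rule smooth_on_slice[OF I(1) radial_open_open[OF S] _ smooth_on_mellin_reg[OF S f open_UNIV]])
      (auto intro!: smooth_intros)
  have ode: "u * deriv R u + R u = g u" if "u \<in> I" for u
    using mellin_reg_ode[OF S f open_UNIV _ _, where u = u and p = 0 and E = "{}" and K = 1 and a = ?a] that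
    by (simp add: R_def[abs_def] smooth_on_const)
  have "((\<lambda>u. u * R u) has_real_derivative g x) (at x)" if "x \<in> I" for x
    using smooth_on_has_real_derivative[OF sm that] ode[OF that]
    by (auto intro!: derivative_eq_intros simp: mult.commute)
  then show ?thesis
    by (intro exI[of _ "\<lambda>u. u * R u"] conjI) (auto intro!: smooth_intros sm I)
qed

section \<open>Corrections along the axes\<close>

text \<open>Write \<open>c x = c 0 + x * hc x\<close>. The integrating factor
  \<open>exp \<psi>\<close> with \<open>\<psi>' = hc\<close> reduces the equation to the constant
  coefficient \<open>c 0\<close>, and \<open>nres\<close> says that \<open>- c 0\<close> is no pole
  of the transform.\<close>

lemma ode_smooth_solution:
  fixes c f :: "real \<Rightarrow> real"
  assumes I: "open I" "is_interval I" "0 \<in> I" and c: "smooth_on I c" and f: "smooth_on I f"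
    and nres: "\<And>k. c 0 + real k \<noteq> 0"
  shows "\<exists>y. smooth_on I y \<and> (\<forall>x\<in>I. x * deriv y x + c x * y x = f x)"
proof -
  let ?S = "I \<times> (UNIV :: real set)"
  have S: "radial_open ?S" by (rule radial_open_interval_Times_UNIV[OF I])
  have oS: "open ?S" by (rule radial_open_open[OF S])
  have lift: "smooth_on ?S (\<lambda>x. g (fst x))" if "smooth_on I g" for g :: "real \<Rightarrow> real"
    by (rule smooth_on_compose[OF oS I(1) _ that]) (auto intro!: smooth_intros oS)
  have slice: "smooth_on I (\<lambda>u. g (u, 0))" if "smooth_on ?S g" for g :: "real \<times> real \<Rightarrow> real"
    by (rule smooth_on_slice[OF I(1) oS _ that]) auto
  define hc where "hc u = hadamard (\<lambda>x. c (fst x)) (u, 0::real)" for u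
  have hc: "smooth_on I hc"
    unfolding hc_def[abs_def] by (rule slice[OF smooth_on_hadamard[OF S lift[OF c]]])
  have c_eq: "c u = c 0 + u * hc u" if "u \<in> I" for u
    using hadamard_eq[OF S lift[OF c], of u 0] that by (simp add: hc_def)
  obtain \<psi> where \<psi>: "smooth_on I \<psi>" "\<And>x. x \<in> I \<Longrightarrow> (\<psi> has_real_derivative hc x) (at x)"
    using antiderivative_exists[OF I hc] by blast
  obtain K :: nat where K: "- c 0 + 1 < real K" using reals_Archimedean2 by blast
  define g where "g x = exp (\<psi> x) * f x" for x
  have g: "smooth_on I g" unfolding g_def[abs_def] by (intro smooth_intros \<psi> f I)
  let ?a = "\<lambda>_. - c 0 :: real"
  define Y where "Y u = mellin_reg {} K (\<lambda>x. g (fst x)) ?a (u, 0::real)" for u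
  have nk: "- c 0 \<noteq> real k" for k
    using nres[of k] by linarith
  then have a: "smooth_on (UNIV :: real set) ?a" "\<And>p k. ?a p \<noteq> real k" "\<And>p. ?a p < real K - 1"
    using K by (auto intro: smooth_on_const)
  have Y: "smooth_on I Y"
    unfolding Y_def[abs_def]
    by (rule slice[OF smooth_on_mellin_reg[OF S lift[OF g] open_UNIV]]) (use a in auto)
  have ode: "u * deriv Y u + c 0 * Y u = g u" if "u \<in> I" for u
    using mellin_reg_ode[OF S lift[OF g] open_UNIV, of ?a K "{}" u 0] a that
    by (simp add: Y_def[abs_def])
  define y where "y x = exp (- \<psi> x) * Y x" for x
  have "x * deriv y x + c x * y x = f x" if x: "x \<in> I" for x
  proof -
    have "(y has_real_derivative exp (- \<psi> x) * deriv Y x + - hc x * exp (- \<psi> x) * Y x) (at x)"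
      unfolding y_def[abs_def]
      by (auto intro!: derivative_eq_intros \<psi>(2) x smooth_on_has_real_derivative[OF Y])
    then have "x * deriv y x + c x * y x
        = x * (exp (- \<psi> x) * deriv Y x - hc x * exp (- \<psi> x) * Y x) + c x * (exp (- \<psi> x) * Y x)"
      by (simp add: DERIV_imp_deriv y_def)
    also have "\<dots> = exp (- \<psi> x) * (x * deriv Y x + (c x - x * hc x) * Y x)"
      by (simp add: algebra_simps)
    also have "c x - x * hc x = c 0" using c_eq[OF x] by simp
    also have "x * deriv Y x + c 0 * Y x = exp (\<psi> x) * f x" using ode[OF x] by (simp add: g_def)
    also have "exp (- \<psi> x) * (exp (\<psi> x) * f x) = f x" by (simp add: exp_minus)
    finally show ?thesis .
  qed
  moreover have "smooth_on I y" unfolding y_def[abs_def] by (intro smooth_intros \<psi> Y I)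
  ultimately show ?thesis by blast
qed

section \<open>Partial derivatives, division in the second coordinate, and the saddle
  operator\<close>

definition pd2 :: "(real \<times> real \<Rightarrow> real) \<Rightarrow> real \<times> real \<Rightarrow> real" where
  "pd2 f x = frechet_derivative f (at x) (0, 1)"

lemma smooth_on_pd2: "smooth_on S f \<Longrightarrow> smooth_on S (pd2 f)"
  unfolding pd2_def[abs_def] by (rule smooth_on_frechet)

lemma pd2_has_real_derivative:
  assumes "smooth_on S f" "(x, y) \<in> S"
  shows "((\<lambda>y. f (x, y)) has_real_derivative pd2 f (x, y)) (at y)"
  unfolding pd2_def using partial_snd_has_derivative[OF smooth_on_has_derivative[OF assms]] .

lemma pd_eqI:
  assumes "(f has_derivative f') (at z)"
  shows "pd1 f z = f' (1, 0)" and "pd2 f z = f' (0, 1)"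
  using frechet_eqI[OF assms] by (simp_all add: pd1_def pd2_def)

lemma pd_add:
  assumes "smooth_on S f" "smooth_on S g" "z \<in> S"
  shows "pd1 (\<lambda>z. f z + g z) z = pd1 f z + pd1 g z" "pd2 (\<lambda>z. f z + g z) z = pd2 f z + pd2 g z"
  using pd_eqI[OF has_derivative_add[OF smooth_on_has_derivative[OF assms(1,3)]
        smooth_on_has_derivative[OF assms(2,3)]]]
  by (auto simp: pd1_def pd2_def)

lemma pd_mult:
  assumes "smooth_on S f" "smooth_on S g" "z \<in> S"
  shows "pd1 (\<lambda>z. f z * g z) z = f z * pd1 g z + pd1 f z * g z"
    "pd2 (\<lambda>z. f z * g z) z = f z * pd2 g z + pd2 f z * g z"
  using pd_eqI[OF has_derivative_mult[OF smooth_on_has_derivative[OF assms(1,3)]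
        smooth_on_has_derivative[OF assms(2,3)]]]
  by (auto simp: pd1_def pd2_def)

lemma pd_fst:
  fixes h :: "real \<Rightarrow> real"
  assumes "(h has_real_derivative h') (at (fst z))"
  shows "pd1 (\<lambda>z. h (fst z)) z = h'" "pd2 (\<lambda>z. h (fst z)) z = 0"
proof -
  have "((\<lambda>z. h (fst z)) has_derivative (\<lambda>v. h' * fst v)) (at z)"
    using diff_chain_at[OF has_derivative_fst[OF has_derivative_ident], of h "(*) h'" z] assms
    by (simp add: has_field_derivative_def o_def)
  from pd_eqI[OF this] show "pd1 (\<lambda>z. h (fst z)) z = h'" "pd2 (\<lambda>z. h (fst z)) z = 0" by auto
qed

lemma pd_snd:
  fixes h :: "real \<Rightarrow> real"
  assumes "(h has_real_derivative h') (at (snd z))"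
  shows "pd1 (\<lambda>z. h (snd z)) z = 0" "pd2 (\<lambda>z. h (snd z)) z = h'"
proof -
  have "((\<lambda>z. h (snd z)) has_derivative (\<lambda>v. h' * snd v)) (at z)"
    using diff_chain_at[OF has_derivative_snd[OF has_derivative_ident], of h "(*) h'" z] assms
    by (simp add: has_field_derivative_def o_def)
  from pd_eqI[OF this] show "pd1 (\<lambda>z. h (snd z)) z = 0" "pd2 (\<lambda>z. h (snd z)) z = h'" by auto
qed

text \<open>Shrinking each coordinate separately allows division in either variable, keeps the
  projections to the axes inside the set, and makes its axis slices intervals around 0.\<close>

definition biradial :: "(real \<times> real) set \<Rightarrow> bool" where
  "biradial S \<longleftrightarrow> open S \<and> (\<forall>x y t. (x, y) \<in> S \<longrightarrow> 0 \<le> t \<longrightarrow> t \<le> 1 \<longrightarrow> (t * x, y) \<in> S \<and> (x, t * y) \<in> S)"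

lemma biradial_radial: "biradial S \<Longrightarrow> radial_open S"
  by (auto simp: biradial_def radial_open_def)

lemma biradial_open: "biradial S \<Longrightarrow> open S"
  by (simp add: biradial_def)

lemma biradial_axes: "biradial S \<Longrightarrow> z \<in> S \<Longrightarrow> (fst z, 0) \<in> S \<and> (0, snd z) \<in> S \<and> (0, 0) \<in> S"
  unfolding biradial_def by (cases z) (metis fst_conv snd_conv le_numeral_extra(1,3) mult_zero_left zero_le_one)

lemma open_swap_vimage: "open S \<Longrightarrow> open (prod.swap -` S)"
  by (rule open_vimage) (auto intro: continuous_on_swap)

lemma biradial_swap: "biradial S \<Longrightarrow> radial_open (prod.swap -` S)"
  using open_swap_vimage by (auto simp: biradial_def radial_open_def)

lemma star_is_interval:
  fixes J :: "real set"
  assumes "\<And>u t. u \<in> J \<Longrightarrow> 0 \<le> t \<Longrightarrow> t \<le> 1 \<Longrightarrow> t * u \<in> J"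
  shows "is_interval J"
  unfolding is_interval_1
proof (intro ballI allI impI)
  fix a b x assume ab: "a \<in> J" "b \<in> J" "a \<le> x \<and> x \<le> b"
  have *: "x \<in> J" if "c \<in> J" "c \<noteq> 0" "0 \<le> x / c" "x / c \<le> 1" for c
    using assms[OF that(1,3,4)] that(2) by simp
  consider "x = 0" | "x > 0" | "x < 0" by linarith
  then show "x \<in> J"
  proof cases
    case 1
    then show ?thesis using assms[OF ab(1), of 0] by simp
  next
    case 2
    then show ?thesis using *[OF ab(2)] ab by (auto simp: divide_simps)
  next
    case 3
    then show ?thesis using *[OF ab(1)] ab by (auto simp: divide_simps)
  qed
qed

lemma biradial_axis_intervals:
  assumes "biradial S" "S \<noteq> {}"
  shows "open {x. (x, 0) \<in> S}" "is_interval {x. (x, 0) \<in> S}" "0 \<in> {x. (x, 0) \<in> S}"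
    and "open {y. (0, y) \<in> S}" "is_interval {y. (0, y) \<in> S}" "0 \<in> {y. (0, y) \<in> S}"
proof -
  have c: "continuous_on UNIV (\<lambda>x::real. (x, 0::real))" "continuous_on UNIV (\<lambda>y::real. (0::real, y))"
    by (intro continuous_intros)+
  show "open {x. (x, 0) \<in> S}" "open {y. (0, y) \<in> S}"
    using open_vimage[OF biradial_open[OF assms(1)] c(1)] open_vimage[OF biradial_open[OF assms(1)] c(2)]
    by (simp_all add: vimage_def)
  show "is_interval {x. (x, 0) \<in> S}" "is_interval {y. (0, y) \<in> S}"
    using assms(1) by (auto intro!: star_is_interval simp: biradial_def)
  show "0 \<in> {x. (x, 0) \<in> S}" "0 \<in> {y. (0, y) \<in> S}"
    using biradial_axes[OF assms(1)] assms(2) by auto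
qed

lemma hadamard_snd:
  assumes S: "biradial S" and f: "smooth_on S f"
  shows "\<exists>g. smooth_on S g \<and> (\<forall>z\<in>S. f z = f (fst z, 0) + snd z * g z)"
proof -
  let ?S = "prod.swap -` S"
  note r = biradial_swap[OF S]
  have sw: "smooth_on A (prod.swap :: real \<times> real \<Rightarrow> real \<times> real)" if "open A" for A
    using that by (auto intro!: smooth_on_linear bounded_linear_Pair bounded_linear_fst bounded_linear_snd
        simp: prod.swap_def[abs_def])
  have fs: "smooth_on ?S (\<lambda>z. f (prod.swap z))"
    by (rule smooth_on_compose[OF radial_open_open[OF r] biradial_open[OF S] _ f sw])
      (auto intro: radial_open_open[OF r])
  have "smooth_on S (\<lambda>z. hadamard (\<lambda>z. f (prod.swap z)) (prod.swap z))"
    by (rule smooth_on_compose[OF biradial_open[OF S] radial_open_open[OF r] _ smooth_on_hadamard[OF r fs] sw])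
      (auto intro: biradial_open[OF S])
  moreover have "f z = f (fst z, 0) + snd z * hadamard (\<lambda>z. f (prod.swap z)) (prod.swap z)" if "z \<in> S" for z
    using hadamard_eq[OF r fs, of "snd z" "fst z"] that by (simp add: prod.swap_def)
  ultimately show ?thesis by blast
qed

text \<open>The first quotient restricts on the axis to the \<open>y\<close>-derivative of
  \<open>f\<close>, which is 0, so it can be divided by \<open>y\<close> once more.\<close>

lemma hadamard_snd_twice:
  assumes S: "biradial S" and f: "smooth_on S f"
    and 0: "\<And>x. (x, 0) \<in> S \<Longrightarrow> f (x, 0) = 0"
    and 1: "\<And>x. (x, 0) \<in> S \<Longrightarrow> ((\<lambda>y. f (x, y)) has_real_derivative 0) (at 0)"
  shows "\<exists>g. smooth_on S g \<and> (\<forall>z\<in>S. f z = (snd z)\<^sup>2 * g z)"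
proof -
  obtain g where g: "smooth_on S g" "\<And>z. z \<in> S \<Longrightarrow> f z = f (fst z, 0) + snd z * g z"
    using hadamard_snd[OF S f] by blast
  have g0: "g (x, 0) = 0" if x: "(x, 0) \<in> S" for x
  proof -
    have "((\<lambda>y. y * g (x, y)) has_real_derivative g (x, 0)) (at 0)"
      using pd2_has_real_derivative[OF g(1) x] by (auto intro!: derivative_eq_intros)
    moreover have "eventually (\<lambda>y. f (x, y) = y * g (x, y)) (nhds 0)"
    proof -
      have "continuous_on UNIV (\<lambda>y::real. (x, y))" by (intro continuous_intros)
      then have "open ((\<lambda>y. (x, y)) -` S)" using biradial_open[OF S] by (rule open_vimage[rotated])
      then have "eventually (\<lambda>y. y \<in> (\<lambda>y. (x, y)) -` S) (nhds 0)"
        using x by (intro eventually_nhds_in_open) auto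
      then show ?thesis
      proof eventually_elim
        case (elim y)
        then have "(x, y) \<in> S" by simp
        from g(2)[OF this] 0[OF x] show ?case unfolding fst_conv snd_conv by linarith
      qed
    qed
    then have "((\<lambda>y. f (x, y)) has_real_derivative 0) (at 0) \<longleftrightarrow>
        ((\<lambda>y. y * g (x, y)) has_real_derivative 0) (at 0)"
      by (intro DERIV_cong_ev) auto
    ultimately show ?thesis using 1[OF x] DERIV_unique by blast
  qed
  obtain h where h: "smooth_on S h" "\<And>z. z \<in> S \<Longrightarrow> g z = g (fst z, 0) + snd z * h z"
    using hadamard_snd[OF S g(1)] by blast
  have "f z = (snd z)\<^sup>2 * h z" if z: "z \<in> S" for z
  proof -
    have ax: "(fst z, 0) \<in> S" using biradial_axes[OF S z] by simp
    have "f z = snd z * g z" using g(2)[OF z] 0[OF ax] by linarith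
    moreover have "g z = snd z * h z" using h(2)[OF z] g0[OF ax] by linarith
    ultimately show ?thesis by (simp add: power2_eq_square)
  qed
  then show ?thesis using h(1) by blast
qed

text \<open>The derivative of \<open>x^a y^b q\<close> along \<open>x P1 d/dx + y P2 d/dy\<close>,
  divided by \<open>x^a y^b\<close>. Hence a monomial factor of \<open>q\<close> just shifts
  \<open>a\<close> or \<open>b\<close>, also for real exponents.\<close>

definition saddle_op :: "(real \<times> real \<Rightarrow> real) \<Rightarrow> (real \<times> real \<Rightarrow> real) \<Rightarrow> real \<Rightarrow> real
    \<Rightarrow> (real \<times> real \<Rightarrow> real) \<Rightarrow> real \<times> real \<Rightarrow> real" where
  "saddle_op P1 P2 a b q z = fst z * P1 z * pd1 q z + snd z * P2 z * pd2 q z + (a * P1 z + b * P2 z) * q z"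

lemma saddle_op_add:
  assumes "smooth_on S f" "smooth_on S g" "z \<in> S"
  shows "saddle_op P1 P2 a b (\<lambda>z. f z + g z) z = saddle_op P1 P2 a b f z + saddle_op P1 P2 a b g z"
  using pd_add[OF assms] by (simp add: saddle_op_def algebra_simps)

lemma saddle_op_fst_power:
  assumes "open S" "smooth_on S q" "z \<in> S"
  shows "saddle_op P1 P2 a b (\<lambda>z. fst z ^ k * q z) z = fst z ^ k * saddle_op P1 P2 (a + real k) b q z"
proof -
  have s: "smooth_on S (\<lambda>z. fst z ^ k)" by (intro smooth_intros assms)
  have d: "pd1 (\<lambda>z. fst z ^ k) z = real k * fst z ^ (k - 1)" "pd2 (\<lambda>z. fst z ^ k) z = 0"
    using pd_fst[OF DERIV_pow[of k "fst z"]] by auto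
  have e: "fst z * (real k * fst z ^ (k - 1)) = real k * fst z ^ k" by (cases k) auto
  have "saddle_op P1 P2 a b (\<lambda>z. fst z ^ k * q z) z
      = fst z ^ k * saddle_op P1 P2 a b q z + P1 z * q z * (fst z * (real k * fst z ^ (k - 1)))"
    unfolding saddle_op_def pd_mult[OF s assms(2,3)] d by (simp add: algebra_simps)
  then show ?thesis unfolding e by (simp add: saddle_op_def algebra_simps)
qed

lemma saddle_op_snd_power:
  assumes "open S" "smooth_on S q" "z \<in> S"
  shows "saddle_op P1 P2 a b (\<lambda>z. snd z ^ k * q z) z = snd z ^ k * saddle_op P1 P2 a (b + real k) q z"
proof -
  have s: "smooth_on S (\<lambda>z. snd z ^ k)" by (intro smooth_intros assms)
  have d: "pd2 (\<lambda>z. snd z ^ k) z = real k * snd z ^ (k - 1)" "pd1 (\<lambda>z. snd z ^ k) z = 0"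
    using pd_snd[OF DERIV_pow[of k "snd z"]] by auto
  have e: "snd z * (real k * snd z ^ (k - 1)) = real k * snd z ^ k" by (cases k) auto
  have "saddle_op P1 P2 a b (\<lambda>z. snd z ^ k * q z) z
      = snd z ^ k * saddle_op P1 P2 a b q z + P2 z * q z * (snd z * (real k * snd z ^ (k - 1)))"
    unfolding saddle_op_def pd_mult[OF s assms(2,3)] d by (simp add: algebra_simps)
  then show ?thesis unfolding e by (simp add: saddle_op_def algebra_simps)
qed

lemma smooth_on_fst_compose:
  fixes h :: "real \<Rightarrow> real"
  assumes S: "biradial S" and h: "smooth_on {x. (x, 0) \<in> S} h"
  shows "smooth_on S (\<lambda>z. h (fst z))"
proof (cases "S = {}")
  case False
  show ?thesis
    by (rule smooth_on_compose[OF biradial_open[OF S] biradial_axis_intervals(1)[OF S False] _ h])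
      (use biradial_axes[OF S] biradial_open[OF S] in \<open>auto intro!: smooth_intros\<close>)
qed (use smooth_on_cong[of "{}" _ "\<lambda>_. 0 :: real"] smooth_on_const in auto)

lemma smooth_on_snd_compose:
  fixes h :: "real \<Rightarrow> real"
  assumes S: "biradial S" and h: "smooth_on {y. (0, y) \<in> S} h"
  shows "smooth_on S (\<lambda>z. h (snd z))"
proof (cases "S = {}")
  case False
  show ?thesis
    by (rule smooth_on_compose[OF biradial_open[OF S] biradial_axis_intervals(4)[OF S False] _ h])
      (use biradial_axes[OF S] biradial_open[OF S] in \<open>auto intro!: smooth_intros\<close>)
qed (use smooth_on_cong[of "{}" _ "\<lambda>_. 0 :: real"] smooth_on_const in auto)

text \<open>On \<open>x = 0\<close>, for \<open>q\<close> depending on \<open>y\<close> alone,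
  division by \<open>P2\<close> turns the equation into
  \<open>y h' + (b + a P1/P2) h = f / P2\<close>, which \<open>ode_smooth_solution\<close> solves.
  The remaining error vanishes on the axis and is therefore divisible by \<open>x\<close>.\<close>

lemma snd_axis_step:
  assumes S: "biradial S" "S \<noteq> {}" and P: "smooth_on S P1" "smooth_on S P2" and f: "smooth_on S f"
    and nz: "\<And>y. (0, y) \<in> S \<Longrightarrow> P2 (0, y) \<noteq> 0"
    and nres: "\<And>j. b + real j + a * (P1 (0, 0) / P2 (0, 0)) \<noteq> 0"
  shows "\<exists>q r. smooth_on S q \<and> smooth_on S r \<and> (\<forall>z\<in>S. saddle_op P1 P2 a b q z = f z - fst z * r z)"
proof -
  let ?J = "{y. (0, y) \<in> S}"
  note J = biradial_axis_intervals(4-6)[OF S]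
  note o = biradial_open[OF S(1)]
  have ax: "smooth_on ?J (\<lambda>y. g (0, y))" if "smooth_on S g" for g :: "real \<times> real \<Rightarrow> real"
    by (rule smooth_on_compose[OF J(1) o _ that]) (auto intro!: smooth_intros J)
  have "\<exists>h. smooth_on ?J h \<and> (\<forall>y\<in>?J. y * deriv h y + (b + a * (P1 (0, y) / P2 (0, y))) * h y = f (0, y) / P2 (0, y))"
  proof (rule ode_smooth_solution[OF J])
    show "smooth_on ?J (\<lambda>y. b + a * (P1 (0, y) / P2 (0, y)))" "smooth_on ?J (\<lambda>y. f (0, y) / P2 (0, y))"
      by (intro smooth_intros ax P f J; use nz in simp)+
    show "b + a * (P1 (0, 0) / P2 (0, 0)) + real k \<noteq> 0" for k
      using nres[of k] by (simp add: algebra_simps)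
  qed
  then obtain h where h: "smooth_on ?J h"
    and ode: "\<And>y. y \<in> ?J \<Longrightarrow> y * deriv h y + (b + a * (P1 (0, y) / P2 (0, y))) * h y = f (0, y) / P2 (0, y)"
    by blast
  let ?q = "\<lambda>z::real \<times> real. h (snd z)"
  have q: "smooth_on S ?q" by (rule smooth_on_snd_compose[OF S(1) h])
  let ?F = "\<lambda>z. f z - saddle_op P1 P2 a b ?q z"
  have F: "smooth_on S ?F"
    unfolding saddle_op_def by (intro smooth_intros o P f q smooth_on_pd1 smooth_on_pd2)
  have F0: "?F (0, y) = 0" if y: "(0, y) \<in> S" for y
  proof -
    have "pd2 ?q (0, y) = deriv h y"
      using pd_snd(2)[of h "deriv h y" "(0, y)"] smooth_on_has_real_derivative[OF h] y by simp
    then have "saddle_op P1 P2 a b ?q (0, y)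
        = P2 (0, y) * (y * deriv h y + (b + a * (P1 (0, y) / P2 (0, y))) * h y)"
      using nz[OF y] by (simp add: saddle_op_def field_simps)
    also have "\<dots> = f (0, y)" using ode[of y] y nz[OF y] by simp
    finally show ?thesis by simp
  qed
  have "saddle_op P1 P2 a b ?q z = f z - fst z * hadamard ?F z" if "z \<in> S" for z
    using hadamard_eq[OF biradial_radial[OF S(1)] F, of "fst z" "snd z"] that F0[of "snd z"]
      biradial_axes[OF S(1) that] by simp
  then show ?thesis
    using q smooth_on_hadamard[OF biradial_radial[OF S(1)] F] by blast
qed

text \<open>Each further factor \<open>x\<close> is gained by correcting the remainder
  \<open>r\<close> with a term \<open>x^K q'\<close>; that factor shifts \<open>a\<close> to
  \<open>a + K\<close>, which is why the condition runs over all \<open>a + k\<close>.\<close>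

lemma snd_axis_chain:
  assumes S: "biradial S" "S \<noteq> {}" and P: "smooth_on S P1" "smooth_on S P2" and f: "smooth_on S f"
    and nz: "\<And>y. (0, y) \<in> S \<Longrightarrow> P2 (0, y) \<noteq> 0"
    and nres: "\<And>j k. b + real j + (a + real k) * (P1 (0, 0) / P2 (0, 0)) \<noteq> 0"
  shows "\<exists>q r. smooth_on S q \<and> smooth_on S r \<and> (\<forall>z\<in>S. saddle_op P1 P2 a b q z = f z - fst z ^ K * r z)"
proof (induction K)
  case 0
  have "smooth_on S (\<lambda>z. f z - saddle_op P1 P2 a b (\<lambda>_. 0) z)"
    unfolding saddle_op_def by (intro smooth_intros biradial_open[OF S(1)] P f smooth_on_pd1 smooth_on_pd2)
  then show ?case
    by (intro exI[of _ "\<lambda>_. 0"] exI[of _ "\<lambda>z. f z - saddle_op P1 P2 a b (\<lambda>_. 0) z"])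
      (auto intro!: smooth_intros biradial_open[OF S(1)])
next
  case (Suc K)
  note o = biradial_open[OF S(1)]
  obtain q r where q: "smooth_on S q" and r: "smooth_on S r"
    and eq: "\<And>z. z \<in> S \<Longrightarrow> saddle_op P1 P2 a b q z = f z - fst z ^ K * r z" using Suc by blast
  obtain q' r' where q': "smooth_on S q'" and r': "smooth_on S r'"
    and eq': "\<And>z. z \<in> S \<Longrightarrow> saddle_op P1 P2 (a + real K) b q' z = r z - fst z * r' z"
    using snd_axis_step[OF S P r nz nres] by blast
  have sq': "smooth_on S (\<lambda>z. fst z ^ K * q' z)" by (intro smooth_intros o q')
  have "saddle_op P1 P2 a b (\<lambda>z. q z + fst z ^ K * q' z) z = f z - fst z ^ Suc K * r' z" if "z \<in> S" for z
    unfolding saddle_op_add[OF q sq' that] saddle_op_fst_power[OF o q' that] eq[OF that] eq'[OF that]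
    by (simp add: algebra_simps)
  moreover have "smooth_on S (\<lambda>z. q z + fst z ^ K * q' z)" by (intro smooth_intros o q sq')
  ultimately show ?case using r' by blast
qed

text \<open>Since \<open>p1 / p2 = - 1 / lam\<close>, the expression is \<open>m - k / lam\<close>,
  and its vanishing would give \<open>lam = k / m\<close>.\<close>

lemma irrational_nonresonance:
  assumes "lam \<notin> \<rat>" "lam = - p2 / p1" "p1 \<noteq> 0" "p2 \<noteq> (0::real)" "m \<noteq> 0"
  shows "real m + real k * (p1 / p2) \<noteq> 0"
proof
  assume "real m + real k * (p1 / p2) = 0"
  then have "real m * p2 + real k * p1 = 0" using assms by (simp add: field_simps)
  moreover have "lam * p1 = - p2" using assms(2,3) by simp
  ultimately have "p1 * (real k - lam * real m) = 0" by algebra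
  then have "lam * real m = real k" using assms(3) by simp
  then have "lam = real k / real m" using assms(5) by (simp add: field_simps)
  then show False using assms(1) by auto
qed

text \<open>With \<open>H = x\<^sup>\<lambda> y exp (E + y\<^sup>2 qH)\<close> and \<open>G = x\<^bsup>n1\<^esup> y\<^bsup>n2\<^esup> (Q + y\<^sup>2 qG)\<close>, the two equations say that
  the field without denominator sends \<open>log H\<close> and \<open>G\<close> to \<open>0\<close> and \<open>x\<^bsup>n1\<^esup> y\<^bsup>n2\<^esup>\<close> up to a defect that is flat of
  order \<open>K\<close> on one axis and of order \<open>2\<close> on the other.  The functions \<open>l\<close>, \<open>m\<close>, \<open>y0\<close>, \<open>y1\<close> make the
  defect of order \<open>2\<close> on the horizontal axis; irrationality of \<open>\<lambda>\<close> then allows the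
  correction along the vertical axis.\<close>

theorem approximate_integrals:
  fixes P1 P2 :: "real \<times> real \<Rightarrow> real" and n1 n2 :: nat and lam :: real
  assumes S: "biradial S" "S \<noteq> {}" and P: "smooth_on S P1" "smooth_on S P2"
    and pos: "\<And>x. (x, 0) \<in> S \<Longrightarrow> P1 (x, 0) > 0" and neg: "\<And>y. (0, y) \<in> S \<Longrightarrow> P2 (0, y) < 0"
    and lam: "lam = - P2 (0, 0) / P1 (0, 0)" "lam \<notin> \<rat>"
    and sm: "smooth_on {x. (x, 0) \<in> S} l" "smooth_on {x. (x, 0) \<in> S} m"
      "smooth_on {x. (x, 0) \<in> S} y0" "smooth_on {x. (x, 0) \<in> S} y1"
    and ode_l: "\<And>x. (x, 0) \<in> S \<Longrightarrow> x * deriv l x = P2 (x, 0) / P1 (x, 0) + lam"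
    and ode_m: "\<And>x. (x, 0) \<in> S \<Longrightarrow> x * deriv m x * P1 (x, 0) + P2 (x, 0) * m x
      = - (pd2 P2 (x, 0) - P2 (x, 0) / P1 (x, 0) * pd2 P1 (x, 0))"
    and ode_y0: "\<And>x. (x, 0) \<in> S \<Longrightarrow> x * deriv y0 x + (real n1 - real n2 * lam) * y0 x
      = exp (real n2 * l x) / P1 (x, 0)"
    and ode_y1: "\<And>x. (x, 0) \<in> S \<Longrightarrow> x * deriv y1 x + (real n1 - (real n2 + 1) * lam) * y1 x
      = - exp ((real n2 + 1) * l x) * (real n2 * m x / P1 (x, 0) + pd2 P1 (x, 0) / (P1 (x, 0))\<^sup>2)"
  defines "E \<equiv> \<lambda>z. - l (fst z) + snd z * m (fst z)"
  defines "Q \<equiv> \<lambda>z. y0 (fst z) * exp (real n2 * E z) + y1 (fst z) * snd z * exp ((real n2 + 1) * E z)"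
  shows "\<exists>qH rH qG rG. smooth_on S qH \<and> smooth_on S rH \<and> smooth_on S qG \<and> smooth_on S rG \<and>
    smooth_on S E \<and> smooth_on S Q \<and>
    (\<forall>z\<in>S. lam * P1 z + P2 z + saddle_op P1 P2 0 0 (\<lambda>z. E z + snd z ^ 2 * qH z) z
        = fst z ^ K * snd z ^ 2 * rH z \<and>
      saddle_op P1 P2 (real n1) (real n2) (\<lambda>z. Q z + snd z ^ 2 * qG z) z
        = 1 + fst z ^ K * snd z ^ 2 * rG z)"
proof -
  let ?J = "{x. (x, 0) \<in> S}"
  note o = biradial_open[OF S(1)]
  note J = biradial_axis_intervals(1-3)[OF S]
  note lift = smooth_on_fst_compose[OF S(1)]
  have ax: "smooth_on ?J (\<lambda>x. g (x, 0))" if "smooth_on S g" for g :: "real \<times> real \<Rightarrow> real"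
    by (rule smooth_on_compose[OF J(1) o _ that]) (auto intro!: smooth_intros J)
  have pz: "(fst z, 0) \<in> S" if "z \<in> S" for z using biradial_axes[OF S(1) that] by simp
  have O: "(0, 0) \<in> S" using J(3) by simp
  have sE: "smooth_on S E" unfolding E_def by (intro smooth_intros o lift sm)
  have sQ: "smooth_on S Q" unfolding Q_def by (intro smooth_intros o lift sm sE)
  \<comment> \<open>\<open>A\<close> and \<open>B\<close> are the right sides of the equations for
    \<open>y0\<close> and \<open>y1\<close>. They are chosen so that
    \<open>P1 * (A exp (n2 E) + y B exp ((n2+1) E))\<close> equals 1 up to order
    \<open>y^2\<close>.\<close>
  define A where "A x = exp (real n2 * l x) / P1 (x, 0)" for x
  define B where "B x = - exp ((real n2 + 1) * l x) * (real n2 * m x / P1 (x, 0) + pd2 P1 (x, 0) / (P1 (x, 0))\<^sup>2)" for x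
  have pos': "P1 (x, 0) \<noteq> 0" "(P1 (x, 0))\<^sup>2 \<noteq> 0" if "x \<in> ?J" for x
    using pos[of x] that by auto
  have sA: "smooth_on ?J A" unfolding A_def[abs_def] using pos' by (intro smooth_intros J sm ax P) auto
  have sB: "smooth_on ?J B" unfolding B_def[abs_def] using pos' by (intro smooth_intros J sm ax P smooth_on_pd2) auto
  define \<Phi> where "\<Phi> z = lam * P1 z + P2 z + fst z * P1 z * (- deriv l (fst z) + snd z * deriv m (fst z))
    + snd z * P2 z * m (fst z)" for z
  have s\<Phi>: "smooth_on S \<Phi>"
    unfolding \<Phi>_def[abs_def] by (intro smooth_intros o P lift sm smooth_on_deriv J)
  \<comment> \<open>With \<open>H = x^lam y exp E\<close>, the function \<open>x^n1 y^n2 Q\<close>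
    is \<open>x^(n1 - lam n2) y0 H^n2 + x^(n1 - lam (n2+1)) y1 H^(n2+1)\<close>. Differentiating the
    factors that depend on \<open>x\<close> alone gives \<open>1 + \<Psi>\<close>; differentiating
    the powers of \<open>H\<close> gives the multiples of \<open>\<Phi>\<close> in
    \<open>opQ\<close>.\<close>
  define \<Psi> where "\<Psi> z = P1 z * (A (fst z) * exp (real n2 * E z) + snd z * B (fst z) * exp ((real n2 + 1) * E z)) - 1" for z
  have s\<Psi>: "smooth_on S \<Psi>"
    unfolding \<Psi>_def[abs_def] by (intro smooth_intros o P lift sA sB sE)
  have dfst: "((\<lambda>z. h (fst z)) has_derivative (\<lambda>v. deriv h (fst z) * fst v)) (at z)"
    if "smooth_on ?J h" "z \<in> S" for h :: "real \<Rightarrow> real" and z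
    using diff_chain_at[OF has_derivative_fst[OF has_derivative_ident], of h "(*) (deriv h (fst z))" z]
      smooth_on_has_real_derivative[OF that(1), of "fst z"] pz[OF that(2)]
    by (simp add: has_field_derivative_def o_def)
  have dE: "(E has_derivative (\<lambda>v. (- deriv l (fst z) + snd z * deriv m (fst z)) * fst v + m (fst z) * snd v)) (at z)"
    if "z \<in> S" for z
    unfolding E_def
    by (rule has_derivative_eq_rhs[OF has_derivative_add[OF has_derivative_minus[OF dfst[OF sm(1) that]]
            has_derivative_mult[OF has_derivative_snd[OF has_derivative_ident] dfst[OF sm(2) that]]]])
      (simp add: fun_eq_iff algebra_simps)
  have opE: "lam * P1 z + P2 z + saddle_op P1 P2 0 0 E z = \<Phi> z" if "z \<in> S" for z
    unfolding saddle_op_def pd_eqI[OF dE[OF that]] \<Phi>_def by (simp add: algebra_simps)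
  have dQ: "(Q has_derivative (\<lambda>v.
      exp (real n2 * E z) * (deriv y0 (fst z) * fst v
        + real n2 * y0 (fst z) * ((- deriv l (fst z) + snd z * deriv m (fst z)) * fst v + m (fst z) * snd v))
      + exp ((real n2 + 1) * E z) * (snd z * deriv y1 (fst z) * fst v + y1 (fst z) * snd v
        + (real n2 + 1) * y1 (fst z) * snd z * ((- deriv l (fst z) + snd z * deriv m (fst z)) * fst v + m (fst z) * snd v))))
      (at z)" if "z \<in> S" for z
  proof -
    have 1: "((\<lambda>z. exp (real n2 * E z)) has_derivative (\<lambda>v. exp (real n2 * E z) * (real n2 *
        ((- deriv l (fst z) + snd z * deriv m (fst z)) * fst v + m (fst z) * snd v)))) (at z)"
      by (rule has_derivative_eq_rhs[OF has_derivative_exp[OF has_derivative_mult_right[OF dE[OF that]]]])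
        (simp add: fun_eq_iff algebra_simps)
    have 2: "((\<lambda>z. exp ((real n2 + 1) * E z)) has_derivative (\<lambda>v. exp ((real n2 + 1) * E z) * ((real n2 + 1) *
        ((- deriv l (fst z) + snd z * deriv m (fst z)) * fst v + m (fst z) * snd v)))) (at z)"
      by (rule has_derivative_eq_rhs[OF has_derivative_exp[OF has_derivative_mult_right[OF dE[OF that]]]])
        (simp add: fun_eq_iff algebra_simps)
    have 3: "((\<lambda>z. y1 (fst z) * snd z) has_derivative (\<lambda>v. y1 (fst z) * snd v + deriv y1 (fst z) * fst v * snd z)) (at z)"
      by (rule has_derivative_mult[OF dfst[OF sm(4) that] has_derivative_snd[OF has_derivative_ident]])
    show ?thesis
      unfolding Q_def
      by (rule has_derivative_eq_rhs[OF has_derivative_add[OF has_derivative_mult[OF dfst[OF sm(3) that] 1]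
              has_derivative_mult[OF 3 2]]])
        (simp add: fun_eq_iff algebra_simps)
  qed
  have opQ: "saddle_op P1 P2 (real n1) (real n2) Q z = 1 + \<Psi> z + \<Phi> z *
      (real n2 * y0 (fst z) * exp (real n2 * E z) + (real n2 + 1) * y1 (fst z) * snd z * exp ((real n2 + 1) * E z))"
    if "z \<in> S" for z
  proof -
    define x y p q where xy: "x = fst z" "y = snd z" "p = P1 z" "q = P2 z"
    define e0 e1 where e: "e0 = exp (real n2 * E z)" "e1 = exp ((real n2 + 1) * E z)"
    define w where w: "w = - deriv l x + y * deriv m x"
    have \<Phi>: "\<Phi> z = lam * p + q + x * p * w + y * q * m x" by (simp add: \<Phi>_def xy w)
    have a: "x * deriv y0 x = A x - (real n1 - real n2 * lam) * y0 x"
      and b: "x * deriv y1 x = B x - (real n1 - (real n2 + 1) * lam) * y1 x"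
      using ode_y0[OF pz[OF that]] ode_y1[OF pz[OF that]] by (simp_all add: xy A_def B_def)
    have "saddle_op P1 P2 (real n1) (real n2) Q z =
        e0 * (p * (x * deriv y0 x) + real n2 * y0 x * (x * p * w + y * q * m x) + (real n1 * p + real n2 * q) * y0 x)
        + y * e1 * (p * (x * deriv y1 x) + q * y1 x + (real n2 + 1) * y1 x * (x * p * w + y * q * m x)
          + (real n1 * p + real n2 * q) * y1 x)"
      unfolding saddle_op_def pd_eqI[OF dQ[OF that]]
      by (simp add: Q_def xy[symmetric] e[symmetric]) (simp add: w algebra_simps)
    also have "\<dots> = p * (A x * e0 + y * B x * e1)
        + (lam * p + q + x * p * w + y * q * m x) * (real n2 * y0 x * e0 + (real n2 + 1) * y1 x * y * e1)"
      unfolding a b by (simp add: algebra_simps)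
    finally show ?thesis
      unfolding \<Phi> by (simp add: \<Psi>_def xy[symmetric] e[symmetric])
  qed
  \<comment> \<open>\<open>ode_l\<close> expresses \<open>\<Phi> (x, 0) = 0\<close>, and given this
    \<open>ode_m\<close> expresses that the \<open>y\<close>-derivative of \<open>\<Phi>\<close>
    vanishes on the axis.\<close>
  obtain R where R: "smooth_on S R" "\<And>z. z \<in> S \<Longrightarrow> \<Phi> z = (snd z)\<^sup>2 * R z"
  proof -
    have "\<Phi> (x, 0) = 0" if x: "(x, 0) \<in> S" for x
    proof -
      have "\<Phi> (x, 0) = lam * P1 (x, 0) + P2 (x, 0) - P1 (x, 0) * (x * deriv l x)"
        by (simp add: \<Phi>_def)
      also have "\<dots> = 0" unfolding ode_l[OF x] using pos[OF x] by (simp add: field_simps)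
      finally show ?thesis .
    qed
    moreover have "((\<lambda>y. \<Phi> (x, y)) has_real_derivative 0) (at 0)" if x: "(x, 0) \<in> S" for x
    proof -
      have "((\<lambda>y. \<Phi> (x, y)) has_real_derivative lam * pd2 P1 (x, 0) + pd2 P2 (x, 0)
          + (x * pd2 P1 (x, 0) * - deriv l x + x * P1 (x, 0) * deriv m x) + P2 (x, 0) * m x) (at 0)"
        unfolding \<Phi>_def fst_conv snd_conv
        by (auto intro!: derivative_eq_intros pd2_has_real_derivative[OF P(1) x] pd2_has_real_derivative[OF P(2) x])
      moreover have "lam * pd2 P1 (x, 0) + pd2 P2 (x, 0)
          + (x * pd2 P1 (x, 0) * - deriv l x + x * P1 (x, 0) * deriv m x) + P2 (x, 0) * m x
          = lam * pd2 P1 (x, 0) + pd2 P2 (x, 0) - pd2 P1 (x, 0) * (x * deriv l x)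
            + (x * deriv m x * P1 (x, 0) + P2 (x, 0) * m x)"
        by (simp add: algebra_simps)
      moreover have "\<dots> = 0"
        unfolding ode_l[OF x] ode_m[OF x] by (simp add: algebra_simps)
      ultimately show ?thesis by simp
    qed
    ultimately show ?thesis using hadamard_snd_twice[OF S(1) s\<Phi>] that by blast
  qed
  obtain R2 where R2: "smooth_on S R2" "\<And>z. z \<in> S \<Longrightarrow> \<Psi> z = (snd z)\<^sup>2 * R2 z"
  proof -
    have "\<Psi> (x, 0) = 0" if x: "(x, 0) \<in> S" for x
      using pos[OF x] by (simp add: \<Psi>_def A_def E_def exp_minus flip: exp_add)
    moreover have "((\<lambda>y. \<Psi> (x, y)) has_real_derivative 0) (at 0)" if x: "(x, 0) \<in> S" for x
    proof -
      have d: "((\<lambda>y. E (x, y)) has_real_derivative m x) (at 0)"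
        unfolding E_def by (auto intro!: derivative_eq_intros)
      have E0: "E (x, 0) = - l x" by (simp add: E_def)
      have d\<Psi>: "((\<lambda>y. \<Psi> (x, y)) has_real_derivative
          pd2 P1 (x, 0) * (A x * exp (real n2 * - l x)) + P1 (x, 0) * (A x * (exp (real n2 * - l x) * (real n2 * m x))
            + B x * exp ((real n2 + 1) * - l x))) (at 0)"
        unfolding \<Psi>_def fst_conv snd_conv
        by (auto intro!: derivative_eq_intros pd2_has_real_derivative[OF P(1) x] d simp: E0)
      have e1: "A x * exp (real n2 * - l x) = 1 / P1 (x, 0)"
        by (simp add: A_def flip: exp_add)
      have e2: "A x * (exp (real n2 * - l x) * (real n2 * m x)) = 1 / P1 (x, 0) * (real n2 * m x)"
        by (simp add: A_def mult.assoc[symmetric] flip: exp_add)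
      have e3: "B x * exp ((real n2 + 1) * - l x) = - (real n2 * m x / P1 (x, 0) + pd2 P1 (x, 0) / (P1 (x, 0))\<^sup>2)"
      proof -
        have e: "exp ((real n2 + 1) * l x) * exp ((real n2 + 1) * - l x) = 1"
          by (simp flip: exp_add)
        have *: "- X * C * Y = - (X * Y) * C" for X Y C :: real by (simp add: algebra_simps)
        show ?thesis unfolding B_def * e by simp
      qed
      have "((\<lambda>y. \<Psi> (x, y)) has_real_derivative
          pd2 P1 (x, 0) * (1 / P1 (x, 0)) + P1 (x, 0) * (1 / P1 (x, 0) * (real n2 * m x)
            + - (real n2 * m x / P1 (x, 0) + pd2 P1 (x, 0) / (P1 (x, 0))\<^sup>2))) (at 0)"
        using d\<Psi> unfolding e1 e2 e3 .
      moreover have "pd2 P1 (x, 0) * (1 / P1 (x, 0)) + P1 (x, 0) * (1 / P1 (x, 0) * (real n2 * m x)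
            + - (real n2 * m x / P1 (x, 0) + pd2 P1 (x, 0) / (P1 (x, 0))\<^sup>2)) = 0"
        using pos[OF x] by (simp add: field_simps power2_eq_square)
      ultimately show ?thesis by simp
    qed
    ultimately show ?thesis using hadamard_snd_twice[OF S(1) s\<Psi>] that by blast
  qed
  define F2 where "F2 z = R2 z + R z *
      (real n2 * y0 (fst z) * exp (real n2 * E z) + (real n2 + 1) * y1 (fst z) * snd z * exp ((real n2 + 1) * E z))" for z
  have sF2: "smooth_on S F2"
    unfolding F2_def[abs_def] by (intro smooth_intros o R R2 lift sm sE)
  have opQ': "saddle_op P1 P2 (real n1) (real n2) Q z = 1 + (snd z)\<^sup>2 * F2 z" if "z \<in> S" for z
    unfolding opQ[OF that] R(2)[OF that] R2(2)[OF that] F2_def by (simp add: algebra_simps)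
  have nz: "P2 (0, y) \<noteq> 0" if "(0, y) \<in> S" for y using neg[OF that] by simp
  have p0: "P1 (0, 0) \<noteq> 0" "P2 (0, 0) \<noteq> 0" using pos[OF O] neg[OF O] by auto
  note nonres = irrational_nonresonance[OF lam(2,1) p0]
  \<comment> \<open>Adding \<open>y^2 qH\<close> changes the defect by
    \<open>y^2 * saddle_op P1 P2 0 2 qH\<close>, so \<open>qH\<close> must cancel \<open>R\<close>
    up to order \<open>K\<close> in \<open>x\<close>. The shift by 2 keeps the
    \<open>y\<close>-index nonzero, which \<open>nonres\<close> requires.\<close>
  have "\<exists>q r. smooth_on S q \<and> smooth_on S r \<and> (\<forall>z\<in>S. saddle_op P1 P2 0 2 q z = - R z - fst z ^ K * r z)"
    by (rule snd_axis_chain[OF S P smooth_on_minus[OF o R(1)] nz]) (use nonres[of "2 + _"] in auto)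
  then obtain qH rH where H: "smooth_on S qH" "smooth_on S rH"
    "\<And>z. z \<in> S \<Longrightarrow> saddle_op P1 P2 0 2 qH z = - R z - fst z ^ K * rH z" by blast
  have "\<exists>q r. smooth_on S q \<and> smooth_on S r \<and>
      (\<forall>z\<in>S. saddle_op P1 P2 (real n1) (real n2 + 2) q z = - F2 z - fst z ^ K * r z)"
  proof (rule snd_axis_chain[OF S P smooth_on_minus[OF o sF2] nz])
    fix j k
    show "real n2 + 2 + real j + (real n1 + real k) * (P1 (0, 0) / P2 (0, 0)) \<noteq> 0"
      using nonres[of "n2 + 2 + j" "n1 + k"] by simp
  qed
  then obtain qG rG where G: "smooth_on S qG" "smooth_on S rG"
    "\<And>z. z \<in> S \<Longrightarrow> saddle_op P1 P2 (real n1) (real n2 + 2) qG z = - F2 z - fst z ^ K * rG z" by blast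
  have sH: "smooth_on S (\<lambda>z. snd z ^ 2 * qH z)" and sG: "smooth_on S (\<lambda>z. snd z ^ 2 * qG z)"
    by (intro smooth_intros o H G)+
  have "lam * P1 z + P2 z + saddle_op P1 P2 0 0 (\<lambda>z. E z + snd z ^ 2 * qH z) z
      = fst z ^ K * snd z ^ 2 * - rH z" if "z \<in> S" for z
  proof -
    have "lam * P1 z + P2 z + saddle_op P1 P2 0 0 (\<lambda>z. E z + snd z ^ 2 * qH z) z
        = \<Phi> z + snd z ^ 2 * saddle_op P1 P2 0 2 qH z"
      unfolding saddle_op_add[OF sE sH that] saddle_op_snd_power[OF o H(1) that] opE[OF that, symmetric] by simp
    then show ?thesis unfolding H(3)[OF that] R(2)[OF that] by (simp add: algebra_simps)
  qed
  moreover have "saddle_op P1 P2 (real n1) (real n2) (\<lambda>z. Q z + snd z ^ 2 * qG z) z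
      = 1 + fst z ^ K * snd z ^ 2 * - rG z" if "z \<in> S" for z
  proof -
    have "saddle_op P1 P2 (real n1) (real n2) (\<lambda>z. Q z + snd z ^ 2 * qG z) z
        = 1 + (snd z)\<^sup>2 * F2 z + snd z ^ 2 * saddle_op P1 P2 (real n1) (real n2 + 2) qG z"
      unfolding saddle_op_add[OF sQ sG that] saddle_op_snd_power[OF o G(1) that] opQ'[OF that] by simp
    then show ?thesis unfolding G(3)[OF that] by (simp add: algebra_simps)
  qed
  moreover have "smooth_on S (\<lambda>z. - rH z)" "smooth_on S (\<lambda>z. - rG z)"
    by (intro smooth_intros o H G)+
  ultimately show ?thesis using sE sQ H(1) G(1) by blast
qed

section \<open>Estimates along the orbits\<close>

text \<open>Every constant of a finite subcover is at most the sum of all their absolute values, and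
  \<open>Pr\<close> is monotone in the constant.\<close>

lemma compact_uniform_neighbourhood:
  fixes Pr :: "real \<Rightarrow> 'a::topological_space \<Rightarrow> bool"
  assumes "compact A" and mono: "\<And>C C' x. Pr C x \<Longrightarrow> C \<le> C' \<Longrightarrow> Pr C' x"
    and loc: "\<And>p. p \<in> A \<Longrightarrow> \<exists>C. eventually (Pr C) (nhds p)"
  shows "\<exists>V C. open V \<and> A \<subseteq> V \<and> (\<forall>x\<in>V. Pr C x)"
proof -
  have "\<exists>V C. open V \<and> p \<in> V \<and> (\<forall>x\<in>V. Pr C x)" if "p \<in> A" for p
    using loc[OF that] unfolding eventually_nhds by blast
  then obtain V C where V: "\<And>p. p \<in> A \<Longrightarrow> open (V p) \<and> p \<in> V p \<and> (\<forall>x\<in>V p. Pr (C p) x)"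
    by metis
  obtain B where B: "B \<subseteq> A" "finite B" "A \<subseteq> (\<Union>p\<in>B. V p)"
    using compactE_image[OF assms(1), of A V] V by blast
  have "Pr (\<Sum>p\<in>B. \<bar>C p\<bar>) x" if "x \<in> (\<Union>p\<in>B. V p)" for x
  proof -
    obtain p where p: "p \<in> B" "x \<in> V p" using \<open>x \<in> (\<Union>p\<in>B. V p)\<close> by blast
    have "C p \<le> (\<Sum>p\<in>B. \<bar>C p\<bar>)"
      using member_le_sum[OF p(1), of "\<lambda>p. \<bar>C p\<bar>"] B(2) by force
    moreover have "Pr (C p) x" using V p B(1) by blast
    ultimately show ?thesis using mono by blast
  qed
  moreover have "open (\<Union>p\<in>B. V p)" using V B(1) by blast
  ultimately show ?thesis using B(3) by blast
qed

lemma eventually_bounded_nhds: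
  fixes f :: "'a::t2_space \<Rightarrow> real"
  assumes "isCont f p"
  shows "eventually (\<lambda>x. \<bar>f x\<bar> \<le> \<bar>f p\<bar> + 1) (nhds p)"
proof -
  have "(f \<longlongrightarrow> f p) (nhds p)" using assms by (simp add: isCont_def tendsto_nhds_iff)
  then have "((\<lambda>x. \<bar>f x\<bar>) \<longlongrightarrow> \<bar>f p\<bar>) (nhds p)" by (rule tendsto_rabs)
  then have "eventually (\<lambda>x. \<bar>f x\<bar> < \<bar>f p\<bar> + 1) (nhds p)" by (rule order_tendstoD) simp
  then show ?thesis by eventually_elim simp
qed

lemma isCont_eventually_gt:
  fixes f :: "'a::t2_space \<Rightarrow> real"
  assumes "isCont f p" "f p > c"
  shows "eventually (\<lambda>x. f x > c) (nhds p)"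
  using assms order_tendstoD(1)[of f "f p" "nhds p" c] by (simp add: isCont_def tendsto_nhds_iff)

text \<open>Both \<open>g + (f - c t)\<close> and \<open>g - (f - c t)\<close> are nondecreasing
  along the arc; \<open>e\<close> is the sign.\<close>

lemma arc_comparison:
  fixes \<gamma> :: "real \<Rightarrow> 'a::real_normed_vector" and f g :: "'a \<Rightarrow> real"
  assumes t: "t \<in> {0..\<tau>}"
    and \<gamma>: "\<And>t. t \<in> {0..\<tau>} \<Longrightarrow> (\<gamma> has_vector_derivative X (\<gamma> t)) (at t within {0..\<tau>})"
    and f: "\<And>t. t \<in> {0..\<tau>} \<Longrightarrow> (f has_derivative f' (\<gamma> t)) (at (\<gamma> t))"
    and g: "\<And>t. t \<in> {0..\<tau>} \<Longrightarrow> (g has_derivative g' (\<gamma> t)) (at (\<gamma> t))"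
    and le: "\<And>t. t \<in> {0..\<tau>} \<Longrightarrow> \<bar>f' (\<gamma> t) (X (\<gamma> t)) - c\<bar> \<le> g' (\<gamma> t) (X (\<gamma> t))"
  shows "\<bar>f (\<gamma> t) - f (\<gamma> 0) - c * t\<bar> \<le> g (\<gamma> t) - g (\<gamma> 0)"
proof -
  have d: "((\<lambda>t. g (\<gamma> t) + e * (f (\<gamma> t) - c * t)) has_vector_derivative
      g' (\<gamma> s) (X (\<gamma> s)) + e * (f' (\<gamma> s) (X (\<gamma> s)) - c)) (at s within {0..\<tau>})" if "s \<in> {0..\<tau>}" for s e
  proof -
    have ch: "((\<lambda>t. h (\<gamma> t)) has_real_derivative h' (X (\<gamma> s))) (at s within {0..\<tau>})"
      if h: "(h has_derivative h') (at (\<gamma> s))" for h h'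
      using vector_derivative_diff_chain_within[OF \<gamma>[OF \<open>s \<in> {0..\<tau>}\<close>] has_derivative_at_withinI[OF h]]
      by (simp add: o_def has_real_derivative_iff_has_vector_derivative)
    have "((\<lambda>t. g (\<gamma> t) + e * (f (\<gamma> t) - c * t)) has_real_derivative
        g' (\<gamma> s) (X (\<gamma> s)) + e * (f' (\<gamma> s) (X (\<gamma> s)) - c)) (at s within {0..\<tau>})"
      using ch[OF f[OF that]] ch[OF g[OF that]] by (auto intro!: derivative_eq_intros)
    then show ?thesis by (simp add: has_real_derivative_iff_has_vector_derivative)
  qed
  have mono: "g (\<gamma> 0) + e * f (\<gamma> 0) \<le> g (\<gamma> t) + e * (f (\<gamma> t) - c * t)" if e: "\<bar>e\<bar> = 1" for e
  proof -
    have "g (\<gamma> 0) + e * (f (\<gamma> 0) - c * 0) \<le> g (\<gamma> t) + e * (f (\<gamma> t) - c * t)"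
    proof (rule DERIV_nonneg_imp_increasing_open[where f = "\<lambda>t. g (\<gamma> t) + e * (f (\<gamma> t) - c * t)"])
      show "0 \<le> t" using t by simp
      show "continuous_on {0..t} (\<lambda>t. g (\<gamma> t) + e * (f (\<gamma> t) - c * t))"
        by (rule continuous_on_subset[OF continuous_on_vector_derivative[OF d]]) (use t in auto)
      fix s assume s: "0 < s" "s < t"
      then have "s \<in> {0..\<tau>}" "at s within {0..\<tau>} = at s"
        using t by (auto intro!: at_within_interior)
      then have "((\<lambda>t. g (\<gamma> t) + e * (f (\<gamma> t) - c * t)) has_real_derivative
          g' (\<gamma> s) (X (\<gamma> s)) + e * (f' (\<gamma> s) (X (\<gamma> s)) - c)) (at s)"
        using d[of s e] by (simp add: has_real_derivative_iff_has_vector_derivative)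
      moreover have "0 \<le> g' (\<gamma> s) (X (\<gamma> s)) + e * (f' (\<gamma> s) (X (\<gamma> s)) - c)"
      proof -
        have "\<bar>e * (f' (\<gamma> s) (X (\<gamma> s)) - c)\<bar> \<le> g' (\<gamma> s) (X (\<gamma> s))"
          using le[OF \<open>s \<in> {0..\<tau>}\<close>] e by (simp add: abs_mult)
        then show ?thesis by linarith
      qed
      ultimately show "\<exists>y. ((\<lambda>t. g (\<gamma> t) + e * (f (\<gamma> t) - c * t)) has_real_derivative y) (at s) \<and> 0 \<le> y"
        by blast
    qed
    then show ?thesis by simp
  qed
  show ?thesis using mono[of 1] mono[of "-1"] by simp
qed

lemma frechet_pd:
  assumes "(f has_derivative f') (at z)"
  shows "f' v = fst v * pd1 f z + snd v * pd2 f z"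
proof -
  have l: "linear f'" using assms has_derivative_linear by blast
  have "f' v = f' (fst v *\<^sub>R (1, 0) + snd v *\<^sub>R (0, 1))" by simp
  also have "\<dots> = fst v * f' (1, 0) + snd v * f' (0, 1)"
    by (simp only: linear_add[OF l] linear_scale[OF l] real_scaleR_def)
  finally show ?thesis using pd_eqI[OF assms] by simp
qed

lemma saddle_op_frechet:
  assumes "(f has_derivative f') (at z)"
  shows "f' ((1 / d) *\<^sub>R (fst z * P1 z, snd z * P2 z)) = saddle_op P1 P2 0 0 f z / d"
  unfolding frechet_pd[OF assms] saddle_op_def by (simp add: algebra_simps add_divide_distrib)

text \<open>Factor \<open>x^k y^j = x^(k - lam j) (x^lam y)^j\<close>: flatness in \<open>x\<close>
  is traded for powers of the first integral, and the leftover exponent is nonnegative.\<close>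

lemma monomial_bound:
  fixes x y lam h C :: real
  assumes "0 < x" "x \<le> C" "0 < y" "x powr lam * y \<le> h" "real k \<ge> lam * real j"
  shows "x ^ k * y ^ j \<le> C powr (real k - lam * real j) * h ^ j"
proof -
  have "x ^ k * y ^ j = x powr (real k - lam * real j) * (x powr lam * y) ^ j"
  proof -
    have "(x powr lam) ^ j = x powr (lam * real j)"
      using assms(1) by (simp add: powr_power mult.commute)
    moreover have "x powr (real k - lam * real j) * x powr (lam * real j) = x ^ k"
      using assms(1) by (simp add: powr_realpow flip: powr_add)
    ultimately show ?thesis by (simp add: power_mult_distrib flip: mult.assoc)
  qed
  also have "\<dots> \<le> C powr (real k - lam * real j) * h ^ j"
    using assms by (intro mult_mono powr_mono2 power_mono) auto
  finally show ?thesis .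
qed

text \<open>The field without denominator differentiates \<open>x - y\<close> to
  \<open>x P1 - y P2\<close>. Away from the corner the term of the nonzero coordinate is positive on
  the axis and wins by continuity, whatever the sign of the other. At the corner the expression is
  0, so there both factors have to be bounded below separately.\<close>

lemma corner_drift:
  fixes P1 P2 :: "real \<times> real \<Rightarrow> real"
  assumes S: "open S" and P: "smooth_on S P1" "smooth_on S P2"
    and pos: "\<And>x. (x, 0) \<in> S \<Longrightarrow> P1 (x, 0) > 0" and neg: "\<And>y. (0, y) \<in> S \<Longrightarrow> P2 (0, y) < 0"
    and p: "p \<in> S" "fst p = 0 \<and> snd p \<ge> 0 \<or> snd p = 0 \<and> fst p \<ge> 0"
  shows "\<exists>C>0. eventually (\<lambda>z. fst z > 0 \<longrightarrow> snd z > 0 \<longrightarrow>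
    fst z + snd z \<le> C * (fst z * P1 z - snd z * P2 z)) (nhds p)"
proof -
  have c1: "isCont P1 p" and c2: "isCont P2 p"
    using smooth_on_isCont[OF P(1) p(1)] smooth_on_isCont[OF P(2) p(1)] by auto
  have main: ?thesis if "c > 0" and ev: "eventually (\<lambda>z. fst z > 0 \<longrightarrow> snd z > 0 \<longrightarrow>
      fst z * (P1 z - c) + snd z * (- P2 z - c) \<ge> 0) (nhds p)" for c
  proof (intro exI[of _ "1 / c"] conjI)
    show "eventually (\<lambda>z. fst z > 0 \<longrightarrow> snd z > 0 \<longrightarrow>
        fst z + snd z \<le> 1 / c * (fst z * P1 z - snd z * P2 z)) (nhds p)"
      using ev by eventually_elim (use \<open>c > 0\<close> in \<open>auto simp: field_simps\<close>)
  qed (use \<open>c > 0\<close> in auto)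
  have cf: "isCont (\<lambda>z. fst z * (P1 z - c) + snd z * (- P2 z - c)) p" for c
    using c1 c2 by (intro continuous_intros)
  obtain a b where ab: "p = (a, b)" by force
  consider "a = 0" "b = 0" | "a = 0" "b > 0" | "a > 0" "b = 0" using p(2) ab by force
  then show ?thesis
  proof cases
    case 1
    define c where "c = min (P1 p) (- P2 p) / 2"
    have c: "c > 0" "c < P1 p" "c < - P2 p"
      using pos[of 0] neg[of 0] p(1) 1 by (auto simp: c_def ab)
    have "isCont (\<lambda>z. - P2 z) p" using c2 by (intro continuous_intros)
    then have "eventually (\<lambda>z. P1 z > c \<and> - P2 z > c) (nhds p)"
      using isCont_eventually_gt[OF c1 c(2)] isCont_eventually_gt[where f = "\<lambda>z. - P2 z" and p = p and c = c] c(3)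
      by (intro eventually_conj) auto
    then show ?thesis
      by (intro main[OF c(1)]) (auto elim!: eventually_mono intro!: add_nonneg_nonneg mult_nonneg_nonneg)
  next
    case 2
    have "P2 p < 0" using neg p(1) 2 ab by simp
    then have "0 < fst p * (P1 p - (- P2 p / 2)) + snd p * (- P2 p - (- P2 p / 2))"
      using 2 ab by (simp add: field_simps mult_pos_neg)
    from isCont_eventually_gt[OF cf this] show ?thesis
      by (intro main[of "- P2 p / 2"]) (use \<open>P2 p < 0\<close> in \<open>auto elim!: eventually_mono\<close>)
  next
    case 3
    have "P1 p > 0" using pos p(1) 3 ab by simp
    then have "0 < fst p * (P1 p - P1 p / 2) + snd p * (- P2 p - P1 p / 2)"
      using 3 ab by (simp add: field_simps)
    from isCont_eventually_gt[OF cf this] show ?thesis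
      by (intro main[of "P1 p / 2"]) (use \<open>P1 p > 0\<close> in \<open>auto elim!: eventually_mono\<close>)
  qed
qed

text \<open>Near the corner path the function \<open>x - y\<close> increases along the orbits at a rate that dominates
  \<open>x + y\<close>.  Hence the integral of \<open>x\<close> along an arc is bounded, and no estimate of
  the transit time is needed.\<close>

theorem orbit_estimates:
  fixes P1 P2 qE rH qQ rG :: "real \<times> real \<Rightarrow> real" and n1 n2 K :: nat and lam :: real
  assumes S: "open S" and P: "smooth_on S P1" "smooth_on S P2"
    and pos: "\<And>x. (x, 0) \<in> S \<Longrightarrow> P1 (x, 0) > 0" and neg: "\<And>y. (0, y) \<in> S \<Longrightarrow> P2 (0, y) < 0"
    and lam: "lam > 0" and K: "real K \<ge> lam * real (n2 + 2) + 1"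
    and sm: "smooth_on S qE" "smooth_on S rH" "smooth_on S qQ" "smooth_on S rG"
    and H: "\<And>z. z \<in> S \<Longrightarrow> lam * P1 z + P2 z + saddle_op P1 P2 0 0 qE z = fst z ^ K * snd z ^ 2 * rH z"
    and G: "\<And>z. z \<in> S \<Longrightarrow> saddle_op P1 P2 (real n1) (real n2) qQ z = 1 + fst z ^ K * snd z ^ 2 * rG z"
    and path: "{0} \<times> {0..v} \<union> {0..u} \<times> {0} \<subseteq> S"
  defines "X \<equiv> \<lambda>z. (1 / (fst z ^ n1 * snd z ^ n2)) *\<^sub>R (fst z * P1 z, snd z * P2 z)"
  defines "lH \<equiv> \<lambda>z. lam * ln (fst z) + ln (snd z) + qE z"
  defines "GG \<equiv> \<lambda>z. fst z ^ n1 * (snd z ^ n2 * qQ z)"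
  shows "\<exists>V C. open V \<and> {0} \<times> {0..v} \<union> {0..u} \<times> {0} \<subseteq> V \<and>
    (\<forall>p q \<tau>. orbit_arc X (V \<inter> {0<..} \<times> {0<..}) p \<tau> q \<longrightarrow>
      \<bar>lH q - lH p\<bar> \<le> C * exp (lH p) ^ 2 \<and> \<bar>GG q - GG p - \<tau>\<bar> \<le> C * exp (lH p) ^ (n2 + 2))"
proof -
  let ?path = "{0} \<times> {0..v} \<union> {0..u} \<times> {0}"
  define Pr where "Pr C z \<longleftrightarrow> C > 0 \<and> z \<in> S \<and> \<bar>rH z\<bar> \<le> C \<and> \<bar>rG z\<bar> \<le> C \<and> \<bar>qE z\<bar> \<le> C \<and> \<bar>fst z\<bar> \<le> C \<and> \<bar>snd z\<bar> \<le> C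
    \<and> (fst z > 0 \<longrightarrow> snd z > 0 \<longrightarrow> fst z + snd z \<le> C * (fst z * P1 z - snd z * P2 z))" for C z
  have mono: "Pr C' z" if "Pr C z" "C \<le> C'" for C C' z
  proof -
    have "fst z + snd z \<le> C' * (fst z * P1 z - snd z * P2 z)" if "fst z > 0" "snd z > 0"
    proof -
      have *: "fst z + snd z \<le> C * (fst z * P1 z - snd z * P2 z)" "C > 0"
        using \<open>Pr C z\<close> that by (auto simp: Pr_def)
      then have "0 < C * (fst z * P1 z - snd z * P2 z)" using that by linarith
      then have "0 \<le> fst z * P1 z - snd z * P2 z" using *(2) by (simp add: zero_less_mult_iff)
      then have "C * (fst z * P1 z - snd z * P2 z) \<le> C' * (fst z * P1 z - snd z * P2 z)"
        using \<open>C \<le> C'\<close> by (intro mult_right_mono)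
      then show ?thesis using * by linarith
    qed
    then show ?thesis using that by (auto simp: Pr_def)
  qed
  have comp: "compact ?path"
    by (intro compact_Un compact_Times) auto
  have loc: "\<exists>C. eventually (Pr C) (nhds p)" if "p \<in> ?path" for p
  proof -
    have pS: "p \<in> S" and pc: "fst p = 0 \<and> snd p \<ge> 0 \<or> snd p = 0 \<and> fst p \<ge> 0"
      using that path by auto
    obtain C0 where C0: "C0 > 0" "eventually (\<lambda>z. fst z > 0 \<longrightarrow> snd z > 0 \<longrightarrow>
        fst z + snd z \<le> C0 * (fst z * P1 z - snd z * P2 z)) (nhds p)"
      using corner_drift[OF S P pos neg pS pc] by blast
    have b: "\<exists>B>0. eventually (\<lambda>z. \<bar>f z\<bar> \<le> B) (nhds p)" if "smooth_on S f" for f :: "real \<times> real \<Rightarrow> real"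
      using eventually_bounded_nhds[OF smooth_on_isCont[OF that pS]]
      by (intro exI[of _ "\<bar>f p\<bar> + 1"]) auto
    have sf: "smooth_on S (\<lambda>z. fst z)" "smooth_on S (\<lambda>z. snd z)" by (intro smooth_intros S)+
    obtain B1 where B1: "B1 > 0" "eventually (\<lambda>z. \<bar>rH z\<bar> \<le> B1) (nhds p)" using b[OF sm(2)] by blast
    obtain B2 where B2: "B2 > 0" "eventually (\<lambda>z. \<bar>rG z\<bar> \<le> B2) (nhds p)" using b[OF sm(4)] by blast
    obtain B3 where B3: "B3 > 0" "eventually (\<lambda>z. \<bar>qE z\<bar> \<le> B3) (nhds p)" using b[OF sm(1)] by blast
    obtain B4 where B4: "B4 > 0" "eventually (\<lambda>z. \<bar>fst z\<bar> \<le> B4) (nhds p)" using b[OF sf(1)] by blast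
    obtain B5 where B5: "B5 > 0" "eventually (\<lambda>z. \<bar>snd z\<bar> \<le> B5) (nhds p)" using b[OF sf(2)] by blast
    define C where "C = C0 + B1 + B2 + B3 + B4 + B5"
    have C: "C0 \<le> C" "B1 \<le> C" "B2 \<le> C" "B3 \<le> C" "B4 \<le> C" "B5 \<le> C"
      using C0(1) B1(1) B2(1) B3(1) B4(1) B5(1) by (simp_all add: C_def)
    have "eventually (Pr C) (nhds p)"
      using B1(2) B2(2) B3(2) B4(2) B5(2) C0(2) eventually_nhds_in_open[OF S pS]
    proof eventually_elim
      case (elim z)
      have "fst z + snd z \<le> C * (fst z * P1 z - snd z * P2 z)" if z: "fst z > 0" "snd z > 0"
      proof -
        have *: "fst z + snd z \<le> C0 * (fst z * P1 z - snd z * P2 z)" using elim z by auto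
        then have "0 < C0 * (fst z * P1 z - snd z * P2 z)" using z by linarith
        then have "0 \<le> fst z * P1 z - snd z * P2 z" using C0(1) by (simp add: zero_less_mult_iff)
        then have "C0 * (fst z * P1 z - snd z * P2 z) \<le> C * (fst z * P1 z - snd z * P2 z)"
          by (intro mult_right_mono C)
        then show ?thesis using * by linarith
      qed
      moreover have "C > 0" using C0(1) C(1) by linarith
      moreover have "\<bar>rH z\<bar> \<le> C" "\<bar>rG z\<bar> \<le> C" "\<bar>qE z\<bar> \<le> C" "\<bar>fst z\<bar> \<le> C" "\<bar>snd z\<bar> \<le> C"
        by (fact order_trans[OF elim(1) C(2)] order_trans[OF elim(2) C(3)] order_trans[OF elim(3) C(4)]
            order_trans[OF elim(4) C(5)] order_trans[OF elim(5) C(6)])+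
      ultimately show ?case using elim(7) unfolding Pr_def by blast
    qed
    then show ?thesis by blast
  qed
  have "\<exists>V C. open V \<and> ?path \<subseteq> V \<and> (\<forall>z\<in>V. Pr C z)"
    by (rule compact_uniform_neighbourhood[OF comp]) (fact mono, fact loc)
  then obtain V C where V: "open V" "?path \<subseteq> V" "\<And>z. z \<in> V \<Longrightarrow> Pr C z"
    by blast
  define Q where "Q = V \<inter> {0<..} \<times> {0<..}"
  have Q: "fst z > 0" "snd z > 0" "z \<in> S" "\<bar>rH z\<bar> \<le> C" "\<bar>rG z\<bar> \<le> C" "\<bar>qE z\<bar> \<le> C" "fst z \<le> C" "snd z \<le> C"
      "fst z + snd z \<le> C * (fst z * P1 z - snd z * P2 z)" "C > 0" if "z \<in> Q" for z
    using V(3)[of z] that by (auto simp: Q_def Pr_def mem_Times_iff)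
  define d where "d z = fst z ^ n1 * snd z ^ n2" for z :: "real \<times> real"
  have dpos: "d z > 0" if "z \<in> Q" for z using Q(1,2)[OF that] by (simp add: d_def)
  have X: "X z = (1 / d z) *\<^sub>R (fst z * P1 z, snd z * P2 z)" for z by (simp add: X_def d_def)
  have dG: "(GG has_derivative frechet_derivative GG (at z)) (at z)" if "z \<in> Q" for z
    by (rule smooth_on_has_derivative[of S]) (use Q(3)[OF that] in \<open>auto simp: GG_def intro!: smooth_intros S sm\<close>)
  have GX: "frechet_derivative GG (at z) (X z) - 1 = fst z ^ K * snd z ^ 2 * rG z" if "z \<in> Q" for z
  proof -
    note z = Q(3)[OF that]
    have s: "smooth_on S (\<lambda>z. snd z ^ n2 * qQ z)" by (intro smooth_intros S sm)
    have "saddle_op P1 P2 0 0 GG z = d z * saddle_op P1 P2 (real n1) (real n2) qQ z"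
      unfolding GG_def saddle_op_fst_power[OF S s z] saddle_op_snd_power[OF S sm(3) z] by (simp add: d_def)
    then show ?thesis
      unfolding X saddle_op_frechet[OF dG[OF that]] G[OF z] using dpos[OF that] by simp
  qed
  define lH' where "lH' z v = lam * (fst v / fst z) + snd v / snd z + frechet_derivative qE (at z) v" for z v
  have dH: "(lH has_derivative lH' z) (at z)" if "z \<in> Q" for z
  proof -
    have 1: "((\<lambda>z. ln (fst z)) has_derivative (\<lambda>v. fst v / fst z)) (at z)"
      using has_derivative_ln[OF Q(1)[OF that] has_derivative_fst[OF has_derivative_ident]]
      by (simp add: divide_inverse mult.commute)
    have 2: "((\<lambda>z. ln (snd z)) has_derivative (\<lambda>v. snd v / snd z)) (at z)"
      using has_derivative_ln[OF Q(2)[OF that] has_derivative_snd[OF has_derivative_ident]]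
      by (simp add: divide_inverse mult.commute)
    show ?thesis
      unfolding lH_def lH'_def[abs_def]
      by (intro has_derivative_add has_derivative_mult_right 1 2 smooth_on_has_derivative[OF sm(1) Q(3)[OF that]])
  qed
  have HX: "lH' z (X z) = fst z ^ K * snd z ^ 2 * rH z / d z" if "z \<in> Q" for z
  proof -
    have "lH' z (X z) = (lam * P1 z + P2 z + saddle_op P1 P2 0 0 qE z) / d z"
      unfolding lH'_def X saddle_op_frechet[OF smooth_on_has_derivative[OF sm(1) Q(3)[OF that]]]
      using Q(1,2)[OF that] by (simp add: add_divide_distrib)
    then show ?thesis unfolding H[OF Q(3)[OF that]] .
  qed
  have dg: "((\<lambda>z. M * (fst z - snd z)) has_derivative (\<lambda>v. M * (fst v - snd v))) (at z)" for M :: real and z :: "real \<times> real"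
    by (auto intro!: derivative_eq_intros)
  \<comment> \<open>A defect of at most \<open>M / C * x\<close>, divided by the same denominator
    \<open>d\<close>, is dominated by the derivative of \<open>M * (x - y)\<close> along
    \<open>X\<close>; the denominator cancels from the comparison.\<close>
  have gX: "M * (fst (X z) - snd (X z)) \<ge> B / d z" if "z \<in> Q" "B \<le> M / C * fst z" "M \<ge> 0" for M B z
  proof -
    note q = Q[OF that(1)]
    have "B \<le> M / C * (fst z + snd z)"
      using that(2,3) q by (smt (verit) divide_nonneg_pos mult_left_mono)
    also have "\<dots> \<le> M / C * (C * (fst z * P1 z - snd z * P2 z))"
      using q that(3) by (intro mult_left_mono) auto
    also have "\<dots> = M * (fst z * P1 z - snd z * P2 z)" using q by simp
    finally have "B / d z \<le> M * (fst z * P1 z - snd z * P2 z) / d z"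
      using dpos[OF that(1)] by (intro divide_right_mono) auto
    then show ?thesis unfolding X by (simp add: diff_divide_distrib right_diff_distrib)
  qed
  have "lam * real (n2 + 2) > 0" using lam by simp
  then have "K \<ge> 1" using K by (cases K) auto
  \<comment> \<open>One factor \<open>x\<close> of \<open>x^K\<close> is reserved for the drift
    estimate; the remaining \<open>K' \<ge> lam * (n2 + 2)\<close> is what
    \<open>monomial_bound\<close> consumes. This explains the \<open>+ 1\<close> in the assumption
    on \<open>K\<close>.\<close>
  then obtain K' where K': "K = Suc K'" by (cases K) auto
  have Cpos: "C > 0" if "z \<in> Q" for z using Q(10)[OF that] .
  \<comment> \<open>Two rounds: the crude \<open>M1\<close> only bounds the change of
    \<open>lH\<close> along the arc, which yields \<open>C2\<close> with
    \<open>x^lam y \<le> C2 * exp (lH p)\<close>. With this bound \<open>M2\<close> and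
    \<open>M3\<close> gain the powers of \<open>exp (lH p)\<close>. The factor \<open>4 * C\<close>
    bounds the variation of \<open>x - y\<close>, as the coordinates lie between 0 and
    \<open>C\<close>.\<close>
  define M1 where "M1 = C * (C ^ K' * C ^ 2 * C)"
  define C2 where "C2 = exp (4 * C * M1 + C)"
  define M2 where "M2 = C * (C powr (real K' - lam * 2) * C2 ^ 2 * C)"
  define M3 where "M3 = C * (C powr (real (n1 + K') - lam * real (n2 + 2)) * C2 ^ (n2 + 2) * C)"
  define C4 where "C4 = 4 * C * (M2 + M3)"
  have est: "\<bar>lH q - lH p\<bar> \<le> C4 * exp (lH p) ^ 2 \<and> \<bar>GG q - GG p - \<tau>\<bar> \<le> C4 * exp (lH p) ^ (n2 + 2)"
    if arc: "orbit_arc X Q p \<tau> q" for p q \<tau>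
  proof -
    obtain \<gamma> where \<gamma>: "\<gamma> 0 = p" "\<gamma> \<tau> = q" "\<tau> > 0" "\<And>t. t \<in> {0..\<tau>} \<Longrightarrow> \<gamma> t \<in> Q"
      "\<And>t. t \<in> {0..\<tau>} \<Longrightarrow> (\<gamma> has_vector_derivative X (\<gamma> t)) (at t within {0..\<tau>})"
      using arc unfolding orbit_arc_def by blast
    have pQ: "p \<in> Q" using \<gamma>(4)[of 0] \<gamma>(1,3) by simp
    have C: "C > 0" by (rule Cpos[OF pQ])
    have Mpos: "M1 \<ge> 0" "M2 \<ge> 0" "M3 \<ge> 0" using C by (auto simp: M1_def M2_def M3_def C2_def)
    have range: "M * (fst (\<gamma> t) - snd (\<gamma> t)) - M * (fst (\<gamma> 0) - snd (\<gamma> 0)) \<le> 4 * C * M"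
      if "t \<in> {0..\<tau>}" "M \<ge> 0" for t M
    proof -
      have "fst (\<gamma> t) - snd (\<gamma> t) - (fst (\<gamma> 0) - snd (\<gamma> 0)) \<le> 4 * C"
        using Q(1,2,7,8)[OF \<gamma>(4)[OF that(1)]] Q(1,2,7,8)[OF pQ] C unfolding \<gamma>(1) by linarith
      from mult_left_mono[OF this that(2)] show ?thesis by (simp add: algebra_simps)
    qed
    have "\<bar>lH (\<gamma> t) - lH p\<bar> \<le> 4 * C * M1" if "t \<in> {0..\<tau>}" for t
    proof -
      have "\<bar>lH (\<gamma> t) - lH (\<gamma> 0) - 0 * t\<bar> \<le> M1 * (fst (\<gamma> t) - snd (\<gamma> t)) - M1 * (fst (\<gamma> 0) - snd (\<gamma> 0))"
      proof (rule arc_comparison[where X = X, OF that \<gamma>(5) dH[OF \<gamma>(4)] dg])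
        fix s assume s: "s \<in> {0..\<tau>}"
        note q = Q[OF \<gamma>(4)[OF s]]
        have "\<bar>fst (\<gamma> s) ^ K * snd (\<gamma> s) ^ 2 * rH (\<gamma> s)\<bar> = fst (\<gamma> s) ^ K' * snd (\<gamma> s) ^ 2 * \<bar>rH (\<gamma> s)\<bar> * fst (\<gamma> s)"
          using q by (simp add: K' abs_mult)
        also have "\<dots> \<le> C ^ K' * C ^ 2 * C * fst (\<gamma> s)"
          using q by (intro mult_right_mono mult_mono power_mono) auto
        also have "\<dots> = M1 / C * fst (\<gamma> s)" using C by (simp add: M1_def)
        finally show "\<bar>lH' (\<gamma> s) (X (\<gamma> s)) - 0\<bar> \<le> M1 * (fst (X (\<gamma> s)) - snd (X (\<gamma> s)))"
          using gX[OF \<gamma>(4)[OF s] _ Mpos(1)] dpos[OF \<gamma>(4)[OF s]] unfolding HX[OF \<gamma>(4)[OF s]] by simp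
      qed auto
      then show ?thesis using range[OF that Mpos(1)] \<gamma>(1) by simp
    qed
    then have h: "fst (\<gamma> t) powr lam * snd (\<gamma> t) \<le> C2 * exp (lH p)" if "t \<in> {0..\<tau>}" for t
    proof -
      note q = Q[OF \<gamma>(4)[OF that]]
      have "fst (\<gamma> t) powr lam * snd (\<gamma> t) = exp (lH (\<gamma> t) - qE (\<gamma> t))"
        using q by (simp add: lH_def exp_add powr_def)
      also have "\<dots> \<le> exp (4 * C * M1 + C + lH p)"
        using \<open>\<And>t. t \<in> {0..\<tau>} \<Longrightarrow> \<bar>lH (\<gamma> t) - lH p\<bar> \<le> 4 * C * M1\<close>[OF that] q(6) by simp
      finally show ?thesis by (simp add: C2_def exp_add)
    qed
    have \<tau>: "\<tau> \<in> {0..\<tau>}" using \<gamma>(3) by simp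
    have e1: "\<bar>lH (\<gamma> \<tau>) - lH (\<gamma> 0) - 0 * \<tau>\<bar> \<le> M2 * exp (lH p) ^ 2 * (fst (\<gamma> \<tau>) - snd (\<gamma> \<tau>))
        - M2 * exp (lH p) ^ 2 * (fst (\<gamma> 0) - snd (\<gamma> 0))"
    proof (rule arc_comparison[where X = X, OF \<tau> \<gamma>(5) dH[OF \<gamma>(4)] dg])
      fix s assume s: "s \<in> {0..\<tau>}"
      note q = Q[OF \<gamma>(4)[OF s]]
      have "lam * 2 \<le> lam * real (n2 + 2)" using lam by simp
      then have "real K' \<ge> lam * real 2" using K by (simp add: K')
      from monomial_bound[OF q(1,7,2) h[OF s] this]
      have mb: "fst (\<gamma> s) ^ K' * snd (\<gamma> s) ^ 2 \<le> C powr (real K' - lam * 2) * (C2 * exp (lH p)) ^ 2" by simp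
      have "fst (\<gamma> s) ^ K' * snd (\<gamma> s) ^ 2 * \<bar>rH (\<gamma> s)\<bar> * fst (\<gamma> s)
          \<le> C powr (real K' - lam * 2) * (C2 * exp (lH p)) ^ 2 * C * fst (\<gamma> s)"
        by (intro mult_right_mono[OF mult_mono[OF mb q(4)]]) (use q in auto)
      also have "\<dots> = M2 * exp (lH p) ^ 2 / C * fst (\<gamma> s)" using C by (simp add: M2_def power_mult_distrib)
      finally have "\<bar>fst (\<gamma> s) ^ K * snd (\<gamma> s) ^ 2 * rH (\<gamma> s)\<bar> \<le> M2 * exp (lH p) ^ 2 / C * fst (\<gamma> s)"
        using q by (simp add: K' abs_mult mult.assoc mult.commute mult.left_commute)
      then show "\<bar>lH' (\<gamma> s) (X (\<gamma> s)) - 0\<bar> \<le> M2 * exp (lH p) ^ 2 * (fst (X (\<gamma> s)) - snd (X (\<gamma> s)))"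
        using gX[OF \<gamma>(4)[OF s], of _ "M2 * exp (lH p) ^ 2"] Mpos dpos[OF \<gamma>(4)[OF s]]
        unfolding HX[OF \<gamma>(4)[OF s]] by simp
    qed auto
    have e2: "\<bar>GG (\<gamma> \<tau>) - GG (\<gamma> 0) - 1 * \<tau>\<bar> \<le> M3 * exp (lH p) ^ (n2 + 2) * (fst (\<gamma> \<tau>) - snd (\<gamma> \<tau>))
        - M3 * exp (lH p) ^ (n2 + 2) * (fst (\<gamma> 0) - snd (\<gamma> 0))"
    proof (rule arc_comparison[where X = X, OF \<tau> \<gamma>(5) dG[OF \<gamma>(4)] dg])
      fix s assume s: "s \<in> {0..\<tau>}"
      note q = Q[OF \<gamma>(4)[OF s]]
      have "real (n1 + K') \<ge> lam * real (n2 + 2)" using K by (simp add: K')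
      note mb = monomial_bound[OF q(1,7,2) h[OF s] this]
      have "fst (\<gamma> s) ^ (n1 + K') * snd (\<gamma> s) ^ (n2 + 2) * \<bar>rG (\<gamma> s)\<bar> * fst (\<gamma> s)
          \<le> C powr (real (n1 + K') - lam * real (n2 + 2)) * (C2 * exp (lH p)) ^ (n2 + 2) * C * fst (\<gamma> s)"
        by (intro mult_right_mono[OF mult_mono[OF mb q(5)]]) (use q in \<open>auto simp: C2_def\<close>)
      also have "\<dots> = M3 * exp (lH p) ^ (n2 + 2) / C * fst (\<gamma> s)"
        using C by (simp add: M3_def power_mult_distrib del: power_Suc power_Suc2)
      finally have "\<bar>d (\<gamma> s) * (fst (\<gamma> s) ^ K * snd (\<gamma> s) ^ 2 * rG (\<gamma> s))\<bar> \<le> M3 * exp (lH p) ^ (n2 + 2) / C * fst (\<gamma> s)"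
        using q by (simp add: K' abs_mult d_def power_add power2_eq_square mult.assoc mult.commute mult.left_commute)
      from gX[OF \<gamma>(4)[OF s] this]
      have "\<bar>d (\<gamma> s) * (fst (\<gamma> s) ^ K * snd (\<gamma> s) ^ 2 * rG (\<gamma> s))\<bar> / d (\<gamma> s)
          \<le> M3 * exp (lH p) ^ (n2 + 2) * (fst (X (\<gamma> s)) - snd (X (\<gamma> s)))" using Mpos by simp
      then show "\<bar>frechet_derivative GG (at (\<gamma> s)) (X (\<gamma> s)) - 1\<bar>
          \<le> M3 * exp (lH p) ^ (n2 + 2) * (fst (X (\<gamma> s)) - snd (X (\<gamma> s)))"
        using dpos[OF \<gamma>(4)[OF s]] unfolding GX[OF \<gamma>(4)[OF s]] by (simp add: abs_mult)
    qed auto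
    have "4 * C * (M2 * exp (lH p) ^ 2) \<le> C4 * exp (lH p) ^ 2"
      "4 * C * (M3 * exp (lH p) ^ (n2 + 2)) \<le> C4 * exp (lH p) ^ (n2 + 2)"
      using C Mpos by (auto simp: C4_def algebra_simps simp del: power_Suc)
    moreover have "0 \<le> M2 * exp (lH p) ^ 2" "0 \<le> M3 * exp (lH p) ^ (n2 + 2)" using Mpos by auto
    ultimately show ?thesis
      using e1 e2 range[OF \<tau>, of "M2 * exp (lH p) ^ 2"] range[OF \<tau>, of "M3 * exp (lH p) ^ (n2 + 2)"]
      unfolding \<gamma>(1,2) by linarith
  qed
  show ?thesis
    using V(1,2) est unfolding Q_def by blast
qed

section \<open>Comparison of asymptotic expansions\<close>

text \<open>Divided by the power with the smallest exponent whose coefficient is nonzero, the sum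
  tends to that coefficient; but this exponent is still below \<open>L\<close>, so the bound forces
  the limit 0.\<close>

lemma powr_sum_unique:
  fixes e c :: "'i \<Rightarrow> real"
  assumes "finite A" "inj_on e A"
    and O: "(\<lambda>s. \<Sum>p\<in>A. c p * s powr e p) \<in> O[at_right 0](\<lambda>s. s powr L)"
    and p: "p \<in> A" "e p < L"
  shows "c p = 0"
proof (rule ccontr)
  assume "c p \<noteq> 0"
  define A' where "A' = {q \<in> A. c q \<noteq> 0}"
  have A': "finite A'" "A' \<noteq> {}" using assms(1) p \<open>c p \<noteq> 0\<close> by (auto simp: A'_def)
  then obtain q where q: "q \<in> A'" "\<And>r. r \<in> A' \<Longrightarrow> e q \<le> e r"
    using ex_min_if_finite[of "e ` A'"] by (metis (no_types, lifting) finite_imageI image_iff image_is_empty not_le)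
  have eq: "e q < L" using q(2)[of p] p \<open>c p \<noteq> 0\<close> by (force simp: A'_def)
  have lim: "((\<lambda>s. \<Sum>r\<in>A'. c r * s powr (e r - e q)) \<longlongrightarrow> (\<Sum>r\<in>A'. if r = q then c r else 0)) (at_right 0)"
  proof (rule tendsto_sum)
    fix r assume r: "r \<in> A'"
    show "((\<lambda>s. c r * s powr (e r - e q)) \<longlongrightarrow> (if r = q then c r else 0)) (at_right 0)"
    proof (cases "r = q")
      case True
      have "eventually (\<lambda>s. c r * s powr (e r - e q) = (if r = q then c r else 0)) (at_right 0)"
        using eventually_at_right_less[of 0] by eventually_elim (simp add: True)
      then show ?thesis by (rule tendsto_eventually)
    next
      case False
      have "e r \<noteq> e q" using False assms(2) r q(1) by (auto simp: A'_def inj_on_def)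
      then have "e r - e q > 0" using q(2)[OF r] by simp
      then have "((\<lambda>s. s powr (e r - e q)) \<longlongrightarrow> 0) (at_right 0)" by real_asymp
      then show ?thesis using False tendsto_mult_right_zero[of _ _ "c r"] by simp
    qed
  qed
  have sumq: "(\<Sum>r\<in>A'. if r = q then c r else 0) = c q"
    using A'(1) q(1) by (simp add: sum.delta)
  have "(\<lambda>s. (\<Sum>p\<in>A. c p * s powr e p) * s powr (- e q)) \<in> O[at_right 0](\<lambda>s. s powr L * s powr (- e q))"
    by (rule landau_o.big.mult[OF O]) simp
  also have "(\<lambda>s. s powr L * s powr (- e q)) = (\<lambda>s. s powr (L - e q))"
    by (simp add: fun_eq_iff flip: powr_add)
  also have "(\<lambda>s. s powr (L - e q)) \<in> o[at_right 0](\<lambda>_. 1 :: real)"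
  proof -
    have "L - e q > 0" using eq by simp
    then have "((\<lambda>s. s powr (L - e q)) \<longlongrightarrow> 0) (at_right 0)" by real_asymp
    then show ?thesis by (intro smalloI_tendsto) auto
  qed
  finally have "((\<lambda>s. (\<Sum>p\<in>A. c p * s powr e p) * s powr (- e q)) \<longlongrightarrow> 0) (at_right 0)"
    by (auto dest: smalloD_tendsto)
  moreover have "(\<Sum>p\<in>A. c p * s powr e p) * s powr (- e q) = (\<Sum>r\<in>A'. c r * s powr (e r - e q))" for s
  proof -
    have "(\<Sum>p\<in>A. c p * s powr e p) = (\<Sum>p\<in>A'. c p * s powr e p)"
      unfolding A'_def using assms(1) by (intro sum.mono_neutral_right) auto
    then show ?thesis by (simp add: sum_distrib_right mult.assoc flip: powr_add)
  qed
  ultimately have "((\<lambda>s. \<Sum>r\<in>A'. c r * s powr (e r - e q)) \<longlongrightarrow> 0) (at_right 0)" by simp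
  from tendsto_unique[OF _ lim this] have "c q = 0" using sumq by simp
  then show False using q(1) by (simp add: A'_def)
qed

lemma taylor_1d:
  fixes f :: "real \<Rightarrow> real"
  assumes "open I" "is_interval I" "0 \<in> I" "smooth_on I f"
  shows "\<exists>a R. smooth_on I R \<and> a 0 = f 0 \<and> (\<forall>x\<in>I. f x = (\<Sum>k<N. a k * x ^ k) + x ^ N * R x)"
proof -
  let ?S = "I \<times> (UNIV :: real set)"
  have S: "radial_open ?S" by (rule radial_open_interval_Times_UNIV[OF assms(1-3)])
  have f: "smooth_on ?S (\<lambda>x. f (fst x))"
    by (rule smooth_on_compose[OF radial_open_open[OF S] assms(1) _ assms(4)])
      (auto intro!: smooth_intros radial_open_open[OF S])
  have "smooth_on I (\<lambda>x. (hadamard ^^ N) (\<lambda>x. f (fst x)) (x, 0::real))"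
    by (rule smooth_on_slice[OF assms(1) radial_open_open[OF S] _ smooth_on_hadamard_iter[OF S f]]) auto
  moreover have "f x = (\<Sum>k<N. tcoef k (\<lambda>x. f (fst x)) (0::real) * x ^ k)
      + x ^ N * (hadamard ^^ N) (\<lambda>x. f (fst x)) (x, 0::real)" if "x \<in> I" for x
    using taylor_radial[OF S f, of x 0 N] that by simp
  moreover have "tcoef 0 (\<lambda>x. f (fst x)) (0::real) = f 0" by (simp add: tcoef_def)
  ultimately show ?thesis
    by (intro exI[of _ "\<lambda>k. tcoef k (\<lambda>x. f (fst x)) (0::real)"]
        exI[of _ "\<lambda>x. (hadamard ^^ N) (\<lambda>x. f (fst x)) (x, 0::real)"] conjI ballI)
qed

lemma taylor_1:
  fixes f :: "real \<Rightarrow> real"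
  assumes "open I" "is_interval I" "0 \<in> I" "smooth_on I f"
  shows "\<exists>R. smooth_on I R \<and> R 0 = deriv f 0 \<and> (\<forall>x\<in>I. f x = f 0 + x * R x)"
proof -
  obtain a R where R: "smooth_on I R" "a 0 = f 0" "\<And>x. x \<in> I \<Longrightarrow> f x = (\<Sum>k<1. a k * x ^ k) + x ^ 1 * R x"
    using taylor_1d[OF assms, of 1] by blast
  have eq: "f x = f 0 + x * R x" if "x \<in> I" for x
    using R(3)[OF that] R(2) by simp
  have "((\<lambda>x. f 0 + x * R x) has_real_derivative R 0) (at 0)"
    using smooth_on_has_real_derivative[OF R(1) assms(3)] by (auto intro!: derivative_eq_intros)
  then have "(f has_real_derivative R 0) (at 0)"
    by (rule has_field_derivative_transform_within_open[OF _ assms(1,3)]) (rule eq[symmetric])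
  then have "R 0 = deriv f 0" by (simp add: DERIV_imp_deriv)
  then show ?thesis using R(1) eq by blast
qed

lemma bigo_compose_tendsto_0:
  fixes R :: "real \<Rightarrow> real"
  assumes "open I" "0 \<in> I" "smooth_on I R" "(f \<longlongrightarrow> 0) F"
  shows "(\<lambda>x. R (f x)) \<in> O[F](\<lambda>_. 1)"
proof -
  have "((\<lambda>x. R (f x)) \<longlongrightarrow> R 0) F"
    using isCont_tendsto_compose[OF smooth_on_isCont[OF assms(3,2)] assms(4)] .
  then show ?thesis by (intro bigoI_tendsto[of _ _ "R 0"]) auto
qed

lemma bigo_powr_mono: "a \<le> b \<Longrightarrow> (\<lambda>s. s powr b) \<in> O[at_right 0](\<lambda>s::real. s powr a)"
proof (rule bigoI[of _ 1])
  assume "a \<le> b"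
  have "eventually (\<lambda>s::real. s \<in> {0<..<1}) (at_right 0)"
    by (rule eventually_at_right_real) simp
  then show "eventually (\<lambda>s::real. norm (s powr b) \<le> 1 * norm (s powr a)) (at_right 0)"
    by eventually_elim (use \<open>a \<le> b\<close> in \<open>auto intro: powr_mono'\<close>)
qed

lemma bigo_powr_mult:
  assumes "f \<in> O[at_right 0](\<lambda>s. s powr a)" "g \<in> O[at_right 0](\<lambda>s. s powr b)" "c \<le> a + b"
  shows "(\<lambda>s. f s * g s) \<in> O[at_right 0](\<lambda>s::real. s powr c)"
proof -
  have "(\<lambda>s. f s * g s) \<in> O[at_right 0](\<lambda>s. s powr a * s powr b)"
    by (rule landau_o.big.mult[OF assms(1,2)])
  also have "(\<lambda>s::real. s powr a * s powr b) = (\<lambda>s. s powr (a + b))" by (simp add: powr_add)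
  also have "\<dots> \<in> O[at_right 0](\<lambda>s. s powr c)" by (rule bigo_powr_mono[OF assms(3)])
  finally show ?thesis .
qed

lemma bigo_powr_power:
  assumes "f \<in> O[at_right 0](\<lambda>s. s powr a)"
  shows "(\<lambda>s. f s ^ k) \<in> O[at_right 0](\<lambda>s::real. s powr (real k * a))"
proof (induction k)
  case 0
  have "eventually (\<lambda>s::real. norm (1::real) \<le> 1 * norm (s powr 0)) (at_right 0)"
    using eventually_at_right_less[of 0] by eventually_elim simp
  then show ?case by (intro bigoI[of _ 1]) simp
next
  case (Suc k)
  then show ?case using bigo_powr_mult[OF assms Suc, of "real (Suc k) * a"] by (simp add: algebra_simps)
qed

lemma bigo_1_powr: "f \<in> O[at_right 0](\<lambda>_. 1) \<Longrightarrow> f \<in> O[at_right 0](\<lambda>s::real. s powr 0)"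
proof -
  assume "f \<in> O[at_right 0](\<lambda>_. 1)"
  also have "(\<lambda>_. 1) \<in> O[at_right 0](\<lambda>s::real. s powr 0)"
    using bigo_powr_power[of "\<lambda>_. 0" 0 0] by simp
  finally show ?thesis .
qed

lemma tendsto_0_of_bigo_powr:
  assumes "f \<in> O[at_right 0](\<lambda>s. s powr a)" "a > 0"
  shows "(f \<longlongrightarrow> 0) (at_right (0::real))"
proof -
  have "((\<lambda>s. s powr a) \<longlongrightarrow> 0) (at_right (0::real))" using assms(2) by real_asymp
  then have "(\<lambda>s. s powr a) \<in> o[at_right (0::real)](\<lambda>_. 1 :: real)" by (intro smalloI_tendsto) auto
  with assms(1) have "f \<in> o[at_right 0](\<lambda>_. 1)" using landau_o.big_small_trans by blast
  then show ?thesis by (auto dest: smalloD_tendsto)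
qed

text \<open>With \<open>h = s\<^sup>\<lambda> \<kappa>(s)\<close> and \<open>\<rho> = D \<eta>(D)\<close> the values at the two ends of an approximate first
  integral, \<open>\<rho> = h (1 + O(h\<^sup>2))\<close>, so the time is \<open>\<xi>(0) h\<^bsup>n\<^esup> + \<xi>'(0) / \<eta>(0) h\<^bsup>n+1\<^esup>\<close> up to
  integer powers of \<open>s\<close> and a remainder \<open>O(h\<^bsup>n+2\<^esup>)\<close>.\<close>

theorem dulac_time_coefficient:
  fixes \<kappa> g \<eta> \<xi> D \<tau> :: "real \<Rightarrow> real" and T :: "nat \<Rightarrow> nat \<Rightarrow> real"
  assumes I: "open I" "is_interval I" "0 \<in> I"
    and sm: "smooth_on I \<kappa>" "smooth_on I g" "smooth_on I \<eta>" "smooth_on I \<xi>"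
    and pos: "\<kappa> 0 > 0" "\<eta> 0 > 0" "lam > 0" "\<delta> > 0" "lam \<notin> \<rat>"
    and D: "eventually (\<lambda>s. D s > 0) (at_right 0)"
      "(\<lambda>s. D s - \<Delta> * s powr lam) \<in> O[at_right 0](\<lambda>s. s powr (lam + \<delta>))"
    and b1: "eventually (\<lambda>s. \<bar>ln (D s * \<eta> (D s)) - ln (s powr lam * \<kappa> s)\<bar> \<le> C * (s powr lam * \<kappa> s) ^ 2) (at_right 0)"
    and b2: "eventually (\<lambda>s. \<bar>(D s * \<eta> (D s)) ^ n * \<xi> (D s) - g s - \<tau> s\<bar> \<le> C * (s powr lam * \<kappa> s) ^ (n + 2)) (at_right 0)"
    and T: "finite B" "(0, n + 1) \<in> B" "L > lam * real (n + 1)"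
      "(\<lambda>s. \<tau> s - (\<Sum>(i, j)\<in>B. T i j * s powr (real i + lam * real j))) \<in> O[at_right 0](\<lambda>s. s powr L)"
  shows "T 0 (n + 1) = deriv \<xi> 0 * \<eta> 0 ^ n * \<Delta> ^ (n + 1)"
proof -
  let ?F = "at_right (0::real)"
  define h where "h s = s powr lam * \<kappa> s" for s
  define \<rho> where "\<rho> s = D s * \<eta> (D s)" for s
  define \<epsilon> where "\<epsilon> s = ln (\<rho> s) - ln (h s)" for s
  have id0: "((\<lambda>s. s) \<longlongrightarrow> 0) ?F" by (simp add: tendsto_ident_at)
  have pos_s: "eventually (\<lambda>s. s > (0::real)) ?F" by (rule eventually_at_right_less)
  have \<kappa>_lim: "(\<kappa> \<longlongrightarrow> \<kappa> 0) ?F"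
    using isCont_tendsto_compose[OF smooth_on_isCont[OF sm(1) I(3)] id0] .
  have \<kappa>_O: "\<kappa> \<in> O[?F](\<lambda>s. s powr 0)"
    by (rule bigo_1_powr, rule bigo_compose_tendsto_0[OF I(1,3) sm(1) id0])
  have self: "(\<lambda>s. s powr a) \<in> O[?F](\<lambda>s. s powr a)" for a by simp
  have h_O: "h \<in> O[?F](\<lambda>s. s powr lam)"
    unfolding h_def[abs_def] by (rule bigo_powr_mult[OF self \<kappa>_O]) simp
  have D_O: "D \<in> O[?F](\<lambda>s. s powr lam)"
  proof -
    have "(\<lambda>s. D s - \<Delta> * s powr lam) \<in> O[?F](\<lambda>s. s powr lam)"
      using D(2) bigo_powr_mono[of lam "lam + \<delta>"] pos(4) landau_o.big_trans by fastforce
    then have "(\<lambda>s. (D s - \<Delta> * s powr lam) + \<Delta> * s powr lam) \<in> O[?F](\<lambda>s. s powr lam)"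
      by (rule sum_in_bigo) simp
    then show ?thesis by simp
  qed
  have D_lim: "(D \<longlongrightarrow> 0) ?F" by (rule tendsto_0_of_bigo_powr[OF D_O pos(3)])
  have D_ratio: "((\<lambda>s. D s / s powr lam) \<longlongrightarrow> \<Delta>) ?F"
  proof -
    have "(\<lambda>s. (D s - \<Delta> * s powr lam) * s powr (- lam)) \<in> O[?F](\<lambda>s. s powr \<delta>)"
      by (rule bigo_powr_mult[OF D(2) self]) simp
    from tendsto_0_of_bigo_powr[OF this pos(4)]
    have "((\<lambda>s. (D s - \<Delta> * s powr lam) * s powr (- lam) + \<Delta>) \<longlongrightarrow> 0 + \<Delta>) ?F"
      by (intro tendsto_intros)
    moreover have "eventually (\<lambda>s. (D s - \<Delta> * s powr lam) * s powr (- lam) + \<Delta> = D s / s powr lam) ?F"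
      using pos_s by eventually_elim (simp add: powr_minus field_simps)
    ultimately show ?thesis using Lim_transform_eventually by force
  qed
  have \<eta>_lim: "((\<lambda>s. \<eta> (D s)) \<longlongrightarrow> \<eta> 0) ?F"
    using isCont_tendsto_compose[OF smooth_on_isCont[OF sm(3) I(3)] D_lim] .
  have \<eta>_O: "(\<lambda>s. \<eta> (D s)) \<in> O[?F](\<lambda>s. s powr 0)"
    by (rule bigo_1_powr, rule bigo_compose_tendsto_0[OF I(1,3) sm(3) D_lim])
  have \<rho>_O: "\<rho> \<in> O[?F](\<lambda>s. s powr lam)"
    unfolding \<rho>_def[abs_def] by (rule bigo_powr_mult[OF D_O \<eta>_O]) simp
  have \<epsilon>_O: "\<epsilon> \<in> O[?F](\<lambda>s. s powr (2 * lam))"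
  proof -
    have "\<epsilon> \<in> O[?F](\<lambda>s. h s ^ 2)"
      by (rule bigoI[of _ C]) (use b1 in \<open>auto simp: \<epsilon>_def \<rho>_def h_def\<close>)
    also have "(\<lambda>s. h s ^ 2) \<in> O[?F](\<lambda>s. s powr (2 * lam))"
      using bigo_powr_power[OF h_O, of 2] by simp
    finally show ?thesis .
  qed
  have \<epsilon>_lim: "(\<epsilon> \<longlongrightarrow> 0) ?F" by (rule tendsto_0_of_bigo_powr[OF \<epsilon>_O]) (use pos in simp)
  have h_pos: "eventually (\<lambda>s. h s > 0) ?F"
    using order_tendstoD(1)[OF \<kappa>_lim pos(1)] pos_s by eventually_elim (simp add: h_def)
  have \<rho>_pos: "eventually (\<lambda>s. \<rho> s > 0) ?F"
    using order_tendstoD(1)[OF \<eta>_lim pos(2)] D(1) by eventually_elim (simp add: \<rho>_def)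
  have \<rho>_eq: "eventually (\<lambda>s. \<rho> s = h s * exp (\<epsilon> s)) ?F"
    using h_pos \<rho>_pos by eventually_elim (simp add: \<epsilon>_def exp_diff)
  \<comment> \<open>Compares the leading terms in \<open>\<rho> = h exp \<epsilon>\<close>; it
    eliminates the first section from the final formula.\<close>
  have \<kappa>0: "\<kappa> 0 = \<Delta> * \<eta> 0"
  proof -
    have "((\<lambda>s. D s / s powr lam * \<eta> (D s)) \<longlongrightarrow> \<Delta> * \<eta> 0) ?F"
      by (intro tendsto_intros D_ratio \<eta>_lim)
    moreover have "((\<lambda>s. \<kappa> s * exp (\<epsilon> s)) \<longlongrightarrow> \<kappa> 0 * exp 0) ?F"
      by (intro tendsto_intros \<kappa>_lim \<epsilon>_lim)
    moreover have "eventually (\<lambda>s. \<kappa> s * exp (\<epsilon> s) = D s / s powr lam * \<eta> (D s)) ?F"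
      using \<rho>_eq pos_s by eventually_elim (auto simp: \<rho>_def h_def field_simps)
    ultimately have "((\<lambda>s. D s / s powr lam * \<eta> (D s)) \<longlongrightarrow> \<kappa> 0 * exp 0) ?F"
      using Lim_transform_eventually by fast
    then show ?thesis
      using tendsto_unique[OF _ \<open>((\<lambda>s. D s / s powr lam * \<eta> (D s)) \<longlongrightarrow> \<Delta> * \<eta> 0) ?F\<close>] by simp
  qed
  have expT: "\<exists>R. smooth_on UNIV R \<and> (\<forall>x. exp (real k * x) = 1 + x * R x)" for k
  proof -
    have "smooth_on UNIV (\<lambda>x. exp (real k * x))" by (intro smooth_intros) auto
    from taylor_1[OF _ _ _ this] show ?thesis by auto
  qed
  obtain E1 where E1: "smooth_on UNIV E1" "\<And>x. exp (real n * x) = 1 + x * E1 x" using expT by blast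
  obtain E2 where E2: "smooth_on UNIV E2" "\<And>x. exp (real (n + 1) * x) = 1 + x * E2 x" using expT by blast
  obtain X1 where X1: "smooth_on I X1" "X1 0 = deriv \<xi> 0" "\<And>x. x \<in> I \<Longrightarrow> \<xi> x = \<xi> 0 + x * X1 x"
    using taylor_1[OF I sm(4)] by blast
  obtain X2 where X2: "smooth_on I X2" "\<And>x. x \<in> I \<Longrightarrow> X1 x = X1 0 + x * X2 x"
    using taylor_1[OF I X1(1)] by blast
  obtain Y where Y: "smooth_on I Y" "\<And>x. x \<in> I \<Longrightarrow> \<eta> x = \<eta> 0 + x * Y x"
    using taylor_1[OF I sm(3)] by blast
  \<comment> \<open>From \<open>\<rho> = D \<eta>(D)\<close> one has
    \<open>D = \<rho> / \<eta> 0 + O(D^2)\<close>, so the linear term of \<open>\<xi>\<close>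
    contributes \<open>q \<rho>^(n+1)\<close>.\<close>
  define q where "q = deriv \<xi> 0 / \<eta> 0"
  have e0: "\<eta> 0 \<noteq> 0" using pos(2) by simp
  have main: "(\<lambda>s. \<rho> s ^ n * \<xi> (D s) - (\<xi> 0 * h s ^ n + q * h s ^ (n + 1))) \<in> O[?F](\<lambda>s. s powr (lam * real (n + 2)))"
  proof -
    have DI: "eventually (\<lambda>s. D s \<in> I) ?F"
      using topological_tendstoD[OF D_lim I(1,3)] .
    have "eventually (\<lambda>s. \<rho> s ^ n * \<xi> (D s) - (\<xi> 0 * h s ^ n + q * h s ^ (n + 1)) =
        \<xi> 0 * (h s ^ n * (\<epsilon> s * E1 (\<epsilon> s))) + q * (h s ^ (n + 1) * (\<epsilon> s * E2 (\<epsilon> s)))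
        + \<rho> s ^ n * (D s ^ 2 * (X2 (D s) - q * Y (D s)))) ?F"
      using DI \<rho>_eq
    proof eventually_elim
      case (elim s)
      have D\<eta>: "D s * \<eta> 0 = \<rho> s - D s ^ 2 * Y (D s)"
        using Y(2)[OF elim(1)] by (simp add: \<rho>_def algebra_simps power2_eq_square)
      have DX: "X1 0 * D s = q * (\<rho> s - D s ^ 2 * Y (D s))"
        unfolding D\<eta>[symmetric] q_def X1(2) using e0 by simp
      have xi: "\<xi> (D s) = \<xi> 0 + X1 0 * D s + D s ^ 2 * X2 (D s)"
        using X1(3)[OF elim(1)] X2(2)[OF elim(1)] by (simp add: algebra_simps power2_eq_square)
      have r1: "\<rho> s ^ n = h s ^ n * (1 + \<epsilon> s * E1 (\<epsilon> s))"
        unfolding E1(2)[symmetric] elim(2) by (simp add: power_mult_distrib exp_of_nat_mult)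
      have r2: "\<rho> s ^ n * \<rho> s = h s ^ (n + 1) * (1 + \<epsilon> s * E2 (\<epsilon> s))"
        unfolding r1 E1(2)[symmetric] E2(2)[symmetric] elim(2)
        by (simp add: algebra_simps exp_add exp_of_nat_mult)
      have "\<rho> s ^ n * \<xi> (D s) = \<xi> 0 * \<rho> s ^ n + q * (\<rho> s ^ n * \<rho> s) + \<rho> s ^ n * (D s ^ 2 * (X2 (D s) - q * Y (D s)))"
        unfolding xi DX by (simp add: algebra_simps)
      also have "\<xi> 0 * \<rho> s ^ n = \<xi> 0 * h s ^ n + \<xi> 0 * (h s ^ n * (\<epsilon> s * E1 (\<epsilon> s)))"
        unfolding r1 by (simp add: algebra_simps)
      also have "q * (\<rho> s ^ n * \<rho> s) = q * h s ^ (n + 1) + q * (h s ^ (n + 1) * (\<epsilon> s * E2 (\<epsilon> s)))"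
        unfolding r2 by (simp add: algebra_simps)
      finally show ?case by simp
    qed
    moreover have "(\<lambda>s. \<xi> 0 * (h s ^ n * (\<epsilon> s * E1 (\<epsilon> s))) + q * (h s ^ (n + 1) * (\<epsilon> s * E2 (\<epsilon> s)))
        + \<rho> s ^ n * (D s ^ 2 * (X2 (D s) - q * Y (D s)))) \<in> O[?F](\<lambda>s. s powr (lam * real (n + 2)))"
    proof (intro sum_in_bigo)
      have r: "(\<lambda>s. R (\<epsilon> s)) \<in> O[?F](\<lambda>s. s powr 0)" if "smooth_on UNIV R" for R
        by (rule bigo_1_powr, rule bigo_compose_tendsto_0[OF open_UNIV _ that \<epsilon>_lim]) simp
      have r': "(\<lambda>s. R (D s)) \<in> O[?F](\<lambda>s. s powr 0)" if "smooth_on I R" for R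
        by (rule bigo_1_powr, rule bigo_compose_tendsto_0[OF I(1,3) that D_lim])
      have e: "(\<lambda>s. \<epsilon> s * R (\<epsilon> s)) \<in> O[?F](\<lambda>s. s powr (2 * lam))" if "smooth_on UNIV R" for R
        by (rule bigo_powr_mult[OF \<epsilon>_O r[OF that]]) simp
      have "(\<lambda>s. h s ^ n * (\<epsilon> s * E1 (\<epsilon> s))) \<in> O[?F](\<lambda>s. s powr (lam * real (n + 2)))"
        by (rule bigo_powr_mult[OF bigo_powr_power[OF h_O] e[OF E1(1)]]) (simp add: algebra_simps)
      then show "(\<lambda>s. \<xi> 0 * (h s ^ n * (\<epsilon> s * E1 (\<epsilon> s)))) \<in> O[?F](\<lambda>s. s powr (lam * real (n + 2)))"
        by simp
      have "(\<lambda>s. h s ^ (n + 1) * (\<epsilon> s * E2 (\<epsilon> s))) \<in> O[?F](\<lambda>s. s powr (lam * real (n + 2)))"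
        by (rule bigo_powr_mult[OF bigo_powr_power[OF h_O] e[OF E2(1)]]) (use pos(3) in \<open>simp add: algebra_simps\<close>)
      then show "(\<lambda>s. q * (h s ^ (n + 1) * (\<epsilon> s * E2 (\<epsilon> s)))) \<in> O[?F](\<lambda>s. s powr (lam * real (n + 2)))"
        by simp
      have "smooth_on I (\<lambda>x. X2 x - q * Y x)" by (intro smooth_intros I X2 Y)
      from bigo_powr_mult[OF bigo_powr_power[OF D_O, of 2] r'[OF this]]
      have "(\<lambda>s. D s ^ 2 * (X2 (D s) - q * Y (D s))) \<in> O[?F](\<lambda>s. s powr (2 * lam))" by simp
      from bigo_powr_mult[OF bigo_powr_power[OF \<rho>_O] this]
      show "(\<lambda>s. \<rho> s ^ n * (D s ^ 2 * (X2 (D s) - q * Y (D s)))) \<in> O[?F](\<lambda>s. s powr (lam * real (n + 2)))"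
        by (simp add: algebra_simps)
    qed
    ultimately show ?thesis using landau_o.big.in_cong by fast
  qed
  have tail: "(\<lambda>s. \<rho> s ^ n * \<xi> (D s) - g s - \<tau> s) \<in> O[?F](\<lambda>s. s powr (lam * real (n + 2)))"
  proof -
    have "(\<lambda>s. \<rho> s ^ n * \<xi> (D s) - g s - \<tau> s) \<in> O[?F](\<lambda>s. h s ^ (n + 2))"
      by (rule bigoI[of _ C]) (use b2 h_pos in eventually_elim, simp add: \<rho>_def h_def)
    also have "(\<lambda>s. h s ^ (n + 2)) \<in> O[?F](\<lambda>s. s powr (lam * real (n + 2)))"
      using bigo_powr_power[OF h_O, of "n + 2"] by (simp add: mult.commute)
    finally show ?thesis .
  qed
  \<comment> \<open>A common order of comparison: beyond the exponent in question, but no further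
    than the given expansion and the error \<open>h^(n+2)\<close> allow.\<close>
  define L' where "L' = min L (lam * real (n + 2))"
  have L': "lam * real (n + 1) < L'" "L' \<le> L" "L' \<le> lam * real (n + 2)"
    using T(3) pos(3) by (auto simp: L'_def)
  have to_L': "f \<in> O[?F](\<lambda>s. s powr L')" if "f \<in> O[?F](\<lambda>s. s powr a)" "L' \<le> a" for f a
    using landau_o.big_trans[OF that(1) bigo_powr_mono[OF that(2)]] .
  obtain N :: nat where N: "real N > L'" using reals_Archimedean2 by blast
  have "0 < lam * real (n + 1)" using pos(3) by simp
  then have N0: "N > 0" using N L'(1) by (intro Nat.gr0I) auto
  have kn: "smooth_on I (\<lambda>x. \<kappa> x ^ k)" for k by (intro smooth_intros I sm)
  obtain a Ra where a: "smooth_on I Ra" "\<And>x. x \<in> I \<Longrightarrow> \<kappa> x ^ n = (\<Sum>k<N. a k * x ^ k) + x ^ N * Ra x"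
    using taylor_1d[OF I kn, of n N] by blast
  obtain b Rb where b: "smooth_on I Rb" "b 0 = \<kappa> 0 ^ (n + 1)"
    "\<And>x. x \<in> I \<Longrightarrow> \<kappa> x ^ (n + 1) = (\<Sum>k<N. b k * x ^ k) + x ^ N * Rb x"
    using taylor_1d[OF I kn, of "n + 1" N] by blast
  obtain c Rc where c: "smooth_on I Rc" "\<And>x. x \<in> I \<Longrightarrow> g x = (\<Sum>k<N. c k * x ^ k) + x ^ N * Rc x"
    using taylor_1d[OF I sm(2), of N] by blast
  have series: "(\<lambda>s. s powr (lam * real j) * f s - (\<Sum>i<N. d i * s powr (real i + lam * real j))) \<in> O[?F](\<lambda>s. s powr L')"
    if "smooth_on I R" "\<And>x. x \<in> I \<Longrightarrow> f x = (\<Sum>k<N. d k * x ^ k) + x ^ N * R x" for f d R j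
  proof -
    have "eventually (\<lambda>s. s \<in> I) ?F" using topological_tendstoD[OF id0 I(1,3)] .
    then have "eventually (\<lambda>s. s powr (lam * real j) * f s - (\<Sum>i<N. d i * s powr (real i + lam * real j))
        = s powr (lam * real j + real N) * R s) ?F"
      using pos_s
    proof eventually_elim
      case (elim s)
      have "d i * s powr (real i + lam * real j) = s powr (lam * real j) * (d i * s ^ i)" for i
        using elim(2) by (simp add: powr_add powr_realpow)
      then show ?case
        unfolding that(2)[OF elim(1)] using elim(2)
        by (simp add: powr_add powr_realpow sum_distrib_left algebra_simps)
    qed
    moreover have "(\<lambda>s. s powr (lam * real j + real N) * R s) \<in> O[?F](\<lambda>s. s powr L')"
      by (rule bigo_powr_mult[OF self bigo_1_powr[OF bigo_compose_tendsto_0[OF I(1,3) that(1) id0]]])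
        (use N pos(3) in \<open>auto intro: order_trans[of _ "real N"]\<close>)
    ultimately show ?thesis using landau_o.big.in_cong by fast
  qed
  have hpow: "eventually (\<lambda>s. h s ^ k = s powr (lam * real k) * \<kappa> s ^ k) ?F" for k
    using pos_s by eventually_elim (simp add: h_def power_mult_distrib powr_power mult.commute)
  have transfer: "f2 \<in> O[?F](\<lambda>s. s powr L')"
    if "f1 \<in> O[?F](\<lambda>s. s powr L')" "eventually (\<lambda>s. f1 s = f2 s) ?F" for f1 f2
    using landau_o.big.in_cong[OF that(2)] that(1) by simp
  have O1: "(\<lambda>s. h s ^ n - (\<Sum>i<N. a i * s powr (real i + lam * real n))) \<in> O[?F](\<lambda>s. s powr L')"
    by (rule transfer[OF series[OF a(1), where f = "\<lambda>s. \<kappa> s ^ n" and j = n]], rule a(2), assumption)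
      (use hpow[of n] in eventually_elim, simp)
  have O2: "(\<lambda>s. h s ^ (n + 1) - (\<Sum>i<N. b i * s powr (real i + lam * real (n + 1)))) \<in> O[?F](\<lambda>s. s powr L')"
    by (rule transfer[OF series[OF b(1), where f = "\<lambda>s. \<kappa> s ^ (n + 1)" and j = "n + 1"]], rule b(3), assumption)
      (use hpow[of "n + 1"] in eventually_elim, simp)
  have O3: "(\<lambda>s. g s - (\<Sum>i<N. c i * s powr (real i + lam * real 0))) \<in> O[?F](\<lambda>s. s powr L')"
    by (rule transfer[OF series[OF c(1), where f = g and j = 0]], rule c(2), assumption)
      (use pos_s in eventually_elim, simp)
  \<comment> \<open>The three contributions are added instead of distinguished by cases because the
    columns \<open>j = n\<close> and \<open>j = 0\<close> coincide when
    \<open>n = 0\<close>.\<close>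
  define R where "R i j = (if j = n then \<xi> 0 * a i else 0) + (if j = n + 1 then q * b i else 0)
    - (if j = 0 then c i else 0)" for i j
  let ?A = "{..<N} \<times> {..n + 1}"
  let ?e = "\<lambda>(i, j). real i + lam * real j"
  have sumR: "(\<Sum>p\<in>?A. (case p of (i, j) \<Rightarrow> R i j) * s powr ?e p) =
      \<xi> 0 * (\<Sum>i<N. a i * s powr (real i + lam * real n)) + q * (\<Sum>i<N. b i * s powr (real i + lam * real (n + 1)))
      - (\<Sum>i<N. c i * s powr (real i + lam * real 0))" for s
  proof -
    have "(\<Sum>j\<le>n + 1. R i j * s powr (real i + lam * real j)) =
        (\<Sum>j\<le>n + 1. (if j = n then \<xi> 0 * a i * s powr (real i + lam * real j) else 0)
          + (if j = n + 1 then q * b i * s powr (real i + lam * real j) else 0)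
          - (if j = 0 then c i * s powr (real i + lam * real j) else 0))" for i
      by (intro sum.cong) (auto simp: R_def algebra_simps)
    also have "\<dots> i = \<xi> 0 * (a i * s powr (real i + lam * real n)) + q * (b i * s powr (real i + lam * real (n + 1)))
        - c i * s powr (real i + lam * real 0)" for i
      unfolding sum_subtractf sum.distrib by (simp add: sum.delta mult.assoc)
    finally have inner: "(\<Sum>j\<le>n + 1. R i j * s powr (real i + lam * real j)) =
        \<xi> 0 * (a i * s powr (real i + lam * real n)) + q * (b i * s powr (real i + lam * real (n + 1)))
        - c i * s powr (real i + lam * real 0)" for i .
    have "(\<Sum>p\<in>?A. (case p of (i, j) \<Rightarrow> R i j) * s powr ?e p)
        = (\<Sum>(i, j)\<in>?A. R i j * s powr (real i + lam * real j))"
      by (intro sum.cong) auto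
    also have "\<dots> = (\<Sum>i<N. \<Sum>j\<le>n + 1. R i j * s powr (real i + lam * real j))"
      by (rule sum.cartesian_product[symmetric])
    also have "\<dots> = \<xi> 0 * (\<Sum>i<N. a i * s powr (real i + lam * real n)) + q * (\<Sum>i<N. b i * s powr (real i + lam * real (n + 1)))
      - (\<Sum>i<N. c i * s powr (real i + lam * real 0))"
      unfolding inner sum_subtractf sum.distrib sum_distrib_left ..
    finally show ?thesis .
  qed
  \<comment> \<open>Difference of the given and the computed expansion on the union of their index
    sets; it is of order \<open>s^L'\<close>, and irrationality of \<open>lam\<close> makes the
    exponents injective, so the entry at \<open>(0, n + 1)\<close> vanishes.\<close>
  define cc where "cc p = (if p \<in> B then (case p of (i, j) \<Rightarrow> T i j) else 0) - (if p \<in> ?A then (case p of (i, j) \<Rightarrow> R i j) else 0)" for p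
  have sumcc: "(\<Sum>p\<in>B \<union> ?A. cc p * s powr ?e p) = (\<Sum>(i, j)\<in>B. T i j * s powr (real i + lam * real j))
      - (\<Sum>p\<in>?A. (case p of (i, j) \<Rightarrow> R i j) * s powr ?e p)" for s
  proof -
    have "(\<Sum>p\<in>B \<union> ?A. cc p * s powr ?e p) =
        (\<Sum>p\<in>B \<union> ?A. if p \<in> B then (case p of (i, j) \<Rightarrow> T i j) * s powr ?e p else 0)
        - (\<Sum>p\<in>B \<union> ?A. if p \<in> ?A then (case p of (i, j) \<Rightarrow> R i j) * s powr ?e p else 0)"
      unfolding sum_subtractf[symmetric] by (intro sum.cong) (auto simp: cc_def algebra_simps)
    also have "(\<Sum>p\<in>B \<union> ?A. if p \<in> B then (case p of (i, j) \<Rightarrow> T i j) * s powr ?e p else 0)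
        = (\<Sum>p\<in>B. (case p of (i, j) \<Rightarrow> T i j) * s powr ?e p)"
      using T(1) by (intro sum.mono_neutral_cong_right) auto
    also have "(\<Sum>p\<in>B \<union> ?A. if p \<in> ?A then (case p of (i, j) \<Rightarrow> R i j) * s powr ?e p else 0)
        = (\<Sum>p\<in>?A. (case p of (i, j) \<Rightarrow> R i j) * s powr ?e p)"
      using T(1) by (intro sum.mono_neutral_cong_right) auto
    finally show ?thesis by (simp add: split_beta)
  qed
  have "cc (0, n + 1) = 0"
  proof (rule powr_sum_unique[where e = ?e and A = "B \<union> ?A" and L = L'])
    show "inj_on ?e (B \<union> ?A)"
    proof (rule inj_onI, clarify)
      fix i j i' j' assume eq: "real i + lam * real j = real i' + lam * real j'"
      show "i = i' \<and> j = j'"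
      proof (cases "j = j'")
        case False
        then have "lam = (real i' - real i) / (real j - real j')" using eq by (simp add: field_simps)
        then have "lam \<in> \<rat>" by simp
        then show ?thesis using pos(5) by simp
      qed (use eq in simp)
    qed
    have cm: "(\<lambda>s. d * f s) \<in> O[?F](\<lambda>s. s powr L')" if "f \<in> O[?F](\<lambda>s. s powr L')" for f d
      using that by simp
    note combined = sum_in_bigo(2)[OF sum_in_bigo(1)[OF sum_in_bigo(1)[OF sum_in_bigo(1)[OF
      sum_in_bigo(2)[OF cm[OF to_L'[OF T(4) L'(2)], of "-1"] to_L'[OF tail L'(3)]]
      to_L'[OF main L'(3)]] cm[OF O1, of "\<xi> 0"]] cm[OF O2, of q]] O3]
    show "(\<lambda>s. \<Sum>p\<in>B \<union> ?A. cc p * s powr ?e p) \<in> O[?F](\<lambda>s. s powr L')"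
      by (rule transfer[OF combined]) (unfold sumcc sumR, simp add: algebra_simps)
  qed (use T L'(1) in auto)
  then have "T 0 (n + 1) = R 0 (n + 1)" using T(2) N0 by (simp add: cc_def)
  also have "\<dots> = q * b 0" by (simp add: R_def)
  also have "\<dots> = deriv \<xi> 0 * \<eta> 0 ^ n * \<Delta> ^ (n + 1)"
    unfolding b(2) \<kappa>0 q_def using e0 by (simp add: power_mult_distrib)
  finally show ?thesis .
qed

section \<open>The auxiliary functions as smooth functions of position and parameter\<close>

text \<open>A solution exists by \<open>ode_smooth_solution\<close> with the constant coefficient
  \<open>- \<alpha>\<close>, and \<open>mellin_eqI\<close> identifies it with the definite
  description.\<close>

lemma mellin_solves:
  assumes I: "open I" "is_interval I" "0 \<in> I" and f: "smooth_on I f" and \<alpha>: "\<And>k. \<alpha> \<noteq> real k"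
  shows "smooth_on I (mellin I f \<alpha>)"
    and "x \<in> I \<Longrightarrow> x * deriv (mellin I f \<alpha>) x - \<alpha> * mellin I f \<alpha> x = f x"
proof -
  have "\<exists>y. smooth_on I y \<and> (\<forall>x\<in>I. x * deriv y x + (- \<alpha>) * y x = f x)"
  proof (rule ode_smooth_solution[OF I _ f, where c = "\<lambda>_. - \<alpha>"])
    show "smooth_on I (\<lambda>_. - \<alpha>)" by (rule smooth_on_const[OF I(1)])
    show "- \<alpha> + real k \<noteq> 0" for k using \<alpha>[of k] by linarith
  qed
  then obtain y where y: "smooth_on I y" "\<And>x. x \<in> I \<Longrightarrow> x * deriv y x - \<alpha> * y x = f x" by auto
  have eq: "mellin I f \<alpha> x = y x" if "x \<in> I" for x
    by (rule mellin_eqI[OF I y \<alpha> that])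
  show "smooth_on I (mellin I f \<alpha>)"
    using smooth_on_cong[OF I(1), of "mellin I f \<alpha>" y] eq y(1) by blast
  assume x: "x \<in> I"
  have "eventually (\<lambda>x. mellin I f \<alpha> x = y x) (nhds x)"
    using eventually_nhds_in_open[OF I(1) x] by eventually_elim (rule eq)
  then have "deriv (mellin I f \<alpha>) x = deriv y x" by (rule deriv_cong_ev) simp
  then show "x * deriv (mellin I f \<alpha>) x - \<alpha> * mellin I f \<alpha> x = f x"
    using y(2)[OF x] eq[OF x] by simp
qed

locale saddle_sections =
  fixes W :: "(real ^ 'n::finite) set" and U :: "(real \<times> real) set"
    and P1 P2 :: "real \<times> real \<Rightarrow> 'n param \<Rightarrow> real" and \<epsilon> \<rho> :: real
    and \<sigma>1 \<sigma>2 :: "real \<Rightarrow> 'n param \<Rightarrow> real \<times> real"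
  assumes family: "saddle_family W U P1 P2"
    and sections: "transverse_sections W U P1 P2 \<epsilon> \<rho> \<sigma>1 \<sigma>2"
begin

lemma open_W: "open W" and open_hat: "open (hat W)"
  using family by (auto simp: saddle_family_def intro: open_Times)

lemma open_U: "open U" "(0, 0) \<in> U"
  using family by (auto simp: saddle_family_def)

lemma smooth_P: "smooth_on (U \<times> hat W) (\<lambda>(x, m). P1 x m)" "smooth_on (U \<times> hat W) (\<lambda>(x, m). P2 x m)"
  using family by (auto simp: saddle_family_def)

lemma P1_pos: "m \<in> hat W \<Longrightarrow> (x, 0) \<in> U \<Longrightarrow> P1 (x, 0) m > 0"
  using family unfolding saddle_family_def by blast

lemma P2_neg: "m \<in> hat W \<Longrightarrow> (0, x) \<in> U \<Longrightarrow> P2 (0, x) m < 0"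
  using family unfolding saddle_family_def by blast

lemma ratio: "m \<in> hat W \<Longrightarrow> fst m = - P2 (0, 0) m / P1 (0, 0) m"
  using family unfolding saddle_family_def by blast

lemma eps_rho: "\<epsilon> > 0" "\<rho> > 0"
  using sections by (auto simp: transverse_sections_def)

lemma smooth_sections:
  "smooth_on ({-\<epsilon><..<\<epsilon>} \<times> hat W) (\<lambda>(s, m). \<sigma>1 s m)" "smooth_on ({-\<epsilon><..<\<epsilon>} \<times> hat W) (\<lambda>(s, m). \<sigma>2 s m)"
  using sections by (auto simp: transverse_sections_def)

lemma sections_at_0:
  assumes "m \<in> hat W"
  shows "fst (\<sigma>1 0 m) = 0" "snd (\<sigma>1 0 m) > 0" "snd (\<sigma>2 0 m) = 0" "fst (\<sigma>2 0 m) > 0"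
    "deriv (\<lambda>s. fst (\<sigma>1 s m)) 0 > 0" "deriv (\<lambda>s. snd (\<sigma>2 s m)) 0 > 0"
    "{0} \<times> I1 \<sigma>1 \<rho> m \<subseteq> U" "I2 \<sigma>2 \<rho> m \<times> {0} \<subseteq> U"
  using sections assms unfolding transverse_sections_def by blast+

text \<open>The interval \<open>I2\<close> varies with the parameter, so functions of position and
  parameter live on this open set, which is not a product.\<close>

definition Dom2 :: "(real \<times> 'n param) set" where
  "Dom2 = {x. snd x \<in> hat W \<and> fst x \<in> I2 \<sigma>2 \<rho> (snd x)}"

lemma I2_interval:
  assumes "m \<in> hat W"
  shows "open (I2 \<sigma>2 \<rho> m)" "is_interval (I2 \<sigma>2 \<rho> m)" "0 \<in> I2 \<sigma>2 \<rho> m" "fst (\<sigma>2 0 m) \<in> I2 \<sigma>2 \<rho> m"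
  using sections_at_0(4)[OF assms] eps_rho by (auto simp: I2_def is_interval_oo)

lemma smooth_section_param:
  fixes \<sigma> :: "real \<Rightarrow> 'n param \<Rightarrow> real \<times> real"
  assumes "smooth_on ({-\<epsilon><..<\<epsilon>} \<times> hat W) (\<lambda>(s, m). \<sigma> s m)"
  shows "smooth_on (hat W) (\<lambda>m. \<sigma> 0 m)"
    and "smooth_on (hat W) (\<lambda>m. deriv (\<lambda>s. fst (\<sigma> s m)) 0)"
    and "smooth_on (hat W) (\<lambda>m. deriv (\<lambda>s. snd (\<sigma> s m)) 0)"
    and "m \<in> hat W \<Longrightarrow> smooth_on {-\<epsilon><..<\<epsilon>} (\<lambda>s. \<sigma> s m)"
proof -
  let ?S = "{-\<epsilon><..<\<epsilon>} \<times> hat W"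
  have oS: "open ?S" by (rule open_Times[OF _ open_hat]) simp
  have c: "smooth_on (hat W) (\<lambda>m. f (0, m))" if "smooth_on ?S f" for f :: "real \<times> 'n param \<Rightarrow> 'b::real_normed_vector"
    by (rule smooth_on_compose[OF open_hat oS _ that])
      (use eps_rho open_hat in \<open>auto intro!: smooth_intros open_W open_Times\<close>)
  show "smooth_on (hat W) (\<lambda>m. \<sigma> 0 m)" using c[OF assms] by simp
  have d: "smooth_on (hat W) (\<lambda>m. deriv (\<lambda>s. f (s, m)) 0)" if f: "smooth_on ?S f" for f :: "real \<times> 'n param \<Rightarrow> real"
  proof -
    have "deriv (\<lambda>s. f (s, m)) 0 = pd1 f (0, m)" if "m \<in> hat W" for m
      using pd1_has_real_derivative[OF f, of 0 m] eps_rho that by (intro DERIV_imp_deriv) auto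
    then show ?thesis
      using smooth_on_cong[OF open_hat, of "\<lambda>m. deriv (\<lambda>s. f (s, m)) 0" "\<lambda>m. pd1 f (0, m)"]
        c[OF smooth_on_pd1[OF f]] by blast
  qed
  show "smooth_on (hat W) (\<lambda>m. deriv (\<lambda>s. fst (\<sigma> s m)) 0)"
    using d[OF smooth_on_fst[OF oS assms]] by simp
  show "smooth_on (hat W) (\<lambda>m. deriv (\<lambda>s. snd (\<sigma> s m)) 0)"
    using d[OF smooth_on_snd[OF oS assms]] by simp
  assume m: "m \<in> hat W"
  have "smooth_on {-\<epsilon><..<\<epsilon>} (\<lambda>s. (\<lambda>(s, m). \<sigma> s m) (s, m))"
    by (rule smooth_on_compose[OF _ oS _ assms]) (use m in \<open>auto intro!: smooth_intros\<close>)
  then show "smooth_on {-\<epsilon><..<\<epsilon>} (\<lambda>s. \<sigma> s m)" by simp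
qed

lemma radial_open_Dom2: "radial_open Dom2"
proof -
  let ?S = "(UNIV :: real set) \<times> hat W"
  have oS: "open ?S" by (rule open_Times[OF _ open_hat]) simp
  have s: "smooth_on ?S (\<lambda>x. fst (\<sigma>2 0 (snd x)) + \<rho> - fst x)"
  proof -
    have "smooth_on ?S (\<lambda>x. fst (\<sigma>2 0 (snd x)))"
      by (rule smooth_on_compose[OF oS open_hat _ smooth_on_fst[OF open_hat smooth_section_param(1)[OF smooth_sections(2)]]])
        (auto intro!: smooth_intros oS)
    then show ?thesis
      by (intro smooth_on_add smooth_on_diff smooth_on_const smooth_on_fst[OF oS smooth_on_id[OF oS]] oS)
  qed
  have "open (?S \<inter> (\<lambda>x. fst (\<sigma>2 0 (snd x)) + \<rho> - fst x) -` {0<..})"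
    by (rule continuous_open_preimage[OF smooth_on_continuous[OF s] oS]) simp
  moreover have "open ({-\<rho><..} \<times> (UNIV :: 'n param set))" by (intro open_Times) auto
  moreover have "Dom2 = (?S \<inter> (\<lambda>x. fst (\<sigma>2 0 (snd x)) + \<rho> - fst x) -` {0<..}) \<inter> ({-\<rho><..} \<times> UNIV)"
    by (auto simp: Dom2_def I2_def)
  ultimately have "open Dom2" by auto
  moreover have "(t * u, p) \<in> Dom2" if "(u, p) \<in> Dom2" "0 \<le> t" "t \<le> 1" for t u p
    using interval_scale[OF I2_interval(2,3)[of p]] that by (auto simp: Dom2_def)
  ultimately show ?thesis by (auto simp: radial_open_def)
qed

lemma open_Dom2: "open Dom2"
  using radial_open_open[OF radial_open_Dom2] .

lemma Dom2_U: "x \<in> Dom2 \<Longrightarrow> (fst x, 0) \<in> U" "x \<in> Dom2 \<Longrightarrow> snd x \<in> hat W"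
  using sections_at_0(8)[of "snd x"] by (auto simp: Dom2_def)

lemma Dom2_I2: "m \<in> hat W \<Longrightarrow> u \<in> I2 \<sigma>2 \<rho> m \<Longrightarrow> (u, m) \<in> Dom2"
  by (simp add: Dom2_def)

lemma smooth_axis:
  fixes f :: "(real \<times> real) \<times> 'n param \<Rightarrow> real"
  assumes "smooth_on (U \<times> hat W) f"
  shows "smooth_on Dom2 (\<lambda>x. f ((fst x, 0), snd x))"
  by (rule smooth_on_compose[OF open_Dom2 open_Times[OF open_U(1) open_hat] _ assms])
    (use Dom2_U in \<open>auto intro!: smooth_intros open_Dom2\<close>)

lemma smooth_P_axis: "smooth_on Dom2 (\<lambda>x. P1 (fst x, 0) (snd x))" "smooth_on Dom2 (\<lambda>x. P2 (fst x, 0) (snd x))"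
  using smooth_axis[OF smooth_P(1)] smooth_axis[OF smooth_P(2)] by auto

lemma P1_axis_pos: "x \<in> Dom2 \<Longrightarrow> P1 (fst x, 0) (snd x) > 0"
  using P1_pos Dom2_U by blast

lemma smooth_P_slice:
  assumes "m \<in> hat W"
  shows "smooth_on U (\<lambda>x. P1 x m)" "smooth_on U (\<lambda>x. P2 x m)"
proof -
  have "smooth_on U (\<lambda>x. f (x, m))" if "smooth_on (U \<times> hat W) f" for f :: "(real \<times> real) \<times> 'n param \<Rightarrow> real"
    by (rule smooth_on_compose[OF open_U(1) open_Times[OF open_U(1) open_hat] _ that])
      (use assms in \<open>auto intro!: smooth_intros open_U\<close>)
  from this[OF smooth_P(1)] this[OF smooth_P(2)]
  show "smooth_on U (\<lambda>x. P1 x m)" "smooth_on U (\<lambda>x. P2 x m)" by auto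
qed

text \<open>\<open>u\<close> times the logarithmic derivative of \<open>L2\<close>. It vanishes at
  \<open>u = 0\<close> by the relation that defines \<open>\<lambda>\<close>, so
  \<open>hadamard gq\<close> removes the apparent singularity of the integrand.\<close>

definition gq :: "real \<times> 'n param \<Rightarrow> real" where
  "gq x = P2 (fst x, 0) (snd x) / P1 (fst x, 0) (snd x) + fst (snd x)"

lemma smooth_gq: "smooth_on Dom2 gq"
proof -
  have "P1 (fst x, 0) (snd x) \<noteq> 0" if "x \<in> Dom2" for x using P1_axis_pos[OF that] by simp
  then show ?thesis
    unfolding gq_def[abs_def]
    by (intro smooth_intros smooth_P_axis open_Dom2)
qed

lemma gq_0: "m \<in> hat W \<Longrightarrow> gq (0, m) = 0"
  using ratio[of m] by (simp add: gq_def)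

text \<open>The antiderivative of \<open>hadamard gq\<close> through the transform with exponent
  \<open>-1\<close>, as in \<open>antiderivative_exists\<close>, now with a genuine
  parameter.\<close>

definition lnL2 :: "real \<times> 'n param \<Rightarrow> real" where
  "lnL2 x = fst x * mellin_reg {} 1 (hadamard gq) (\<lambda>_. -1) x"

lemma smooth_lnL2: "smooth_on Dom2 lnL2"
proof -
  have "smooth_on Dom2 (mellin_reg {} 1 (hadamard gq) (\<lambda>_. -1))"
    by (rule smooth_on_mellin_reg[OF radial_open_Dom2 smooth_on_hadamard[OF radial_open_Dom2 smooth_gq] open_UNIV])
      (auto intro: smooth_on_const)
  then show ?thesis
    unfolding lnL2_def[abs_def] by (intro smooth_intros open_Dom2)
qed

lemma lnL2_has_derivative:
  assumes "m \<in> hat W" "u \<in> I2 \<sigma>2 \<rho> m"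
  shows "((\<lambda>u. lnL2 (u, m)) has_real_derivative hadamard gq (u, m)) (at u)"
proof -
  note S = radial_open_Dom2
  note h = smooth_on_hadamard[OF S smooth_gq]
  note x = Dom2_I2[OF assms]
  let ?R = "\<lambda>u. mellin_reg {} 1 (hadamard gq) (\<lambda>_. -1) (u, m)"
  have sR: "smooth_on Dom2 (mellin_reg {} 1 (hadamard gq) (\<lambda>_. -1))"
    by (rule smooth_on_mellin_reg[OF S h open_UNIV]) (auto intro: smooth_on_const)
  have "smooth_on (I2 \<sigma>2 \<rho> m) ?R"
    by (rule smooth_on_slice[OF I2_interval(1)[OF assms(1)] open_Dom2 Dom2_I2[OF assms(1)] sR])
  then have "(?R has_real_derivative deriv ?R u) (at u)"
    using smooth_on_has_real_derivative assms(2) by blast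
  then have "((\<lambda>u. u * ?R u) has_real_derivative (u * deriv ?R u + ?R u)) (at u)"
    by (auto intro!: derivative_eq_intros simp: mult.commute)
  moreover have "u * deriv ?R u - (-1) * ?R u = hadamard gq (u, m) - (\<Sum>k\<in>{} \<inter> {..<1}. tcoef k (hadamard gq) m * u ^ k)"
    by (rule mellin_reg_ode[OF S h open_UNIV _ _ _ _ x]) (auto intro: smooth_on_const)
  ultimately show ?thesis by (simp add: lnL2_def)
qed

lemma hadamard_gq:
  assumes "m \<in> hat W" "u \<in> I2 \<sigma>2 \<rho> m"
  shows "u * hadamard gq (u, m) = P2 (u, 0) m / P1 (u, 0) m + fst m"
  using hadamard_eq[OF radial_open_Dom2 smooth_gq Dom2_I2[OF assms]] gq_0[OF assms(1)]
  by (simp add: gq_def)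

text \<open>The integrand of \<open>L2\<close> agrees with \<open>hadamard gq\<close> on the open
  interval of integration, which excludes the point \<open>z = 0\<close> with its division by zero;
  \<open>lnL2\<close> is an antiderivative vanishing at 0.\<close>

lemma L2_eq:
  assumes m: "m \<in> hat W" and u: "u \<in> I2 \<sigma>2 \<rho> m"
  shows "L2 P1 P2 m u = exp (lnL2 (u, m))"
proof -
  have sub: "z \<in> I2 \<sigma>2 \<rho> m" if "min 0 u \<le> z" "z \<le> max 0 u" for z
    using that I2_interval(2-3)[OF m] u by (auto simp: I2_def min_def max_def split: if_splits)
  have "(LBINT z=ereal 0..ereal u. (P2 (z, 0) m / P1 (z, 0) m + fst m) / z) = (LBINT z=ereal 0..ereal u. hadamard gq (z, m))"
  proof (rule interval_integral_cong)
    fix z assume "z \<in> einterval (min (ereal 0) (ereal u)) (max (ereal 0) (ereal u))"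
    then have z: "min 0 u < z" "z < max 0 u" by (auto simp: einterval_def min_def max_def split: if_splits)
    then have "z \<noteq> 0" by (auto simp: min_def max_def split: if_splits)
    then show "(P2 (z, 0) m / P1 (z, 0) m + fst m) / z = hadamard gq (z, m)"
      using hadamard_gq[OF m sub[of z]] z by (simp add: field_simps)
  qed
  also have "\<dots> = lnL2 (u, m) - lnL2 (0, m)"
  proof (rule interval_integral_FTC_finite)
    have "smooth_on (I2 \<sigma>2 \<rho> m) (\<lambda>u. hadamard gq (u, m))"
      by (rule smooth_on_slice[OF I2_interval(1)[OF m] open_Dom2 Dom2_I2[OF m]
            smooth_on_hadamard[OF radial_open_Dom2 smooth_gq]])
    then show "continuous_on {min 0 u..max 0 u} (\<lambda>z. hadamard gq (z, m))"
      by (rule continuous_on_subset[OF smooth_on_continuous]) (use sub in auto)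
  next
    fix z assume "min 0 u \<le> z" "z \<le> max 0 u"
    then show "((\<lambda>u. lnL2 (u, m)) has_vector_derivative hadamard gq (z, m)) (at z within {min 0 u..max 0 u})"
      using lnL2_has_derivative[OF m sub[of z]]
      by (simp add: has_real_derivative_iff_has_vector_derivative has_vector_derivative_at_within)
  qed
  finally show ?thesis by (simp add: L2_def lnL2_def zero_ereal_def)
qed

text \<open>The derivative in \<open>x2\<close> on the axis, taken from the total derivative in
  position and parameter, so that its joint smoothness is immediate.\<close>

definition D2 :: "(real \<times> real \<Rightarrow> 'n param \<Rightarrow> real) \<Rightarrow> real \<times> 'n param \<Rightarrow> real" where
  "D2 P x = frechet_derivative (\<lambda>(z, m). P z m) (at ((fst x, 0), snd x)) ((0, 1), 0)"

lemma smooth_D2: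
  assumes "smooth_on (U \<times> hat W) (\<lambda>(x, m). P x m)"
  shows "smooth_on Dom2 (D2 P)"
  unfolding D2_def[abs_def] using smooth_axis[OF smooth_on_frechet[OF assms, of "((0, 1), 0)"]] by simp

lemma D2_has_real_derivative:
  fixes P :: "real \<times> real \<Rightarrow> 'n param \<Rightarrow> real"
  assumes P: "smooth_on (U \<times> hat W) (\<lambda>(x, m). P x m)" and m: "m \<in> hat W" "(u, 0) \<in> U"
  shows "((\<lambda>v. P (u, v) m) has_real_derivative D2 P (u, m)) (at 0)"
    and "pd2 (\<lambda>x. P x m) (u, 0) = D2 P (u, m)"
proof -
  have d: "((\<lambda>(x, m). P x m) has_derivative frechet_derivative (\<lambda>(x, m). P x m) (at ((u, 0), m))) (at ((u, 0), m))"
    by (rule smooth_on_has_derivative[OF P]) (use m in auto)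
  have "((\<lambda>x. (x, m)) has_derivative (\<lambda>h. (h, 0))) (at (u, 0 :: real))"
    by (auto intro!: derivative_eq_intros)
  from diff_chain_at[OF this, of "\<lambda>(x, m). P x m"] d
  have "((\<lambda>x. P x m) has_derivative (\<lambda>h. frechet_derivative (\<lambda>(x, m). P x m) (at ((u, 0), m)) (h, 0))) (at (u, 0))"
    by (simp add: o_def)
  from partial_snd_has_derivative[OF this] pd_eqI(2)[OF this]
  show "((\<lambda>v. P (u, v) m) has_real_derivative D2 P (u, m)) (at 0)" "pd2 (\<lambda>x. P x m) (u, 0) = D2 P (u, m)"
    by (simp_all add: D2_def)
qed

lemma deriv_quotients:
  assumes m: "m \<in> hat W" "(u, 0) \<in> U"
  shows "deriv (\<lambda>v. P2 (u, v) m / P1 (u, v) m) 0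
      = (D2 P2 (u, m) * P1 (u, 0) m - P2 (u, 0) m * D2 P1 (u, m)) / (P1 (u, 0) m)\<^sup>2"
    and "deriv (\<lambda>v. 1 / P1 (u, v) m) 0 = - D2 P1 (u, m) / (P1 (u, 0) m)\<^sup>2"
  using D2_has_real_derivative(1)[OF smooth_P(1) m] D2_has_real_derivative(1)[OF smooth_P(2) m] P1_pos[OF m]
  by (auto intro!: DERIV_imp_deriv derivative_eq_intros simp: power2_eq_square)

text \<open>\<open>fM\<close>, \<open>fA\<close> and \<open>fC\<close> are \<open>M2\<close>,
  \<open>A2\<close> and \<open>C2\<close> with the integral and the derivatives carried out, as
  functions of position and parameter whose joint smoothness is visible.\<close>

definition fM :: "real \<times> 'n param \<Rightarrow> real" where
  "fM x = exp (lnL2 x) * ((D2 P2 x * P1 (fst x, 0) (snd x) - P2 (fst x, 0) (snd x) * D2 P1 x) / (P1 (fst x, 0) (snd x))\<^sup>2)"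

definition fA :: "nat \<Rightarrow> real \<times> 'n param \<Rightarrow> real" where
  "fA n2 x = exp (lnL2 x) ^ n2 / P1 (fst x, 0) (snd x)"

definition fC :: "nat \<Rightarrow> real \<times> 'n param \<Rightarrow> real" where
  "fC n2 x = exp (lnL2 x) ^ (n2 + 1) * (- D2 P1 x / (P1 (fst x, 0) (snd x))\<^sup>2)"

lemma smooth_fM: "smooth_on Dom2 fM" and smooth_fA: "smooth_on Dom2 (fA n2)" and smooth_fC: "smooth_on Dom2 (fC n2)"
proof -
  have nz: "P1 (fst x, 0) (snd x) \<noteq> 0" "(P1 (fst x, 0) (snd x))\<^sup>2 \<noteq> 0" if "x \<in> Dom2" for x
    using P1_axis_pos[OF that] by auto
  show "smooth_on Dom2 fM" "smooth_on Dom2 (fA n2)" "smooth_on Dom2 (fC n2)"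
    unfolding fM_def[abs_def] fA_def[abs_def] fC_def[abs_def]
    by (intro smooth_intros open_Dom2 smooth_lnL2 smooth_D2 smooth_P smooth_P_axis nz; assumption)+
qed

lemma
  assumes "m \<in> hat W" "u \<in> I2 \<sigma>2 \<rho> m"
  shows M2_eq: "M2 P1 P2 m u = fM (u, m)"
    and A2_eq: "A2 P1 P2 n2 m u = fA n2 (u, m)"
    and C2_eq: "C2 P1 P2 n2 m u = fC n2 (u, m)"
  using deriv_quotients[OF assms(1) Dom2_U(1)[OF Dom2_I2[OF assms], simplified]] L2_eq[OF assms]
  by (simp_all add: M2_def A2_def C2_def fM_def fA_def fC_def)

lemma smooth_I2_slice:
  fixes f :: "real \<times> 'n param \<Rightarrow> real"
  assumes "m \<in> hat W" "smooth_on Dom2 f"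
  shows "smooth_on (I2 \<sigma>2 \<rho> m) (\<lambda>u. f (u, m))"
  by (rule smooth_on_slice[OF I2_interval(1)[OF assms(1)] open_Dom2 Dom2_I2[OF assms(1)] assms(2)])

lemma
  assumes m: "m \<in> hat W"
  shows smooth_M2: "smooth_on (I2 \<sigma>2 \<rho> m) (M2 P1 P2 m)"
    and smooth_A2: "smooth_on (I2 \<sigma>2 \<rho> m) (A2 P1 P2 n2 m)"
    and smooth_C2: "smooth_on (I2 \<sigma>2 \<rho> m) (C2 P1 P2 n2 m)"
  using smooth_I2_slice[OF m smooth_fM] smooth_I2_slice[OF m smooth_fA[of n2]] smooth_I2_slice[OF m smooth_fC[of n2]]
    smooth_on_cong[OF I2_interval(1)[OF m], of "M2 P1 P2 m" "\<lambda>u. fM (u, m)"] M2_eq[OF m]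
    smooth_on_cong[OF I2_interval(1)[OF m], of "A2 P1 P2 n2 m" "\<lambda>u. fA n2 (u, m)"] A2_eq[OF m]
    smooth_on_cong[OF I2_interval(1)[OF m], of "C2 P1 P2 n2 m" "\<lambda>u. fC n2 (u, m)"] C2_eq[OF m]
  by blast+

end

section \<open>The coefficient for irrational ratio of hyperbolicity\<close>

lemma irrational_not_Dij:
  assumes "l \<notin> \<rat>"
  shows "l \<notin> Dij k i j"
proof
  assume "l \<in> Dij k i j"
  then obtain i' j' where ne: "(i', j') \<noteq> (i, j)" and eq: "real i + l * real j = real i' + l * real j'"
    unfolding Dij_def by auto
  have "j \<noteq> j'" using ne eq by auto
  then have "l = (real i' - real i) / (real j - real j')" using eq by (simp add: field_simps)
  then show False using assms by simp
qed

lemma irrational_not_DL: "l \<notin> \<rat> \<Longrightarrow> l \<notin> DL k L"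
  using irrational_not_Dij unfolding DL_def by blast

lemma finite_Bset:
  assumes "l > 0"
  shows "finite (Bset k l L)"
proof (rule finite_subset)
  show "Bset k l L \<subseteq> {..nat \<lceil>L\<rceil>} \<times> {..nat \<lceil>L / l\<rceil>}"
  proof
    fix p assume "p \<in> Bset k l L"
    then obtain i j where p: "p = (i, j)" "real i + l * real j \<le> L" by (auto simp: Bset_def)
    have "real i \<le> L" using p(2) assms by (smt (verit) mult_nonneg_nonneg of_nat_0_le_iff)
    moreover have "l * real j \<le> L" using p(2) by linarith
    then have "real j \<le> L / l" using assms by (simp add: field_simps)
    ultimately show "p \<in> {..nat \<lceil>L\<rceil>} \<times> {..nat \<lceil>L / l\<rceil>}"
      unfolding p by (auto simp: le_nat_iff le_ceiling_iff intro: order_trans)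
  qed
qed simp

lemma flat_on_bigo:
  assumes "flat_on L A \<psi>" "m \<in> A"
  shows "(\<lambda>s. \<psi> s m) \<in> O[at_right 0](\<lambda>s. s powr L)"
proof -
  have "flat_at L m \<psi>" using assms by (simp add: flat_on_def)
  from conjunct2[OF this[unfolded flat_at_def], THEN spec[of _ "[]"]]
  obtain V C s0 where V: "m \<in> V" "s0 > 0" "\<forall>s\<in>{0<..<s0}. \<forall>m\<in>V. \<bar>\<psi> s m\<bar> \<le> C * s powr L" by auto
  then have C: "s0 > 0" "\<And>s. s \<in> {0<..<s0} \<Longrightarrow> \<bar>\<psi> s m\<bar> \<le> C * s powr L" by blast+
  have "eventually (\<lambda>s. s \<in> {0<..<s0}) (at_right 0)" by (rule eventually_at_right_real[OF C(1)])
  then have "eventually (\<lambda>s. norm (\<psi> s m) \<le> C * norm (s powr L)) (at_right 0)"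
    by eventually_elim (use C(2) in simp)
  then show ?thesis by (rule bigoI)
qed

text \<open>The complement is the projection of a closed set along the compact square of scaling
  factors, hence closed.\<close>

lemma biradial_core:
  assumes "open U0"
  shows "biradial {z. \<forall>k\<in>{0..1} \<times> {0..1}. (fst k * fst z, snd k * snd z) \<in> U0}" (is "biradial ?S")
proof -
  let ?f = "\<lambda>x :: (real \<times> real) \<times> (real \<times> real). (fst (fst x) * fst (snd x), snd (fst x) * snd (snd x))"
  have "continuous_on UNIV ?f" by (intro continuous_intros)
  then have "open (?f -` U0)" using assms by (rule open_vimage[rotated])
  then have "closed (- (?f -` U0))" by (simp add: closed_Compl)
  moreover have "compact ({0..1} \<times> {0..1 :: real} :: (real \<times> real) set)" by (intro compact_Times) auto
  ultimately have c1: "closed {z. \<exists>k. k \<in> {0..1} \<times> {0..1} \<and> (k, z) \<in> - (?f -` U0)}"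
    by (intro closed_compact_projection)
  have c2: "- ?S = {z. \<exists>k. k \<in> {0..1} \<times> {0..1} \<and> (k, z) \<in> - (?f -` U0)}"
    by (simp add: Compl_eq Bex_def del: mem_Times_iff)
  have "open ?S" unfolding open_closed c2 by (rule c1)
  moreover have "(t * x, y) \<in> ?S \<and> (x, t * y) \<in> ?S" if "(x, y) \<in> ?S" "0 \<le> t" "t \<le> 1" for x y t
  proof -
    have "(a * (t * x), b * y) \<in> U0 \<and> (a * x, b * (t * y)) \<in> U0" if ab: "a \<in> {0..1}" "b \<in> {0..1}" for a b
    proof -
      have "(a * t, b) \<in> {0..1} \<times> {0..1}" "(a, b * t) \<in> {0..1} \<times> {0..1}"
        using ab \<open>0 \<le> t\<close> \<open>t \<le> 1\<close> by (auto simp: mult_le_one)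
      then show ?thesis using \<open>(x, y) \<in> ?S\<close> by (force simp: mult.assoc)
    qed
    then show ?thesis by auto
  qed
  ultimately show ?thesis by (auto simp: biradial_def)
qed

lemma orbit_arc_mono: "orbit_arc X G p \<tau> q \<Longrightarrow> G \<subseteq> G' \<Longrightarrow> orbit_arc X G' p \<tau> q"
  unfolding orbit_arc_def by blast

context saddle_sections
begin

text \<open>For \<open>n2 = 0\<close> the second exponent is \<open>- n1\<close>, which is negative
  because \<open>(n1, n2) \<noteq> (0, 0)\<close>; in all other cases an integer value would make
  \<open>lam\<close> rational.\<close>

lemma mellin_nonresonant:
  assumes "lam \<notin> \<rat>" "(n1, n2) \<noteq> (0, 0)"
  shows "lam \<noteq> real k" "lam * real n2 - real n1 \<noteq> real k" "lam * real (n2 + 1) - real n1 \<noteq> real k"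
proof -
  show "lam \<noteq> real k" using assms(1) by auto
  have *: "lam * real j - real n1 \<noteq> real k" if "j \<noteq> 0" for j
  proof
    assume "lam * real j - real n1 = real k"
    then have "lam = (real k + real n1) / real j" using that by (simp add: field_simps)
    then show False using assms(1) by simp
  qed
  show "lam * real (n2 + 1) - real n1 \<noteq> real k" using *[of "n2 + 1"] by simp
  show "lam * real n2 - real n1 \<noteq> real k" using *[of n2] assms(2) by (cases "n2 = 0") auto
qed

lemma smooth_B2:
  assumes m: "m \<in> hat W" and lam: "\<And>k. fst m \<noteq> real k"
  shows "smooth_on (I2 \<sigma>2 \<rho> m) (B2 P1 P2 n2 (I2 \<sigma>2 \<rho> m) m)"
  unfolding B2_def[abs_def]
  by (intro smooth_intros I2_interval(1)[OF m] smooth_A2[OF m] smooth_C2[OF m]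
      mellin_solves(1)[OF I2_interval(1-3)[OF m] smooth_M2[OF m] lam])

text \<open>The four equations of \<open>approximate_integrals\<close> are solved on all of
  \<open>I2\<close> by \<open>l = ln L2\<close>, by \<open>mf = - \<mu> / L2\<close> with
  \<open>\<mu>\<close> the transform of \<open>M2\<close>, and by the transforms \<open>y0\<close>
  of \<open>A2\<close> and \<open>y1\<close> of \<open>B2\<close> with exponents
  \<open>lam n2 - n1\<close> and \<open>lam (n2+1) - n1\<close>. So \<open>B2\<close> is the right
  side that the term linear in \<open>y\<close> produces.\<close>

theorem irrational_coefficient:
  fixes n1 n2 :: nat and D \<tau> :: "real \<Rightarrow> 'n param \<Rightarrow> real" and \<Delta> T :: "nat \<Rightarrow> nat \<Rightarrow> 'n param \<Rightarrow> real"
  assumes m: "m \<in> hat W" and irr: "fst m \<notin> \<rat>" and n: "(n1, n2) \<noteq> (0, 0)"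
    and dmt: "dulac_map_time W U P1 P2 n1 n2 \<sigma>1 \<sigma>2 D \<tau>"
    and dmc: "dulac_map_coeffs W D \<Delta>" and dtc: "dulac_time_coeffs W (n1, n2) \<tau> T"
  defines "u \<equiv> fst (\<sigma>2 0 m)" and "L \<equiv> L2 P1 P2 m (fst (\<sigma>2 0 m))"
    and "s211 \<equiv> deriv (\<lambda>s. fst (\<sigma>2 s m)) 0" and "s221 \<equiv> deriv (\<lambda>s. snd (\<sigma>2 s m)) 0"
  shows "T 0 (n2 + 1) m = \<Delta> 0 0 m ^ (n2 + 1) * (s221 / L) ^ n2 * u ^ n1 *
    (A2 P1 P2 n2 m u * s211 / u
      + mellin (I2 \<sigma>2 \<rho> m) (B2 P1 P2 n2 (I2 \<sigma>2 \<rho> m) m) (fst m * real (n2 + 1) - real n1) u * s221 / L)"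
proof -
  let ?I = "I2 \<sigma>2 \<rho> m"
  define lam where "lam = fst m"
  define v where "v = snd (\<sigma>1 0 m)"
  note I = I2_interval[OF m]
  note sec0 = sections_at_0[OF m]
  have lam0: "lam > 0" using m by (auto simp: lam_def)
  have irr: "lam \<notin> \<rat>" using irr by (simp add: lam_def)
  note nonres = mellin_nonresonant[OF irr n]
  have u: "u > 0" "u \<in> ?I" and v: "v > 0" using sec0 I(4) by (simp_all add: u_def v_def)
  define p1 where "p1 x = P1 x m" for x
  define p2 where "p2 x = P2 x m" for x
  define \<mu> where "\<mu> = mellin ?I (M2 P1 P2 m) lam"
  define y0 where "y0 = mellin ?I (A2 P1 P2 n2 m) (lam * real n2 - real n1)"
  define y1 where "y1 = mellin ?I (B2 P1 P2 n2 ?I m) (lam * real (n2 + 1) - real n1)"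
  define l where "l x = lnL2 (x, m)" for x
  define mf where "mf x = - \<mu> x * exp (- l x)" for x
  have sl: "smooth_on ?I l" unfolding l_def[abs_def] by (rule smooth_I2_slice[OF m smooth_lnL2])
  note \<mu> = mellin_solves[OF I(1-3) smooth_M2[OF m] nonres(1), folded \<mu>_def]
  note y0 = mellin_solves[OF I(1-3) smooth_A2[OF m, of n2] nonres(2), folded y0_def]
  have "fst m \<noteq> real k" for k using nonres(1) by (simp add: lam_def)
  note y1 = mellin_solves[OF I(1-3) smooth_B2[OF m this, of n2] nonres(3), folded y1_def]
  have smf: "smooth_on ?I mf" unfolding mf_def[abs_def] by (intro smooth_intros I(1) \<mu>(1) sl)
  \<comment> \<open>Points all of whose coordinatewise shrinkings stay in the common domain: a
    biradial neighbourhood of the corner path.\<close>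
  define Om where "Om = {z. \<forall>k\<in>{0..1} \<times> {0..1}. (fst k * fst z, snd k * snd z) \<in> U \<inter> (?I \<times> I1 \<sigma>1 \<rho> m)}"
  have Om: "biradial Om"
    unfolding Om_def by (rule biradial_core) (auto intro!: open_Int open_U open_Times I simp: I1_def)
  note oOm = biradial_open[OF Om]
  have Om_U: "z \<in> U \<inter> (?I \<times> I1 \<sigma>1 \<rho> m)" if "z \<in> Om" for z
  proof -
    have "(1, 1) \<in> {0..1 :: real} \<times> {0..1 :: real}" by simp
    with that have "(fst (1::real, 1::real) * fst z, snd (1::real, 1::real) * snd z) \<in> U \<inter> (?I \<times> I1 \<sigma>1 \<rho> m)"
      unfolding Om_def by blast
    then show ?thesis by simp
  qed
  have J: "x \<in> ?I" "(x, 0) \<in> U" if "(x, 0) \<in> Om" for x using Om_U[OF that] by auto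
  have Jsub: "{x. (x, 0) \<in> Om} \<subseteq> ?I" using J by auto
  have path: "{0} \<times> {0..v} \<union> {0..u} \<times> {0} \<subseteq> Om"
  proof -
    have "(0, t * y) \<in> U" "t * y \<in> I1 \<sigma>1 \<rho> m" if "y \<in> {0..v}" "t \<in> {0..1}" for t y
    proof -
      have "is_interval (I1 \<sigma>1 \<rho> m)" "0 \<in> I1 \<sigma>1 \<rho> m" "y \<in> I1 \<sigma>1 \<rho> m"
        using that eps_rho v by (auto simp: I1_def is_interval_oo v_def)
      then show "t * y \<in> I1 \<sigma>1 \<rho> m" using interval_scale that(2) by auto
      then show "(0, t * y) \<in> U" using sec0(7) by auto
    qed
    moreover have "(t * x, 0) \<in> U" "t * x \<in> ?I" if "x \<in> {0..u}" "t \<in> {0..1}" for t x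
    proof -
      have "x \<in> ?I" using mem_is_interval_1_I[OF I(2,3) u(2)] that by auto
      then show "t * x \<in> ?I" using interval_scale[OF I(2,3)] that(2) by auto
      then show "(t * x, 0) \<in> U" using sec0(8) by auto
    qed
    moreover have "0 \<in> I1 \<sigma>1 \<rho> m" using eps_rho v by (auto simp: I1_def v_def)
    ultimately show ?thesis using I(3) unfolding Om_def by auto
  qed
  have Om_ne: "Om \<noteq> {}" using path u(1) by force
  have smU: "smooth_on Om p1" "smooth_on Om p2"
    unfolding p1_def[abs_def] p2_def[abs_def]
    using smooth_on_subset[OF smooth_P_slice(1)[OF m]] smooth_on_subset[OF smooth_P_slice(2)[OF m]] Om_U by blast+
  have pos: "p1 (x, 0) > 0" if "(x, 0) \<in> Om" for x using P1_pos[OF m J(2)[OF that]] by (simp add: p1_def)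
  have neg: "p2 (0, y) < 0" if "(0, y) \<in> Om" for y
    using P2_neg[OF m, of y] Om_U[OF that] by (auto simp: p2_def)
  have lam_eq: "lam = - p2 (0, 0) / p1 (0, 0)" using ratio[OF m] by (simp add: lam_def p1_def p2_def)
  have restrict: "smooth_on {x. (x, 0) \<in> Om} h" if "smooth_on ?I h" for h :: "real \<Rightarrow> real"
    by (rule smooth_on_subset[OF that Jsub])
  have dl: "(l has_real_derivative hadamard gq (x, m)) (at x)" if "x \<in> ?I" for x
    unfolding l_def by (rule lnL2_has_derivative[OF m that])
  have L2l: "L2 P1 P2 m x = exp (l x)" if "x \<in> ?I" for x using L2_eq[OF m that] by (simp add: l_def)
  have ode_l: "x * deriv l x = p2 (x, 0) / p1 (x, 0) + lam" if "(x, 0) \<in> Om" for x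
    using hadamard_gq[OF m J(1)[OF that]] DERIV_imp_deriv[OF dl[OF J(1)[OF that]]]
    by (simp add: p1_def p2_def lam_def)
  have ode_m: "x * deriv mf x * p1 (x, 0) + p2 (x, 0) * mf x
      = - (pd2 p2 (x, 0) - p2 (x, 0) / p1 (x, 0) * pd2 p1 (x, 0))" if x: "(x, 0) \<in> Om" for x
  proof -
    have xI: "x \<in> ?I" and xU: "(x, 0) \<in> U" using J[OF x] by auto
    have "(mf has_real_derivative (- deriv \<mu> x * exp (- l x) + \<mu> x * (deriv l x * exp (- l x)))) (at x)"
      unfolding mf_def[abs_def]
      using smooth_on_has_real_derivative[OF \<mu>(1) xI] smooth_on_has_real_derivative[OF sl xI]
      by (auto intro!: derivative_eq_intros)
    then have "x * deriv mf x = exp (- l x) * (\<mu> x * (x * deriv l x) - x * deriv \<mu> x)"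
      by (simp add: DERIV_imp_deriv algebra_simps)
    also have "x * deriv \<mu> x = lam * \<mu> x + M2 P1 P2 m x" using \<mu>(2)[OF xI] by simp
    also have "x * deriv l x = p2 (x, 0) / p1 (x, 0) + lam" by (rule ode_l[OF x])
    also have "exp (- l x) * (\<mu> x * (p2 (x, 0) / p1 (x, 0) + lam) - (lam * \<mu> x + M2 P1 P2 m x))
        = exp (- l x) * (\<mu> x * p2 (x, 0) / p1 (x, 0)) - exp (- l x) * M2 P1 P2 m x" by (simp add: algebra_simps)
    also have "exp (- l x) * M2 P1 P2 m x = (D2 P2 (x, m) * p1 (x, 0) - p2 (x, 0) * D2 P1 (x, m)) / (p1 (x, 0))\<^sup>2"
      using M2_eq[OF m xI] by (simp add: fM_def l_def p1_def p2_def exp_minus)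
    finally have xd: "x * deriv mf x = exp (- l x) * (\<mu> x * p2 (x, 0) / p1 (x, 0))
        - (D2 P2 (x, m) * p1 (x, 0) - p2 (x, 0) * D2 P1 (x, m)) / (p1 (x, 0))\<^sup>2" .
    have mfx: "mf x = - \<mu> x * exp (- l x)" by (simp add: mf_def)
    have "x * deriv mf x * p1 (x, 0) + p2 (x, 0) * mf x
        = - (D2 P2 (x, m) - p2 (x, 0) / p1 (x, 0) * D2 P1 (x, m))"
      unfolding xd mfx using pos[OF x] by (simp add: field_simps power2_eq_square)
    then show ?thesis
      using D2_has_real_derivative(2)[OF smooth_P(1) m xU] D2_has_real_derivative(2)[OF smooth_P(2) m xU]
      by (simp add: p1_def[abs_def] p2_def[abs_def])
  qed
  have A2e: "A2 P1 P2 n2 m x = exp (real n2 * l x) / p1 (x, 0)" if "x \<in> ?I" for x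
    using A2_eq[OF m that, of n2] by (simp add: fA_def l_def p1_def exp_of_nat_mult)
  have ode_y0: "x * deriv y0 x + (real n1 - real n2 * lam) * y0 x = exp (real n2 * l x) / p1 (x, 0)"
    if "(x, 0) \<in> Om" for x
    using y0(2)[OF J(1)[OF that]] A2e[OF J(1)[OF that]] by (simp add: algebra_simps)
  have ode_y1: "x * deriv y1 x + (real n1 - (real n2 + 1) * lam) * y1 x
      = - exp ((real n2 + 1) * l x) * (real n2 * mf x / p1 (x, 0) + pd2 p1 (x, 0) / (p1 (x, 0))\<^sup>2)"
    if x: "(x, 0) \<in> Om" for x
  proof -
    have xI: "x \<in> ?I" and xU: "(x, 0) \<in> U" using J[OF x] by auto
    have e: "exp ((real n2 + 1) * l x) = exp (real n2 * l x) * exp (l x)"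
      by (simp add: algebra_simps flip: exp_add)
    have "C2 P1 P2 n2 m x = - exp ((real n2 + 1) * l x) * (pd2 p1 (x, 0) / (p1 (x, 0))\<^sup>2)"
      using C2_eq[OF m xI, of n2] D2_has_real_derivative(2)[OF smooth_P(1) m xU]
      unfolding e by (simp add: fC_def l_def p1_def[abs_def] exp_of_nat_mult mult.commute)
    moreover have "real n2 * A2 P1 P2 n2 m x * \<mu> x = - exp ((real n2 + 1) * l x) * (real n2 * mf x / p1 (x, 0))"
      unfolding A2e[OF xI] e mf_def by (simp add: exp_minus)
    ultimately have "B2 P1 P2 n2 ?I m x = - exp ((real n2 + 1) * l x) * (real n2 * mf x / p1 (x, 0) + pd2 p1 (x, 0) / (p1 (x, 0))\<^sup>2)"
      by (simp add: B2_def \<mu>_def lam_def algebra_simps)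
    then show ?thesis using y1(2)[OF xI] by (simp add: algebra_simps)
  qed
  obtain K :: nat where K: "lam * real (n2 + 2) + 1 \<le> real K" using real_arch_simple by blast
  define E where "E z = - l (fst z) + snd z * mf (fst z)" for z :: "real \<times> real"
  define Q where "Q z = y0 (fst z) * exp (real n2 * E z) + y1 (fst z) * snd z * exp ((real n2 + 1) * E z)" for z :: "real \<times> real"
  have "\<exists>qH rH qG rG. smooth_on Om qH \<and> smooth_on Om rH \<and> smooth_on Om qG \<and> smooth_on Om rG \<and>
      smooth_on Om (\<lambda>z. E z) \<and> smooth_on Om (\<lambda>z. Q z) \<and>
      (\<forall>z\<in>Om. lam * p1 z + p2 z + saddle_op p1 p2 0 0 (\<lambda>z. E z + snd z ^ 2 * qH z) z
          = fst z ^ K * snd z ^ 2 * rH z \<and>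
        saddle_op p1 p2 (real n1) (real n2) (\<lambda>z. Q z + snd z ^ 2 * qG z) z
          = 1 + fst z ^ K * snd z ^ 2 * rG z)"
    unfolding Q_def E_def
    by (rule approximate_integrals[OF Om Om_ne smU _ _ lam_eq irr restrict[OF sl] restrict[OF smf]
        restrict[OF y0(1)] restrict[OF y1(1)]])
      (fact pos neg ode_l ode_m ode_y0 ode_y1)+
  then obtain qH rH qG rG where q: "smooth_on Om qH" "smooth_on Om rH" "smooth_on Om qG" "smooth_on Om rG"
      "smooth_on Om E" "smooth_on Om Q"
    and HG: "\<forall>z\<in>Om. lam * p1 z + p2 z + saddle_op p1 p2 0 0 (\<lambda>z. E z + snd z ^ 2 * qH z) z
          = fst z ^ K * snd z ^ 2 * rH z \<and>
        saddle_op p1 p2 (real n1) (real n2) (\<lambda>z. Q z + snd z ^ 2 * qG z) z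
          = 1 + fst z ^ K * snd z ^ 2 * rG z"
    by (elim exE conjE) (rule that)
  note H = conjunct1[OF bspec[OF HG]] and G = conjunct2[OF bspec[OF HG]]
  define qE where "qE z = E z + snd z ^ 2 * qH z" for z
  define qQ where "qQ z = Q z + snd z ^ 2 * qG z" for z
  have sq: "smooth_on Om qE" "smooth_on Om qQ"
    unfolding qE_def[abs_def] qQ_def[abs_def] by (intro smooth_intros oOm q)+
  define lH where "lH z = lam * ln (fst z) + ln (snd z) + qE z" for z
  define GG where "GG z = fst z ^ n1 * (snd z ^ n2 * qQ z)" for z
  define X where "X z = (1 / (fst z ^ n1 * snd z ^ n2)) *\<^sub>R (fst z * p1 z, snd z * p2 z)" for z
  have X: "X = X_field n1 n2 P1 P2 m"
    by (simp add: fun_eq_iff X_def X_field_def saddle_field_def p1_def p2_def)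
  have "\<exists>V C. open V \<and> {0} \<times> {0..v} \<union> {0..u} \<times> {0} \<subseteq> V \<and>
    (\<forall>p q \<tau>. orbit_arc (\<lambda>z. X z) (V \<inter> {0<..} \<times> {0<..}) p \<tau> q \<longrightarrow>
      \<bar>lH q - lH p\<bar> \<le> C * exp (lH p) ^ 2 \<and> \<bar>GG q - GG p - \<tau>\<bar> \<le> C * exp (lH p) ^ (n2 + 2))"
    unfolding lH_def GG_def X_def
    by (rule orbit_estimates[OF oOm smU _ _ lam0 K sq(1) q(2) sq(2) q(4) _ _ path])
      (fact pos neg H[folded qE_def] G[folded qQ_def])+
  then obtain V C where V: "open V" "{0} \<times> {0..v} \<union> {0..u} \<times> {0} \<subseteq> V"
    and VC: "\<forall>p q \<tau>. orbit_arc X (V \<inter> {0<..} \<times> {0<..}) p \<tau> q \<longrightarrow>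
      \<bar>lH q - lH p\<bar> \<le> C * exp (lH p) ^ 2 \<and> \<bar>GG q - GG p - \<tau>\<bar> \<le> C * exp (lH p) ^ (n2 + 2)"
    by (elim exE conjE) (rule that)
  note est = VC[rule_format]
  let ?e = "{-\<epsilon><..<\<epsilon>}"
  have e: "open ?e" "is_interval ?e" "0 \<in> ?e" using eps_rho by (auto simp: is_interval_oo)
  define a1 b1 a2 b2 where ab: "a1 s = fst (\<sigma>1 s m)" "b1 s = snd (\<sigma>1 s m)" "a2 s = fst (\<sigma>2 s m)" "b2 s = snd (\<sigma>2 s m)" for s
  note s\<sigma>1 = smooth_section_param(4)[OF smooth_sections(1) m]
  note s\<sigma>2 = smooth_section_param(4)[OF smooth_sections(2) m]
  have sab: "smooth_on ?e a1" "smooth_on ?e b1" "smooth_on ?e a2" "smooth_on ?e b2"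
    unfolding ab[abs_def] by (intro smooth_on_fst smooth_on_snd s\<sigma>1 s\<sigma>2 e)+
  have ab0: "a1 0 = 0" "b1 0 = v" "a2 0 = u" "b2 0 = 0" using sec0 by (simp_all add: ab u_def v_def)
  obtain R1 where R1: "smooth_on ?e R1" "R1 0 = deriv a1 0" "\<And>x. x \<in> ?e \<Longrightarrow> a1 x = x * R1 x"
    using taylor_1[OF e sab(1)] ab0 by auto
  obtain R2 where R2: "smooth_on ?e R2" "R2 0 = deriv b2 0" "\<And>x. x \<in> ?e \<Longrightarrow> b2 x = x * R2 x"
    using taylor_1[OF e sab(4)] ab0 by auto
  have R10: "R1 0 > 0" and R20: "R2 0 = s221" "s221 > 0"
    using R1(2) R2(2) sec0(5,6) by (simp_all add: ab[abs_def] s221_def)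
  have \<sigma>0: "\<sigma>1 0 m = (0, v)" "\<sigma>2 0 m = (u, 0)" using ab0 by (simp_all add: ab prod_eq_iff)
  have ev: "eventually (\<lambda>s. s \<in> ?e \<and> R1 s > 0 \<and> b1 s > 0 \<and> R2 s > 0 \<and> a2 s > 0 \<and> \<sigma>1 s m \<in> Om \<and> \<sigma>2 s m \<in> Om) (nhds 0)"
  proof -
    have c: "isCont f 0" if "smooth_on ?e f" for f :: "real \<Rightarrow> 'b::real_normed_vector"
      by (rule smooth_on_isCont[OF that e(3)])
    have "\<sigma>1 0 m \<in> Om" "\<sigma>2 0 m \<in> Om" unfolding \<sigma>0 using path u v by auto
    then have "eventually (\<lambda>s. \<sigma>1 s m \<in> Om) (nhds 0)" "eventually (\<lambda>s. \<sigma>2 s m \<in> Om) (nhds 0)"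
      using topological_tendstoD[of "\<lambda>s. \<sigma>1 s m" "\<sigma>1 0 m" "nhds 0" Om] topological_tendstoD[of "\<lambda>s. \<sigma>2 s m" "\<sigma>2 0 m" "nhds 0" Om]
        c[OF s\<sigma>1] c[OF s\<sigma>2] oOm by (simp_all add: isCont_def tendsto_nhds_iff)
    moreover have "eventually (\<lambda>s. s \<in> ?e) (nhds 0)" by (rule eventually_nhds_in_open[OF e(1,3)])
    moreover have "eventually (\<lambda>s. R1 s > 0) (nhds 0)" by (rule isCont_eventually_gt[OF c[OF R1(1)] R10])
    moreover have "eventually (\<lambda>s. R2 s > 0) (nhds 0)" by (rule isCont_eventually_gt[OF c[OF R2(1)]]) (simp add: R20)
    moreover have "eventually (\<lambda>s. b1 s > 0) (nhds 0)" by (rule isCont_eventually_gt[OF c[OF sab(2)]]) (simp add: ab0 v)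
    moreover have "eventually (\<lambda>s. a2 s > 0) (nhds 0)" by (rule isCont_eventually_gt[OF c[OF sab(3)]]) (simp add: ab0 u)
    ultimately show ?thesis by eventually_elim blast
  qed
  then obtain r where r: "r > 0" "\<And>s. \<bar>s\<bar> < r \<Longrightarrow> s \<in> ?e \<and> R1 s > 0 \<and> b1 s > 0 \<and> R2 s > 0 \<and> a2 s > 0 \<and> \<sigma>1 s m \<in> Om \<and> \<sigma>2 s m \<in> Om"
    unfolding eventually_nhds_metric by (auto simp: dist_real_def)
  let ?r = "{-r<..<r}"
  have ri: "open ?r" "is_interval ?r" "0 \<in> ?r" using r(1) by (auto simp: is_interval_oo)
  have rr: "s \<in> ?e" "R1 s > 0" "b1 s > 0" "R2 s > 0" "a2 s > 0" "\<sigma>1 s m \<in> Om" "\<sigma>2 s m \<in> Om" if "s \<in> ?r" for s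
    using r(2)[of s] that by auto
  have rsub: "?r \<subseteq> ?e" using rr(1) by blast
  note sr = smooth_on_subset[OF _ rsub]
  have comp1: "smooth_on ?r (\<lambda>s. f (\<sigma>1 s m))" and comp2: "smooth_on ?r (\<lambda>s. f (\<sigma>2 s m))"
    if "smooth_on Om f" for f :: "real \<times> real \<Rightarrow> real"
    using smooth_on_compose[OF ri(1) oOm rr(6) that sr[OF s\<sigma>1]] smooth_on_compose[OF ri(1) oOm rr(7) that sr[OF s\<sigma>2]] by auto
  \<comment> \<open>Values of the integrals on the sections: \<open>exp lH\<close> is
    \<open>s^lam \<kappa>(s)\<close> on the first and \<open>d \<eta>(d)\<close> on the second,
    \<open>GG\<close> is \<open>g(s)\<close> on the first and
    \<open>(d \<eta>(d))^n2 \<xi>(d)\<close> on the second. The factors \<open>R1\<close> and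
    \<open>R2\<close> absorb the simple zeros of the coordinates at 0.\<close>
  define \<kappa> where "\<kappa> s = R1 s powr lam * b1 s * exp (qE (\<sigma>1 s m))" for s
  define g where "g s = GG (\<sigma>1 s m)" for s
  define \<eta> where "\<eta> d = a2 d powr lam * R2 d * exp (qE (\<sigma>2 d m))" for d
  define \<xi> where "\<xi> d = a2 d ^ n1 * qQ (\<sigma>2 d m) / (a2 d powr lam * exp (qE (\<sigma>2 d m))) ^ n2" for d
  have nz: "(a2 s powr lam * exp (qE (\<sigma>2 s m))) ^ n2 \<noteq> 0" if "s \<in> ?r" for s
    using rr(5)[OF that] by simp
  have s\<kappa>: "smooth_on ?r \<kappa>" unfolding \<kappa>_def[abs_def]
    by (intro smooth_on_mult smooth_on_powr smooth_on_exp smooth_on_const ri comp1 sq sr R1 sab rr)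
  have sg: "smooth_on ?r g" unfolding g_def[abs_def] GG_def ab(1,2)[symmetric]
    by (intro smooth_on_mult smooth_on_power ri comp1 sq sr sab)
  have s\<eta>: "smooth_on ?r \<eta>" unfolding \<eta>_def[abs_def]
    by (intro smooth_on_mult smooth_on_powr smooth_on_exp smooth_on_const ri comp2 sq sr R2 sab rr)
  have s\<xi>: "smooth_on ?r \<xi>" unfolding \<xi>_def[abs_def]
    by (intro smooth_on_divide smooth_on_mult smooth_on_power smooth_on_powr smooth_on_exp smooth_on_const nz ri comp2 sq sr sab rr)
  have E0: "qE (u, 0) = - l u" by (simp add: qE_def E_def)
  have L: "L = exp (l u)" using L2l[OF u(2)] by (simp add: L_def u_def)
  have \<eta>0: "\<eta> 0 = u powr lam * s221 / L"
    by (simp add: \<eta>_def ab0 R20 \<sigma>0 E0 L exp_minus divide_inverse)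
  have \<kappa>0: "\<kappa> 0 > 0" using R10 v by (simp add: \<kappa>_def ab0)
  have \<xi>': "deriv \<xi> 0 = u ^ n1 * u powr (- lam * real n2) * (A2 P1 P2 n2 m u * s211 / u + y1 u * s221 / L)"
  proof -
    define w where "w d = b2 d ^ 2 * qH (\<sigma>2 d m)" for d
    \<comment> \<open>Splits \<open>\<xi>\<close> as \<open>F(a2) exp (- n2 w) + b2 Z\<close>, where
      \<open>w\<close> is of order \<open>d^2\<close> and \<open>b2\<close> vanishes at 0. By the
      equation for \<open>y0\<close>, the derivative of \<open>F(x) = x^(n1 - lam n2) y0(x)\<close>
      is \<open>x^(n1 - lam n2 - 1) A2(x)\<close>, so \<open>y0\<close> itself drops out.\<close>
    define F where "F x = x ^ n1 * (x powr (- lam * real n2) * y0 x)" for x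
    define Z where "Z d = a2 d ^ n1 * (a2 d powr (- lam * real n2) * (y1 (a2 d) * exp (E (\<sigma>2 d m) - real n2 * w d)
      + b2 d * (qG (\<sigma>2 d m) * exp (- real n2 * qE (\<sigma>2 d m)))))" for d
    have aJ: "a2 d \<in> ?I" if "d \<in> ?r" for d
      using Om_U[OF rr(7)[OF that]] by (auto simp: ab)
    have sy1: "smooth_on ?r (\<lambda>d. y1 (a2 d))"
      by (rule smooth_on_compose[OF ri(1) I(1) aJ y1(1) sr[OF sab(3)]])
    have sw: "smooth_on ?r w" unfolding w_def[abs_def] by (intro smooth_on_mult smooth_on_power ri comp2 q sr sab)
    have sZ: "smooth_on ?r Z" unfolding Z_def[abs_def]
      by (intro smooth_on_mult smooth_on_add smooth_on_diff smooth_on_power smooth_on_powr smooth_on_exp smooth_on_const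
          ri comp2 sq q sr sab rr sy1 sw)
    have dF: "(F has_real_derivative u ^ n1 * u powr (- lam * real n2) * A2 P1 P2 n2 m u / u) (at u)"
    proof -
      have "(F has_real_derivative real n1 * u ^ (n1 - 1) * (u powr (- lam * real n2) * y0 u)
          + u ^ n1 * ((- lam * real n2) * u powr (- lam * real n2 - 1) * y0 u + u powr (- lam * real n2) * deriv y0 u)) (at u)"
        unfolding F_def[abs_def] using u(1) smooth_on_has_real_derivative[OF y0(1) u(2)]
        by (auto intro!: derivative_eq_intros has_real_derivative_powr)
      moreover have "real n1 * u ^ (n1 - 1) * (u powr (- lam * real n2) * y0 u)
          + u ^ n1 * ((- lam * real n2) * u powr (- lam * real n2 - 1) * y0 u + u powr (- lam * real n2) * deriv y0 u)
          = u ^ n1 * u powr (- lam * real n2) * (u * deriv y0 u - (lam * real n2 - real n1) * y0 u) / u"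
      proof -
        have e1: "real n1 * u ^ (n1 - 1) = real n1 * u ^ n1 / u" using u(1) by (cases n1) auto
        have e2: "u powr (- lam * real n2 - 1) = u powr (- lam * real n2) / u"
          using u(1) by (simp add: powr_diff)
        show ?thesis unfolding e1 e2 using u(1) by (simp add: field_simps)
      qed
      ultimately show ?thesis using y0(2)[OF u(2)] by simp
    qed
    have da: "(a2 has_real_derivative s211) (at 0)"
      using smooth_on_has_real_derivative[OF sab(3) e(3)] by (simp add: s211_def ab[abs_def])
    have db: "(b2 has_real_derivative s221) (at 0)"
      using smooth_on_has_real_derivative[OF sab(4) e(3)] by (simp add: s221_def ab[abs_def])
    have dw: "(w has_real_derivative 0) (at 0)"
      unfolding w_def[abs_def]
      using db smooth_on_has_real_derivative[OF comp2[OF q(1)] ri(3)]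
      by (auto intro!: derivative_eq_intros simp: ab0)
    have w0: "w 0 = 0" by (simp add: w_def ab0)
    have "((\<lambda>d. F (a2 d)) has_real_derivative u ^ n1 * u powr (- lam * real n2) * A2 P1 P2 n2 m u / u * s211) (at 0)"
      using DERIV_chain2[OF dF[folded ab0(3)] da] unfolding ab0(3) .
    then have "((\<lambda>d. F (a2 d) * exp (- real n2 * w d) + b2 d * Z d) has_real_derivative
        u ^ n1 * u powr (- lam * real n2) * A2 P1 P2 n2 m u / u * s211 + s221 * Z 0) (at 0)"
      using db dw smooth_on_has_real_derivative[OF sZ ri(3)]
      by (auto intro!: derivative_eq_intros simp: w0 ab0)
    moreover have "F (a2 d) * exp (- real n2 * w d) + b2 d * Z d = \<xi> d" if d: "d \<in> ?r" for d
    proof -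
      have p: "(a2 d powr lam) ^ n2 = inverse (a2 d powr (- lam * real n2))"
        using rr(5)[OF d] by (simp add: powr_power powr_minus mult.commute)
      have qe: "qE (\<sigma>2 d m) = E (\<sigma>2 d m) + w d" by (simp add: qE_def w_def ab)
      have x: "exp (qE (\<sigma>2 d m)) ^ n2 = inverse (exp (- real n2 * qE (\<sigma>2 d m)))"
        by (simp add: exp_of_nat_mult[symmetric] exp_minus)
      have "\<xi> d = a2 d ^ n1 * (a2 d powr (- lam * real n2) * (qQ (\<sigma>2 d m) * exp (- real n2 * qE (\<sigma>2 d m))))"
        unfolding \<xi>_def power_mult_distrib p x by (simp add: divide_inverse)
      also have "qQ (\<sigma>2 d m) * exp (- real n2 * qE (\<sigma>2 d m)) =
          y0 (a2 d) * (exp (real n2 * E (\<sigma>2 d m)) * exp (- real n2 * qE (\<sigma>2 d m)))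
          + b2 d * (y1 (a2 d) * (exp ((real n2 + 1) * E (\<sigma>2 d m)) * exp (- real n2 * qE (\<sigma>2 d m)))
            + b2 d * (qG (\<sigma>2 d m) * exp (- real n2 * qE (\<sigma>2 d m))))"
        by (simp add: qQ_def Q_def ab power2_eq_square algebra_simps)
      also have "exp (real n2 * E (\<sigma>2 d m)) * exp (- real n2 * qE (\<sigma>2 d m)) = exp (- real n2 * w d)"
        unfolding qe by (simp add: algebra_simps flip: exp_add)
      also have "exp ((real n2 + 1) * E (\<sigma>2 d m)) * exp (- real n2 * qE (\<sigma>2 d m)) = exp (E (\<sigma>2 d m) - real n2 * w d)"
        unfolding qe by (simp add: algebra_simps flip: exp_add)
      finally show ?thesis by (simp add: F_def Z_def algebra_simps)
    qed
    ultimately have "(\<xi> has_real_derivative u ^ n1 * u powr (- lam * real n2) * A2 P1 P2 n2 m u / u * s211 + s221 * Z 0) (at 0)"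
      using has_field_derivative_transform_within_open[OF _ ri(1,3)] by blast
    then have "deriv \<xi> 0 = u ^ n1 * u powr (- lam * real n2) * A2 P1 P2 n2 m u / u * s211 + s221 * Z 0"
      by (rule DERIV_imp_deriv)
    also have "Z 0 = u ^ n1 * u powr (- lam * real n2) * (y1 u / L)"
      by (simp add: Z_def ab0 w0 \<sigma>0 E_def L exp_minus divide_inverse)
    finally show ?thesis by (simp add: algebra_simps)
  qed
  \<comment> \<open>The neighbourhood \<open>V\<close> makes the orbit estimates applicable to the
    arc, and the bound \<open>r\<close> places the arrival parameter where \<open>\<eta>\<close> and
    \<open>\<xi>\<close> are smooth.\<close>
  obtain Vm s0 where Vm: "m \<in> Vm" "s0 > 0" and arc: "\<And>s. s \<in> {0<..<s0} \<Longrightarrow> 0 < D s m \<and> D s m < r \<and>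
      orbit_arc (X_field n1 n2 P1 P2 m) (V \<inter> U \<inter> {0<..} \<times> {0<..}) (\<sigma>1 s m) (\<tau> s m) (\<sigma>2 (D s m) m)"
  proof -
    have "open V \<and> corner_path \<sigma>1 \<sigma>2 m \<subseteq> V \<and> r > 0"
      using V r(1) by (simp add: corner_path_def u_def v_def)
    then have "\<exists>Vm s0. open Vm \<and> m \<in> Vm \<and> s0 > 0 \<and> (\<forall>m\<in>Vm \<inter> hat W. \<forall>s\<in>{0<..<s0}. 0 < D s m \<and> D s m < r \<and>
        orbit_arc (X_field n1 n2 P1 P2 m) (V \<inter> U \<inter> {0<..} \<times> {0<..}) (\<sigma>1 s m) (\<tau> s m) (\<sigma>2 (D s m) m))"
      using dmt m unfolding dulac_map_time_def by blast
    then show ?thesis using that m by blast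
  qed
  have ev0: "eventually (\<lambda>s. s \<in> {0<..<min s0 r}) (at_right 0)"
    by (rule eventually_at_right_real) (use Vm r in simp)
  have bounds: "D s m > 0 \<and>
      \<bar>ln (D s m * \<eta> (D s m)) - ln (s powr lam * \<kappa> s)\<bar> \<le> C * (s powr lam * \<kappa> s) ^ 2 \<and>
      \<bar>(D s m * \<eta> (D s m)) ^ n2 * \<xi> (D s m) - g s - \<tau> s m\<bar> \<le> C * (s powr lam * \<kappa> s) ^ (n2 + 2)"
    if s: "s \<in> {0<..<min s0 r}" for s
  proof -
    have s': "s \<in> {0<..<s0}" "s \<in> ?r" "s > 0" using s by auto
    define d where "d = D s m"
    have d: "d > 0" "d \<in> ?r" using arc[OF s'(1)] r(1) by (auto simp: d_def)
    have o: "orbit_arc X (V \<inter> {0<..} \<times> {0<..}) (\<sigma>1 s m) (\<tau> s m) (\<sigma>2 d m)"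
      using arc[OF s'(1)] orbit_arc_mono[of X "V \<inter> U \<inter> {0<..} \<times> {0<..}" _ _ _ "V \<inter> {0<..} \<times> {0<..}"]
      unfolding X d_def by blast
    note q1 = rr[OF s'(2)] and q2 = rr[OF d(2)]
    have 1: "exp (lH (\<sigma>1 s m)) = s powr lam * \<kappa> s"
    proof -
      have "exp (lH (\<sigma>1 s m)) = a1 s powr lam * b1 s * exp (qE (\<sigma>1 s m))"
        using q1 s' R1(3)[OF q1(1)] by (simp add: lH_def ab(1,2)[symmetric] exp_add powr_def)
      then show ?thesis using q1 s' R1(3)[OF q1(1)] by (simp add: \<kappa>_def powr_mult)
    qed
    have 2: "d * \<eta> d = exp (lH (\<sigma>2 d m))"
    proof -
      have "exp (lH (\<sigma>2 d m)) = a2 d powr lam * b2 d * exp (qE (\<sigma>2 d m))"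
        using q2 d R2(3)[OF q2(1)] by (simp add: lH_def ab(3,4)[symmetric] exp_add powr_def)
      then show ?thesis using R2(3)[OF q2(1)] by (simp add: \<eta>_def)
    qed
    have 3: "(d * \<eta> d) ^ n2 * \<xi> d = GG (\<sigma>2 d m)"
    proof -
      have "d * \<eta> d = b2 d * (a2 d powr lam * exp (qE (\<sigma>2 d m)))" using R2(3)[OF q2(1)] by (simp add: \<eta>_def)
      then have "(d * \<eta> d) ^ n2 * \<xi> d = b2 d ^ n2 * (a2 d ^ n1 * qQ (\<sigma>2 d m))"
        using q2(5) by (simp add: \<xi>_def power_mult_distrib)
      then show ?thesis by (simp add: GG_def ab mult.left_commute)
    qed
    show ?thesis
      using est[OF o] d unfolding d_def[symmetric] 3 unfolding 2 g_def unfolding 1[symmetric] ln_exp by blast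
  qed
  \<comment> \<open>Smaller than both 1 and \<open>lam\<close>, so that the index set up to
    \<open>\<delta>\<close> consists of \<open>(0, 0)\<close> and the expansion of the Dulac map
    reduces to its leading term.\<close>
  define \<delta> where "\<delta> = min 1 lam / 2"
  have \<delta>: "\<delta> > 0" "\<delta> < 1" "\<delta> < lam" using lam0 by (auto simp: \<delta>_def min_def)
  have Dasym: "(\<lambda>s. D s m - \<Delta> 0 0 m * s powr lam) \<in> O[at_right 0](\<lambda>s. s powr (lam + \<delta>))"
  proof -
    have B: "Bset (0, 0) lam \<delta> = {(0, 0)}"
    proof -
      have "i = 0 \<and> j = 0" if "real i + lam * real j \<le> \<delta>" for i j
      proof -
        have "i = 0"
        proof (rule ccontr)
          assume "i \<noteq> 0"
          then have "1 \<le> real i" by simp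
          moreover have "0 \<le> lam * real j" using lam0 by simp
          ultimately show False using that \<delta> by linarith
        qed
        moreover have "j = 0"
        proof (rule ccontr)
          assume "j \<noteq> 0"
          then have "lam * 1 \<le> lam * real j" using lam0 by (intro mult_left_mono) auto
          then show False using that \<delta> by linarith
        qed
        ultimately show ?thesis by simp
      qed
      then show ?thesis using \<delta> by (auto simp: Bset_def Lam_def)
    qed
    have "lam + \<delta> > 0 \<and> lam > 0 \<and> lam \<notin> DL (0, 0) (lam + \<delta> - lam)"
      using lam0 \<delta> irrational_not_DL[OF irr] by simp
    then have "flat_on (lam + \<delta>) ({lam} \<times> W) (\<lambda>s m. D s m - s powr fst m *
        (\<Sum>(i, j)\<in>Bset (0, 0) lam (lam + \<delta> - lam). \<Delta> i j m * s powr (real i + fst m * real j)))"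
      using dmc unfolding dulac_map_coeffs_def by blast
    from flat_on_bigo[OF this, of m] m
    have "(\<lambda>s. D s m - s powr lam * (\<Delta> 0 0 m * s powr 0)) \<in> O[at_right 0](\<lambda>s. s powr (lam + \<delta>))"
      using B by (auto simp: lam_def mem_Times_iff)
    moreover have "eventually (\<lambda>s. D s m - s powr lam * (\<Delta> 0 0 m * s powr 0) = D s m - \<Delta> 0 0 m * s powr lam) (at_right 0)"
      using eventually_at_right_less[of 0] by eventually_elim (simp add: mult.commute)
    ultimately show ?thesis using landau_o.big.in_cong by fast
  qed
  define LL where "LL = lam * real (n2 + 1) + 1"
  have LL: "LL > lam * real (n2 + 1)" "LL > 0"
    using lam0 by (auto simp: LL_def intro: add_nonneg_pos)
  have Tasym: "(\<lambda>s. \<tau> s m - (\<Sum>(i, j)\<in>Bset (n1, n2) lam LL. T i j m * s powr (real i + lam * real j))) \<in> O[at_right 0](\<lambda>s. s powr LL)"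
  proof -
    have "LL > 0 \<and> lam > 0 \<and> lam \<notin> DL (n1, n2) LL"
      using lam0 LL irrational_not_DL[OF irr] by simp
    then have "flat_on LL ({lam} \<times> W) (\<lambda>s m. \<tau> s m -
        (\<Sum>(i, j)\<in>Bset (n1, n2) lam LL. T i j m * s powr (real i + fst m * real j)))"
      using dtc unfolding dulac_time_coeffs_def by blast
    from flat_on_bigo[OF this, of m] m show ?thesis by (auto simp: lam_def mem_Times_iff)
  qed
  have B: "(0, n2 + 1) \<in> Bset (n1, n2) lam LL" using LL by (simp add: Bset_def Lam_def)
  have "T 0 (n2 + 1) m = deriv \<xi> 0 * \<eta> 0 ^ n2 * \<Delta> 0 0 m ^ (n2 + 1)"
  proof (rule dulac_time_coefficient[where D = "\<lambda>s. D s m" and T = "\<lambda>i j. T i j m" and \<tau> = "\<lambda>s. \<tau> s m",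
        OF ri s\<kappa> sg s\<eta> s\<xi> \<kappa>0 _ lam0 \<delta>(1) irr _ Dasym _ _ finite_Bset[OF lam0] B LL(1) Tasym])
    show "\<eta> 0 > 0" using u R20 by (simp add: \<eta>0 L)
    show "eventually (\<lambda>s. 0 < D s m) (at_right 0)"
      "eventually (\<lambda>s. \<bar>ln (D s m * \<eta> (D s m)) - ln (s powr lam * \<kappa> s)\<bar> \<le> C * (s powr lam * \<kappa> s) ^ 2) (at_right 0)"
      "eventually (\<lambda>s. \<bar>(D s m * \<eta> (D s m)) ^ n2 * \<xi> (D s m) - g s - \<tau> s m\<bar> \<le> C * (s powr lam * \<kappa> s) ^ (n2 + 2)) (at_right 0)"
      using ev0 by (eventually_elim, use bounds in blast)+
  qed
  also have "\<eta> 0 ^ n2 = u powr (lam * real n2) * (s221 / L) ^ n2"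
    unfolding \<eta>0 using u by (simp add: power_mult_distrib powr_power power_divide mult.commute)
  also have "deriv \<xi> 0 * (u powr (lam * real n2) * (s221 / L) ^ n2) * \<Delta> 0 0 m ^ (n2 + 1) =
      \<Delta> 0 0 m ^ (n2 + 1) * (s221 / L) ^ n2 * u ^ n1 * (A2 P1 P2 n2 m u * s211 / u + y1 u * s221 / L)"
  proof -
    have "u powr (- lam * real n2) * u powr (lam * real n2) = 1" using u by (simp flip: powr_add)
    then show ?thesis unfolding \<xi>' by (simp add: algebra_simps)
  qed
  finally show ?thesis by (simp add: y1_def lam_def)
qed

end

section \<open>Poles of the coefficient\<close>

lemma leibniz_sum:
  fixes F G :: "nat \<Rightarrow> real"
  shows "(\<Sum>j\<le>n. real (n choose j) * (F (Suc j) * G (n - j) + F j * G (Suc n - j)))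
    = (\<Sum>j\<le>Suc n. real (Suc n choose j) * (F j * G (Suc n - j)))"
proof -
  have "(\<Sum>j\<le>Suc n. real (Suc n choose j) * (F j * G (Suc n - j)))
      = F 0 * G (Suc n) + (\<Sum>j\<le>n. real (Suc n choose Suc j) * (F (Suc j) * G (n - j)))"
    by (subst sum.atMost_Suc_shift) simp
  also have "\<dots> = (\<Sum>j\<le>n. real (n choose j) * (F (Suc j) * G (n - j)))
      + (F 0 * G (Suc n) + (\<Sum>j\<le>n. real (n choose Suc j) * (F (Suc j) * G (n - j))))"
    by (simp add: algebra_simps sum.distrib)
  also have "F 0 * G (Suc n) + (\<Sum>j\<le>n. real (n choose Suc j) * (F (Suc j) * G (n - j)))
      = (\<Sum>j\<le>Suc n. real (n choose j) * (F j * G (Suc n - j)))"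
    by (subst sum.atMost_Suc_shift) simp
  also have "\<dots> = (\<Sum>j\<le>n. real (n choose j) * (F j * G (Suc n - j)))"
    by simp
  finally show ?thesis by (simp add: algebra_simps sum.distrib)
qed

lemma nderiv_mult:
  fixes f g :: "real \<Rightarrow> real"
  assumes I: "open I" and f: "smooth_on I f" and g: "smooth_on I g" and x: "x \<in> I"
  shows "nderiv n (\<lambda>x. f x * g x) x = (\<Sum>j\<le>n. real (n choose j) * (nderiv j f x * nderiv (n - j) g x))"
  using x
proof (induction n arbitrary: x)
  case (Suc n)
  have "eventually (\<lambda>x. nderiv n (\<lambda>x. f x * g x) x
      = (\<Sum>j\<le>n. real (n choose j) * (nderiv j f x * nderiv (n - j) g x))) (nhds x)"
    using eventually_nhds_in_open[OF I Suc.prems] by eventually_elim (rule Suc.IH)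
  then have "nderiv (Suc n) (\<lambda>x. f x * g x) x
      = deriv (\<lambda>x. \<Sum>j\<le>n. real (n choose j) * (nderiv j f x * nderiv (n - j) g x)) x"
    by (simp add: deriv_cong_ev)
  also have "\<dots> = (\<Sum>j\<le>n. real (n choose j) * (nderiv (Suc j) f x * nderiv (n - j) g x + nderiv j f x * nderiv (Suc n - j) g x))"
  proof (rule DERIV_imp_deriv, rule DERIV_sum)
    fix j assume "j \<in> {..n}"
    then have e: "Suc n - j = Suc (n - j)" by auto
    show "((\<lambda>x. real (n choose j) * (nderiv j f x * nderiv (n - j) g x)) has_real_derivative
      real (n choose j) * (nderiv (Suc j) f x * nderiv (n - j) g x + nderiv j f x * nderiv (Suc n - j) g x)) (at x)"
      unfolding e
      using DERIV_cmult[OF DERIV_mult[OF nderiv_has_real_derivative[OF I f Suc.prems, of j]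
            nderiv_has_real_derivative[OF I g Suc.prems, of "n - j"]], of "real (n choose j)"]
      by (simp only: mult.commute[of "nderiv (Suc (n - j)) g x"] add.commute)
  qed
  also have "\<dots> = (\<Sum>j\<le>Suc n. real (Suc n choose j) * (nderiv j f x * nderiv (Suc n - j) g x))"
    by (rule leibniz_sum)
  finally show ?case .
qed simp

lemma nderiv_add:
  fixes f g :: "real \<Rightarrow> real"
  assumes I: "open I" and f: "smooth_on I f" and g: "smooth_on I g" and x: "x \<in> I"
  shows "nderiv n (\<lambda>x. f x + g x) x = nderiv n f x + nderiv n g x"
  using x
proof (induction n arbitrary: x)
  case (Suc n)
  have "eventually (\<lambda>x. nderiv n (\<lambda>x. f x + g x) x = nderiv n f x + nderiv n g x) (nhds x)"
    using eventually_nhds_in_open[OF I Suc.prems] by eventually_elim (rule Suc.IH)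
  then have "nderiv (Suc n) (\<lambda>x. f x + g x) x = deriv (\<lambda>x. nderiv n f x + nderiv n g x) x"
    by (simp add: deriv_cong_ev)
  also have "\<dots> = nderiv (Suc n) f x + nderiv (Suc n) g x"
    by (rule DERIV_imp_deriv, rule DERIV_add[OF nderiv_has_real_derivative[OF I f Suc.prems]
          nderiv_has_real_derivative[OF I g Suc.prems]])
  finally show ?case .
qed simp

lemma nderiv_cmult:
  fixes f :: "real \<Rightarrow> real"
  assumes I: "open I" and f: "smooth_on I f" and x: "x \<in> I"
  shows "nderiv n (\<lambda>x. c * f x) x = c * nderiv n f x"
  using x
proof (induction n arbitrary: x)
  case (Suc n)
  have "eventually (\<lambda>x. nderiv n (\<lambda>x. c * f x) x = c * nderiv n f x) (nhds x)"
    using eventually_nhds_in_open[OF I Suc.prems] by eventually_elim (rule Suc.IH)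
  then have "nderiv (Suc n) (\<lambda>x. c * f x) x = deriv (\<lambda>x. c * nderiv n f x) x"
    by (simp add: deriv_cong_ev)
  also have "\<dots> = c * nderiv (Suc n) f x"
    by (rule DERIV_imp_deriv, rule DERIV_cmult[OF nderiv_has_real_derivative[OF I f Suc.prems]])
  finally show ?case .
qed simp

lemma nderiv_of_expansion:
  fixes f R :: "real \<Rightarrow> real"
  assumes I: "open I" "0 \<in> I" and R: "smooth_on I R" and "j < K"
    and f: "\<And>x. x \<in> I \<Longrightarrow> f x = (\<Sum>k<K. a k * x ^ k) + x ^ K * R x"
  shows "nderiv j f 0 = fact j * a j"
  using assms(4,5)
proof (induction j arbitrary: K a f)
  case 0
  then obtain K' where K: "K = Suc K'" by (cases K) auto
  have "f 0 = a 0" unfolding 0(2)[OF I(2)] K by (subst sum.lessThan_Suc_shift) simp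
  then show ?case by simp
next
  case (Suc j)
  then obtain K' where K: "K = Suc K'" by (cases K) auto
  define r where "r x = (\<Sum>k<K'. a (Suc k) * x ^ k) + x ^ K' * R x" for x
  have r: "smooth_on I r" unfolding r_def[abs_def] by (intro smooth_intros I R)
  have f: "f x = a 0 + x * r x" if "x \<in> I" for x
    unfolding Suc.prems(2)[OF that] K r_def
    by (subst sum.lessThan_Suc_shift) (simp add: algebra_simps sum_distrib_left)
  have "nderiv (Suc j) f 0 = nderiv (Suc j) (\<lambda>x. a 0 + x * r x) 0"
    by (rule nderiv_cong[OF I(1) _ I(2)]) (rule f)
  also have "\<dots> = real (Suc j) * nderiv j r 0"
    using nderiv_linear_plus[OF I(1) r I(2), of j "a 0"] by (simp del: funpow.simps of_nat_Suc)
  also have "nderiv j r 0 = fact j * a (Suc j)"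
    by (rule Suc.IH[of K' r "\<lambda>k. a (Suc k)"]) (use Suc.prems(1) K in \<open>auto simp: r_def\<close>)
  finally show ?case by (simp add: algebra_simps)
qed

text \<open>On Taylor coefficients the transform is division by \<open>k - a\<close>. The set
  \<open>E\<close> allows the use at a pole itself, for the coefficients that are not
  omitted.\<close>

lemma nderiv_mellin_reg:
  fixes f :: "real \<times> 'p::euclidean_space \<Rightarrow> real"
  assumes S: "radial_open S" and f: "smooth_on S f"
    and Q: "open Q" "snd ` S \<subseteq> Q" "smooth_on Q a" "\<And>p. p \<in> Q \<Longrightarrow> a p < real K - 1"
    and I: "open I" "0 \<in> I" "\<And>u. u \<in> I \<Longrightarrow> (u, p) \<in> S"
    and j: "j < K" "j \<notin> E"
  shows "nderiv j (\<lambda>u. mellin_reg E K f a (u, p)) 0 = nderiv j (\<lambda>u. f (u, p)) 0 / (real j - a p)"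
proof -
  let ?R = "radial_int ((hadamard ^^ K) f) (\<lambda>p. real K - a p - 1) 0"
  have "smooth_on S ?R"
    by (rule smooth_on_radial_int[OF S smooth_on_hadamard_iter[OF S f] Q(1,2)])
      (use Q in \<open>auto intro!: smooth_intros simp: algebra_simps\<close>)
  from smooth_on_slice[OF I(1) radial_open_open[OF S] I(3) this]
  have R: "smooth_on I (\<lambda>u. ?R (u, p))" by blast
  have "nderiv j (\<lambda>u. mellin_reg E K f a (u, p)) 0
      = fact j * (if j \<in> E then 0 else tcoef j f p / (real j - a p))"
  proof (rule nderiv_of_expansion[OF I(1,2) R j(1)])
    fix x
    have "(\<Sum>k<K. (if k \<in> E then 0 else tcoef k f p / (real k - a p)) * x ^ k)
        = (\<Sum>k\<in>{..<K} - E. tcoef k f p * x ^ k / (real k - a p))"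
      by (intro sum.mono_neutral_cong_right) auto
    then show "mellin_reg E K f a (x, p) = (\<Sum>k<K. (if k \<in> E then 0 else tcoef k f p / (real k - a p)) * x ^ k)
        + x ^ K * ?R (x, p)"
      by (simp add: mellin_reg_def)
  qed
  then show ?thesis
    using j(2) nderiv_0_eq_tcoef[OF S f I(3)[OF I(2)], of j] by simp
qed

lemma open_contains_irrational:
  fixes S :: "real set"
  assumes "open S" "x \<in> S"
  shows "\<exists>y\<in>S. y \<notin> \<rat>"
proof (rule ccontr)
  assume "\<not> ?thesis"
  then have sub: "S \<subseteq> \<rat>" by auto
  obtain e where e: "e > 0" "ball x e \<subseteq> S" using assms open_contains_ball by blast
  have "{x<..<x + e} \<subseteq> ball x e" by (auto simp: dist_real_def)
  then have "{x<..<x + e} \<subseteq> \<rat>" using e(2) sub by blast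
  then have "countable {x<..<x + e}" using countable_rat countable_subset by blast
  then show False using uncountable_open_interval[of x "x + e"] e(1) by simp
qed

lemma eventually_not_nat:
  "eventually (\<lambda>x. \<forall>k. real k \<noteq> a \<longrightarrow> x \<noteq> real k) (nhds a)"
proof -
  have "open (- (of_nat ` {k. real k \<noteq> a} :: real set))"
    by (intro open_Compl closed_of_nat_image)
  then have "eventually (\<lambda>x. x \<in> - (of_nat ` {k. real k \<noteq> a})) (nhds a)"
    by (rule eventually_nhds_in_open) auto
  then show ?thesis by eventually_elim auto
qed

context saddle_sections
begin

lemma smooth_at_section:
  fixes f :: "real \<times> 'n param \<Rightarrow> real"
  assumes "open V" "V \<subseteq> hat W" "smooth_on {x \<in> Dom2. snd x \<in> V} f"
  shows "smooth_on V (\<lambda>m. f (fst (\<sigma>2 0 m), m))"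
proof -
  have "open (Dom2 \<inter> snd -` V)" by (intro open_Int open_Dom2 open_vimage assms continuous_on_snd continuous_on_id)
  then have o: "open {x \<in> Dom2. snd x \<in> V}" by (simp add: vimage_def Int_def)
  have s: "smooth_on V (\<lambda>m. fst (\<sigma>2 0 m))"
    by (rule smooth_on_fst[OF assms(1) smooth_on_subset[OF smooth_section_param(1)[OF smooth_sections(2)] assms(2)]])
  show ?thesis
  proof (rule smooth_on_compose[OF assms(1) o _ assms(3)])
    show "smooth_on V (\<lambda>m. (fst (\<sigma>2 0 m), m))" by (intro smooth_on_Pair assms(1) s smooth_on_id)
    show "(fst (\<sigma>2 0 m), m) \<in> {x \<in> Dom2. snd x \<in> V}" if "m \<in> V" for m
    proof -
      have "m \<in> hat W" using that assms(2) by blast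
      then show ?thesis using that Dom2_I2[OF _ I2_interval(4)] by simp
    qed
  qed
qed

text \<open>The irrational ratios are dense, so a smooth function that agrees with the coefficient there is
  the smooth extension.\<close>

lemma coefficient_extension:
  fixes n1 n2 :: nat and D \<tau> :: "real \<Rightarrow> 'n param \<Rightarrow> real" and \<Delta> T :: "nat \<Rightarrow> nat \<Rightarrow> 'n param \<Rightarrow> real"
  defines "A \<equiv> ({0<..} - Dij (n1, n2) 0 (n2 + 1)) \<times> W"
  assumes n: "(n1, n2) \<noteq> (0, 0)"
    and dmt: "dulac_map_time W U P1 P2 n1 n2 \<sigma>1 \<sigma>2 D \<tau>"
    and dmc: "dulac_map_coeffs W D \<Delta>" and dtc: "dulac_time_coeffs W (n1, n2) \<tau> T"
    and V: "open V" "V \<subseteq> hat W" "(l0, \<mu>0) \<in> V" and N: "smooth_on V N" and p: "p \<noteq> 0"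
    and eq: "\<And>m. m \<in> V \<Longrightarrow> fst m \<notin> \<rat> \<Longrightarrow> (fst m - l0) ^ p *
      mellin (I2 \<sigma>2 \<rho> m) (B2 P1 P2 n2 (I2 \<sigma>2 \<rho> m) m) (fst m * real (n2 + 1) - real n1) (fst (\<sigma>2 0 m)) = N m"
  shows "extends_smooth_at A (\<lambda>m. (fst m - l0) ^ p * T 0 (n2 + 1) m) (l0, \<mu>0)" (is ?ext)
    and "((\<lambda>m. (fst m - l0) ^ p * T 0 (n2 + 1) m) \<longlongrightarrow>
      \<Delta> 0 0 (l0, \<mu>0) ^ (n2 + 1) * deriv (\<lambda>s. snd (\<sigma>2 s (l0, \<mu>0))) 0 ^ (n2 + 1)
        * fst (\<sigma>2 0 (l0, \<mu>0)) ^ n1 / L2 P1 P2 (l0, \<mu>0) (fst (\<sigma>2 0 (l0, \<mu>0))) ^ (n2 + 1) * N (l0, \<mu>0))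
      (at (l0, \<mu>0) within A)" (is ?lim)
proof -
  let ?m0 = "(l0, \<mu>0)"
  define u where "u m = fst (\<sigma>2 0 m)" for m
  define s211 where "s211 m = deriv (\<lambda>s. fst (\<sigma>2 s m)) 0" for m
  define s221 where "s221 m = deriv (\<lambda>s. snd (\<sigma>2 s m)) 0" for m
  \<comment> \<open>The formula of \<open>irrational_coefficient\<close> times
    \<open>(\<lambda> - l0)^p\<close>, with the transform of \<open>B2\<close> replaced by its
    regularization \<open>N\<close>. At \<open>l0\<close> the first summand is killed since
    \<open>p \<noteq> 0\<close>.\<close>
  define h where "h m = \<Delta> 0 0 m ^ (n2 + 1) * (s221 m / exp (lnL2 (u m, m))) ^ n2 * u m ^ n1 *
    ((fst m - l0) ^ p * (fA n2 (u m, m) * s211 m / u m) + N m * s221 m / exp (lnL2 (u m, m)))" for m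
  let ?f = "\<lambda>m. (fst m - l0) ^ p * T 0 (n2 + 1) m"
  have mh: "m \<in> hat W" if "m \<in> V" for m using that V(2) by blast
  have su: "smooth_on V u"
    unfolding u_def[abs_def]
    by (rule smooth_on_fst[OF V(1) smooth_on_subset[OF smooth_section_param(1)[OF smooth_sections(2)] V(2)]])
  have s2: "smooth_on V s211" "smooth_on V s221"
    unfolding s211_def[abs_def] s221_def[abs_def]
    using smooth_on_subset[OF smooth_section_param(2)[OF smooth_sections(2)] V(2)]
      smooth_on_subset[OF smooth_section_param(3)[OF smooth_sections(2)] V(2)] by auto
  have sD: "smooth_on V (\<Delta> 0 0)"
  proof -
    \<comment> \<open>Hence \<open>\<Delta> 0 0\<close> is smooth across the pole.\<close>
    have D0: "Dij (0, 0) 0 0 = {}"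
    proof (rule equals0I)
      fix l assume "l \<in> Dij (0, 0) 0 0"
      then have l: "l > 0" and "\<exists>(i', j')\<in>Lam (0, 0) - {(0, 0)}. real 0 + l * real 0 = real i' + l * real j'"
        unfolding Dij_def by blast+
      then obtain p where p: "p \<noteq> (0, 0)" "case p of (i', j') \<Rightarrow> real 0 + l * real 0 = real i' + l * real j'"
        by blast
      obtain i' j' where ij: "p = (i', j')" by force
      have ne: "(i', j') \<noteq> (0, 0)" and eq: "0 = real i' + l * real j'" using p unfolding ij by simp_all
      have "0 \<le> l * real j'" using l by simp
      then have "real i' = 0" "l * real j' = 0" using eq by linarith+
      then show False using l ne by simp
    qed
    have all: "\<forall>(i, j)\<in>Lam (0, 0). smooth_on (({0<..} - Dij (0, 0) i j) \<times> W) (\<Delta> i j)"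
      using dmc unfolding dulac_map_coeffs_def by (rule conjunct1)
    have "(0, 0) \<in> Lam (0, 0)" by (simp add: Lam_def)
    from bspec[OF all this] have "smooth_on (({0<..} - Dij (0, 0) 0 0) \<times> W) (\<Delta> 0 0)" by simp
    then show ?thesis unfolding D0 using V(2) by (auto intro: smooth_on_subset)
  qed
  have at: "smooth_on V (\<lambda>m. f (u m, m))" if "smooth_on Dom2 f" for f :: "real \<times> 'n param \<Rightarrow> real"
    unfolding u_def by (rule smooth_at_section[OF V(1,2)]) (auto intro: smooth_on_subset[OF that])
  have u0: "u m \<noteq> 0" if "m \<in> V" for m using sections_at_0(4)[OF mh[OF that]] by (simp add: u_def)
  have sh: "smooth_on V h"
  proof -
    have fm: "smooth_on V (\<lambda>m. fst m - l0)" by (intro smooth_intros V(1))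
    show ?thesis
      unfolding h_def[abs_def]
      by (intro smooth_on_mult smooth_on_add smooth_on_power smooth_on_divide smooth_on_exp V(1) sD s2 su at
          smooth_lnL2 smooth_fA N fm exp_not_eq_zero u0)
  qed
  have irr_eq: "?f m = h m" if m: "m \<in> V" "fst m \<notin> \<rat>" for m
  proof -
    note I = I2_interval(4)[OF mh[OF m(1)]]
    have L: "L2 P1 P2 m (u m) = exp (lnL2 (u m, m))" and A: "A2 P1 P2 n2 m (u m) = fA n2 (u m, m)"
      using L2_eq[OF mh[OF m(1)] I] A2_eq[OF mh[OF m(1)] I, of n2] by (simp_all add: u_def)
    define X where "X = mellin (I2 \<sigma>2 \<rho> m) (B2 P1 P2 n2 (I2 \<sigma>2 \<rho> m) m) (fst m * real (n2 + 1) - real n1) (u m)"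
    have T: "T 0 (n2 + 1) m = \<Delta> 0 0 m ^ (n2 + 1) * (s221 m / exp (lnL2 (u m, m))) ^ n2 * u m ^ n1 *
        (fA n2 (u m, m) * s211 m / u m + X * s221 m / exp (lnL2 (u m, m)))"
      using irrational_coefficient[OF mh[OF m(1)] m(2) n dmt dmc dtc, folded u_def s211_def s221_def, unfolded L A]
      unfolding X_def .
    have N: "N m = (fst m - l0) ^ p * X" using eq[OF m] by (simp add: X_def u_def)
    show ?thesis unfolding T h_def N by (simp add: algebra_simps)
  qed
  have cT: "isCont ?f m" if m: "m \<in> A" for m
  proof -
    have all: "\<forall>(i, j)\<in>Lam (n1, n2). smooth_on (({0<..} - Dij (n1, n2) i j) \<times> W) (T i j)"
      using dtc unfolding dulac_time_coeffs_def by (rule conjunct1)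
    have "(0, n2 + 1) \<in> Lam (n1, n2)" by (simp add: Lam_def)
    from bspec[OF all this] have "smooth_on A (T 0 (n2 + 1))" by (simp add: A_def)
    then have "isCont (T 0 (n2 + 1)) m" using m by (rule smooth_on_isCont)
    then show ?thesis by (intro continuous_intros)
  qed
  have ext_eq: "h m = ?f m" if m: "m \<in> V" "m \<in> A" for m
  proof (rule ccontr)
    assume ne: "h m \<noteq> ?f m"
    have "isCont (\<lambda>m. h m - ?f m) m"
      by (rule continuous_diff[OF smooth_on_isCont[OF sh m(1)] cT[OF m(2)]])
    then have "((\<lambda>m. h m - ?f m) \<longlongrightarrow> h m - ?f m) (nhds m)" by (simp add: isCont_def tendsto_nhds_iff)
    then have "eventually (\<lambda>m. h m - ?f m \<in> - {0}) (nhds m)"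
      by (rule topological_tendstoD) (use ne in auto)
    \<comment> \<open>If the two sides differed at a point, they would differ nearby, where
      \<open>\<lambda>\<close> can be moved to an irrational value with the other parameters
      kept.\<close>
    then obtain G where G: "open G" "m \<in> G" "\<And>m'. m' \<in> G \<Longrightarrow> h m' \<noteq> ?f m'"
      unfolding eventually_nhds by auto
    have "continuous_on UNIV (\<lambda>l::real. (l, snd m))" by (intro continuous_intros)
    then have "open ((\<lambda>l. (l, snd m)) -` (G \<inter> V))" using G(1) V(1) by (intro open_vimage open_Int)
    moreover have "fst m \<in> (\<lambda>l. (l, snd m)) -` (G \<inter> V)" using G(2) m(1) by simp
    ultimately obtain l where l: "(l, snd m) \<in> G" "(l, snd m) \<in> V" "l \<notin> \<rat>"
      using open_contains_irrational by blast
    then show False using irr_eq[of "(l, snd m)"] G(3)[OF l(1)] by simp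
  qed
  show ?ext
    unfolding extends_smooth_at_def using V(1,3) sh ext_eq by blast
  have "(h \<longlongrightarrow> h ?m0) (at ?m0 within A)"
    using smooth_on_isCont[OF sh V(3)] by (auto simp: isCont_def intro: tendsto_within_subset)
  moreover have "eventually (\<lambda>m. h m = ?f m) (at ?m0 within A)"
    using eventually_nhds_in_open[OF V(1,3)] unfolding eventually_at_filter
    by eventually_elim (use ext_eq in auto)
  ultimately have "(?f \<longlongrightarrow> h ?m0) (at ?m0 within A)"
    by (rule Lim_transform_eventually)
  moreover have "h ?m0 = \<Delta> 0 0 ?m0 ^ (n2 + 1) * s221 ?m0 ^ (n2 + 1) * u ?m0 ^ n1 / L2 P1 P2 ?m0 (u ?m0) ^ (n2 + 1) * N ?m0"
  proof -
    have z: "(fst ?m0 - l0) ^ p = 0" using p by simp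
    have L: "L2 P1 P2 ?m0 (u ?m0) = exp (lnL2 (u ?m0, ?m0))"
      unfolding u_def by (rule L2_eq[OF mh[OF V(3)] I2_interval(4)[OF mh[OF V(3)]]])
    show ?thesis unfolding h_def z L by (simp add: power_divide ac_simps)
  qed
  ultimately show ?lim by (simp add: s221_def u_def)
qed

text \<open>Near an integer \<open>\<lambda> = i\<close> the transform of \<open>M\<^sub>2\<close> has the polar part
  \<open>M\<^sub>2\<^bsup>(i)\<^esup>(0) u\<^sup>i / (i! (i - \<lambda>))\<close>, which the transform of \<open>B\<^sub>2\<close> turns into a multiple of
  \<open>u\<^sup>i\<close> times the transform of \<open>A\<^sub>2\<close> with exponent lowered by \<open>i\<close>.\<close>

lemma mellin_B2_split:
  assumes m: "m \<in> hat W" and u: "u \<in> I2 \<sigma>2 \<rho> m" and \<alpha>: "\<And>k. \<alpha> \<noteq> real k" "\<And>k. \<alpha> - real i \<noteq> real k"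
    and lam: "\<And>k. fst m \<noteq> real k" and R: "smooth_on (I2 \<sigma>2 \<rho> m) R"
    and BR: "\<And>u. u \<in> I2 \<sigma>2 \<rho> m \<Longrightarrow> B2 P1 P2 n2 (I2 \<sigma>2 \<rho> m) m u = R u + c * (u ^ i * A2 P1 P2 n2 m u)"
  shows "mellin (I2 \<sigma>2 \<rho> m) (B2 P1 P2 n2 (I2 \<sigma>2 \<rho> m) m) \<alpha> u
    = mellin (I2 \<sigma>2 \<rho> m) R \<alpha> u + c * (u ^ i * mellin (I2 \<sigma>2 \<rho> m) (A2 P1 P2 n2 m) (\<alpha> - real i) u)"
proof -
  let ?I = "I2 \<sigma>2 \<rho> m"
  note I = I2_interval(1-3)[OF m]
  note Y = mellin_solves[OF I R \<alpha>(1)] and Z = mellin_solves[OF I smooth_A2[OF m, of n2] \<alpha>(2)]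
  show ?thesis
  proof (rule mellin_eqI[OF I _ _ \<alpha>(1) u])
    show "smooth_on ?I (\<lambda>u. mellin ?I R \<alpha> u + c * (u ^ i * mellin ?I (A2 P1 P2 n2 m) (\<alpha> - real i) u))"
      by (intro smooth_intros I Y(1) Z(1))
    fix x assume x: "x \<in> ?I"
    let ?y = "mellin ?I R \<alpha>" and ?z = "mellin ?I (A2 P1 P2 n2 m) (\<alpha> - real i)"
    have "((\<lambda>u. ?y u + c * (u ^ i * ?z u)) has_real_derivative
        deriv ?y x + c * (real i * x ^ (i - 1) * ?z x + x ^ i * deriv ?z x)) (at x)"
      using smooth_on_has_real_derivative[OF Y(1) x] smooth_on_has_real_derivative[OF Z(1) x]
      by (auto intro!: derivative_eq_intros)
    then have "x * deriv (\<lambda>u. ?y u + c * (u ^ i * ?z u)) x - \<alpha> * (?y x + c * (x ^ i * ?z x))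
        = (x * deriv ?y x - \<alpha> * ?y x) + c * ((x * (real i * x ^ (i - 1)) - \<alpha> * x ^ i) * ?z x + x ^ i * (x * deriv ?z x))"
      by (simp add: DERIV_imp_deriv algebra_simps)
    also have "x * (real i * x ^ (i - 1)) = real i * x ^ i" by (cases i) auto
    also have "c * ((real i * x ^ i - \<alpha> * x ^ i) * ?z x + x ^ i * (x * deriv ?z x))
        = c * (x ^ i * (x * deriv ?z x - (\<alpha> - real i) * ?z x))" by (simp add: algebra_simps)
    finally show "x * deriv (\<lambda>u. ?y u + c * (u ^ i * ?z u)) x - \<alpha> * (?y x + c * (x ^ i * ?z x))
        = B2 P1 P2 n2 ?I m x"
      unfolding Y(2)[OF x] Z(2)[OF x] BR[OF x] .
  qed
qed

lemma restricted_domain: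
  assumes "open N" "l0 \<in> N" "(l0, \<mu>0) \<in> hat W"
  defines "V \<equiv> {m \<in> hat W. fst m \<in> N}"
  defines "S \<equiv> {x \<in> Dom2. snd x \<in> V}"
  shows "open V" "V \<subseteq> hat W" "(l0, \<mu>0) \<in> V" "radial_open S" "snd ` S \<subseteq> V"
    and "\<And>m u. m \<in> V \<Longrightarrow> u \<in> I2 \<sigma>2 \<rho> m \<Longrightarrow> (u, m) \<in> S"
    and "\<And>f :: real \<times> 'n param \<Rightarrow> real. smooth_on Dom2 f \<Longrightarrow> smooth_on S f"
    and "smooth_on V fst"
proof -
  have "open (hat W \<inter> fst -` N)" by (intro open_Int open_hat open_vimage assms continuous_on_fst continuous_on_id)
  then show oV: "open V" by (simp add: V_def vimage_def Int_def)
  show "V \<subseteq> hat W" "(l0, \<mu>0) \<in> V" "snd ` S \<subseteq> V" using assms(2,3) by (auto simp: V_def S_def)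
  have "open (Dom2 \<inter> snd -` V)" by (intro open_Int open_Dom2 open_vimage oV continuous_on_snd continuous_on_id)
  then have "open S" by (simp add: S_def vimage_def Int_def)
  then show "radial_open S"
    using radial_open_Dom2 by (auto simp: radial_open_def S_def)
  show "(u, m) \<in> S" if "m \<in> V" "u \<in> I2 \<sigma>2 \<rho> m" for m u
    using that Dom2_I2[of m u] by (auto simp: S_def V_def)
  show "smooth_on S f" if "smooth_on Dom2 f" for f :: "real \<times> 'n param \<Rightarrow> real"
    by (rule smooth_on_subset[OF that]) (auto simp: S_def)
  show "smooth_on V fst" by (rule smooth_on_linear[OF oV bounded_linear_fst])
qed

text \<open>Near a non-integer \<open>l0\<close> the transform of \<open>M2\<close> has no pole, so
  \<open>B2\<close> is smooth in position and parameter. The simple pole arises as the exponent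
  \<open>\<lambda> (n2+1) - n1\<close> crosses \<open>i\<close>; it moves with speed
  \<open>n2 + 1\<close>, whence the factor \<open>1 / (n2+1)\<close>.\<close>

lemma pole_non_integer:
  assumes m0: "(l0, \<mu>0) \<in> hat W" and l0: "l0 = real (n1 + i) / real (n2 + 1)" "\<And>k. l0 \<noteq> real k"
  shows "\<exists>V N. open V \<and> V \<subseteq> hat W \<and> (l0, \<mu>0) \<in> V \<and> smooth_on V N \<and>
    (\<forall>m\<in>V. fst m \<notin> \<rat> \<longrightarrow> (fst m - l0) ^ 1 *
      mellin (I2 \<sigma>2 \<rho> m) (B2 P1 P2 n2 (I2 \<sigma>2 \<rho> m) m) (fst m * real (n2 + 1) - real n1) (fst (\<sigma>2 0 m)) = N m) \<and>
    N (l0, \<mu>0) = - (nderiv i (B2 P1 P2 n2 (I2 \<sigma>2 \<rho> (l0, \<mu>0)) (l0, \<mu>0)) 0 / fact i) * fst (\<sigma>2 0 (l0, \<mu>0)) ^ i / real (n2 + 1)"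
proof -
  let ?m0 = "(l0, \<mu>0)"
  let ?a = "\<lambda>l. l * real (n2 + 1) - real n1"
  have a0: "?a l0 = real i" unfolding l0(1) by simp
  obtain K :: nat where K: "real K > \<bar>l0\<bar> + real i + 2" using reals_Archimedean2 by blast
  have "eventually (\<lambda>l. (\<forall>k. l \<noteq> real k) \<and> (\<forall>k. k \<noteq> i \<longrightarrow> ?a l \<noteq> real k) \<and> l < real K - 1 \<and> ?a l < real K - 1) (nhds l0)"
  proof (intro eventually_conj)
    show "eventually (\<lambda>l. \<forall>k. l \<noteq> real k) (nhds l0)"
      using eventually_not_nat[of l0] by eventually_elim (use l0(2) in metis)
    have t: "(?a \<longlongrightarrow> real i) (nhds l0)"
      unfolding a0[symmetric] by (intro tendsto_intros filterlim_ident)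
    show "eventually (\<lambda>l. \<forall>k. k \<noteq> i \<longrightarrow> ?a l \<noteq> real k) (nhds l0)"
      using eventually_compose_filterlim[OF eventually_not_nat[of "real i"] t] by eventually_elim auto
    show "eventually (\<lambda>l. ?a l < real K - 1) (nhds l0)" by (rule order_tendstoD(2)[OF t]) (use K in linarith)
    show "eventually (\<lambda>l. l < real K - 1) (nhds l0)"
      by (rule order_tendstoD(2)[OF filterlim_ident]) (use K in linarith)
  qed
  then obtain Nl where Nl: "open Nl" "l0 \<in> Nl" "\<And>l. l \<in> Nl \<Longrightarrow> (\<forall>k. l \<noteq> real k) \<and> (\<forall>k. k \<noteq> i \<longrightarrow> ?a l \<noteq> real k) \<and> l < real K - 1 \<and> ?a l < real K - 1"
    unfolding eventually_nhds by auto
  define V where "V = {m \<in> hat W. fst m \<in> Nl}"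
  define S where "S = {x \<in> Dom2. snd x \<in> V}"
  note dom = restricted_domain[OF Nl(1,2) m0, folded V_def, folded S_def]
  have VN: "\<forall>k. fst m \<noteq> real k" "\<forall>k. k \<noteq> i \<longrightarrow> ?a (fst m) \<noteq> real k" "fst m < real K - 1" "?a (fst m) < real K - 1"
    if "m \<in> V" for m using Nl(3)[of "fst m"] that by (auto simp: V_def)
  have oS: "open S" using radial_open_open[OF dom(4)] .
  define RM where "RM = mellin_reg {} K fM fst"
  have sRM: "smooth_on S RM"
    unfolding RM_def by (rule smooth_on_mellin_reg[OF dom(4) dom(7)[OF smooth_fM] dom(1,5,8)]) (use VN in auto)
  define B where "B x = real n2 * fA n2 x * RM x + fC n2 x" for x
  have sB: "smooth_on S B"
    unfolding B_def[abs_def] by (intro smooth_intros oS sRM dom(7) smooth_fA smooth_fC)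
  have mh: "m \<in> hat W" if "m \<in> V" for m using that dom(2) by blast
  have B2: "B2 P1 P2 n2 (I2 \<sigma>2 \<rho> m) m u = B (u, m)" if m: "m \<in> V" and u: "u \<in> I2 \<sigma>2 \<rho> m" for m u
  proof -
    have "mellin (I2 \<sigma>2 \<rho> m) (M2 P1 P2 m) (fst m) u = (\<Sum>k\<in>{} \<inter> {..<K}. tcoef k fM m * u ^ k / (real k - fst m)) + mellin_reg {} K fM fst (u, m)"
      by (rule mellin_eq_reg[OF dom(4) dom(7)[OF smooth_fM] dom(1,5,8) _ _ I2_interval(1-3)[OF mh[OF m]] dom(6)[OF m] M2_eq[OF mh[OF m]] _ u])
        (use VN m in auto)
    then show ?thesis
      using A2_eq[OF mh[OF m] u, of n2] C2_eq[OF mh[OF m] u, of n2] by (simp add: B2_def B_def RM_def)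
  qed
  define RB where "RB = mellin_reg {i} K B (\<lambda>m. ?a (fst m))"
  have sa: "smooth_on V (\<lambda>m. ?a (fst m))" by (intro smooth_intros dom(1,8))
  have sRB: "smooth_on S RB"
    unfolding RB_def by (rule smooth_on_mellin_reg[OF dom(4) sB dom(1,5) sa]) (use VN in auto)
  have iK: "i < K" using K by linarith
  \<comment> \<open>The residue term plus \<open>\<lambda> - l0\<close> times the regular part of
    the transform.\<close>
  define N where "N m = - tcoef i B m * fst (\<sigma>2 0 m) ^ i / real (n2 + 1) + (fst m - l0) * RB (fst (\<sigma>2 0 m), m)" for m
  have stc: "smooth_on V (\<lambda>m. tcoef i B m)"
    using smooth_at_section[OF dom(1,2), folded S_def, OF smooth_on_tcoef[OF dom(4) sB]] by simp
  have su: "smooth_on V (\<lambda>m. fst (\<sigma>2 0 m))"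
    using smooth_at_section[OF dom(1,2), folded S_def, OF smooth_on_fst[OF oS smooth_on_id[OF oS]]] by simp
  have sN: "smooth_on V N"
    unfolding N_def[abs_def]
    by (intro smooth_on_add smooth_on_mult smooth_on_divide smooth_on_minus smooth_on_power smooth_on_diff smooth_on_const
        dom(1,8) stc su smooth_at_section[OF dom(1,2), folded S_def, OF sRB]) simp
  have "(fst m - l0) ^ 1 * mellin (I2 \<sigma>2 \<rho> m) (B2 P1 P2 n2 (I2 \<sigma>2 \<rho> m) m) (?a (fst m)) (fst (\<sigma>2 0 m)) = N m"
    if m: "m \<in> V" and irr: "fst m \<notin> \<rat>" for m
  proof -
    let ?u = "fst (\<sigma>2 0 m)"
    have nr: "?a (fst m) \<noteq> real k" for k
    proof
      assume "?a (fst m) = real k"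
      then have "fst m = (real k + real n1) / real (n2 + 1)" by (simp add: field_simps)
      then show False using irr by simp
    qed
    have "mellin (I2 \<sigma>2 \<rho> m) (B2 P1 P2 n2 (I2 \<sigma>2 \<rho> m) m) (?a (fst m)) ?u
        = (\<Sum>k\<in>{i} \<inter> {..<K}. tcoef k B m * ?u ^ k / (real k - ?a (fst m))) + mellin_reg {i} K B (\<lambda>m. ?a (fst m)) (?u, m)"
      by (rule mellin_eq_reg[OF dom(4) sB dom(1,5) sa _ _ I2_interval(1-3)[OF mh[OF m]] dom(6)[OF m] B2[OF m] nr I2_interval(4)[OF mh[OF m]]])
        (use VN in auto)
    moreover have "{i} \<inter> {..<K} = {i}" using iK by auto
    moreover have "real i - ?a (fst m) = - real (n2 + 1) * (fst m - l0)" unfolding a0[symmetric] by (simp add: algebra_simps)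
    ultimately have e: "mellin (I2 \<sigma>2 \<rho> m) (B2 P1 P2 n2 (I2 \<sigma>2 \<rho> m) m) (?a (fst m)) ?u
        = tcoef i B m * ?u ^ i / (- real (n2 + 1) * (fst m - l0)) + RB (?u, m)" by (simp add: RB_def)
    have "l0 \<in> \<rat>" unfolding l0(1) by (intro Rats_divide Rats_of_nat)
    then have "fst m - l0 \<noteq> 0" using irr by auto
    then have c: "(fst m - l0) * (t / (- c * (fst m - l0))) = - t / c" for t c :: real by simp
    show ?thesis unfolding e N_def power_one_right distrib_left c by simp
  qed
  moreover have "N ?m0 = - (nderiv i (B2 P1 P2 n2 (I2 \<sigma>2 \<rho> ?m0) ?m0) 0 / fact i) * fst (\<sigma>2 0 ?m0) ^ i / real (n2 + 1)"
  proof -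
    have "nderiv i (B2 P1 P2 n2 (I2 \<sigma>2 \<rho> ?m0) ?m0) 0 = nderiv i (\<lambda>u. B (u, ?m0)) 0"
      by (rule nderiv_cong[OF I2_interval(1)[OF m0] B2[OF dom(3)] I2_interval(3)[OF m0]])
    also have "\<dots> = fact i * tcoef i B ?m0"
      by (rule nderiv_0_eq_tcoef[OF dom(4) sB dom(6)[OF dom(3) I2_interval(3)[OF m0]]])
    finally show ?thesis by (simp add: N_def)
  qed
  ultimately show ?thesis using dom(1-3) sN by blast
qed

text \<open>Collects all polar parts at \<open>\<lambda> = i\<close>: \<open>c\<close> belongs to
  the transform of \<open>M2\<close>, while \<open>PA\<close> and \<open>PB\<close> are the polar
  coefficients of the transforms of \<open>A2\<close> and of the regular part of \<open>B2\<close>.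
  The exponents of the latter two reach \<open>n2 i - n1\<close> and \<open>(n2+1) i - n1\<close>,
  and a pole occurs when the value is nonnegative. Thus \<open>c * PA\<close> is the double pole of
  case (a), and \<open>PA = 0\<close> when \<open>n2 i < n1\<close>.\<close>

lemma pole_integer:
  fixes i :: nat
  assumes m0: "(real i, \<mu>0) \<in> hat W"
  shows "\<exists>V PA PB RA RB c. open V \<and> V \<subseteq> hat W \<and> (real i, \<mu>0) \<in> V \<and>
    smooth_on V PA \<and> smooth_on V PB \<and> smooth_on V RA \<and> smooth_on V RB \<and> smooth_on V c \<and>
    (\<forall>m\<in>V. fst m \<notin> \<rat> \<longrightarrow>
      mellin (I2 \<sigma>2 \<rho> m) (B2 P1 P2 n2 (I2 \<sigma>2 \<rho> m) m) (fst m * real (n2 + 1) - real n1) (fst (\<sigma>2 0 m))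
        = - PB m / (real (n2 + 1) * (fst m - real i)) + RB m
          - real n2 * c m / (fst m - real i) * (fst (\<sigma>2 0 m) ^ i * (- PA m / (real (n2 + 1) * (fst m - real i)) + RA m))) \<and>
    c (real i, \<mu>0) = nderiv i (M2 P1 P2 (real i, \<mu>0)) 0 / fact i \<and>
    (n1 \<le> n2 * i \<longrightarrow> PA (real i, \<mu>0) = nderiv (n2 * i - n1) (A2 P1 P2 n2 (real i, \<mu>0)) 0 / fact (n2 * i - n1)
      * fst (\<sigma>2 0 (real i, \<mu>0)) ^ (n2 * i - n1)) \<and>
    (n2 * i < n1 \<longrightarrow> (\<forall>m\<in>V. PA m = 0) \<and>
      RA (real i, \<mu>0) = mellin (I2 \<sigma>2 \<rho> (real i, \<mu>0)) (A2 P1 P2 n2 (real i, \<mu>0)) (real i * real n2 - real n1) (fst (\<sigma>2 0 (real i, \<mu>0)))) \<and>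
    (n2 * i < n1 \<longrightarrow> PB (real i, \<mu>0) = (if n1 \<le> (n2 + 1) * i then
        fst (\<sigma>2 0 (real i, \<mu>0)) ^ ((n2 + 1) * i - n1) / fact ((n2 + 1) * i - n1) *
        (real n2 * (\<Sum>j=0..(n2 + 1) * i - n1. real (((n2 + 1) * i - n1) choose j) *
            (nderiv j (M2 P1 P2 (real i, \<mu>0)) 0 * nderiv ((n2 + 1) * i - n1 - j) (A2 P1 P2 n2 (real i, \<mu>0)) 0) / (real j - real i))
          + nderiv ((n2 + 1) * i - n1) (C2 P1 P2 n2 (real i, \<mu>0)) 0) else 0))"
proof -
  let ?l0 = "real i"
  let ?m0 = "(?l0, \<mu>0)"
  let ?a = "\<lambda>l. l * real (n2 + 1) - real n1"
  let ?b = "\<lambda>l. l * real (n2 + 1) - real n1 - real i"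
  \<comment> \<open>At most one index each: the exponent reached at \<open>\<lambda> = i\<close>, or
    none if it is negative. This treats the cases of the statement uniformly.\<close>
  define EA where "EA = {k. real k = ?b ?l0}"
  define EB where "EB = {k. real k = ?a ?l0}"
  have b0: "?b ?l0 = real n2 * real i - real n1" by (simp add: algebra_simps)
  obtain K :: nat where K: "real K > \<bar>?l0\<bar> + \<bar>?a ?l0\<bar> + \<bar>?b ?l0\<bar> + 2" using reals_Archimedean2 by blast
  have "eventually (\<lambda>l. (\<forall>k. k \<noteq> i \<longrightarrow> l \<noteq> real k) \<and> (\<forall>k. k \<notin> EB \<longrightarrow> ?a l \<noteq> real k) \<and> (\<forall>k. k \<notin> EA \<longrightarrow> ?b l \<noteq> real k)
      \<and> l < real K - 1 \<and> ?a l < real K - 1 \<and> ?b l < real K - 1) (nhds ?l0)"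
  proof (intro eventually_conj)
    have ta: "(?a \<longlongrightarrow> ?a ?l0) (nhds ?l0)" and tb: "(?b \<longlongrightarrow> ?b ?l0) (nhds ?l0)"
      by (intro tendsto_intros filterlim_ident)+
    show "eventually (\<lambda>l. \<forall>k. k \<noteq> i \<longrightarrow> l \<noteq> real k) (nhds ?l0)"
      using eventually_not_nat[of ?l0] by eventually_elim auto
    show "eventually (\<lambda>l. \<forall>k. k \<notin> EB \<longrightarrow> ?a l \<noteq> real k) (nhds ?l0)"
      using eventually_compose_filterlim[OF eventually_not_nat[of "?a ?l0"] ta]
      by eventually_elim (simp add: EB_def)
    show "eventually (\<lambda>l. \<forall>k. k \<notin> EA \<longrightarrow> ?b l \<noteq> real k) (nhds ?l0)"
      using eventually_compose_filterlim[OF eventually_not_nat[of "?b ?l0"] tb]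
      by eventually_elim (simp add: EA_def)
    show "eventually (\<lambda>l. l < real K - 1) (nhds ?l0)"
      by (rule order_tendstoD(2)[OF filterlim_ident]) (use K in linarith)
    show "eventually (\<lambda>l. ?a l < real K - 1) (nhds ?l0)" by (rule order_tendstoD(2)[OF ta]) (use K in linarith)
    show "eventually (\<lambda>l. ?b l < real K - 1) (nhds ?l0)" by (rule order_tendstoD(2)[OF tb]) (use K in linarith)
  qed
  then obtain Nl where Nl: "open Nl" "?l0 \<in> Nl" "\<And>l. l \<in> Nl \<Longrightarrow> (\<forall>k. k \<noteq> i \<longrightarrow> l \<noteq> real k) \<and> (\<forall>k. k \<notin> EB \<longrightarrow> ?a l \<noteq> real k)
      \<and> (\<forall>k. k \<notin> EA \<longrightarrow> ?b l \<noteq> real k) \<and> l < real K - 1 \<and> ?a l < real K - 1 \<and> ?b l < real K - 1"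
    unfolding eventually_nhds by auto
  define V where "V = {m \<in> hat W. fst m \<in> Nl}"
  define S where "S = {x \<in> Dom2. snd x \<in> V}"
  note dom = restricted_domain[OF Nl(1,2) m0, folded V_def, folded S_def]
  have VN: "\<And>k. k \<notin> {i} \<Longrightarrow> fst m \<noteq> real k" "\<And>k. k \<notin> EB \<Longrightarrow> ?a (fst m) \<noteq> real k" "\<And>k. k \<notin> EA \<Longrightarrow> ?b (fst m) \<noteq> real k"
      "fst m < real K - 1" "?a (fst m) < real K - 1" "?b (fst m) < real K - 1"
    if "m \<in> V" for m using Nl(3)[of "fst m"] that by (auto simp: V_def)
  have oS: "open S" using radial_open_open[OF dom(4)] .
  have mh: "m \<in> hat W" if "m \<in> V" for m using that dom(2) by blast
  have iK: "i < K" using K by linarith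
  have sa: "smooth_on V (\<lambda>m. ?a (fst m))" and sb: "smooth_on V (\<lambda>m. ?b (fst m))"
    by (intro smooth_intros dom(1,8))+
  note sM = dom(7)[OF smooth_fM] and sA = dom(7)[OF smooth_fA[of n2]] and sC = dom(7)[OF smooth_fC[of n2]]
  define RM where "RM = mellin_reg {i} K fM fst"
  have sRM: "smooth_on S RM"
    unfolding RM_def by (rule smooth_on_mellin_reg[OF dom(4) sM dom(1,5,8) VN(4) VN(1)])
  define c where "c = tcoef i (fM :: real \<times> 'n param \<Rightarrow> real)"
  \<comment> \<open>\<open>B2\<close> with the transform of \<open>M2\<close> replaced by its
    regular part, hence jointly smooth also at \<open>\<lambda> = i\<close>.\<close>
  define BR where "BR x = real n2 * (fA n2 x * RM x) + fC n2 x" for x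
  have sBR: "smooth_on S BR"
    unfolding BR_def[abs_def] by (intro smooth_intros oS sRM sA sC)
  define u where "u m = fst (\<sigma>2 0 m)" for m
  note at = smooth_at_section[OF dom(1,2), folded S_def, folded u_def]
  have su: "smooth_on V u"
    using at[OF smooth_on_fst[OF oS smooth_on_id[OF oS]]] by simp
  define RA where "RA m = mellin_reg EA K (fA n2) (\<lambda>m. ?b (fst m)) (u m, m)" for m
  define RB where "RB m = mellin_reg EB K BR (\<lambda>m. ?a (fst m)) (u m, m)" for m
  define PA where "PA m = (\<Sum>k\<in>EA \<inter> {..<K}. tcoef k (fA n2) m * u m ^ k)" for m
  define PB where "PB m = (\<Sum>k\<in>EB \<inter> {..<K}. tcoef k BR m * u m ^ k)" for m
  have stc: "smooth_on V (\<lambda>m. tcoef k f m)" if "smooth_on S f" for k f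
    using at[OF smooth_on_tcoef[OF dom(4) that]] by simp
  have sRA: "smooth_on V RA" unfolding RA_def[abs_def]
    by (rule at, rule smooth_on_mellin_reg[OF dom(4) sA dom(1,5) sb VN(6) VN(3)])
  have sRB: "smooth_on V RB" unfolding RB_def[abs_def]
    by (rule at, rule smooth_on_mellin_reg[OF dom(4) sBR dom(1,5) sa VN(5) VN(2)])
  have sPA: "smooth_on V PA" unfolding PA_def[abs_def]
    by (intro smooth_on_sum smooth_on_mult smooth_on_power dom(1) su stc sA)
  have sPB: "smooth_on V PB" unfolding PB_def[abs_def]
    by (intro smooth_on_sum smooth_on_mult smooth_on_power dom(1) su stc sBR)
  have sc: "smooth_on V c" unfolding c_def using stc[OF sM] .
  \<comment> \<open>Both exponents move with slope \<open>n2 + 1\<close> in \<open>\<lambda>\<close>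
    and equal the omitted index at \<open>\<lambda> = i\<close>, so all denominators are the
    same.\<close>
  have polar: "(\<Sum>k\<in>E \<inter> {..<K}. t k * w ^ k / (real k - a)) = - (\<Sum>k\<in>E \<inter> {..<K}. t k * w ^ k) / (real (n2 + 1) * (l - ?l0))"
    if "\<And>k. k \<in> E \<Longrightarrow> real k - a = - (real (n2 + 1) * (l - ?l0))" for t :: "nat \<Rightarrow> real" and w a l E
  proof -
    have "(\<Sum>k\<in>E \<inter> {..<K}. t k * w ^ k / (real k - a)) = (\<Sum>k\<in>E \<inter> {..<K}. t k * w ^ k / - (real (n2 + 1) * (l - ?l0)))"
      by (intro sum.cong) (use that in auto)
    then show ?thesis by (simp add: sum_divide_distrib sum_negf)
  qed
  have EBp: "real k - ?a l = - (real (n2 + 1) * (l - ?l0))" if "k \<in> EB" for k l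
    using that by (simp add: EB_def algebra_simps)
  have EAp: "real k - ?b l = - (real (n2 + 1) * (l - ?l0))" if "k \<in> EA" for k l
    using that by (simp add: EA_def algebra_simps)
  have F1: "mellin (I2 \<sigma>2 \<rho> m) (B2 P1 P2 n2 (I2 \<sigma>2 \<rho> m) m) (?a (fst m)) (fst (\<sigma>2 0 m))
      = - PB m / (real (n2 + 1) * (fst m - ?l0)) + RB m
        - real n2 * c m / (fst m - ?l0) * (fst (\<sigma>2 0 m) ^ i * (- PA m / (real (n2 + 1) * (fst m - ?l0)) + RA m))"
    if m: "m \<in> V" and irr: "fst m \<notin> \<rat>" for m
  proof -
    let ?I = "I2 \<sigma>2 \<rho> m"
    note I = I2_interval[OF mh[OF m]]
    have nr0: "fst m \<noteq> real k" for k using irr by auto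
    have nra: "?a (fst m) \<noteq> real k" for k
    proof
      assume "?a (fst m) = real k"
      then have "fst m = (real k + real n1) / real (n2 + 1)" by (simp add: field_simps)
      then show False using irr by simp
    qed
    have nrb: "?a (fst m) - real i \<noteq> real k" for k using nra[of "k + i"] by (simp add: algebra_simps)
    have M: "mellin ?I (M2 P1 P2 m) (fst m) w = c m * w ^ i / (?l0 - fst m) + RM (w, m)" if w: "w \<in> ?I" for w
    proof -
      have "mellin ?I (M2 P1 P2 m) (fst m) w = (\<Sum>k\<in>{i} \<inter> {..<K}. tcoef k fM m * w ^ k / (real k - fst m)) + mellin_reg {i} K fM fst (w, m)"
        by (rule mellin_eq_reg[OF dom(4) sM dom(1,5,8) VN(4) VN(1) I(1-3) dom(6)[OF m] M2_eq[OF mh[OF m]] nr0 w])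
      moreover have "{i} \<inter> {..<K} = {i}" using iK by auto
      ultimately show ?thesis by (simp add: c_def RM_def)
    qed
    have sBRm: "smooth_on ?I (\<lambda>w. BR (w, m))"
      by (rule smooth_on_slice[OF I(1) oS dom(6)[OF m] sBR])
    have split: "mellin ?I (B2 P1 P2 n2 ?I m) (?a (fst m)) (u m)
        = mellin ?I (\<lambda>w. BR (w, m)) (?a (fst m)) (u m)
          + real n2 * c m / (?l0 - fst m) * (u m ^ i * mellin ?I (A2 P1 P2 n2 m) (?a (fst m) - real i) (u m))"
    proof (rule mellin_B2_split[OF mh[OF m] _ nra nrb nr0 sBRm])
      show "u m \<in> ?I" using I(4) by (simp add: u_def)
      fix w assume w: "w \<in> ?I"
      show "B2 P1 P2 n2 ?I m w = BR (w, m) + real n2 * c m / (?l0 - fst m) * (w ^ i * A2 P1 P2 n2 m w)"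
        using M[OF w] A2_eq[OF mh[OF m] w, of n2] C2_eq[OF mh[OF m] w, of n2]
        by (simp add: B2_def BR_def algebra_simps)
    qed
    have uI: "u m \<in> ?I" using I(4) by (simp add: u_def)
    have YB: "mellin ?I (\<lambda>w. BR (w, m)) (?a (fst m)) (u m) = - PB m / (real (n2 + 1) * (fst m - ?l0)) + RB m"
    proof -
      have "mellin ?I (\<lambda>w. BR (w, m)) (?a (fst m)) (u m)
          = (\<Sum>k\<in>EB \<inter> {..<K}. tcoef k BR m * u m ^ k / (real k - ?a (fst m))) + mellin_reg EB K BR (\<lambda>m. ?a (fst m)) (u m, m)"
        by (rule mellin_eq_reg[OF dom(4) sBR dom(1,5) sa VN(5) VN(2) I(1-3) dom(6)[OF m] refl nra uI])
      moreover have "(\<Sum>k\<in>EB \<inter> {..<K}. tcoef k BR m * u m ^ k / (real k - ?a (fst m))) = - PB m / (real (n2 + 1) * (fst m - ?l0))"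
        unfolding PB_def by (rule polar) (rule EBp)
      ultimately show ?thesis by (simp add: RB_def)
    qed
    have YA: "mellin ?I (A2 P1 P2 n2 m) (?a (fst m) - real i) (u m) = - PA m / (real (n2 + 1) * (fst m - ?l0)) + RA m"
    proof -
      have "mellin ?I (A2 P1 P2 n2 m) (?b (fst m)) (u m)
          = (\<Sum>k\<in>EA \<inter> {..<K}. tcoef k (fA n2) m * u m ^ k / (real k - ?b (fst m))) + mellin_reg EA K (fA n2) (\<lambda>m. ?b (fst m)) (u m, m)"
        by (rule mellin_eq_reg[OF dom(4) sA dom(1,5) sb VN(6) VN(3) I(1-3) dom(6)[OF m] A2_eq[OF mh[OF m]] nrb uI])
      moreover have "(\<Sum>k\<in>EA \<inter> {..<K}. tcoef k (fA n2) m * u m ^ k / (real k - ?b (fst m))) = - PA m / (real (n2 + 1) * (fst m - ?l0))"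
        unfolding PA_def by (rule polar) (rule EAp)
      ultimately show ?thesis by (simp add: RA_def)
    qed
    have neg: "real n2 * c m / (?l0 - fst m) = - (real n2 * c m / (fst m - ?l0))"
      by (metis minus_diff_eq divide_minus_right)
    show ?thesis
      using split[unfolded YB YA neg] unfolding u_def by simp
  qed
  have I0: "0 \<in> I2 \<sigma>2 \<rho> ?m0" by (rule I2_interval(3)[OF m0])
  note nd = nderiv_0_eq_tcoef[OF dom(4) _ dom(6)[OF dom(3) I0]]
  have ndM: "nderiv k (M2 P1 P2 ?m0) 0 = nderiv k (\<lambda>u. fM (u, ?m0)) 0" for k
    by (rule nderiv_cong[OF I2_interval(1)[OF m0] M2_eq[OF m0] I0])
  have ndA: "nderiv k (A2 P1 P2 n2 ?m0) 0 = nderiv k (\<lambda>u. fA n2 (u, ?m0)) 0" for k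
    by (rule nderiv_cong[OF I2_interval(1)[OF m0] A2_eq[OF m0] I0])
  have ndC: "nderiv k (C2 P1 P2 n2 ?m0) 0 = nderiv k (\<lambda>u. fC n2 (u, ?m0)) 0" for k
    by (rule nderiv_cong[OF I2_interval(1)[OF m0] C2_eq[OF m0] I0])
  have F2: "c ?m0 = nderiv i (M2 P1 P2 ?m0) 0 / fact i"
    using nd[OF sM, of i] ndM[of i] by (simp add: c_def)
  have F3: "PA ?m0 = nderiv (n2 * i - n1) (A2 P1 P2 n2 ?m0) 0 / fact (n2 * i - n1) * u ?m0 ^ (n2 * i - n1)" if "n1 \<le> n2 * i"
  proof -
    have e: "real (n2 * i - n1) = ?b ?l0" using that b0 by (simp add: of_nat_diff)
    then have "EA = {n2 * i - n1}" by (auto simp: EA_def simp flip: e)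
    moreover have "n2 * i - n1 < K" using K e by linarith
    ultimately have "EA \<inter> {..<K} = {n2 * i - n1}" by auto
    then show ?thesis using nd[OF sA, of "n2 * i - n1"] ndA[of "n2 * i - n1"] by (simp add: PA_def)
  qed
  have F4: "(\<forall>m\<in>V. PA m = 0) \<and> RA ?m0 = mellin (I2 \<sigma>2 \<rho> ?m0) (A2 P1 P2 n2 ?m0) (real i * real n2 - real n1) (u ?m0)" if "n2 * i < n1"
  proof -
    \<comment> \<open>The exponent is negative at \<open>\<lambda> = i\<close>, so there is no polar
      part and \<open>RA\<close> is the full transform even at the integer parameter.\<close>
    have lt: "real n2 * real i < real n1" using that by (metis of_nat_less_iff of_nat_mult)
    then have EA: "EA = {}" unfolding EA_def b0 by auto
    have M: "mellin (I2 \<sigma>2 \<rho> ?m0) (A2 P1 P2 n2 ?m0) (?b (fst ?m0)) (u ?m0)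
        = (\<Sum>k\<in>EA \<inter> {..<K}. tcoef k (fA n2) ?m0 * u ?m0 ^ k / (real k - ?b (fst ?m0))) + mellin_reg EA K (fA n2) (\<lambda>m. ?b (fst m)) (u ?m0, ?m0)"
    proof (rule mellin_eq_reg[OF dom(4) sA dom(1,5) sb VN(6) VN(3) I2_interval(1-3)[OF m0] dom(6)[OF dom(3)] A2_eq[OF m0]])
      show "?b (fst ?m0) \<noteq> real k" for k using EA unfolding EA_def by (metis (mono_tags, lifting) empty_Collect_eq fst_conv)
      show "u ?m0 \<in> I2 \<sigma>2 \<rho> ?m0" using I2_interval(4)[OF m0] by (simp add: u_def)
    qed
    have b: "real i * real n2 - real n1 = ?b (fst ?m0)" by (simp add: algebra_simps)
    show ?thesis unfolding b M using EA by (simp add: PA_def RA_def)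
  qed
  have F4a: "PA m = 0" if "n2 * i < n1" "m \<in> V" for m
    using F4[OF that(1)] that(2) by blast
  have F4b: "RA ?m0 = mellin (I2 \<sigma>2 \<rho> ?m0) (A2 P1 P2 n2 ?m0) (real i * real n2 - real n1) (fst (\<sigma>2 0 ?m0))"
    if "n2 * i < n1"
    using F4[OF that] by (simp add: u_def)
  have F5: "PB ?m0 = (if n1 \<le> (n2 + 1) * i then u ?m0 ^ ((n2 + 1) * i - n1) / fact ((n2 + 1) * i - n1) *
        (real n2 * (\<Sum>j=0..(n2 + 1) * i - n1. real (((n2 + 1) * i - n1) choose j) *
            (nderiv j (M2 P1 P2 ?m0) 0 * nderiv ((n2 + 1) * i - n1 - j) (A2 P1 P2 n2 ?m0) 0) / (real j - real i))
          + nderiv ((n2 + 1) * i - n1) (C2 P1 P2 n2 ?m0) 0) else 0)" if lt: "n2 * i < n1"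
  proof (cases "n1 \<le> (n2 + 1) * i")
    case True
    define i1 where "i1 = (n2 + 1) * i - n1"
    \<comment> \<open>Because \<open>i1 = i - (n1 - n2 i)\<close>. So every
      \<open>j \<le> i1\<close> differs from \<open>i\<close>: the denominators \<open>j - i\<close>
      are nonzero and \<open>nderiv_mellin_reg\<close> applies with \<open>E = {i}\<close>.\<close>
    have i1: "i1 < i" using lt True by (simp add: i1_def)
    have e: "real i1 = ?a ?l0" using True by (simp add: i1_def of_nat_diff algebra_simps)
    then have "EB = {i1}" by (auto simp: EB_def simp flip: e)
    moreover have i1K: "i1 < K" using i1 iK by simp
    ultimately have "EB \<inter> {..<K} = {i1}" by auto
    then have "PB ?m0 = tcoef i1 BR ?m0 * u ?m0 ^ i1" by (simp add: PB_def)
    also have "tcoef i1 BR ?m0 = nderiv i1 (\<lambda>u. BR (u, ?m0)) 0 / fact i1"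
      using nd[OF sBR, of i1] by simp
    also have "nderiv i1 (\<lambda>u. BR (u, ?m0)) 0 = real n2 * (\<Sum>j=0..i1. real (i1 choose j) *
        (nderiv j (M2 P1 P2 ?m0) 0 * nderiv (i1 - j) (A2 P1 P2 n2 ?m0) 0) / (real j - real i)) + nderiv i1 (C2 P1 P2 n2 ?m0) 0"
    proof -
      note I = I2_interval(1)[OF m0]
      have sl: "smooth_on (I2 \<sigma>2 \<rho> ?m0) (\<lambda>u. f (u, ?m0))" if "smooth_on S f" for f :: "real \<times> 'n param \<Rightarrow> real"
        by (rule smooth_on_slice[OF I oS dom(6)[OF dom(3)] that])
      have RMj: "nderiv j (\<lambda>u. RM (u, ?m0)) 0 = nderiv j (M2 P1 P2 ?m0) 0 / (real j - real i)" if "j \<le> i1" for j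
        unfolding RM_def ndM
        using nderiv_mellin_reg[OF dom(4) sM dom(1,5,8) VN(4) I I0 dom(6)[OF dom(3)], of j "{i}"] that i1 i1K by simp
      have "nderiv i1 (\<lambda>u. BR (u, ?m0)) 0 = nderiv i1 (\<lambda>u. real n2 * (RM (u, ?m0) * fA n2 (u, ?m0)) + fC n2 (u, ?m0)) 0"
        by (simp add: BR_def mult.commute)
      also have "\<dots> = real n2 * nderiv i1 (\<lambda>u. RM (u, ?m0) * fA n2 (u, ?m0)) 0 + nderiv i1 (\<lambda>u. fC n2 (u, ?m0)) 0"
        by (subst nderiv_add[OF I _ sl[OF sC] I0], (intro smooth_intros I sl sRM sA),
            subst nderiv_cmult[OF I _ I0], (intro smooth_intros I sl sRM sA), rule refl)
      also have "nderiv i1 (\<lambda>u. RM (u, ?m0) * fA n2 (u, ?m0)) 0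
          = (\<Sum>j\<le>i1. real (i1 choose j) * (nderiv j (\<lambda>u. RM (u, ?m0)) 0 * nderiv (i1 - j) (\<lambda>u. fA n2 (u, ?m0)) 0))"
        by (rule nderiv_mult[OF I sl[OF sRM] sl[OF sA] I0])
      also have "\<dots> = (\<Sum>j=0..i1. real (i1 choose j) *
        (nderiv j (M2 P1 P2 ?m0) 0 * nderiv (i1 - j) (A2 P1 P2 n2 ?m0) 0) / (real j - real i))"
        by (intro sum.cong) (auto simp: RMj ndA)
      finally show ?thesis by (simp add: ndC)
    qed
    finally have F: "PB ?m0 = (real n2 * (\<Sum>j=0..i1. real (i1 choose j) *
        (nderiv j (M2 P1 P2 ?m0) 0 * nderiv (i1 - j) (A2 P1 P2 n2 ?m0) 0) / (real j - real i))
        + nderiv i1 (C2 P1 P2 n2 ?m0) 0) / fact i1 * u ?m0 ^ i1" .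
    show ?thesis unfolding if_P[OF True] i1_def[symmetric] F by (simp add: mult.commute)
  next
    case False
    then have "real ((n2 + 1) * i) < real n1" by linarith
    then have "?a ?l0 < 0" by (simp add: algebra_simps)
    then have "EB = {}" by (auto simp: EB_def)
    then show ?thesis using False by (simp add: PB_def)
  qed
  show ?thesis
    by (rule exI[of _ V], rule exI[of _ PA], rule exI[of _ PB], rule exI[of _ RA], rule exI[of _ RB], rule exI[of _ c],
        intro conjI ballI impI)
      (fact dom(1-3) sPA sPB sRA sRB sc F1 F2 F3[unfolded u_def] F4a F4b F5[unfolded u_def])+
qed

end

section \<open>Assembly of the double pole (a) and the simple poles (b1) and (b2)\<close>

theorem proposition3p4:
  fixes W :: "(real ^ 'n::finite) set"
    and U :: "(real \<times> real) set"
    and P1 P2 :: "real \<times> real \<Rightarrow> 'n param \<Rightarrow> real"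
    and \<sigma>1 \<sigma>2 :: "real \<Rightarrow> 'n param \<Rightarrow> real \<times> real"
    and \<epsilon> \<rho> :: real
    and n1 n2 :: nat
    and D \<tau> :: "real \<Rightarrow> 'n param \<Rightarrow> real"
    and \<Delta> T :: "nat \<Rightarrow> nat \<Rightarrow> 'n param \<Rightarrow> real"
  assumes "(n1, n2) \<noteq> (0, 0)"
    and "saddle_family W U P1 P2"
    and "transverse_sections W U P1 P2 \<epsilon> \<rho> \<sigma>1 \<sigma>2"
    and "dulac_map_time W U P1 P2 n1 n2 \<sigma>1 \<sigma>2 D \<tau>"
    and "dulac_map_coeffs W D \<Delta>"
    and "\<forall>m\<in>hat W. \<Delta> 0 0 m > 0"
    and "dulac_time_coeffs W (n1, n2) \<tau> T"
  shows
    "(\<forall>l0 \<mu>0. l0 \<in> Dij (n1, n2) 0 (n2 + 1) \<and> \<mu>0 \<in> W \<and>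
        l0 \<in> real ` {i. 1 \<le> i \<and> n1 \<le> n2 * i} \<longrightarrow>
        extends_smooth_at (({0<..} - Dij (n1, n2) 0 (n2 + 1)) \<times> W)
          (\<lambda>m. (fst m - l0)\<^sup>2 * T 0 (n2 + 1) m) (l0, \<mu>0) \<and>
        (\<forall>i. 1 \<le> i \<and> n1 \<le> n2 * i \<and> l0 = real i \<longrightarrow>
          ((\<lambda>m. (fst m - l0)\<^sup>2 * T 0 (n2 + 1) m) \<longlongrightarrow>
             lim_a P1 P2 n1 n2 \<sigma>2 \<Delta> i (l0, \<mu>0))
            (at (l0, \<mu>0) within ({0<..} - Dij (n1, n2) 0 (n2 + 1)) \<times> W)))
     \<and>
     (\<forall>l0 \<mu>0. l0 \<in> Dij (n1, n2) 0 (n2 + 1) \<and> \<mu>0 \<in> W \<and>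
        l0 \<notin> real ` {i. 1 \<le> i \<and> n1 \<le> n2 * i} \<longrightarrow>
        extends_smooth_at (({0<..} - Dij (n1, n2) 0 (n2 + 1)) \<times> W)
          (\<lambda>m. (fst m - l0) * T 0 (n2 + 1) m) (l0, \<mu>0) \<and>
        (\<forall>i. 1 \<le> i \<and> n2 * i < n1 \<and> l0 = real i \<longrightarrow>
          ((\<lambda>m. (fst m - l0) * T 0 (n2 + 1) m) \<longlongrightarrow>
             lim_b1 P1 P2 n1 n2 \<rho> \<sigma>2 \<Delta> i (l0, \<mu>0))
            (at (l0, \<mu>0) within ({0<..} - Dij (n1, n2) 0 (n2 + 1)) \<times> W)) \<and>
        (\<forall>i. l0 = real (n1 + i) / real (n2 + 1) \<and> l0 \<notin> real ` {1..} \<longrightarrow>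
          ((\<lambda>m. (fst m - l0) * T 0 (n2 + 1) m) \<longlongrightarrow>
             lim_b2 P1 P2 n1 n2 \<rho> \<sigma>2 \<Delta> i (l0, \<mu>0))
            (at (l0, \<mu>0) within ({0<..} - Dij (n1, n2) 0 (n2 + 1)) \<times> W)))"
proof -
  interpret saddle_sections W U P1 P2 \<epsilon> \<rho> \<sigma>1 \<sigma>2
    by unfold_locales (fact assms(2,3))+
  let ?A = "({0<..} - Dij (n1, n2) 0 (n2 + 1)) \<times> W"
  note ext = coefficient_extension[OF assms(1,4,5,7)]
  have nat: "real (n2 + 1) \<noteq> 0" by simp
  have a: "extends_smooth_at ?A (\<lambda>m. (fst m - real i) ^ 2 * T 0 (n2 + 1) m) (real i, \<mu>0) \<and>
      ((\<lambda>m. (fst m - real i) ^ 2 * T 0 (n2 + 1) m) \<longlongrightarrow> lim_a P1 P2 n1 n2 \<sigma>2 \<Delta> i (real i, \<mu>0)) (at (real i, \<mu>0) within ?A)"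
    if i: "1 \<le> i" "n1 \<le> n2 * i" and \<mu>0: "\<mu>0 \<in> W" for i \<mu>0
  proof -
    let ?m0 = "(real i, \<mu>0)"
    have m0: "?m0 \<in> hat W" using i \<mu>0 by simp
    obtain V PA PB RA RB c where V: "open V" "V \<subseteq> hat W" "?m0 \<in> V"
      and sm: "smooth_on V PA" "smooth_on V PB" "smooth_on V RA" "smooth_on V RB" "smooth_on V c"
      and eq: "\<forall>m\<in>V. fst m \<notin> \<rat> \<longrightarrow>
      mellin (I2 \<sigma>2 \<rho> m) (B2 P1 P2 n2 (I2 \<sigma>2 \<rho> m) m) (fst m * real (n2 + 1) - real n1) (fst (\<sigma>2 0 m))
        = - PB m / (real (n2 + 1) * (fst m - real i)) + RB m
          - real n2 * c m / (fst m - real i) * (fst (\<sigma>2 0 m) ^ i * (- PA m / (real (n2 + 1) * (fst m - real i)) + RA m))"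
      and c0: "c ?m0 = nderiv i (M2 P1 P2 ?m0) 0 / fact i"
      and PA0: "n1 \<le> n2 * i \<longrightarrow> PA ?m0 = nderiv (n2 * i - n1) (A2 P1 P2 n2 ?m0) 0 / fact (n2 * i - n1)
        * fst (\<sigma>2 0 ?m0) ^ (n2 * i - n1)"
      using pole_integer[OF m0, of n2 n1] by (elim exE conjE) (rule that)
    \<comment> \<open>The expression of \<open>pole_integer\<close> cleared of
      \<open>(\<lambda> - i)^2\<close>: the product of the two simple poles survives at
      \<open>\<lambda> = i\<close>, and two minus signs make it positive.\<close>
    define N where "N m = real n2 * c m * fst (\<sigma>2 0 m) ^ i * PA m / real (n2 + 1)
      + (fst m - real i) * (- PB m / real (n2 + 1) + (fst m - real i) * RB m - real n2 * c m * fst (\<sigma>2 0 m) ^ i * RA m)" for m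
    have su: "smooth_on V (\<lambda>m. fst (\<sigma>2 0 m))"
      by (rule smooth_on_fst[OF V(1) smooth_on_subset[OF smooth_section_param(1)[OF smooth_sections(2)] V(2)]])
    have sN: "smooth_on V N"
      unfolding N_def[abs_def]
      by (intro smooth_on_add smooth_on_mult smooth_on_divide smooth_on_minus smooth_on_power smooth_on_diff smooth_on_const
          V(1) sm su smooth_on_linear[OF V(1) bounded_linear_fst] nat)
    have alg: "x ^ 2 * (- pb / (k * x) + rb - n * c / x * (w * (- pa / (k * x) + ra)))
        = n * c * w * pa / k + x * (- pb / k + x * rb - n * c * w * ra)" if "x \<noteq> 0" "k \<noteq> 0" for x k pb rb n c w pa ra :: real
      using that by (simp add: field_simps power2_eq_square)
    have E: "(fst m - real i) ^ 2 * mellin (I2 \<sigma>2 \<rho> m) (B2 P1 P2 n2 (I2 \<sigma>2 \<rho> m) m) (fst m * real (n2 + 1) - real n1) (fst (\<sigma>2 0 m)) = N m"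
      if m: "m \<in> V" "fst m \<notin> \<rat>" for m
    proof -
      have "fst m - real i \<noteq> 0" using m(2) by auto
      from alg[OF this nat] show ?thesis unfolding bspec[OF eq m(1), THEN mp, OF m(2)] N_def .
    qed
    have lim: "lim_a P1 P2 n1 n2 \<sigma>2 \<Delta> i ?m0 = \<Delta> 0 0 ?m0 ^ (n2 + 1) * deriv (\<lambda>s. snd (\<sigma>2 s ?m0)) 0 ^ (n2 + 1)
        * fst (\<sigma>2 0 ?m0) ^ n1 / L2 P1 P2 ?m0 (fst (\<sigma>2 0 ?m0)) ^ (n2 + 1) * N ?m0"
    proof -
      \<comment> \<open>Three sources of the power of the section's position: the prefactor, the
        polar term of \<open>M2\<close> and the polar term of \<open>A2\<close>.\<close>
      have "(n2 + 1) * i = n1 + i + (n2 * i - n1)" using i(2) by simp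
      then have u: "fst (\<sigma>2 0 ?m0) ^ ((n2 + 1) * i) = fst (\<sigma>2 0 ?m0) ^ n1 * fst (\<sigma>2 0 ?m0) ^ i * fst (\<sigma>2 0 ?m0) ^ (n2 * i - n1)"
        by (simp only: power_add)
      have N0: "N ?m0 = real n2 * c ?m0 * fst (\<sigma>2 0 ?m0) ^ i * PA ?m0 / real (n2 + 1)" by (simp add: N_def)
      show ?thesis
        unfolding lim_a_def Let_def u N0 c0 mp[OF PA0 i(2)] by (simp only: times_divide_eq_right times_divide_eq_left divide_divide_eq_left ac_simps)
    qed
    show ?thesis
      unfolding lim by (intro conjI ext[OF V sN _ E]) simp_all
  qed
  have b1: "extends_smooth_at ?A (\<lambda>m. (fst m - real i) ^ 1 * T 0 (n2 + 1) m) (real i, \<mu>0) \<and>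
      ((\<lambda>m. (fst m - real i) ^ 1 * T 0 (n2 + 1) m) \<longlongrightarrow> lim_b1 P1 P2 n1 n2 \<rho> \<sigma>2 \<Delta> i (real i, \<mu>0)) (at (real i, \<mu>0) within ?A)"
    if i: "1 \<le> i" "n2 * i < n1" and \<mu>0: "\<mu>0 \<in> W" for i \<mu>0
  proof -
    let ?m0 = "(real i, \<mu>0)"
    define i1 where "i1 = (n2 + 1) * i - n1"
    have m0: "?m0 \<in> hat W" using i \<mu>0 by simp
    obtain V PA PB RA RB c where V: "open V" "V \<subseteq> hat W" "?m0 \<in> V"
      and sm: "smooth_on V PA" "smooth_on V PB" "smooth_on V RA" "smooth_on V RB" "smooth_on V c"
      and eq: "\<forall>m\<in>V. fst m \<notin> \<rat> \<longrightarrow>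
      mellin (I2 \<sigma>2 \<rho> m) (B2 P1 P2 n2 (I2 \<sigma>2 \<rho> m) m) (fst m * real (n2 + 1) - real n1) (fst (\<sigma>2 0 m))
        = - PB m / (real (n2 + 1) * (fst m - real i)) + RB m
          - real n2 * c m / (fst m - real i) * (fst (\<sigma>2 0 m) ^ i * (- PA m / (real (n2 + 1) * (fst m - real i)) + RA m))"
      and c0: "c ?m0 = nderiv i (M2 P1 P2 ?m0) 0 / fact i"
      and PA0: "n2 * i < n1 \<longrightarrow> (\<forall>m\<in>V. PA m = 0) \<and>
        RA ?m0 = mellin (I2 \<sigma>2 \<rho> ?m0) (A2 P1 P2 n2 ?m0) (real i * real n2 - real n1) (fst (\<sigma>2 0 ?m0))"
      and PB0: "n2 * i < n1 \<longrightarrow> PB ?m0 = (if n1 \<le> (n2 + 1) * i then fst (\<sigma>2 0 ?m0) ^ i1 / fact i1 *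
        (real n2 * (\<Sum>j=0..i1. real (i1 choose j) *
            (nderiv j (M2 P1 P2 ?m0) 0 * nderiv (i1 - j) (A2 P1 P2 n2 ?m0) 0) / (real j - real i))
          + nderiv i1 (C2 P1 P2 n2 ?m0) 0) else 0)"
      using pole_integer[OF m0, of n2 n1, folded i1_def] by (elim exE conjE) (rule that)
    \<comment> \<open>With \<open>PA = 0\<close> on \<open>V\<close> the pole is simple; its
      coefficient combines the pole of \<open>BR\<close> with the residue \<open>c\<close> times the
      regular value \<open>RA\<close>.\<close>
    define N where "N m = - PB m / real (n2 + 1) + (fst m - real i) * RB m - real n2 * c m * fst (\<sigma>2 0 m) ^ i * RA m" for m
    have su: "smooth_on V (\<lambda>m. fst (\<sigma>2 0 m))"
      by (rule smooth_on_fst[OF V(1) smooth_on_subset[OF smooth_section_param(1)[OF smooth_sections(2)] V(2)]])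
    have sN: "smooth_on V N"
      unfolding N_def[abs_def]
      by (intro smooth_on_add smooth_on_mult smooth_on_divide smooth_on_minus smooth_on_power smooth_on_diff smooth_on_const
          V(1) sm su smooth_on_linear[OF V(1) bounded_linear_fst] nat)
    have alg: "x ^ 1 * (- pb / (k * x) + rb - n * c / x * (w * (- 0 / (k * x) + ra)))
        = - pb / k + x * rb - n * c * w * ra" if "x \<noteq> 0" "k \<noteq> 0" for x k pb rb n c w ra :: real
      using that by (simp add: field_simps)
    have E: "(fst m - real i) ^ 1 * mellin (I2 \<sigma>2 \<rho> m) (B2 P1 P2 n2 (I2 \<sigma>2 \<rho> m) m) (fst m * real (n2 + 1) - real n1) (fst (\<sigma>2 0 m)) = N m"
      if m: "m \<in> V" "fst m \<notin> \<rat>" for m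
    proof -
      have "fst m - real i \<noteq> 0" using m(2) by auto
      moreover have "PA m = 0" using PA0 i(2) m(1) by blast
      ultimately show ?thesis
        unfolding bspec[OF eq m(1), THEN mp, OF m(2)] N_def by (simp only: alg nat not_False_eq_True)
    qed
    have lim: "lim_b1 P1 P2 n1 n2 \<rho> \<sigma>2 \<Delta> i ?m0 = \<Delta> 0 0 ?m0 ^ (n2 + 1) * deriv (\<lambda>s. snd (\<sigma>2 s ?m0)) 0 ^ (n2 + 1)
        * fst (\<sigma>2 0 ?m0) ^ n1 / L2 P1 P2 ?m0 (fst (\<sigma>2 0 ?m0)) ^ (n2 + 1) * N ?m0"
    proof -
      have N0: "N ?m0 = - (real n2 * c ?m0 * fst (\<sigma>2 0 ?m0) ^ i * RA ?m0 + PB ?m0 / real (n2 + 1))" by (simp add: N_def)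
      have RA0: "RA ?m0 = mellin (I2 \<sigma>2 \<rho> ?m0) (A2 P1 P2 n2 ?m0) (real i * real n2 - real n1) (fst (\<sigma>2 0 ?m0))"
        using PA0 i(2) by blast
      have PB1: "PB ?m0 / real (n2 + 1) = (if n1 \<le> (n2 + 1) * i
              then real n2 * fst (\<sigma>2 0 ?m0) ^ i1 / (real (n2 + 1) * fact i1)
                   * (\<Sum>j=0..i1. real (i1 choose j) * (nderiv j (M2 P1 P2 ?m0) 0 * nderiv (i1 - j) (A2 P1 P2 n2 ?m0) 0)
                        / (real j - real i)) else 0)
          + (if n1 \<le> (n2 + 1) * i then fst (\<sigma>2 0 ?m0) ^ i1 / (real (n2 + 1) * fact i1) * nderiv i1 (C2 P1 P2 n2 ?m0) 0 else 0)"
      proof -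
        have *: "w / f * (n * s + c) / k = n * w / (k * f) * s + w / (k * f) * c" for w f n s c k :: real
          by (simp add: distrib_left add_divide_distrib ac_simps)
        show ?thesis unfolding mp[OF PB0 i(2)] by (cases "n1 \<le> (n2 + 1) * i") (simp_all only: if_True if_False * div_0 add_0)
      qed
      show ?thesis
        unfolding lim_b1_def Let_def i1_def[symmetric] N0 c0 RA0 PB1 by (simp only: mult_minus_left mult_minus_right add.assoc)
    qed
    show ?thesis
      unfolding lim by (intro conjI ext[OF V sN _ E]) simp_all
  qed
  have b2: "extends_smooth_at ?A (\<lambda>m. (fst m - l0) ^ 1 * T 0 (n2 + 1) m) (l0, \<mu>0) \<and>
      ((\<lambda>m. (fst m - l0) ^ 1 * T 0 (n2 + 1) m) \<longlongrightarrow> lim_b2 P1 P2 n1 n2 \<rho> \<sigma>2 \<Delta> i (l0, \<mu>0)) (at (l0, \<mu>0) within ?A)"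
    if l0: "l0 > 0" "l0 = real (n1 + i) / real (n2 + 1)" "l0 \<notin> real ` {1..}" and \<mu>0: "\<mu>0 \<in> W" for l0 i \<mu>0
  proof -
    let ?m0 = "(l0, \<mu>0)"
    have m0: "?m0 \<in> hat W" using l0 \<mu>0 by simp
    \<comment> \<open>The value \<open>k = 0\<close> is excluded by \<open>l0 > 0\<close>, since the
      set \<open>{1..}\<close> does not cover it.\<close>
    have "l0 \<noteq> real k" for k using l0(1,3) by (cases "k = 0") (auto simp: image_iff)
    from pole_non_integer[OF m0 l0(2) this]
    obtain V N where V: "open V" "V \<subseteq> hat W" "?m0 \<in> V" and sN: "smooth_on V N"
      and eq: "\<forall>m\<in>V. fst m \<notin> \<rat> \<longrightarrow> (fst m - l0) ^ 1 *
      mellin (I2 \<sigma>2 \<rho> m) (B2 P1 P2 n2 (I2 \<sigma>2 \<rho> m) m) (fst m * real (n2 + 1) - real n1) (fst (\<sigma>2 0 m)) = N m"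
      and N0: "N ?m0 = - (nderiv i (B2 P1 P2 n2 (I2 \<sigma>2 \<rho> ?m0) ?m0) 0 / fact i) * fst (\<sigma>2 0 ?m0) ^ i / real (n2 + 1)"
      by (elim exE conjE) (rule that)
    note E = bspec[OF eq, THEN mp]
    have lim: "lim_b2 P1 P2 n1 n2 \<rho> \<sigma>2 \<Delta> i ?m0 = \<Delta> 0 0 ?m0 ^ (n2 + 1) * deriv (\<lambda>s. snd (\<sigma>2 s ?m0)) 0 ^ (n2 + 1)
        * fst (\<sigma>2 0 ?m0) ^ n1 / L2 P1 P2 ?m0 (fst (\<sigma>2 0 ?m0)) ^ (n2 + 1) * N ?m0"
      unfolding lim_b2_def Let_def N0 power_add
      by (simp only: times_divide_eq_right times_divide_eq_left divide_divide_eq_left mult_minus_left mult_minus_right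
          minus_divide_left[symmetric] ac_simps)
    show ?thesis
      unfolding lim by (intro conjI ext[OF V sN _ E]) simp_all
  qed
  show ?thesis
  proof (intro conjI allI impI; (elim conjE)?)
    fix l0 \<mu>0 assume \<mu>0: "\<mu>0 \<in> W" and l0: "l0 \<in> real ` {i. 1 \<le> i \<and> n1 \<le> n2 * i}"
    then obtain i where i: "1 \<le> i" "n1 \<le> n2 * i" "l0 = real i" by auto
    show "extends_smooth_at ?A (\<lambda>m. (fst m - l0)\<^sup>2 * T 0 (n2 + 1) m) (l0, \<mu>0)"
      using a[OF i(1,2) \<mu>0] unfolding i(3) by blast
  next
    fix l0 \<mu>0 i assume "\<mu>0 \<in> W" "1 \<le> i" "n1 \<le> n2 * i" "l0 = real i"
    then show "((\<lambda>m. (fst m - l0)\<^sup>2 * T 0 (n2 + 1) m) \<longlongrightarrow> lim_a P1 P2 n1 n2 \<sigma>2 \<Delta> i (l0, \<mu>0)) (at (l0, \<mu>0) within ?A)"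
      using a[of i \<mu>0] by blast
  next
    fix l0 \<mu>0 assume l0: "l0 \<in> Dij (n1, n2) 0 (n2 + 1)" and \<mu>0: "\<mu>0 \<in> W" and not: "l0 \<notin> real ` {i. 1 \<le> i \<and> n1 \<le> n2 * i}"
    show "extends_smooth_at ?A (\<lambda>m. (fst m - l0) * T 0 (n2 + 1) m) (l0, \<mu>0)"
    proof (cases "l0 \<in> real ` {1..}")
      case True
      then obtain i where i: "1 \<le> i" "l0 = real i" by auto
      then have "n2 * i < n1" using not by (force simp: not_le)
      then show ?thesis using b1[OF i(1) _ \<mu>0] unfolding i(2) power_one_right by blast
    next
      case False
      \<comment> \<open>A non-integer element of the exceptional set has a numerator of at least
        \<open>n1\<close>, so \<open>k - n1\<close> is an honest natural index for case
        (b2).\<close>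
      then obtain k where k: "l0 = real k / real (n2 + 1)" "k \<ge> 1" "k \<ge> n1"
        using l0 unfolding Dij_0_Suc_n2 by blast
      have "l0 > 0" using l0 by (simp add: Dij_def)
      moreover have "l0 = real (n1 + (k - n1)) / real (n2 + 1)" using k by simp
      ultimately show ?thesis using b2[OF _ _ False \<mu>0] unfolding power_one_right by blast
    qed
  next
    fix l0 \<mu>0 i assume "\<mu>0 \<in> W" "1 \<le> i" "n2 * i < n1" "l0 = real i"
    then show "((\<lambda>m. (fst m - l0) * T 0 (n2 + 1) m) \<longlongrightarrow> lim_b1 P1 P2 n1 n2 \<rho> \<sigma>2 \<Delta> i (l0, \<mu>0)) (at (l0, \<mu>0) within ?A)"
      using b1[of i \<mu>0] unfolding power_one_right by blast
  next
    fix l0 \<mu>0 i assume "l0 \<in> Dij (n1, n2) 0 (n2 + 1)" "\<mu>0 \<in> W" "l0 = real (n1 + i) / real (n2 + 1)" "l0 \<notin> real ` {1..}"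
    then show "((\<lambda>m. (fst m - l0) * T 0 (n2 + 1) m) \<longlongrightarrow> lim_b2 P1 P2 n1 n2 \<rho> \<sigma>2 \<Delta> i (l0, \<mu>0)) (at (l0, \<mu>0) within ?A)"
      using b2[of l0 i \<mu>0] unfolding power_one_right by (simp add: Dij_def)
  qed
qed

end
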